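(* Let $N>K\ge2$, $k>0$, and let $f$ satisfy (F1)–(F4). Then $m_k$ is attained and is a critical value of $\Phi_k$: there is $u_k\in\mathcal M_k$ with $\Phi_k(u_k)=m_k$ and $\Phi_k'(u_k)=0$, so $u_k$ is a weak solution of $-\Delta u+\frac{u}{|y|^2}+ku=f(u)$ in $\mathbb{R}^N$. Moreover, if $f$ is odd, $u_k$ can be chosen with $u_k\ge0$.
   Context: Points of $\mathbb{R}^N$ are written $x=(y,z)\in\mathbb{R}^K\times\mathbb{R}^{N-K}$, $N>K\ge2$, $2^*=\frac{2N}{N-2}$. $\mathcal G(K)=\mathcal O(K)\times I_{N-K}$; $u$ is $\mathcal G(K)$-invariant if $u(Ay,z)=u(y,z)$ for all $A\in\mathcal O(K)$. Assumptions on $f$, $F(u)=\int_0^uf$: (F1) $f$ continuous, $|f(u)|\le C(1+|u|^{p-1})$ for some $p\in(2,2^* )$; (F2) $f(u)=o(u)$ as $u\to0$; (F3) $F(u)/u^2\to\infty$ as $|u|\to\infty$; (F4) $f(u)/|u|$ increasing on $(-\infty,0)$ and on $(0,\infty)$. $Y=\{u\in H^1(\mathbb{R}^N):\int\frac{u^2}{|y|^2}<\infty\}$, $Y^{\mathcal G(K)}$ its subspace of $\mathcal G(K)$-invariant functions. For $k>0$: $\Phi_k(u)=\frac12\int|\nabla u|^2+\frac{u^2}{|y|^2}+ku^2\,dx-\int F(u)\,dx$ on $Y$, $\mathcal M_k=\{u\in Y^{\mathcal G(K)}\setminus\{0\}:\int|\nabla u|^2+\frac{u^2}{|y|^2}+ku^2=\int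 f(u)u\}$, $m_k=\inf_{\mathcal M_k}\Phi_k$. *)

theory Defs
  imports "HOL-Analysis.Analysis"
begin

text \<open>Points of R^N are pairs (y,z) with y in R^K = real^'k and z in R^(N-K) = real^'m,
  so K = CARD('k), N = CARD('k) + CARD('m) (N > K is automatic).\<close>

primrec C_k :: "nat \<Rightarrow> ('a::euclidean_space \<Rightarrow> real) \<Rightarrow> bool" where
  "C_k 0 f = continuous_on UNIV f"
| "C_k (Suc n) f = (continuous_on UNIV f \<and> f differentiable_on UNIV \<and>
      (\<forall>v. C_k n (\<lambda>x. frechet_derivative f (at x) v)))"

definition test_fun :: "('a::euclidean_space \<Rightarrow> real) \<Rightarrow> bool" where
  "test_fun \<phi> \<longleftrightarrow> (\<forall>n. C_k n \<phi>) \<and> (\<exists>r. \<forall>x. r < norm x \<longrightarrow> \<phi> x = 0)"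

definition weak_grad :: "('a::euclidean_space \<Rightarrow> real) \<Rightarrow> ('a \<Rightarrow> 'a) \<Rightarrow> bool" where
  "weak_grad u g \<longleftrightarrow> g \<in> borel_measurable lborel \<and>
     (\<forall>\<phi>. test_fun \<phi> \<longrightarrow> (\<forall>v.
        (LINT x|lborel. u x * frechet_derivative \<phi> (at x) v) =
        - (LINT x|lborel. (g x \<bullet> v) * \<phi> x)))"

text \<open>H^1(R^N) (elements are represented by functions, equality being a.e.).\<close>
definition H1 :: "('a::euclidean_space \<Rightarrow> real) \<Rightarrow> bool" where
  "H1 u \<longleftrightarrow> u \<in> borel_measurable lborel \<and> integrable lborel (\<lambda>x. (u x)\<^sup>2) \<and>
     (\<exists>g. weak_grad u g \<and> integrable lborel (\<lambda>x. (norm (g x))\<^sup>2))"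

definition grad :: "('a::euclidean_space \<Rightarrow> real) \<Rightarrow> 'a \<Rightarrow> 'a" where
  "grad u = (SOME g. weak_grad u g \<and> integrable lborel (\<lambda>x. (norm (g x))\<^sup>2))"

definition Yspace :: "((real^'k) \<times> (real^'m) \<Rightarrow> real) \<Rightarrow> bool" where
  "Yspace u \<longleftrightarrow> H1 u \<and> integrable lborel (\<lambda>x. (u x)\<^sup>2 / (norm (fst x))\<^sup>2)"

text \<open>G(K)-invariance (as elements of L^2, i.e. a.e. for each A).\<close>
definition G_inv :: "((real^'k) \<times> (real^'m) \<Rightarrow> real) \<Rightarrow> bool" where
  "G_inv u \<longleftrightarrow> (\<forall>A::real^'k^'k. orthogonal_matrix A \<longrightarrow>
      (AE x in lborel. u (A *v fst x, snd x) = u x))"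

definition prim :: "(real \<Rightarrow> real) \<Rightarrow> real \<Rightarrow> real" where
  "prim f s = (LBINT t=0..s. f t)"

definition quad_k :: "real \<Rightarrow> ((real^'k) \<times> (real^'m) \<Rightarrow> real) \<Rightarrow> real" where
  "quad_k k u = (LINT x|lborel. (norm (grad u x))\<^sup>2 + (u x)\<^sup>2 / (norm (fst x))\<^sup>2 + k * (u x)\<^sup>2)"

definition Phi :: "real \<Rightarrow> (real \<Rightarrow> real) \<Rightarrow> ((real^'k) \<times> (real^'m) \<Rightarrow> real) \<Rightarrow> real" where
  "Phi k f u = quad_k k u / 2 - (LINT x|lborel. prim f (u x))"

definition Nehari :: "real \<Rightarrow> (real \<Rightarrow> real) \<Rightarrow> ((real^'k) \<times> (real^'m) \<Rightarrow> real) set" where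
  "Nehari k f = {u. Yspace u \<and> G_inv u \<and> \<not> (AE x in lborel. u x = 0) \<and>
      quad_k k u = (LINT x|lborel. f (u x) * u x)}"

definition m_k :: "real \<Rightarrow> (real \<Rightarrow> real) \<Rightarrow> ('k::finite itself) \<Rightarrow> ('m::finite itself) \<Rightarrow> real" where
  "m_k k f (_::'k itself) (_::'m itself) =
     Inf (Phi k f ` (Nehari k f :: ((real^'k) \<times> (real^'m) \<Rightarrow> real) set))"

text \<open>Phi_k'(u) = 0 on Y, expressed via directional derivatives along all v in Y.\<close>
definition critical :: "real \<Rightarrow> (real \<Rightarrow> real) \<Rightarrow> ((real^'k) \<times> (real^'m) \<Rightarrow> real) \<Rightarrow> bool" where
  "critical k f u \<longleftrightarrow> (\<forall>v. Yspace v \<longrightarrow>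
      ((\<lambda>t. Phi k f (\<lambda>x. u x + t * v x)) has_real_derivative 0) (at 0))"

definition weak_solution :: "real \<Rightarrow> (real \<Rightarrow> real) \<Rightarrow> ((real^'k) \<times> (real^'m) \<Rightarrow> real) \<Rightarrow> bool" where
  "weak_solution k f u \<longleftrightarrow> (\<forall>v. Yspace v \<longrightarrow>
      (LINT x|lborel. grad u x \<bullet> grad v x + u x * v x / (norm (fst x))\<^sup>2 + k * u x * v x)
      = (LINT x|lborel. f (u x) * v x))"

end

theory Submission
  imports Defs "HOL-Complex_Analysis.Great_Picard" "HOL-Real_Asymp.Real_Asymp"
    "HOL-Computational_Algebra.Polynomial"
begin

text \<open>
  A minimizing sequence on the Nehari set is bounded and, by Lions' vanishing argument, keeps a fixed amount
  of \<open>L\<^sup>2\<close> mass in some unit ball. Invariance under \<open>O(K)\<close> with \<open>K \<ge> 2\<close> keeps the centers of these balls at bounded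
  distance from \<open>y = 0\<close>, so after translations in \<open>z\<close> the sequence \<open>u\<^sub>n\<close> has a nonzero limit \<open>w\<close>. If
  \<open>Q(w) \<le> \<integral> f(w) w\<close>, with \<open>Q\<close> the quadratic form, its projection to the Nehari set is a minimizer by Fatou's lemma;
  otherwise the Brezis-Lieb splitting makes the remainders \<open>u\<^sub>n - w\<close> competitors below the infimum.
  A minimizer is critical on invariant functions since it can be perturbed inside the Nehari set, and then on all of
  \<open>Y\<close> because the Riesz representative of an invariant functional is invariant.

  Weak compactness is avoided throughout: limits in \<open>L\<^sup>2\<close> and \<open>Y\<close> are obtained from parallelogram arguments.
  The Sobolev estimates only use the translation bound \<open>\<parallel>u(\<cdot> + h) - u\<parallel>\<^sub>2 \<le> |h| \<parallel>\<nabla>u\<parallel>\<^sub>2\<close>.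
\<close>

text \<open>Both difficulties are met with (F4). It makes each Nehari element a maximum of the
  functional on its ray. A perturbation \<open>t * u + e * v\<close> inside the Nehari set may
  therefore carry an uncontrolled factor t near 1, whose effect on the energy has the favourable
  sign. Comparison with a point of fixed norm on the same ray gives the positive lower energy bound
  and the non-vanishing of normalized elements, from which (F3) bounds the form. On the Nehari set
  the functional is the integral of \<open>H s = f s * s / 2 - prim f s\<close>, which (F4) makes
  nonnegative and nondecreasing along rays. Hence Fatou's lemma applies to the energy, and moving a
  function with Q(u) \<le> \<integral> f(u) u back to the Nehari set by a factor at most 1 does not
  raise the integral of \<open>H\<close>. If the limit violates this inequality, the remainders
  eventually satisfy it, while their \<open>H\<close>-integrals tend to the infimum minus a positive
  number.\<close>

section \<open>Semi-inner products and minimization by the parallelogram law\<close>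

text \<open>\<open>B\<close> is only semidefinite, so functions can stand for their classes modulo
  null sets. Completeness is left out of the interface because the test functions with the L^2
  product are one of the instances.\<close>

locale pre_hilbert =
  fixes S :: "('b \<Rightarrow> real) set" and B :: "('b \<Rightarrow> real) \<Rightarrow> ('b \<Rightarrow> real) \<Rightarrow> real"
  assumes S_nonempty: "S \<noteq> {}"
    and lin_closed: "u \<in> S \<Longrightarrow> v \<in> S \<Longrightarrow> (\<lambda>x. a * u x + b * v x) \<in> S"
    and B_sym: "u \<in> S \<Longrightarrow> v \<in> S \<Longrightarrow> B u v = B v u"
    and B_lin: "u \<in> S \<Longrightarrow> v \<in> S \<Longrightarrow> w \<in> S \<Longrightarrow> B (\<lambda>x. a * u x + b * v x) w = a * B u w + b * B v w"
    and B_pos: "u \<in> S \<Longrightarrow> 0 \<le> B u u"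
begin

lemma add_closed: "u \<in> S \<Longrightarrow> v \<in> S \<Longrightarrow> (\<lambda>x. u x + v x) \<in> S"
  using lin_closed[of u v 1 1] by simp

lemma diff_closed: "u \<in> S \<Longrightarrow> v \<in> S \<Longrightarrow> (\<lambda>x. u x - v x) \<in> S"
  using lin_closed[of u v 1 "-1"] by simp

lemma B_lin_right:
  assumes "u \<in> S" "v \<in> S" "w \<in> S"
  shows "B w (\<lambda>x. a * u x + b * v x) = a * B w u + b * B w v"
  using B_lin[OF assms, of a b] B_sym[OF assms(3) lin_closed[OF assms(1,2), of a b]]
    B_sym[OF assms(1,3)] B_sym[OF assms(2,3)] by simp

lemma B_expand:
  assumes "u \<in> S" "v \<in> S"
  shows "B (\<lambda>x. a * u x + b * v x) (\<lambda>x. a * u x + b * v x)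
    = a\<^sup>2 * B u u + 2 * a * b * B u v + b\<^sup>2 * B v v"
proof -
  have "B (\<lambda>x. a * u x + b * v x) (\<lambda>x. a * u x + b * v x)
    = a * B u (\<lambda>x. a * u x + b * v x) + b * B v (\<lambda>x. a * u x + b * v x)"
    using assms by (intro B_lin lin_closed)
  also have "\<dots> = a * (a * B u u + b * B u v) + b * (a * B v u + b * B v v)"
    using assms by (simp add: B_lin_right)
  also have "B v u = B u v" using assms B_sym by blast
  finally show ?thesis by (simp add: power2_eq_square algebra_simps)
qed

lemma B_diff_expand:
  assumes "u \<in> S" "v \<in> S"
  shows "B (\<lambda>x. u x - v x) (\<lambda>x. u x - v x) = B u u - 2 * B u v + B v v"
  using B_expand[OF assms, of 1 "-1"] by simp

lemma B_add_expand:
  assumes "u \<in> S" "v \<in> S"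
  shows "B (\<lambda>x. u x + t * v x) (\<lambda>x. u x + t * v x) = B u u + 2 * t * B u v + t\<^sup>2 * B v v"
  using B_expand[OF assms, of 1 t] by simp

lemma B_scale: "u \<in> S \<Longrightarrow> B (\<lambda>x. a * u x) (\<lambda>x. a * u x) = a\<^sup>2 * B u u"
  using B_expand[of u u a 0] by simp

lemma B_diff_left:
  assumes "u \<in> S" "v \<in> S" "w \<in> S"
  shows "B (\<lambda>x. u x - v x) w = B u w - B v w"
  using B_lin[OF assms, of 1 "-1"] by simp

lemma B_diff_le:
  assumes "u \<in> S" "v \<in> S"
  shows "B (\<lambda>x. u x - v x) (\<lambda>x. u x - v x) \<le> 2 * B u u + 2 * B v v"
  using B_diff_expand[OF assms] B_pos[OF add_closed[OF assms]] B_expand[OF assms, of 1 1] by simp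

text \<open>Since \<open>B\<close> may be degenerate, \<open>B v v = 0\<close> is treated
  separately: there the form at \<open>u + t * v\<close> is affine in t, and nonnegativity for all t
  forces zero slope.\<close>

lemma Cauchy_Schwarz:
  assumes "u \<in> S" "v \<in> S"
  shows "(B u v)\<^sup>2 \<le> B u u * B v v"
proof (cases "B v v = 0")
  case False
  then have pos: "B v v > 0" using B_pos[OF assms(2)] by simp
  have "0 \<le> B (\<lambda>x. 1 * u x + (- B u v / B v v) * v x) (\<lambda>x. 1 * u x + (- B u v / B v v) * v x)"
    by (intro B_pos lin_closed assms)
  also have "\<dots> = B u u - (B u v)\<^sup>2 / B v v"
    using pos by (subst B_expand[OF assms]) (simp add: field_simps power2_eq_square)
  finally show ?thesis using pos by (simp add: field_simps)
next
  case True
  have "B u v = 0"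
  proof (rule ccontr)
    assume n: "B u v \<noteq> 0"
    \<comment> \<open>Chosen so that the affine function \<open>B u u + 2 * t * B u v\<close> takes
      the value -1.\<close>
    define t where "t = - (B u u + 1) / (2 * B u v)"
    have "0 \<le> B (\<lambda>x. 1 * u x + t * v x) (\<lambda>x. 1 * u x + t * v x)"
      by (intro B_pos lin_closed assms)
    also have "\<dots> = B u u + 2 * t * B u v" using True by (subst B_expand[OF assms]) simp
    also have "\<dots> = -1" using n by (simp add: t_def field_simps)
    finally show False by simp
  qed
  then show ?thesis using True by simp
qed

lemma tendsto_B:
  assumes "\<And>n. w n \<in> S" "w' \<in> S" "v \<in> S"
    and lim: "(\<lambda>n. B (\<lambda>x. w n x - w' x) (\<lambda>x. w n x - w' x)) \<longlonglongrightarrow> 0"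
  shows "(\<lambda>n. B (w n) v) \<longlonglongrightarrow> B w' v"
proof -
  have "(\<lambda>n. B (\<lambda>x. w n x - w' x) (\<lambda>x. w n x - w' x) * B v v) \<longlonglongrightarrow> 0 * B v v"
    by (intro tendsto_intros lim)
  then have l: "(\<lambda>n. (B (w n) v - B w' v)\<^sup>2) \<longlonglongrightarrow> 0"
  proof (rule_tac tendsto_sandwich[OF _ _ tendsto_const[of 0]])
    show "\<forall>\<^sub>F n in sequentially. (B (w n) v - B w' v)\<^sup>2
       \<le> B (\<lambda>x. w n x - w' x) (\<lambda>x. w n x - w' x) * B v v"
      using Cauchy_Schwarz[OF diff_closed[OF assms(1) assms(2)] assms(3)]
      by (simp add: B_diff_left assms)
  qed auto
  then have "(\<lambda>n. sqrt ((B (w n) v - B w' v)\<^sup>2)) \<longlonglongrightarrow> sqrt 0" by (intro tendsto_intros)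
  then have "(\<lambda>n. B (w n) v - B w' v) \<longlonglongrightarrow> 0" by (simp add: tendsto_rabs_zero_iff)
  then show ?thesis by (rule LIM_zero_cancel)
qed

lemma tendsto_B_self:
  assumes "\<And>n. w n \<in> S" "w' \<in> S"
    and lim: "(\<lambda>n. B (\<lambda>x. w n x - w' x) (\<lambda>x. w n x - w' x)) \<longlonglongrightarrow> 0"
  shows "(\<lambda>n. B (w n) (w n)) \<longlonglongrightarrow> B w' w'"
proof -
  have "(\<lambda>n. B (\<lambda>x. w n x - w' x) (\<lambda>x. w n x - w' x) + 2 * B (w n) w' - B w' w')
     \<longlonglongrightarrow> 0 + 2 * B w' w' - B w' w'"
    by (intro tendsto_intros lim tendsto_B assms)
  then show ?thesis by (simp add: B_diff_expand assms)
qed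

text \<open>A substitute for the Riesz representation theorem in an incomplete space: a minimizing sequence
  of \<open>B v v - 2 * L v\<close> is Cauchy by the parallelogram law.\<close>

lemma Riesz_sequence:
  fixes L :: "('b \<Rightarrow> real) \<Rightarrow> real"
  assumes L_lin: "\<And>u v a b. u \<in> S \<Longrightarrow> v \<in> S \<Longrightarrow> L (\<lambda>x. a * u x + b * v x) = a * L u + b * L v"
    and L_bdd: "\<And>v. v \<in> S \<Longrightarrow> (L v)\<^sup>2 \<le> K * B v v"
  obtains w where "\<And>n. w n \<in> S"
    "\<And>n m. B (\<lambda>x. w n x - w m x) (\<lambda>x. w n x - w m x) \<le> 2 / real (Suc n) + 2 / real (Suc m)"
    "\<And>v. v \<in> S \<Longrightarrow> (\<lambda>n. B (w n) v) \<longlonglongrightarrow> L v"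
proof -
  define J where "J v = B v v - 2 * L v" for v
  have Jlow: "J v \<ge> - \<bar>K\<bar>" if "v \<in> S" for v
  proof -
    have b: "(L v)\<^sup>2 \<le> \<bar>K\<bar> * B v v"
      using L_bdd[OF that] B_pos[OF that] by (meson abs_ge_self mult_right_mono order_trans)
    have "(2 * L v)\<^sup>2 \<le> 4 * (\<bar>K\<bar> * B v v)" using b by (simp add: power_mult_distrib)
    also have "\<dots> \<le> (\<bar>K\<bar> + B v v)\<^sup>2"
      using zero_le_power2[of "\<bar>K\<bar> - B v v"] by (simp add: power2_eq_square algebra_simps)
    finally have "2 * L v \<le> \<bar>K\<bar> + B v v"
      by (rule power2_le_imp_le) (use B_pos[OF that] in simp)
    then show ?thesis by (simp add: J_def)
  qed
  define d where "d = Inf (J ` S)"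
  have bdd: "bdd_below (J ` S)" using Jlow by (auto intro!: bdd_belowI[of _ "- \<bar>K\<bar>"])
  have dle: "d \<le> J v" if "v \<in> S" for v unfolding d_def using that bdd by (intro cInf_lower) auto
  have "\<exists>v\<in>S. J v < d + 1 / real (Suc n)" for n
  proof -
    have "Inf (J ` S) < d + 1 / real (Suc n)" by (simp add: d_def)
    then show ?thesis using cInf_lessD[of "J ` S"] S_nonempty by blast
  qed
  then obtain w where w: "\<And>n. w n \<in> S" and wJ: "\<And>n. J (w n) < d + 1 / real (Suc n)" by metis
  show ?thesis
  proof (rule that[of w])
    show "w n \<in> S" for n by (rule w)
    show "B (\<lambda>x. w n x - w m x) (\<lambda>x. w n x - w m x) \<le> 2 / real (Suc n) + 2 / real (Suc m)" for n m
    proof -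
      have "d \<le> J (\<lambda>x. (1/2) * w n x + (1/2) * w m x)" by (intro dle lin_closed w)
      also have "\<dots> = (B (w n) (w n) + 2 * B (w n) (w m) + B (w m) (w m)) / 4 - (L (w n) + L (w m))"
        unfolding J_def by (subst B_expand[OF w w], subst L_lin[OF w w]) (simp add: field_simps power2_eq_square)
      finally have "4 * d \<le> B (w n) (w n) + 2 * B (w n) (w m) + B (w m) (w m) - 4 * (L (w n) + L (w m))"
        by (simp add: field_simps)
      then show ?thesis using wJ[of n] wJ[of m] by (simp add: B_diff_expand w J_def)
    qed
    show "(\<lambda>n. B (w n) v) \<longlonglongrightarrow> L v" if v: "v \<in> S" for v
    proof -
      \<comment> \<open>The square of this step is the bound on the excess of \<open>J (w n)\<close>
        over the infimum, so dividing the minimality inequality by the step leaves an error of the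
        same order as the step.\<close>
      define s where "s n = 1 / sqrt (real (Suc n))" for n
      have spos: "s n > 0" and s2: "s n * s n = 1 / real (Suc n)" for n by (auto simp: s_def)
      \<comment> \<open>The two signs test the directions v and -v; together they bound the absolute
        value.\<close>
      have key: "- s n * (1 + B v v) \<le> 2 * \<sigma> * (B (w n) v - L v)" if sg: "\<bar>\<sigma>\<bar> = 1" for \<sigma> n
      proof -
        have sg2: "\<sigma> * \<sigma> = 1" using sg by (metis abs_mult_self_eq mult.right_neutral)
        have "d \<le> J (\<lambda>x. 1 * w n x + (\<sigma> * s n) * v x)" by (intro dle lin_closed w v)
        also have "\<dots> = J (w n) + 2 * \<sigma> * s n * (B (w n) v - L v) + s n * s n * B v v"
          unfolding J_def using sg2
          by (subst B_expand[OF w v], subst L_lin[OF w v]) (simp add: algebra_simps power2_eq_square)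
        finally have "- (s n * s n) * (1 + B v v) \<le> 2 * \<sigma> * s n * (B (w n) v - L v)"
          using wJ[of n] s2[of n] by (simp add: algebra_simps add_divide_distrib)
        then have "s n * (- s n * (1 + B v v)) \<le> s n * (2 * \<sigma> * (B (w n) v - L v))"
          by (simp add: algebra_simps)
        then show ?thesis using spos[of n] by (simp only: mult_le_cancel_left_pos)
      qed
      have "\<bar>B (w n) v - L v\<bar> \<le> s n * (1 + B v v)" for n
        using key[of 1 n] key[of "-1" n] by simp
      moreover have "(\<lambda>n. s n * (1 + B v v)) \<longlonglongrightarrow> 0"
      proof -
        have "s \<longlonglongrightarrow> 0" unfolding s_def by real_asymp
        from tendsto_mult_left_zero[OF this] show ?thesis .
      qed
      ultimately have "(\<lambda>n. B (w n) v - L v) \<longlonglongrightarrow> 0"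
        by (rule_tac Lim_null_comparison[of _ "\<lambda>n. s n * (1 + B v v)"]) simp_all
      then show ?thesis by (rule LIM_zero_cancel)
    qed
  qed
qed

text \<open>This replaces weak compactness: almost minimizers \<open>w n\<close> of the norm on a decreasing sequence of convex
  sets converge, and the variational inequality of the minimizers bounds \<open>B (u m) (w n)\<close> from below.\<close>

lemma convex_sequence:
  fixes C :: "nat \<Rightarrow> ('b \<Rightarrow> real) set"
  assumes CS: "\<And>n. C n \<subseteq> S" and dec: "\<And>m n. m \<le> n \<Longrightarrow> C n \<subseteq> C m"
    and conv: "\<And>n u v s. u \<in> C n \<Longrightarrow> v \<in> C n \<Longrightarrow> 0 \<le> s \<Longrightarrow> s \<le> 1 \<Longrightarrow> (\<lambda>x. (1 - s) * u x + s * v x) \<in> C n"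
    and u: "\<And>n. u n \<in> C n" and K: "\<And>n. B (u n) (u n) \<le> K"
  obtains w where "\<And>n. w n \<in> C n"
    "\<And>e. e > 0 \<Longrightarrow> \<exists>M. \<forall>m\<ge>M. \<forall>n\<ge>M. B (\<lambda>x. w n x - w m x) (\<lambda>x. w n x - w m x) < e"
    "\<And>e. e > 0 \<Longrightarrow> \<exists>M. \<forall>n\<ge>M. \<forall>m\<ge>n. B (w n) (u m) \<ge> B (w n) (w n) - e"
proof -
  define d where "d n = Inf ((\<lambda>v. B v v) ` C n)" for n
  have bdd: "bdd_below ((\<lambda>v. B v v) ` C n)" for n using B_pos CS by (auto intro!: bdd_belowI[of _ 0])
  have dle: "d n \<le> B v v" if "v \<in> C n" for v n unfolding d_def using that bdd by (intro cInf_lower) auto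
  have dK: "d n \<le> K" for n using dle[OF u] K order_trans by blast
  have dmono: "d m \<le> d n" if "m \<le> n" for m n
    unfolding d_def using u[of n] dec[OF that] bdd[of m] by (intro cInf_superset_mono) auto
  have "\<exists>v\<in>C n. B v v < d n + 1 / real (Suc n)" for n
  proof -
    have "Inf ((\<lambda>v. B v v) ` C n) < d n + 1 / real (Suc n)" by (simp add: d_def)
    then show ?thesis using cInf_lessD[of "(\<lambda>v. B v v) ` C n"] u[of n] by blast
  qed
  then obtain w where w: "\<And>n. w n \<in> C n" and wd: "\<And>n. B (w n) (w n) < d n + 1 / real (Suc n)" by metis
  have wS: "w n \<in> S" and uS: "u n \<in> S" for n using w u CS by auto
  have "convergent d"
  proof (rule Bseq_mono_convergent)
    have "\<bar>d n\<bar> \<le> \<bar>K\<bar> + \<bar>d 0\<bar>" for n using dmono[of 0 n] dK[of n] by linarith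
    then show "Bseq d" by (intro BseqI'[of _ "\<bar>K\<bar> + \<bar>d 0\<bar>"]) simp
    show "\<forall>m n. m \<le> n \<longrightarrow> d m \<le> d n" using dmono by blast
  qed
  then have "Cauchy d" by (simp add: convergent_Cauchy)
  \<comment> \<open>The midpoint of \<open>w n\<close> and \<open>w m\<close> lies in the larger set
    \<open>C n\<close>, so its form is at least \<open>d n\<close>. The difference
    \<open>d m - d n\<close> becomes small because d is monotone and bounded.\<close>
  have half: "B (\<lambda>x. w n x - w m x) (\<lambda>x. w n x - w m x) \<le> 2 * (d m - d n) + 4 / real (Suc n)"
    if "n \<le> m" for n m
  proof -
    have "w m \<in> C n" using dec[OF that] w by auto
    then have "d n \<le> B (\<lambda>x. (1 - 1/2) * w n x + (1/2) * w m x) (\<lambda>x. (1 - 1/2) * w n x + (1/2) * w m x)"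
      by (intro dle conv w) auto
    also have "\<dots> = (B (w n) (w n) + 2 * B (w n) (w m) + B (w m) (w m)) / 4"
      by (subst B_expand[OF wS wS]) (simp add: field_simps power2_eq_square)
    finally have "4 * d n \<le> B (w n) (w n) + 2 * B (w n) (w m) + B (w m) (w m)" by simp
    moreover have "1 / real (Suc m) \<le> 1 / real (Suc n)" using that by (simp add: frac_le)
    ultimately show ?thesis using wd[of n] wd[of m] by (simp add: B_diff_expand wS)
  qed
  have swap: "B (\<lambda>x. w n x - w m x) (\<lambda>x. w n x - w m x) = B (\<lambda>x. w m x - w n x) (\<lambda>x. w m x - w n x)" for n m
    using B_sym[OF wS wS, of n m] by (simp add: B_diff_expand wS)
  show ?thesis
  proof (rule that[of w])
    show "w n \<in> C n" for n by (rule w)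
    fix e :: real assume e: "e > 0"
    obtain M1 where M1: "\<And>m n. m \<ge> M1 \<Longrightarrow> n \<ge> M1 \<Longrightarrow> \<bar>d m - d n\<bar> < e / 4"
      using \<open>Cauchy d\<close> e unfolding Cauchy_def dist_real_def by (meson divide_pos_pos zero_less_numeral)
    obtain M2 where M2: "4 / real (Suc M2) < e / 2"
    proof -
      have "(\<lambda>n. 4 / real (Suc n)) \<longlonglongrightarrow> 0" by real_asymp
      then have "eventually (\<lambda>n. 4 / real (Suc n) < e / 2) sequentially" using e by (intro order_tendstoD) auto
      then show ?thesis using that by (auto simp: eventually_sequentially)
    qed
    have main: "B (\<lambda>x. w n x - w m x) (\<lambda>x. w n x - w m x) < e"
      if "n \<ge> max M1 M2" "n \<le> m" for n m
    proof -
      have "4 / real (Suc n) \<le> 4 / real (Suc M2)" using that by (simp add: frac_le)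
      moreover have "\<bar>d m - d n\<bar> < e / 4" using that by (intro M1) auto
      moreover have "x < e" if "x \<le> 2 * t + p" "p \<le> q" "\<bar>t\<bar> < e / 4" "q < e / 2" for x t p q :: real
        using that by linarith
      ultimately show ?thesis using half[OF that(2)] M2 by blast
    qed
    show "\<exists>M. \<forall>m\<ge>M. \<forall>n\<ge>M. B (\<lambda>x. w n x - w m x) (\<lambda>x. w n x - w m x) < e"
    proof (intro exI[of _ "max M1 M2"] allI impI)
      fix m n assume mn: "m \<ge> max M1 M2" "n \<ge> max M1 M2"
      show "B (\<lambda>x. w n x - w m x) (\<lambda>x. w n x - w m x) < e"
        using main[of n m] main[of m n] swap[of n m] mn by (cases "n \<le> m") auto
    qed
    \<comment> \<open>Bounds the form at \<open>w n - u m\<close>: the form of \<open>w n\<close> is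
      at most |K| + 1, that of \<open>u m\<close> at most |K|.\<close>
    define A where "A = 2 * (\<bar>K\<bar> + 1) + 2 * \<bar>K\<bar>"
    \<comment> \<open>First variation at \<open>w n\<close> towards \<open>u m\<close> with step
      1/sqrt(n+1). Since \<open>w n\<close> is minimal only up to 1/(n+1), the error is of order
      1/sqrt(n+1).\<close>
    have est: "B (w n) (u m) - B (w n) (w n) \<ge> - (1 / sqrt (real (Suc n))) * (1 + A) / 2" if "n \<le> m" for n m
    proof -
      define s where "s = 1 / sqrt (real (Suc n))"
      have s: "0 < s" "s \<le> 1" "s * s = 1 / real (Suc n)" by (auto simp: s_def)
      have "u m \<in> C n" using dec[OF that] u by auto
      then have "d n \<le> B (\<lambda>x. (1 - s) * w n x + s * u m x) (\<lambda>x. (1 - s) * w n x + s * u m x)"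
        using s by (intro dle conv w) auto
      also have "\<dots> = B (w n) (w n) + 2 * s * (B (w n) (u m) - B (w n) (w n)) + s * s * (B (w n) (w n) - 2 * B (w n) (u m) + B (u m) (u m))"
        by (subst B_expand[OF wS uS]) (simp add: algebra_simps power2_eq_square)
      finally have e1: "d n \<le> B (w n) (w n) + 2 * s * (B (w n) (u m) - B (w n) (w n)) + s * s * (B (w n) (w n) - 2 * B (w n) (u m) + B (u m) (u m))" .
      have XA: "B (w n) (w n) - 2 * B (w n) (u m) + B (u m) (u m) \<le> A"
      proof -
        have "1 / real (Suc n) \<le> 1" by simp
        then have "B (w n) (w n) \<le> \<bar>K\<bar> + 1" using wd[of n] dK[of n] by linarith
        moreover have "B (u m) (u m) \<le> \<bar>K\<bar>" using K[of m] by simp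
        ultimately show ?thesis using B_diff_le[OF wS uS, of n m] by (simp add: B_diff_expand wS uS A_def)
      qed
      have "s * s * (B (w n) (w n) - 2 * B (w n) (u m) + B (u m) (u m)) \<le> s * s * A"
        using XA s(1) by (intro mult_left_mono) auto
      then have "- (s * s) - s * s * A \<le> 2 * s * (B (w n) (u m) - B (w n) (w n))"
        using wd[of n] e1 unfolding s(3)[symmetric] by linarith
      then have "- (s * s) * (1 + A) \<le> 2 * s * (B (w n) (u m) - B (w n) (w n))"
        by (simp add: algebra_simps)
      then have "s * (- s * (1 + A)) \<le> s * (2 * (B (w n) (u m) - B (w n) (w n)))"
        by (simp add: algebra_simps)
      then show ?thesis using s(1) by (simp only: mult_le_cancel_left_pos) (simp add: s_def)
    qed
    have "(\<lambda>n. (1 / sqrt (real (Suc n))) * (1 + A) / 2) \<longlonglongrightarrow> 0" by real_asymp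
    from order_tendstoD(2)[OF this e] obtain M
      where M: "\<And>n. n \<ge> M \<Longrightarrow> (1 / sqrt (real (Suc n))) * (1 + A) / 2 < e"
      unfolding eventually_sequentially by blast
    show "\<exists>M. \<forall>n\<ge>M. \<forall>m\<ge>n. B (w n) (u m) \<ge> B (w n) (w n) - e"
    proof (intro exI allI impI)
      fix n m assume "n \<ge> M" "m \<ge> n"
      then show "B (w n) (u m) \<ge> B (w n) (w n) - e" using est[of n m] M[of n] by simp
    qed
  qed
qed

end

section \<open>Square integrable functions and their completeness\<close>

text \<open>Values in an arbitrary Euclidean space: gradients and the vectors \<open>Yvec\<close>
  then fall under the same completeness theorem as scalar functions.\<close>

definition L2 :: "'a measure \<Rightarrow> ('a \<Rightarrow> 'e::euclidean_space) \<Rightarrow> bool" where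
  "L2 M f \<longleftrightarrow> f \<in> borel_measurable M \<and> integrable M (\<lambda>x. (norm (f x))\<^sup>2)"

lemma L2_measurable: "L2 M f \<Longrightarrow> f \<in> borel_measurable M"
  by (simp add: L2_def)

lemma L2_square_integrable: "L2 M u \<Longrightarrow> integrable M (\<lambda>x. (u x)\<^sup>2)" for u :: "'a \<Rightarrow> real"
  by (simp add: L2_def)

lemma L2_inner_integrable:
  assumes "L2 M f" "L2 M g"
  shows "integrable M (\<lambda>x. f x \<bullet> g x)"
proof (rule Bochner_Integration.integrable_bound[where f="\<lambda>x. (norm (f x))\<^sup>2 + (norm (g x))\<^sup>2"])
  show "integrable M (\<lambda>x. (norm (f x))\<^sup>2 + (norm (g x))\<^sup>2)" using assms by (auto simp: L2_def)
  show "(\<lambda>x. f x \<bullet> g x) \<in> borel_measurable M" using assms by (auto simp: L2_def)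
  show "AE x in M. norm (f x \<bullet> g x) \<le> norm ((norm (f x))\<^sup>2 + (norm (g x))\<^sup>2)"
  proof (rule AE_I2)
    fix x
    have "\<bar>f x \<bullet> g x\<bar> \<le> norm (f x) * norm (g x)" by (rule Cauchy_Schwarz_ineq2)
    also have "\<dots> \<le> (norm (f x))\<^sup>2 + (norm (g x))\<^sup>2"
      using sum_squares_bound[of "norm (f x)" "norm (g x)"]
        mult_nonneg_nonneg[OF norm_ge_zero[of "f x"] norm_ge_zero[of "g x"]]
      unfolding mult.assoc by linarith
    finally show "norm (f x \<bullet> g x) \<le> norm ((norm (f x))\<^sup>2 + (norm (g x))\<^sup>2)" by simp
  qed
qed

lemma L2_mult_integrable:
  fixes u v :: "'a \<Rightarrow> real"
  shows "L2 M u \<Longrightarrow> L2 M v \<Longrightarrow> integrable M (\<lambda>x. u x * v x)"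
  using L2_inner_integrable[of M u v] by simp

lemma L2_lin:
  assumes f: "L2 M f" and g: "L2 M g"
  shows "L2 M (\<lambda>x. a *\<^sub>R f x + b *\<^sub>R g x)"
  unfolding L2_def
proof
  have "(norm (a *\<^sub>R f x + b *\<^sub>R g x))\<^sup>2 = a\<^sup>2 * (norm (f x))\<^sup>2 + 2 * a * b * (f x \<bullet> g x) + b\<^sup>2 * (norm (g x))\<^sup>2" for x
    by (simp add: power2_norm_eq_inner algebra_simps inner_commute) (simp add: power2_eq_square)
  moreover have "integrable M (\<lambda>x. a\<^sup>2 * (norm (f x))\<^sup>2 + 2 * a * b * (f x \<bullet> g x) + b\<^sup>2 * (norm (g x))\<^sup>2)"
    using assms L2_inner_integrable[OF f g] by (auto simp: L2_def)
  ultimately show "integrable M (\<lambda>x. (norm (a *\<^sub>R f x + b *\<^sub>R g x))\<^sup>2)" by simp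
qed (use assms in \<open>auto simp: L2_def\<close>)

lemma L2_lin_real: "L2 M u \<Longrightarrow> L2 M v \<Longrightarrow> L2 M (\<lambda>x. a * u x + b * v x)" for u v :: "'a \<Rightarrow> real"
  using L2_lin[of M u v a b] by simp

lemma L2_diff: "L2 M f \<Longrightarrow> L2 M g \<Longrightarrow> L2 M (\<lambda>x. f x - g x)"
  using L2_lin[of M f g 1 "-1"] by simp

lemma L2_zero: "L2 M (\<lambda>x. 0)"
  by (simp add: L2_def)

lemma L2_bound:
  assumes "L2 M g" "f \<in> borel_measurable M" "AE x in M. norm (f x) \<le> norm (g x)"
  shows "L2 M f"
  unfolding L2_def
proof
  show "integrable M (\<lambda>x. (norm (f x))\<^sup>2)"
    by (rule Bochner_Integration.integrable_bound[where f="\<lambda>x. (norm (g x))\<^sup>2"])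
      (use assms in \<open>auto simp: L2_def power_mono\<close>)
qed (rule assms)

lemma L2_AE_cong:
  assumes "L2 M g" "f \<in> borel_measurable M" "AE x in M. f x = g x"
  shows "L2 M f"
  using assms by (intro L2_bound[OF assms(1,2)]) auto

lemma pre_hilbert_L2: "pre_hilbert {u::'a \<Rightarrow> real. L2 M u} (\<lambda>u v. LINT x|M. u x * v x)"
proof
  show "{u::'a \<Rightarrow> real. L2 M u} \<noteq> {}" using L2_zero by blast
  show "(LINT x|M. (a * u x + b * v x) * w x) = a * (LINT x|M. u x * w x) + b * (LINT x|M. v x * w x)"
    if "u \<in> {u. L2 M u}" "v \<in> {u. L2 M u}" "w \<in> {u. L2 M u}" for u v w :: "'a \<Rightarrow> real" and a b
    using that by (subst Bochner_Integration.integral_add[symmetric] integral_mult_right_zero[symmetric]; (simp add: L2_mult_integrable algebra_simps)?)+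
qed (auto intro: L2_lin_real simp: mult.commute)

lemma integral_Cauchy_Schwarz:
  fixes u v :: "'a \<Rightarrow> real"
  assumes "L2 M u" "L2 M v"
  shows "(LINT x|M. u x * v x)\<^sup>2 \<le> (LINT x|M. (u x)\<^sup>2) * (LINT x|M. (v x)\<^sup>2)"
  using pre_hilbert.Cauchy_Schwarz[OF pre_hilbert_L2, of u M v] assms by (simp add: power2_eq_square)

text \<open>Besides the bound it delivers integrability of the limit, which the completeness proof
  takes from it.\<close>

lemma Fatou_bounded:
  fixes F :: "nat \<Rightarrow> 'a \<Rightarrow> real"
  assumes int: "\<And>n. integrable M (F n)" and pos: "\<And>n x. x \<in> space M \<Longrightarrow> 0 \<le> F n x"
    and lim: "AE x in M. (\<lambda>n. F n x) \<longlonglongrightarrow> G x" and G: "G \<in> borel_measurable M"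
    and le: "\<forall>\<^sub>F n in sequentially. (LINT x|M. F n x) \<le> c"
  shows "integrable M G \<and> (LINT x|M. G x) \<le> c"
proof -
  have Gpos: "AE x in M. 0 \<le> G x"
    using lim by (rule AE_mp) (auto intro!: AE_I2 LIMSEQ_le_const pos)
  have c0: "0 \<le> c"
  proof -
    obtain n where "(LINT x|M. F n x) \<le> c" using le by (auto simp: eventually_sequentially)
    then show ?thesis using integral_nonneg_AE[of "F n" M] pos by (smt (verit) AE_I2)
  qed
  have "(\<integral>\<^sup>+x. ennreal (G x) \<partial>M) = (\<integral>\<^sup>+x. liminf (\<lambda>n. ennreal (F n x)) \<partial>M)"
  proof (rule nn_integral_cong_AE, use lim in eventually_elim)
    case (elim x)
    then have "(\<lambda>n. ennreal (F n x)) \<longlonglongrightarrow> ennreal (G x)" by (rule tendsto_ennrealI)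
    then show ?case by (simp add: lim_imp_Liminf)
  qed
  also have "\<dots> \<le> liminf (\<lambda>n. \<integral>\<^sup>+x. ennreal (F n x) \<partial>M)"
    using int by (intro nn_integral_liminf) auto
  also have "\<dots> \<le> ennreal c"
  proof (rule Liminf_le[OF _ ], simp)
    show "\<forall>\<^sub>F n in sequentially. (\<integral>\<^sup>+x. ennreal (F n x) \<partial>M) \<le> ennreal c"
      using le
    proof eventually_elim
      case (elim n)
      have "(\<integral>\<^sup>+x. ennreal (F n x) \<partial>M) = ennreal (LINT x|M. F n x)"
        using pos by (intro nn_integral_eq_integral int) auto
      then show ?case using elim by (simp add: ennreal_leI)
    qed
  qed
  finally have b: "(\<integral>\<^sup>+x. ennreal (G x) \<partial>M) \<le> ennreal c" .
  have i: "integrable M G"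
    using G Gpos b by (intro integrableI_nonneg) (auto simp: ennreal_less_top order_le_less_trans)
  then have "ennreal (LINT x|M. G x) \<le> ennreal c"
    using b nn_integral_eq_integral[OF i Gpos] by simp
  then show ?thesis using i c0 by (simp add: ennreal_le_iff)
qed

text \<open>Serves to pass to a subsequence along which the k-th of countably many tail estimates
  holds from its k-th member on; the partial sums make the choice increasing.\<close>

lemma strict_mono_above:
  fixes N :: "nat \<Rightarrow> nat"
  obtains r :: "nat \<Rightarrow> nat" where "strict_mono r" "\<And>k. N k \<le> r k"
proof (rule that[of "\<lambda>k. k + (\<Sum>i\<le>k. N i)"])
  show "strict_mono (\<lambda>k. k + (\<Sum>i\<le>k. N i))" by (simp add: strict_mono_Suc_iff)
  show "N k \<le> k + (\<Sum>i\<le>k. N i)" for k using member_le_sum[of k "{..k}" N] by simp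
qed

text \<open>Riesz-Fischer: along a fast subsequence almost every point has geometrically decaying
  increments, and Fatou's lemma turns the Cauchy estimate into convergence to the pointwise limit.
  The a.e. convergent subsequence is part of the conclusion because limits in Y and local limits are
  identified through it.\<close>

theorem L2_complete:
  fixes f :: "nat \<Rightarrow> 'a \<Rightarrow> 'e::euclidean_space"
  assumes f: "\<And>n. L2 M (f n)"
    and C: "\<And>e. e > 0 \<Longrightarrow> \<exists>N. \<forall>m\<ge>N. \<forall>n\<ge>N. (LINT x|M. (norm (f m x - f n x))\<^sup>2) < e"
  obtains g r where "L2 M g" "(\<lambda>n. LINT x|M. (norm (f n x - g x))\<^sup>2) \<longlonglongrightarrow> 0"
    "strict_mono (r::nat\<Rightarrow>nat)" "AE x in M. (\<lambda>k. f (r k) x) \<longlonglongrightarrow> g x"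
proof -
  have fm[measurable]: "f n \<in> borel_measurable M" for n using f by (simp add: L2_def)
  have fi: "integrable M (\<lambda>x. (norm (f m x - f n x))\<^sup>2)" for m n
    using L2_diff[OF f f] by (simp add: L2_def)
  have "\<exists>N. \<forall>m\<ge>N. \<forall>n\<ge>N. (LINT x|M. (norm (f m x - f n x))\<^sup>2) < (1/4)^k" for k
    by (rule C) simp
  then obtain N where N: "\<And>k m n. m \<ge> N k \<Longrightarrow> n \<ge> N k \<Longrightarrow> (LINT x|M. (norm (f m x - f n x))\<^sup>2) < (1/4)^k"
    by metis
  obtain r where r: "strict_mono r" and rN: "\<And>k. N k \<le> r k" using strict_mono_above by blast
  \<comment> \<open>The integrals are below (1/4)^k, so the weights 2^k still leave a convergent
    series; where it is finite, they give \<open>D k x \<le> c * (1/2)^k\<close>.\<close>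
  define D where "D k x = (norm (f (r (Suc k)) x - f (r k) x))\<^sup>2" for k x
  have Dm[measurable]: "D k \<in> borel_measurable M" for k unfolding D_def[abs_def] by measurable
  have rS: "N k \<le> r (Suc k)" for k
    using rN[of k] strict_mono_less_eq[OF r, of k "Suc k"] by simp
  have Dint: "(\<integral>\<^sup>+x. ennreal (2^k * D k x) \<partial>M) \<le> ennreal ((1/2)^k)" for k
  proof -
    have "(\<integral>\<^sup>+x. ennreal (2^k * D k x) \<partial>M) = ennreal (LINT x|M. 2^k * D k x)"
      unfolding D_def by (intro nn_integral_eq_integral integrable_mult_right fi) auto
    also have "(LINT x|M. 2^k * D k x) = 2^k * (LINT x|M. D k x)" by simp
    also have "\<dots> \<le> 2^k * (1/4)^k"
      using N[OF rS rN, of k] unfolding D_def by (intro mult_left_mono) auto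
    also have "\<dots> = (1/2)^k" by (simp add: power_mult_distrib[symmetric])
    finally show ?thesis by (simp add: ennreal_leI)
  qed
  have "(\<integral>\<^sup>+x. (\<Sum>k. ennreal (2^k * D k x)) \<partial>M) = (\<Sum>k. \<integral>\<^sup>+x. ennreal (2^k * D k x) \<partial>M)"
    by (rule nn_integral_suminf) measurable
  also have "\<dots> \<le> (\<Sum>k. ennreal ((1/2)^k))" by (intro suminf_le Dint) auto
  also have "\<dots> = ennreal (\<Sum>k. (1/2)^k)" by (intro suminf_ennreal2) auto
  finally have "(\<integral>\<^sup>+x. (\<Sum>k. ennreal (2^k * D k x)) \<partial>M) \<noteq> \<infinity>"
    by (auto simp: top_unique)
  then have "AE x in M. (\<Sum>k. ennreal (2^k * D k x)) \<noteq> \<infinity>"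
    by (intro nn_integral_PInf_AE) auto
  then have conv: "AE x in M. convergent (\<lambda>k. f (r k) x)"
  proof eventually_elim
    case (elim x)
    then obtain c where c: "0 \<le> c" "(\<Sum>k. ennreal (2^k * D k x)) = ennreal c"
      by (metis ennreal_cases infinity_ennreal_def)
    have b: "norm (f (r (Suc k)) x - f (r k) x) \<le> sqrt c * (sqrt (1/2))^k" for k
    proof -
      have "ennreal (2^k * D k x) \<le> ennreal c"
        unfolding c(2)[symmetric] using sum_le_suminf[of "\<lambda>k. ennreal (2^k * D k x)" "{k}"] by simp
      then have "2^k * D k x \<le> c" using c by (simp add: ennreal_le_iff)
      then have "D k x \<le> c * (1/2)^k" by (simp add: field_simps power_one_over)
      then have "sqrt (D k x) \<le> sqrt (c * (1/2)^k)" by simp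
      also have "\<dots> = sqrt c * (sqrt (1/2))^k" by (simp add: real_sqrt_mult real_sqrt_power)
      finally show ?thesis by (simp add: D_def)
    qed
    have "summable (\<lambda>k. sqrt c * (sqrt (1/2))^k)"
    proof (intro summable_mult summable_geometric)
      show "norm (sqrt (1/2)) < 1" by (simp add: real_sqrt_divide)
    qed
    then have "summable (\<lambda>k. f (r (Suc k)) x - f (r k) x)"
      by (rule summable_comparison_test'[where N=0]) (rule b)
    then have "convergent (\<lambda>n. \<Sum>k<n. f (r (Suc k)) x - f (r k) x)" by (simp add: summable_iff_convergent)
    then have "convergent (\<lambda>n. f (r n) x - f (r 0) x)" by (simp add: sum_lessThan_telescope[of "\<lambda>k. f (r k) x"])
    from convergent_add[OF this convergent_const[of "f (r 0) x"]] show ?case by simp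
  qed
  define g where "g x = lim (\<lambda>k. f (r k) x)" for x
  have gm[measurable]: "g \<in> borel_measurable M" unfolding g_def[abs_def] by measurable
  have AEg: "AE x in M. (\<lambda>k. f (r k) x) \<longlonglongrightarrow> g x"
    using conv by eventually_elim (simp add: g_def convergent_LIMSEQ_iff)
  have key: "integrable M (\<lambda>x. (norm (f n x - g x))\<^sup>2) \<and> (LINT x|M. (norm (f n x - g x))\<^sup>2) \<le> (1/4)^k"
    if "n \<ge> N k" for n k
  proof (rule Fatou_bounded[where F="\<lambda>j x. (norm (f n x - f (r j) x))\<^sup>2"])
    show "AE x in M. (\<lambda>j. (norm (f n x - f (r j) x))\<^sup>2) \<longlonglongrightarrow> (norm (f n x - g x))\<^sup>2"
      using AEg by eventually_elim (intro tendsto_intros)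
    show "\<forall>\<^sub>F j in sequentially. (LINT x|M. (norm (f n x - f (r j) x))\<^sup>2) \<le> (1/4)^k"
      using eventually_ge_at_top[of "k"]
    proof eventually_elim
      case (elim j)
      then have "N k \<le> r j" using rN[of k] strict_mono_less_eq[OF r, of k j] by linarith
      then show ?case using N[OF that, of "r j"] by simp
    qed
  qed (use fi in auto)
  have "L2 M (\<lambda>x. f (N 0) x - g x)" using key[of 0 "N 0"] by (simp add: L2_def)
  then have gL: "L2 M g" using L2_diff[OF f[of "N 0"]] by fastforce
  have "(\<lambda>n. LINT x|M. (norm (f n x - g x))\<^sup>2) \<longlonglongrightarrow> 0"
  proof (rule LIMSEQ_I)
    fix e :: real assume "e > 0"
    then obtain k where k: "(1/4)^k < e" using real_arch_pow_inv[of e "1/4"] by auto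
    show "\<exists>no. \<forall>n\<ge>no. norm ((LINT x|M. (norm (f n x - g x))\<^sup>2) - 0) < e"
    proof (intro exI allI impI)
      fix n assume "n \<ge> N k"
      then show "norm ((LINT x|M. (norm (f n x - g x))\<^sup>2) - 0) < e" using key[of k n] k by simp
    qed
  qed
  then show ?thesis using that gL r AEg by blast
qed

section \<open>Functions of class C^k and the smooth cutoff\<close>

text \<open>Replaces the derivative chosen by \<open>frechet_derivative\<close> with an explicit
  one; the continuity and differentiability clauses of \<open>C_k\<close> follow from its
  existence.\<close>

lemma C_k_SucI:
  assumes "\<And>x. (f has_derivative D x) (at x)" "\<And>v. C_k n (\<lambda>x. D x v)"
  shows "C_k (Suc n) f"
proof -
  have "frechet_derivative f (at x) = D x" for x using frechet_derivative_at[OF assms(1)] by simp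
  moreover have "f differentiable_on UNIV"
    using assms(1) by (auto simp: differentiable_on_def differentiable_def intro: has_derivative_at_withinI)
  ultimately show ?thesis using assms by (simp add: differentiable_imp_continuous_on)
qed

lemma C_k_Suc_has_derivative:
  "C_k (Suc n) f \<Longrightarrow> (f has_derivative frechet_derivative f (at x)) (at x)"
  by (simp add: differentiable_on_def frechet_derivative_works)

lemma C_k_Suc_deriv: "C_k (Suc n) f \<Longrightarrow> C_k n (\<lambda>x. frechet_derivative f (at x) v)"
  by simp

lemma C_k_SucD: "C_k (Suc n) f \<Longrightarrow> C_k n f"
  by (induction n arbitrary: f) auto

lemma C_k_const: "C_k n (\<lambda>x. c)"
proof (induction n arbitrary: c)
  case (Suc n)
  show ?case by (rule C_k_SucI[where D="\<lambda>x v. 0"]) (auto intro: Suc)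
qed auto

lemma C_k_add: "C_k n f \<Longrightarrow> C_k n g \<Longrightarrow> C_k n (\<lambda>x. f x + g x)"
proof (induction n arbitrary: f g)
  case (Suc n)
  show ?case
  proof (rule C_k_SucI)
    show "((\<lambda>x. f x + g x) has_derivative (\<lambda>v. frechet_derivative f (at x) v + frechet_derivative g (at x) v)) (at x)" for x
      by (intro has_derivative_add C_k_Suc_has_derivative[OF Suc.prems(1)] C_k_Suc_has_derivative[OF Suc.prems(2)])
    show "C_k n (\<lambda>x. frechet_derivative f (at x) v + frechet_derivative g (at x) v)" for v
      by (rule Suc.IH[OF C_k_Suc_deriv[OF Suc.prems(1)] C_k_Suc_deriv[OF Suc.prems(2)]])
  qed
qed (auto intro: continuous_intros)

lemma C_k_mult: "C_k n f \<Longrightarrow> C_k n g \<Longrightarrow> C_k n (\<lambda>x. f x * g x)"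
proof (induction n arbitrary: f g)
  case (Suc n)
  show ?case
  proof (rule C_k_SucI)
    show "((\<lambda>x. f x * g x) has_derivative (\<lambda>v. f x * frechet_derivative g (at x) v + frechet_derivative f (at x) v * g x)) (at x)" for x
      by (intro has_derivative_mult C_k_Suc_has_derivative[OF Suc.prems(1)] C_k_Suc_has_derivative[OF Suc.prems(2)])
    show "C_k n (\<lambda>x. f x * frechet_derivative g (at x) v + frechet_derivative f (at x) v * g x)" for v
      by (rule C_k_add[OF Suc.IH[OF C_k_SucD[OF Suc.prems(1)] C_k_Suc_deriv[OF Suc.prems(2)]]
            Suc.IH[OF C_k_Suc_deriv[OF Suc.prems(1)] C_k_SucD[OF Suc.prems(2)]]])
  qed
qed (auto intro: continuous_intros)

lemma C_k_prod: "(\<And>i. i \<in> I \<Longrightarrow> C_k n (f i)) \<Longrightarrow> C_k n (\<lambda>x. \<Prod>i\<in>I. f i x)"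
  by (induction I rule: infinite_finite_induct) (auto intro: C_k_mult C_k_const)

lemma C_k_linear:
  assumes "bounded_linear l"
  shows "C_k n l"
proof (cases n)
  case (Suc k)
  show ?thesis unfolding Suc
    by (rule C_k_SucI[where D="\<lambda>x. l"]) (auto intro: bounded_linear_imp_has_derivative assms C_k_const)
qed (use assms in \<open>auto intro: linear_continuous_on\<close>)

lemma C_k_compose_affine:
  fixes A :: "'a::euclidean_space \<Rightarrow> 'b::euclidean_space"
  assumes "bounded_linear A"
  shows "C_k n f \<Longrightarrow> C_k n (\<lambda>x. f (A x + a))"
proof (induction n arbitrary: f)
  case 0
  have "continuous_on UNIV (\<lambda>x. A x + a)" using assms by (intro continuous_intros linear_continuous_on)
  then show ?case using 0 continuous_on_compose2[of UNIV f UNIV "\<lambda>x. A x + a"] by auto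
next
  case (Suc n)
  show ?case
  proof (rule C_k_SucI[where D="\<lambda>x v. frechet_derivative f (at (A x + a)) (A v)"])
    fix x
    have A: "((\<lambda>x. A x + a) has_derivative A) (at x)"
      using has_derivative_add[OF bounded_linear_imp_has_derivative[OF assms] has_derivative_const[of a]] by simp
    show "((\<lambda>x. f (A x + a)) has_derivative (\<lambda>v. frechet_derivative f (at (A x + a)) (A v))) (at x)"
      by (rule has_derivative_compose[OF A C_k_Suc_has_derivative[OF Suc.prems]])
  qed (use Suc in \<open>auto simp del: C_k.simps intro: C_k_Suc_deriv\<close>)
qed

text \<open>\<open>flat 1\<close> is the classical smooth function exp(-1/x) on the positive
  half-line. The polynomial factor in 1/x makes the family closed under differentiation, so
  smoothness is an induction in which \<open>p\<close> varies.\<close>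

definition flat :: "real poly \<Rightarrow> real \<Rightarrow> real" where
  "flat p x = (if x > 0 then poly p (1 / x) * exp (- 1 / x) else 0)"

lemma poly_times_exp_minus_tendsto_0: "((\<lambda>t. poly p t * exp (- t)) \<longlongrightarrow> (0::real)) at_top"
proof -
  have "((\<lambda>t. \<Sum>i\<le>degree p. coeff p i * (t ^ i / exp t)) \<longlongrightarrow> (\<Sum>i\<le>degree p. coeff p i * 0)) at_top"
    by (intro tendsto_intros tendsto_power_div_exp_0)
  then show ?thesis by (simp add: poly_altdef sum_divide_distrib exp_minus field_simps)
qed

text \<open>In the variable t = 1/x one has d/dx = - t^2 d/dt, and p(t) exp(-t) has t-derivative (p'
  - p)(t) exp(-t); this explains the factor \<open>[:0, 0, 1:]\<close>, which is t^2.\<close>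

lemma has_derivative_flat: "(flat p has_real_derivative flat ([:0, 0, 1:] * (p - pderiv p)) x) (at x)"
proof -
  consider "x > 0" | "x < 0" | "x = 0" by linarith
  then show ?thesis
  proof cases
    case 1
    have "((\<lambda>x. poly p (1 / x) * exp (- 1 / x)) has_real_derivative
      (poly (pderiv p) (1 / x) * (- 1 / x\<^sup>2)) * exp (- 1 / x) + poly p (1 / x) * (exp (- 1 / x) * (1 / x\<^sup>2))) (at x)"
      using 1 by (auto intro!: derivative_eq_intros simp: field_simps power2_eq_square)
    then have "((\<lambda>x. poly p (1 / x) * exp (- 1 / x)) has_real_derivative flat ([:0, 0, 1:] * (p - pderiv p)) x) (at x)"
      by (rule DERIV_cong) (use 1 in \<open>simp add: flat_def algebra_simps power2_eq_square\<close>)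
    then show ?thesis
      by (rule has_field_derivative_transform_within_open[of _ _ _ "{0<..}"]) (use 1 in \<open>auto simp: flat_def\<close>)
  next
    case 2
    have "((\<lambda>x. 0) has_real_derivative 0) (at x)" by simp
    then have "(flat p has_real_derivative 0) (at x)"
      by (rule has_field_derivative_transform_within_open[of _ _ _ "{..<0}"]) (use 2 in \<open>auto simp: flat_def\<close>)
    then show ?thesis using 2 by (simp add: flat_def)
  next
    case 3
    \<comment> \<open>With h = 1/t the difference quotient at 0 becomes t * p(t) * exp(-t).\<close>
    have "((\<lambda>h. flat p h / h) \<longlongrightarrow> 0) (at_right 0)"
      unfolding filterlim_at_right_to_top
    proof (rule Lim_transform_eventually[OF poly_times_exp_minus_tendsto_0[of "[:0,1:] * p"]])
      show "\<forall>\<^sub>F t in at_top. poly ([:0, 1:] * p) t * exp (- t) = flat p (inverse t) / inverse t"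
        using eventually_gt_at_top[of "0::real"] by eventually_elim (simp add: flat_def field_simps)
    qed
    moreover have "((\<lambda>h. flat p h / h) \<longlongrightarrow> 0) (at_left 0)"
    proof (rule Lim_transform_eventually[OF tendsto_const])
      show "\<forall>\<^sub>F h in at_left 0. 0 = flat p h / h"
        by (auto simp: eventually_at_filter flat_def)
    qed
    ultimately have "((\<lambda>h. flat p h / h) \<longlongrightarrow> 0) (at 0)" by (simp add: filterlim_split_at)
    moreover have "flat q 0 = 0" for q by (simp add: flat_def)
    ultimately show ?thesis using 3 by (simp add: has_field_derivative_iff)
  qed
qed

lemma continuous_on_flat: "continuous_on UNIV (flat p)"
  using has_derivative_flat by (meson DERIV_continuous_on has_field_derivative_at_within)

lemma C_k_flat:
  assumes g: "\<And>n. C_k n g"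
  shows "C_k n (\<lambda>x. flat p (g x))"
proof (induction n arbitrary: p)
  case 0
  have "continuous_on UNIV g" using g[of 0] by simp
  then show ?case using continuous_on_compose2[OF continuous_on_flat[of p], of UNIV g] by simp
next
  case (Suc n)
  show ?case
  proof (rule C_k_SucI[where D="\<lambda>x v. frechet_derivative g (at x) v * flat ([:0, 0, 1:] * (p - pderiv p)) (g x)"])
    fix x
    have 1: "(flat p has_derivative (\<lambda>h. h * flat ([:0, 0, 1:] * (p - pderiv p)) (g x))) (at (g x))"
      using has_derivative_flat[of p "g x"] by (simp add: has_field_derivative_def mult.commute[of _ "flat _ _"] mult_commute_abs)
    show "((\<lambda>x. flat p (g x)) has_derivative (\<lambda>v. frechet_derivative g (at x) v * flat ([:0, 0, 1:] * (p - pderiv p)) (g x))) (at x)"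
      by (rule has_derivative_compose[OF C_k_Suc_has_derivative[OF g] 1])
    show "C_k n (\<lambda>x. frechet_derivative g (at x) v * flat ([:0, 0, 1:] * (p - pderiv p)) (g x))" for v
      by (intro C_k_mult Suc.IH C_k_Suc_deriv[OF g])
  qed
qed

lemma flat_1_bounds: "0 \<le> flat 1 x" "flat 1 x \<le> 1"
  by (auto simp: flat_def)

lemma flat_1_scaled_tendsto: "(\<lambda>n. flat 1 (real n * x)) \<longlonglongrightarrow> (if x > 0 then 1 else 0)"
proof (cases "x > 0")
  case True
  have "(\<lambda>n. exp (- 1 / (real n * x))) \<longlonglongrightarrow> 1" using True by real_asymp
  moreover have "\<forall>\<^sub>F n in sequentially. exp (- 1 / (real n * x)) = flat 1 (real n * x)"
    using eventually_gt_at_top[of 0] by eventually_elim (use True in \<open>simp add: flat_def\<close>)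
  ultimately show ?thesis using True Lim_transform_eventually by fastforce
next
  case False
  then have "flat 1 (real n * x) = 0" for n by (simp add: flat_def zero_less_mult_iff)
  then show ?thesis using False by simp
qed

subsection \<open>Test functions\<close>

lemma test_fun_C_k: "test_fun \<phi> \<Longrightarrow> C_k n \<phi>"
  by (simp add: test_fun_def)

lemma test_fun_has_derivative:
  "test_fun \<phi> \<Longrightarrow> (\<phi> has_derivative frechet_derivative \<phi> (at x)) (at x)"
  using C_k_Suc_has_derivative test_fun_C_k by blast

lemma test_fun_continuous: "test_fun \<phi> \<Longrightarrow> continuous_on UNIV \<phi>"
  using test_fun_C_k[of \<phi> 0] by simp

lemma test_fun_lin:
  assumes "test_fun \<phi>" "test_fun \<psi>"
  shows "test_fun (\<lambda>x. a * \<phi> x + b * \<psi> x)"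
proof -
  obtain r s where "\<forall>x. r < norm x \<longrightarrow> \<phi> x = 0" "\<forall>x. s < norm x \<longrightarrow> \<psi> x = 0"
    using assms by (auto simp: test_fun_def)
  then have "\<forall>x. max r s < norm x \<longrightarrow> a * \<phi> x + b * \<psi> x = 0" by auto
  moreover have "C_k n (\<lambda>x. a * \<phi> x + b * \<psi> x)" for n
    by (intro C_k_add C_k_mult C_k_const test_fun_C_k assms)
  ultimately show ?thesis unfolding test_fun_def by blast
qed

lemma test_fun_zero: "test_fun (\<lambda>x. 0)"
  by (simp add: test_fun_def C_k_const)

lemma test_fun_deriv:
  assumes "test_fun \<phi>"
  shows "test_fun (\<lambda>x. frechet_derivative \<phi> (at x) v)"
proof -
  obtain r where r: "\<And>x. r < norm x \<Longrightarrow> \<phi> x = 0" using assms by (auto simp: test_fun_def)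
  have "frechet_derivative \<phi> (at x) = (\<lambda>h. 0)" if "r < norm x" for x
  proof -
    have "((\<lambda>x. 0) has_derivative (\<lambda>h. 0)) (at x)" by simp
    then have "(\<phi> has_derivative (\<lambda>h. 0)) (at x)"
    proof (rule has_derivative_transform_within_open[of _ _ _ UNIV "{x. r < norm x}"])
      show "open {x::'a. r < norm x}" by (intro open_Collect_less continuous_intros)
    qed (use r that in auto)
    then show ?thesis using frechet_derivative_at by metis
  qed
  then have "\<forall>x. r < norm x \<longrightarrow> frechet_derivative \<phi> (at x) v = 0" by simp
  moreover have "C_k n (\<lambda>x. frechet_derivative \<phi> (at x) v)" for n
    using C_k_Suc_deriv[OF test_fun_C_k[OF assms]] .
  ultimately show ?thesis unfolding test_fun_def by blast
qed

lemma test_fun_isometry: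
  fixes A :: "'a::euclidean_space \<Rightarrow> 'a" and \<phi> :: "'a \<Rightarrow> real"
  assumes "test_fun \<phi>" "orthogonal_transformation A"
  shows "test_fun (\<lambda>x. \<phi> (A x + a))"
proof -
  obtain r where r: "\<And>x. r < norm x \<Longrightarrow> \<phi> x = 0" using assms by (auto simp: test_fun_def)
  have "\<forall>x. r + norm a < norm x \<longrightarrow> \<phi> (A x + a) = 0"
  proof (intro allI impI r)
    fix x :: 'a assume "r + norm a < norm x"
    moreover have "norm (A x) \<le> norm (A x + a) + norm a" using norm_triangle_ineq4[of "A x + a" a] by simp
    ultimately show "r < norm (A x + a)" using orthogonal_transformation_norm[OF assms(2), of x] by simp
  qed
  moreover have "bounded_linear A"
    using assms(2) by (simp add: orthogonal_transformation_linear linear_conv_bounded_linear[symmetric])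
  ultimately show ?thesis unfolding test_fun_def
    using C_k_compose_affine test_fun_C_k[OF assms(1)] by blast
qed

lemma test_fun_shift: "test_fun \<phi> \<Longrightarrow> test_fun (\<lambda>x. \<phi> (x + a))"
  using test_fun_isometry[OF _ orthogonal_transformation_id, of \<phi> a] by simp

lemma continuous_compact_support:
  fixes f :: "'a::euclidean_space \<Rightarrow> real"
  assumes c: "continuous_on UNIV f" and r: "\<And>x. r < norm x \<Longrightarrow> f x = 0"
  shows "integrable lborel f" "\<exists>K. \<forall>x. \<bar>f x\<bar> \<le> K"
proof -
  have e: "(\<lambda>x. indicator (cball 0 r) x *\<^sub>R f x) = f" using r by (auto simp: indicator_def fun_eq_iff not_le)
  have "integrable lborel (\<lambda>x. indicator (cball 0 r) x *\<^sub>R f x)"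
    by (intro borel_integrable_compact continuous_on_subset[OF c]) auto
  then show "integrable lborel f" unfolding e .
  have "compact (f ` cball 0 r)" by (intro compact_continuous_image continuous_on_subset[OF c]) auto
  then obtain K where "\<And>x. x \<in> cball 0 r \<Longrightarrow> norm (f x) \<le> K"
    using compact_imp_bounded bounded_iff by (metis imageI)
  then have "\<bar>f x\<bar> \<le> max K 0" for x
    using r[of x] by (cases "norm x \<le> r") (auto simp: max_def, smt (verit))
  then show "\<exists>K. \<forall>x. \<bar>f x\<bar> \<le> K" by blast
qed

lemma test_fun_measurable: "test_fun \<phi> \<Longrightarrow> \<phi> \<in> borel_measurable lborel"
  using borel_measurable_continuous_onI[OF test_fun_continuous] by simp

lemma test_fun_bounded: "test_fun \<phi> \<Longrightarrow> \<exists>K. \<forall>x. \<bar>\<phi> x\<bar> \<le> K"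
  using continuous_compact_support(2) test_fun_continuous unfolding test_fun_def by metis

lemma test_fun_integrable: "test_fun \<phi> \<Longrightarrow> integrable lborel \<phi>"
  using continuous_compact_support(1) test_fun_continuous unfolding test_fun_def by metis

lemma test_fun_mult:
  assumes "test_fun \<phi>" "test_fun \<psi>"
  shows "test_fun (\<lambda>x. \<phi> x * \<psi> x)"
  using assms unfolding test_fun_def by (fastforce intro: C_k_mult)

lemma test_fun_L2: "test_fun \<phi> \<Longrightarrow> L2 lborel \<phi>"
  using test_fun_integrable[OF test_fun_mult, of \<phi> \<phi>] test_fun_measurable
  by (simp add: L2_def power2_eq_square)

section \<open>The fundamental lemma and duality with test functions\<close>

text \<open>Smooth approximations of the indicator of \<open>box a b\<close>: all are supported in
  the same box and bounded by 1, so dominated convergence applies as n grows.\<close>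

definition box_test :: "'a::euclidean_space \<Rightarrow> 'a \<Rightarrow> nat \<Rightarrow> 'a \<Rightarrow> real" where
  "box_test a b n x = (\<Prod>i\<in>Basis. flat 1 (real n * ((x - a) \<bullet> i)) * flat 1 (real n * ((b - x) \<bullet> i)))"

lemma box_test_outside: "x \<notin> box a b \<Longrightarrow> box_test a b n x = 0"
proof -
  assume "x \<notin> box a b"
  then obtain i where i: "i \<in> Basis" "(x - a) \<bullet> i \<le> 0 \<or> (b - x) \<bullet> i \<le> 0"
    by (force simp: mem_box inner_diff_left)
  then have "flat 1 (real n * ((x - a) \<bullet> i)) * flat 1 (real n * ((b - x) \<bullet> i)) = 0"
    by (auto simp: flat_def zero_less_mult_iff)
  then show ?thesis using i unfolding box_test_def by (intro prod_zero) auto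
qed

lemma box_test_bounds: "0 \<le> box_test a b n x" "box_test a b n x \<le> 1"
  unfolding box_test_def by (auto intro!: prod_nonneg prod_le_1 mult_nonneg_nonneg mult_le_one flat_1_bounds)

lemma test_fun_box_test: "test_fun (box_test a b n)"
proof -
  have "bounded (box a b)" by (rule bounded_box)
  then obtain r where "\<forall>x\<in>box a b. norm x \<le> r" by (auto simp: bounded_iff)
  then have "\<forall>x. r < norm x \<longrightarrow> box_test a b n x = 0" using box_test_outside by (metis not_le)
  moreover have "C_k k (box_test a b n)" for k
  proof -
    have lin: "C_k j (\<lambda>x. c * (x \<bullet> i) + d)" for j c d and i :: 'a
      by (intro C_k_add C_k_mult C_k_const C_k_linear bounded_linear_inner_left)
    have "C_k k (\<lambda>x. flat 1 (real n * ((x - a) \<bullet> i)))" for i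
      using C_k_flat[OF lin[of _ "real n" i "- real n * (a \<bullet> i)"], of k 1] by (simp add: algebra_simps)
    moreover have "C_k k (\<lambda>x. flat 1 (real n * ((b - x) \<bullet> i)))" for i
      using C_k_flat[OF lin[of _ "- real n" i "real n * (b \<bullet> i)"], of k 1] by (simp add: algebra_simps)
    ultimately show ?thesis unfolding box_test_def[abs_def] by (intro C_k_prod C_k_mult)
  qed
  ultimately show ?thesis unfolding test_fun_def by blast
qed

lemma box_test_tendsto: "(\<lambda>n. box_test a b n x) \<longlonglongrightarrow> indicator (box a b) x"
proof -
  have "(\<lambda>n. box_test a b n x) \<longlonglongrightarrow>
    (\<Prod>i\<in>Basis. (if (x - a) \<bullet> i > 0 then 1 else 0) * (if (b - x) \<bullet> i > 0 then 1 else 0))"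
    unfolding box_test_def by (intro tendsto_intros flat_1_scaled_tendsto)
  also have "(\<Prod>i\<in>Basis. (if (x - a) \<bullet> i > 0 then 1 else 0) * (if (b - x) \<bullet> i > 0 then 1 else (0::real))) = indicator (box a b) x"
  proof (cases "x \<in> box a b")
    case True
    then show ?thesis by (auto simp: mem_box inner_diff_left intro!: prod.neutral)
  next
    case False
    then obtain i where "i \<in> Basis" "\<not> ((x - a) \<bullet> i > 0 \<and> (b - x) \<bullet> i > 0)"
      by (force simp: mem_box inner_diff_left)
    then have "(\<Prod>i\<in>Basis. (if (x - a) \<bullet> i > 0 then 1 else 0) * (if (b - x) \<bullet> i > 0 then 1 else (0::real))) = 0"
      by (intro prod_zero) auto
    then show ?thesis using False by simp
  qed
  finally show ?thesis .
qed

lemma L2_indicator: "A \<in> sets M \<Longrightarrow> emeasure M A < \<infinity> \<Longrightarrow> L2 M (indicator A :: 'a \<Rightarrow> real)"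
  by (simp add: L2_def power2_eq_square indicator_inter_arith[symmetric])

text \<open>Orthogonality passes from test functions to indicators of boxes. The measures with
  densities w^+ and w^- then agree on boxes, an intersection-stable generator, hence everywhere, and
  densities are unique almost everywhere.\<close>

theorem fundamental_lemma:
  fixes w :: "'a::euclidean_space \<Rightarrow> real"
  assumes w: "L2 lborel w" and orth: "\<And>\<phi>. test_fun \<phi> \<Longrightarrow> (LINT x|lborel. w x * \<phi> x) = 0"
  shows "AE x in lborel. w x = 0"
proof -
  have wm[measurable]: "w \<in> borel_measurable borel" using w by (simp add: L2_def)
  have wi: "integrable lborel (\<lambda>x. w x * indicator (box a b) x)" for a b
    using emeasure_bounded_finite[OF bounded_box[of a b]] by (intro L2_mult_integrable w L2_indicator) auto
  have w0: "(LINT x|lborel. w x * indicator (box a b) x) = 0" for a b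
  proof -
    have "(\<lambda>n. LINT x|lborel. w x * box_test a b n x) \<longlonglongrightarrow> (LINT x|lborel. w x * indicator (box a b) x)"
    proof (rule integral_dominated_convergence[where w="\<lambda>x. \<bar>w x * indicator (box a b) x\<bar>"])
      show "(\<lambda>x. w x * box_test a b n x) \<in> borel_measurable lborel" for n
        using test_fun_measurable[OF test_fun_box_test, of a b n] by simp
      show "AE x in lborel. (\<lambda>n. w x * box_test a b n x) \<longlonglongrightarrow> w x * indicator (box a b) x"
        by (intro AE_I2 tendsto_intros box_test_tendsto)
      show "AE x in lborel. norm (w x * box_test a b n x) \<le> \<bar>w x * indicator (box a b) x\<bar>" for n
      proof (rule AE_I2)
        fix x show "norm (w x * box_test a b n x) \<le> \<bar>w x * indicator (box a b) x\<bar>"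
          using box_test_outside[of x a b n] box_test_bounds[of a b n x]
          by (cases "x \<in> box a b") (auto simp: abs_mult mult_left_le)
      qed
    qed (use wi in auto)
    then show ?thesis by (simp add: orth[OF test_fun_box_test] LIMSEQ_const_iff)
  qed
  define P where "P x = ennreal (max 0 (w x))" for x
  define Q where "Q x = ennreal (max 0 (- w x))" for x
  have [measurable]: "P \<in> borel_measurable borel" "Q \<in> borel_measurable borel"
    unfolding P_def[abs_def] Q_def[abs_def] by measurable
  have box_eq: "emeasure (density lborel P) (box a b) = ennreal (LINT x|lborel. max 0 (w x) * indicator (box a b) x)"
    "emeasure (density lborel Q) (box a b) = ennreal (LINT x|lborel. max 0 (- w x) * indicator (box a b) x)"
    "(LINT x|lborel. max 0 (w x) * indicator (box a b) x) = (LINT x|lborel. max 0 (- w x) * indicator (box a b) x)" for a b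
  proof -
    have 1: "integrable lborel (\<lambda>x. max 0 (w x) * indicator (box a b) x)"
      by (rule Bochner_Integration.integrable_bound[OF wi[of a b]]) (auto simp: indicator_def)
    have 2: "integrable lborel (\<lambda>x. max 0 (- w x) * indicator (box a b) x)"
      by (rule Bochner_Integration.integrable_bound[OF wi[of a b]]) (auto simp: indicator_def)
    have "emeasure (density lborel P) (box a b) = (\<integral>\<^sup>+x. ennreal (max 0 (w x) * indicator (box a b) x) \<partial>lborel)"
      by (subst emeasure_density) (auto simp: P_def indicator_def intro!: nn_integral_cong)
    then show "emeasure (density lborel P) (box a b) = ennreal (LINT x|lborel. max 0 (w x) * indicator (box a b) x)"
      using nn_integral_eq_integral[OF 1] by simp
    have "emeasure (density lborel Q) (box a b) = (\<integral>\<^sup>+x. ennreal (max 0 (- w x) * indicator (box a b) x) \<partial>lborel)"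
      by (subst emeasure_density) (auto simp: Q_def indicator_def intro!: nn_integral_cong)
    then show "emeasure (density lborel Q) (box a b) = ennreal (LINT x|lborel. max 0 (- w x) * indicator (box a b) x)"
      using nn_integral_eq_integral[OF 2] by simp
    have "(LINT x|lborel. max 0 (w x) * indicator (box a b) x) - (LINT x|lborel. max 0 (- w x) * indicator (box a b) x)
      = (LINT x|lborel. max 0 (w x) * indicator (box a b) x - max 0 (- w x) * indicator (box a b) x)"
      using 1 2 by simp
    also have "\<dots> = (LINT x|lborel. w x * indicator (box a b) x)"
      by (intro Bochner_Integration.integral_cong) (auto simp: indicator_def)
    finally show "(LINT x|lborel. max 0 (w x) * indicator (box a b) x) = (LINT x|lborel. max 0 (- w x) * indicator (box a b) x)"
      using w0[of a b] by simp
  qed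
  have "density lborel P = density lborel Q"
  proof (rule measure_eqI_generator_eq[where E="range (\<lambda>(a, b). box a b)" and \<Omega>=UNIV and A="\<lambda>n::nat. box (- (real n *\<^sub>R One)) (real n *\<^sub>R One)"])
    show "Int_stable (range (\<lambda>(a, b). box a b :: 'a set))" by (auto simp: Int_stable_def box_Int_box)
    show "sets (density lborel P) = sigma_sets UNIV (range (\<lambda>(a, b). box a b))" "sets (density lborel Q) = sigma_sets UNIV (range (\<lambda>(a, b). box a b))"
      by (simp_all add: borel_eq_box)
    show "(\<Union>n::nat. box (- (real n *\<^sub>R One)) (real n *\<^sub>R One) :: 'a set) = UNIV"
      by (rule UN_box_eq_UNIV)
    show "emeasure (density lborel P) (box (- (real n *\<^sub>R One)) (real n *\<^sub>R One)) \<noteq> \<infinity>" for n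
      by (simp add: box_eq)
    show "emeasure (density lborel P) X = emeasure (density lborel Q) X" if "X \<in> range (\<lambda>(a, b). box a b)" for X
      using that box_eq by auto
  qed auto
  then have "AE x in lborel. P x = Q x" by (intro sigma_finite_measure.density_unique[OF sigma_finite_lborel]) auto
  then show ?thesis by eventually_elim (auto simp: P_def Q_def max_def ennreal_eq_0_iff split: if_splits)
qed

lemma pre_hilbert_test_fun: "pre_hilbert {\<phi>::'a::euclidean_space \<Rightarrow> real. test_fun \<phi>} (\<lambda>u v. LINT x|lborel. u x * v x)"
proof -
  interpret L: pre_hilbert "{u::'a \<Rightarrow> real. L2 lborel u}" "\<lambda>u v. LINT x|lborel. u x * v x"
    by (rule pre_hilbert_L2)
  show ?thesis
  proof
    show "{\<phi>::'a \<Rightarrow> real. test_fun \<phi>} \<noteq> {}" using test_fun_zero by blast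
    show "(LINT x|lborel. (a * u x + b * v x) * w x) = a * (LINT x|lborel. u x * w x) + b * (LINT x|lborel. v x * w x)"
      if "u \<in> {\<phi>. test_fun \<phi>}" "v \<in> {\<phi>. test_fun \<phi>}" "w \<in> {\<phi>. test_fun \<phi>}" for u v w :: "'a \<Rightarrow> real" and a b
      by (rule L.B_lin) (use that test_fun_L2 in auto)
  qed (auto intro: test_fun_lin simp: mult.commute)
qed

text \<open>The Riesz sequence is built from test functions and converges in L^2 to
  \<open>g\<close>. Evaluating the bound of \<open>L\<close> on that sequence gives
  \<parallel>g\<parallel>^4 \<le> K \<parallel>g\<parallel>^2 in the limit, hence the sharp constant
  \<open>K\<close>.\<close>

lemma Riesz_test_fun:
  fixes L :: "('a::euclidean_space \<Rightarrow> real) \<Rightarrow> real"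
  assumes lin: "\<And>u v a b. test_fun u \<Longrightarrow> test_fun v \<Longrightarrow> L (\<lambda>x. a * u x + b * v x) = a * L u + b * L v"
    and bdd: "\<And>v. test_fun v \<Longrightarrow> (L v)\<^sup>2 \<le> K * (LINT x|lborel. (v x)\<^sup>2)"
    and K: "0 \<le> K"
  obtains g \<phi> where "L2 lborel g" "\<And>n::nat. test_fun (\<phi> n)"
    "(\<lambda>n. LINT x|lborel. (\<phi> n x - g x)\<^sup>2) \<longlonglongrightarrow> 0"
    "\<And>v. test_fun v \<Longrightarrow> (LINT x|lborel. g x * v x) = L v"
    "(LINT x|lborel. (g x)\<^sup>2) \<le> K"
proof -
  interpret L2: pre_hilbert "{u::'a \<Rightarrow> real. L2 lborel u}" "\<lambda>u v. LINT x|lborel. u x * v x"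
    by (rule pre_hilbert_L2)
  interpret T: pre_hilbert "{\<phi>::'a \<Rightarrow> real. test_fun \<phi>}" "\<lambda>u v. LINT x|lborel. u x * v x"
    by (rule pre_hilbert_test_fun)
  obtain \<phi> where p: "\<And>n. test_fun (\<phi> n)"
    and pC: "\<And>n m. (LINT x|lborel. (\<phi> n x - \<phi> m x) * (\<phi> n x - \<phi> m x)) \<le> 2 / real (Suc n) + 2 / real (Suc m)"
    and pL: "\<And>v. test_fun v \<Longrightarrow> (\<lambda>n. LINT x|lborel. \<phi> n x * v x) \<longlonglongrightarrow> L v"
    using T.Riesz_sequence[of L K] lin bdd by (auto simp: power2_eq_square)
  obtain g where g: "L2 lborel g" and lim: "(\<lambda>n. LINT x|lborel. (norm (\<phi> n x - g x))\<^sup>2) \<longlonglongrightarrow> 0"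
  proof (rule L2_complete[where f=\<phi> and M=lborel])
    show "L2 lborel (\<phi> n)" for n using p by (rule test_fun_L2)
    fix e :: real assume "e > 0"
    have "(\<lambda>n. 2 / real (Suc n)) \<longlonglongrightarrow> 0" by real_asymp
    from order_tendstoD(2)[OF this half_gt_zero[OF \<open>e > 0\<close>]] obtain N where N: "2 / real (Suc N) < e / 2"
      unfolding eventually_sequentially by blast
    show "\<exists>N. \<forall>m\<ge>N. \<forall>n\<ge>N. (LINT x|lborel. (norm (\<phi> m x - \<phi> n x))\<^sup>2) < e"
    proof (intro exI[of _ N] allI impI)
      fix m n assume "m \<ge> N" "n \<ge> N"
      then have "2 / real (Suc m) \<le> 2 / real (Suc N)" "2 / real (Suc n) \<le> 2 / real (Suc N)"
        by (auto simp: frac_le)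
      moreover have "p + q < e" if "p \<le> c" "q \<le> c" "c < e / 2" for p q c :: real using that by linarith
      ultimately have "2 / real (Suc m) + 2 / real (Suc n) < e" using N by blast
      then show "(LINT x|lborel. (norm (\<phi> m x - \<phi> n x))\<^sup>2) < e"
        using pC[of m n] by (simp add: power2_eq_square)
    qed
  qed (use that in blast)
  have lim': "(\<lambda>n. LINT x|lborel. (\<phi> n x - g x) * (\<phi> n x - g x)) \<longlonglongrightarrow> 0"
    using lim by (simp add: power2_eq_square)
  have gL: "(LINT x|lborel. g x * v x) = L v" if v: "test_fun v" for v
    using L2.tendsto_B[of \<phi> g v, OF _ _ _ lim'] pL[OF v] p g v test_fun_L2 LIMSEQ_unique by blast
  have 1: "(\<lambda>n. LINT x|lborel. \<phi> n x * g x) \<longlonglongrightarrow> (LINT x|lborel. g x * g x)"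
    using L2.tendsto_B[of \<phi> g g, OF _ _ _ lim'] p g test_fun_L2 by blast
  have 2: "(\<lambda>n. LINT x|lborel. \<phi> n x * \<phi> n x) \<longlonglongrightarrow> (LINT x|lborel. g x * g x)"
    using L2.tendsto_B_self[of \<phi> g, OF _ _ lim'] p g test_fun_L2 by blast
  have "(\<lambda>n. (LINT x|lborel. \<phi> n x * g x)\<^sup>2) \<longlonglongrightarrow> (LINT x|lborel. g x * g x)\<^sup>2"
    by (intro tendsto_intros 1)
  moreover have "(\<lambda>n. K * (LINT x|lborel. \<phi> n x * \<phi> n x)) \<longlonglongrightarrow> K * (LINT x|lborel. g x * g x)"
    by (intro tendsto_intros 2)
  moreover have "(LINT x|lborel. \<phi> n x * g x)\<^sup>2 \<le> K * (LINT x|lborel. \<phi> n x * \<phi> n x)" for n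
    using gL[OF p, of n] bdd[OF p, of n] by (simp add: mult.commute power2_eq_square)
  ultimately have sq: "(LINT x|lborel. g x * g x)\<^sup>2 \<le> K * (LINT x|lborel. g x * g x)"
    by (meson LIMSEQ_le)
  have "(LINT x|lborel. g x * g x) \<le> K"
  proof (cases "(LINT x|lborel. g x * g x) = 0")
    case False
    then have "(LINT x|lborel. g x * g x) > 0" by (simp add: less_le)
    then show ?thesis using sq by (simp add: power2_eq_square)
  qed (use K in simp)
  then show ?thesis using that[of g \<phi>] g p lim gL by (simp add: power2_eq_square)
qed

text \<open>The functional \<phi> \<mapsto> \<integral> w \<phi> has a representative of norm square
  at most \<open>K\<close>, and the fundamental lemma identifies this representative with
  \<open>w\<close>. It allows L^2 norms to be estimated by moving all operations onto test
  functions.\<close>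

lemma L2_duality:
  fixes w :: "'a::euclidean_space \<Rightarrow> real"
  assumes w: "L2 lborel w" and K: "0 \<le> K"
    and bdd: "\<And>v. test_fun v \<Longrightarrow> (LINT x|lborel. w x * v x)\<^sup>2 \<le> K * (LINT x|lborel. (v x)\<^sup>2)"
  shows "(LINT x|lborel. (w x)\<^sup>2) \<le> K"
proof -
  have lin: "(LINT x|lborel. w x * (a * u x + b * v x)) = a * (LINT x|lborel. w x * u x) + b * (LINT x|lborel. w x * v x)"
    if "test_fun u" "test_fun v" for u v and a b :: real
    using pre_hilbert.B_lin_right[OF pre_hilbert_L2[of lborel], of u v w a b] that w test_fun_L2 by auto
  obtain g where g: "L2 lborel g" and gK: "(LINT x|lborel. (g x)\<^sup>2) \<le> K"
    and gw: "\<And>v. test_fun v \<Longrightarrow> (LINT x|lborel. g x * v x) = (LINT x|lborel. w x * v x)"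
    by (rule Riesz_test_fun[where L="\<lambda>v. LINT x|lborel. w x * v x", OF lin bdd K]) (assumption | rule that)+
  have "AE x in lborel. g x - w x = 0"
  proof (rule fundamental_lemma[OF L2_diff[OF g w]])
    fix v :: "'a \<Rightarrow> real" assume v: "test_fun v"
    have "(LINT x|lborel. (g x - w x) * v x) = (LINT x|lborel. g x * v x) - (LINT x|lborel. w x * v x)"
      using pre_hilbert.B_diff_left[OF pre_hilbert_L2[of lborel], of g w v] g w v test_fun_L2 by auto
    then show "(LINT x|lborel. (g x - w x) * v x) = 0" using gw[OF v] by simp
  qed
  then have "(LINT x|lborel. (w x)\<^sup>2) = (LINT x|lborel. (g x)\<^sup>2)"
    using L2_measurable[OF w] L2_measurable[OF g] by (intro integral_cong_AE) auto
  then show ?thesis using gK by simp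
qed

lemma L2_inner: "L2 M g \<Longrightarrow> L2 M (\<lambda>x. g x \<bullet> v)" for v :: "'e::euclidean_space"
proof (rule L2_bound[where g="\<lambda>x. norm v *\<^sub>R g x"])
  assume g: "L2 M g"
  show "L2 M (\<lambda>x. norm v *\<^sub>R g x)" using L2_lin[OF g g, of "norm v" 0] by simp
  show "AE x in M. norm (g x \<bullet> v) \<le> norm (norm v *\<^sub>R g x)"
    by (simp add: Cauchy_Schwarz_ineq2 mult.commute[of "norm v"])
qed (auto simp: L2_def)

lemma norm_square_Basis: "(norm (x::'e::euclidean_space))\<^sup>2 = (\<Sum>b\<in>Basis. (x \<bullet> b)\<^sup>2)"
  unfolding power2_norm_eq_inner by (subst euclidean_inner) (simp add: power2_eq_square)

lemma integral_norm_square_Basis: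
  fixes g :: "'a \<Rightarrow> 'e::euclidean_space"
  assumes "L2 M g"
  shows "(LINT x|M. (norm (g x))\<^sup>2) = (\<Sum>b\<in>Basis. LINT x|M. (g x \<bullet> b)\<^sup>2)"
  unfolding norm_square_Basis
  using L2_inner[OF assms] by (intro Bochner_Integration.integral_sum) (auto simp: L2_def)

lemma lborel_shift_distr: "distr lborel borel (\<lambda>x. x + a) = (lborel :: 'a::euclidean_space measure)"
proof -
  have "(\<lambda>x. x + a) = (+) a" by (auto simp: add.commute)
  then show ?thesis using lborel_distr_plus[of a] by simp
qed

lemma integral_shift:
  fixes f :: "'a::euclidean_space \<Rightarrow> real"
  assumes "f \<in> borel_measurable borel"
  shows "(LINT x|lborel. f (x + a)) = (LINT x|lborel. f x)"
  using integral_distr[of "\<lambda>x. x + a" lborel borel f] assms by (simp add: lborel_shift_distr)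

lemma integrable_shift:
  fixes f :: "'a::euclidean_space \<Rightarrow> real"
  assumes "f \<in> borel_measurable borel" "integrable lborel f"
  shows "integrable lborel (\<lambda>x. f (x + a))"
  using integrable_distr_eq[of "\<lambda>x. x + a" lborel borel f] assms by (simp add: lborel_shift_distr)

lemma L2_shift:
  fixes u :: "'a::euclidean_space \<Rightarrow> real"
  assumes "L2 lborel u"
  shows "L2 lborel (\<lambda>x. u (x + a))"
  using integrable_shift[of "\<lambda>x. (u x)\<^sup>2" a] assms by (auto simp: L2_def)

subsection \<open>Weak gradients\<close>

lemma H1_iff: "H1 u \<longleftrightarrow> L2 lborel u \<and> (\<exists>g. weak_grad u g \<and> L2 lborel g)"
  by (auto simp: H1_def L2_def weak_grad_def)

lemma H1_L2: "H1 u \<Longrightarrow> L2 lborel u"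
  by (simp add: H1_iff)

lemma H1_I: "L2 lborel u \<Longrightarrow> weak_grad u g \<Longrightarrow> L2 lborel g \<Longrightarrow> H1 u"
  by (auto simp: H1_iff)

lemma weak_gradD:
  "weak_grad u g \<Longrightarrow> test_fun \<phi> \<Longrightarrow> (LINT x|lborel. u x * frechet_derivative \<phi> (at x) v) = - (LINT x|lborel. (g x \<bullet> v) * \<phi> x)"
  by (simp add: weak_grad_def)

lemma grad_weak_grad: "H1 u \<Longrightarrow> weak_grad u (grad u)"
  and grad_L2: "H1 u \<Longrightarrow> L2 lborel (grad u)"
proof -
  assume "H1 u"
  then have "\<exists>g. weak_grad u g \<and> integrable lborel (\<lambda>x. (norm (g x))\<^sup>2)" by (simp add: H1_def)
  from someI_ex[OF this] have "weak_grad u (grad u) \<and> integrable lborel (\<lambda>x. (norm (grad u x))\<^sup>2)"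
    by (simp add: grad_def)
  then show "weak_grad u (grad u)" "L2 lborel (grad u)" by (auto simp: L2_def weak_grad_def)
qed

lemma weak_grad_unique:
  fixes g h :: "'a::euclidean_space \<Rightarrow> 'a"
  assumes "weak_grad u g" "weak_grad u h" and g: "L2 lborel g" and h: "L2 lborel h"
  shows "AE x in lborel. g x = h x"
proof -
  have "AE x in lborel. g x \<bullet> b - h x \<bullet> b = 0" for b
  proof (rule fundamental_lemma[OF L2_diff[OF L2_inner[OF g] L2_inner[OF h]]])
    fix \<phi> :: "'a \<Rightarrow> real" assume p: "test_fun \<phi>"
    have "(LINT x|lborel. (g x \<bullet> b - h x \<bullet> b) * \<phi> x) = (LINT x|lborel. (g x \<bullet> b) * \<phi> x) - (LINT x|lborel. (h x \<bullet> b) * \<phi> x)"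
      using pre_hilbert.B_diff_left[OF pre_hilbert_L2[of lborel], of "\<lambda>x. g x \<bullet> b" "\<lambda>x. h x \<bullet> b" \<phi>] L2_inner[OF g] L2_inner[OF h] test_fun_L2[OF p]
      by simp
    then show "(LINT x|lborel. (g x \<bullet> b - h x \<bullet> b) * \<phi> x) = 0"
      using weak_gradD[OF assms(1) p, of b] weak_gradD[OF assms(2) p, of b] by simp
  qed
  then have "AE x in lborel. \<forall>b\<in>Basis. g x \<bullet> b - h x \<bullet> b = 0" by (intro AE_finite_allI) auto
  then show ?thesis by eventually_elim (rule euclidean_eqI, simp)
qed

lemma grad_eqI:
  assumes "L2 lborel u" "weak_grad u g" "L2 lborel g"
  shows "AE x in lborel. grad u x = g x"
  using weak_grad_unique[OF grad_weak_grad assms(2) grad_L2 assms(3)] H1_I[OF assms] by blast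

lemma weak_grad_lin:
  assumes u: "L2 lborel u" and v: "L2 lborel v" and g: "L2 lborel g" and h: "L2 lborel h"
    and ug: "weak_grad u g" and vh: "weak_grad v h"
  shows "weak_grad (\<lambda>x. a * u x + b * v x) (\<lambda>x. a *\<^sub>R g x + b *\<^sub>R h x)"
  unfolding weak_grad_def
proof (intro conjI allI impI)
  show "(\<lambda>x. a *\<^sub>R g x + b *\<^sub>R h x) \<in> borel_measurable lborel" using L2_lin[OF g h] by (rule L2_measurable)
  fix \<phi> :: "'a \<Rightarrow> real" and w :: 'a assume p: "test_fun \<phi>"
  interpret L: pre_hilbert "{u::'a \<Rightarrow> real. L2 lborel u}" "\<lambda>u v. LINT x|lborel. u x * v x"
    by (rule pre_hilbert_L2)
  have "(LINT x|lborel. (a * u x + b * v x) * frechet_derivative \<phi> (at x) w)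
    = a * (LINT x|lborel. u x * frechet_derivative \<phi> (at x) w) + b * (LINT x|lborel. v x * frechet_derivative \<phi> (at x) w)"
    by (rule L.B_lin) (use u v test_fun_L2[OF test_fun_deriv[OF p]] in auto)
  also have "\<dots> = - (a * (LINT x|lborel. (g x \<bullet> w) * \<phi> x) + b * (LINT x|lborel. (h x \<bullet> w) * \<phi> x))"
    by (simp add: weak_gradD[OF ug p] weak_gradD[OF vh p])
  also have "a * (LINT x|lborel. (g x \<bullet> w) * \<phi> x) + b * (LINT x|lborel. (h x \<bullet> w) * \<phi> x)
    = (LINT x|lborel. (a * (g x \<bullet> w) + b * (h x \<bullet> w)) * \<phi> x)"
    by (rule L.B_lin[symmetric]) (use L2_inner[OF g] L2_inner[OF h] test_fun_L2[OF p] in auto)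
  also have "\<dots> = (LINT x|lborel. ((a *\<^sub>R g x + b *\<^sub>R h x) \<bullet> w) * \<phi> x)" by (simp add: inner_add_left)
  finally show "(LINT x|lborel. (a * u x + b * v x) * frechet_derivative \<phi> (at x) w) = - (LINT x|lborel. ((a *\<^sub>R g x + b *\<^sub>R h x) \<bullet> w) * \<phi> x)" .
qed

lemma H1_lin: "H1 u \<Longrightarrow> H1 v \<Longrightarrow> H1 (\<lambda>x. a * u x + b * v x)"
  by (rule H1_I[OF L2_lin_real weak_grad_lin[where g="grad u" and h="grad v"] L2_lin]) (auto intro: H1_L2 grad_L2 grad_weak_grad)

lemma grad_lin:
  "H1 u \<Longrightarrow> H1 v \<Longrightarrow> AE x in lborel. grad (\<lambda>x. a * u x + b * v x) x = a *\<^sub>R grad u x + b *\<^sub>R grad v x"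
  by (intro grad_eqI L2_lin_real weak_grad_lin L2_lin grad_weak_grad grad_L2 H1_L2)

text \<open>The test function is transported by the inverse map y \<mapsto> T y - T a, and
  \<open>T\<close>, being the inverse of \<open>A\<close>, is also its adjoint. Invariance of the
  measure enters as a hypothesis; it is established in \<open>symm_distr\<close> for the maps to
  which the lemma is applied.\<close>

lemma weak_grad_isometry:
  fixes A T :: "'a::euclidean_space \<Rightarrow> 'a"
  assumes A: "orthogonal_transformation A" and T: "orthogonal_transformation T"
    and AT: "\<And>x. A (T x) = x" "\<And>x. T (A x) = x"
    and inv: "distr lborel borel (\<lambda>x. A x + a) = lborel"
    and ug: "weak_grad u g" and u: "u \<in> borel_measurable borel"
  shows "weak_grad (\<lambda>x. u (A x + a)) (\<lambda>x. T (g (A x + a)))"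
  unfolding weak_grad_def
proof (intro conjI allI impI)
  have bl: "bounded_linear A" "bounded_linear T"
    using A T by (simp_all add: orthogonal_transformation_linear linear_conv_bounded_linear[symmetric])
  have Tm[measurable]: "T \<in> borel_measurable borel" and Am[measurable]: "A \<in> borel_measurable borel"
    using bl by (auto intro!: borel_measurable_continuous_onI linear_continuous_on)
  have gm[measurable]: "g \<in> borel_measurable borel" using ug by (simp add: weak_grad_def)
  note u[measurable]
  show "(\<lambda>x. T (g (A x + a))) \<in> borel_measurable lborel" by simp
  fix \<phi> :: "'a \<Rightarrow> real" and v :: 'a assume p: "test_fun \<phi>"
  define \<psi> where "\<psi> y = \<phi> (T y + (- T a))" for y
  have ps: "test_fun \<psi>" unfolding \<psi>_def by (rule test_fun_isometry[OF p T])
  have ST: "T (A x + a) + (- T a) = x" for x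
    using linear_add[OF orthogonal_transformation_linear[OF T], of "A x" a] AT by simp
  have d: "frechet_derivative \<psi> (at (A x + a)) (A v) = frechet_derivative \<phi> (at x) v" for x
  proof -
    have l: "((\<lambda>y. T y + (- T a)) has_derivative T) (at (A x + a))"
      using has_derivative_add[OF bounded_linear_imp_has_derivative[OF bl(2)] has_derivative_const[of "- T a"]] by simp
    have "(\<phi> has_derivative frechet_derivative \<phi> (at x)) (at (T (A x + a) + (- T a)))"
      unfolding ST by (rule test_fun_has_derivative[OF p])
    from has_derivative_compose[OF l this]
    have "(\<psi> has_derivative (\<lambda>h. frechet_derivative \<phi> (at x) (T h))) (at (A x + a))" by (simp add: \<psi>_def[abs_def])
    from fun_cong[OF frechet_derivative_at[OF this], of "A v"] show ?thesis by (simp add: AT)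
  qed
  have pm: "\<psi> \<in> borel_measurable borel" "(\<lambda>y. frechet_derivative \<psi> (at y) (A v)) \<in> borel_measurable borel"
    using test_fun_measurable[OF ps] test_fun_measurable[OF test_fun_deriv[OF ps]] by auto
  have "(LINT x|lborel. u (A x + a) * frechet_derivative \<phi> (at x) v)
    = (LINT x|lborel. u (A x + a) * frechet_derivative \<psi> (at (A x + a)) (A v))" by (simp add: d)
  also have "\<dots> = (LINT y|distr lborel borel (\<lambda>x. A x + a). u y * frechet_derivative \<psi> (at y) (A v))"
    using pm by (subst integral_distr) auto
  also have "\<dots> = - (LINT y|lborel. (g y \<bullet> A v) * \<psi> y)"
    unfolding inv by (rule weak_gradD[OF ug ps])
  also have "(LINT y|lborel. (g y \<bullet> A v) * \<psi> y) = (LINT y|distr lborel borel (\<lambda>x. A x + a). (g y \<bullet> A v) * \<psi> y)"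
    unfolding inv ..
  also have "\<dots> = (LINT x|lborel. (g (A x + a) \<bullet> A v) * \<psi> (A x + a))"
    using pm by (subst integral_distr) auto
  also have "\<dots> = (LINT x|lborel. (T (g (A x + a)) \<bullet> v) * \<phi> x)"
  proof -
    have "w \<bullet> A v = T w \<bullet> v" for w using T AT by (metis orthogonal_transformation_def)
    moreover have "\<psi> (A x + a) = \<phi> x" for x unfolding \<psi>_def ST ..
    ultimately show ?thesis by simp
  qed
  finally show "(LINT x|lborel. u (A x + a) * frechet_derivative \<phi> (at x) v) = - (LINT x|lborel. (T (g (A x + a)) \<bullet> v) * \<phi> x)" .
qed

text \<open>Both sides of the defining identity are L^2 pairings with fixed functions, hence
  continuous under L^2 convergence. This identifies the gradient component of limits in Y.\<close>

lemma weak_grad_closed: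
  fixes u :: "'a::euclidean_space \<Rightarrow> real"
  assumes un: "\<And>n. L2 lborel (un n)" and gn: "\<And>n. L2 lborel (gn n)" and u: "L2 lborel u" and g: "L2 lborel g"
    and wg: "\<And>n. weak_grad (un n) (gn n)"
    and limu: "(\<lambda>n. LINT x|lborel. (un n x - u x)\<^sup>2) \<longlonglongrightarrow> 0"
    and limg: "(\<lambda>n. LINT x|lborel. (norm (gn n x - g x))\<^sup>2) \<longlonglongrightarrow> 0"
  shows "weak_grad u g"
  unfolding weak_grad_def
proof (intro conjI allI impI)
  show "g \<in> borel_measurable lborel" using g by (rule L2_measurable)
  fix \<phi> :: "'a \<Rightarrow> real" and v :: 'a assume p: "test_fun \<phi>"
  interpret L: pre_hilbert "{u::'a \<Rightarrow> real. L2 lborel u}" "\<lambda>u v. LINT x|lborel. u x * v x"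
    by (rule pre_hilbert_L2)
  have 1: "(\<lambda>n. LINT x|lborel. un n x * frechet_derivative \<phi> (at x) v) \<longlonglongrightarrow> (LINT x|lborel. u x * frechet_derivative \<phi> (at x) v)"
    by (rule L.tendsto_B) (use un u test_fun_L2[OF test_fun_deriv[OF p]] limu in \<open>auto simp: power2_eq_square\<close>)
  have 2: "(\<lambda>n. LINT x|lborel. (gn n x \<bullet> v) * \<phi> x) \<longlonglongrightarrow> (LINT x|lborel. (g x \<bullet> v) * \<phi> x)"
  proof (rule L.tendsto_B)
    have "(\<lambda>n. (norm v)\<^sup>2 * (LINT x|lborel. (norm (gn n x - g x))\<^sup>2)) \<longlonglongrightarrow> (norm v)\<^sup>2 * 0"
      by (intro tendsto_intros limg)
    then have l0: "(\<lambda>n. (norm v)\<^sup>2 * (LINT x|lborel. (norm (gn n x - g x))\<^sup>2)) \<longlonglongrightarrow> 0" by simp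
    show "(\<lambda>n. LINT x|lborel. (gn n x \<bullet> v - g x \<bullet> v) * (gn n x \<bullet> v - g x \<bullet> v)) \<longlonglongrightarrow> 0"
    proof (rule tendsto_sandwich[OF _ _ tendsto_const l0])
      show "\<forall>\<^sub>F n in sequentially. (LINT x|lborel. (gn n x \<bullet> v - g x \<bullet> v) * (gn n x \<bullet> v - g x \<bullet> v)) \<le> (norm v)\<^sup>2 * (LINT x|lborel. (norm (gn n x - g x))\<^sup>2)"
      proof (intro always_eventually allI)
        fix n
        have d: "L2 lborel (\<lambda>x. gn n x - g x)" by (rule L2_diff[OF gn g])
        have "(LINT x|lborel. (gn n x \<bullet> v - g x \<bullet> v) * (gn n x \<bullet> v - g x \<bullet> v)) = (LINT x|lborel. ((gn n x - g x) \<bullet> v)\<^sup>2)"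
          by (simp add: inner_diff_left power2_eq_square)
        also have "\<dots> \<le> (LINT x|lborel. (norm v)\<^sup>2 * (norm (gn n x - g x))\<^sup>2)"
        proof (rule integral_mono)
          show "integrable lborel (\<lambda>x. ((gn n x - g x) \<bullet> v)\<^sup>2)" using L2_inner[OF d, of v] by (simp add: L2_def)
          show "integrable lborel (\<lambda>x. (norm v)\<^sup>2 * (norm (gn n x - g x))\<^sup>2)" using d by (simp add: L2_def)
          show "((gn n x - g x) \<bullet> v)\<^sup>2 \<le> (norm v)\<^sup>2 * (norm (gn n x - g x))\<^sup>2" for x
            using Cauchy_Schwarz_ineq[of "gn n x - g x" v] by (simp add: power2_norm_eq_inner mult.commute)
        qed
        finally show "(LINT x|lborel. (gn n x \<bullet> v - g x \<bullet> v) * (gn n x \<bullet> v - g x \<bullet> v)) \<le> (norm v)\<^sup>2 * (LINT x|lborel. (norm (gn n x - g x))\<^sup>2)"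
          by simp
      qed
    qed auto
  qed (use L2_inner[OF gn] L2_inner[OF g] test_fun_L2[OF p] in auto)
  have "(\<lambda>n. - (LINT x|lborel. (gn n x \<bullet> v) * \<phi> x)) \<longlonglongrightarrow> (LINT x|lborel. u x * frechet_derivative \<phi> (at x) v)"
    using 1 by (simp add: weak_gradD[OF wg p])
  from LIMSEQ_unique[OF this tendsto_minus[OF 2]]
  show "(LINT x|lborel. u x * frechet_derivative \<phi> (at x) v) = - (LINT x|lborel. (g x \<bullet> v) * \<phi> x)" .
qed

section \<open>Translations, difference quotients and weak gradients\<close>

lemma test_fun_line_derivative:
  assumes "test_fun \<phi>"
  shows "((\<lambda>s. \<phi> (x + s *\<^sub>R h)) has_real_derivative frechet_derivative \<phi> (at (x + t *\<^sub>R h)) h) (at t)"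
proof -
  have l: "((\<lambda>s. x + s *\<^sub>R h) has_derivative (\<lambda>s. s *\<^sub>R h)) (at t)"
    by (auto intro!: derivative_eq_intros)
  have D: "(\<phi> has_derivative frechet_derivative \<phi> (at (x + t *\<^sub>R h))) (at (x + t *\<^sub>R h))"
    by (rule test_fun_has_derivative[OF assms])
  have "((\<lambda>s. \<phi> (x + s *\<^sub>R h)) has_derivative (\<lambda>s. frechet_derivative \<phi> (at (x + t *\<^sub>R h)) (s *\<^sub>R h))) (at t)"
    by (rule has_derivative_compose[OF l D])
  moreover have "frechet_derivative \<phi> (at (x + t *\<^sub>R h)) (s *\<^sub>R h) = frechet_derivative \<phi> (at (x + t *\<^sub>R h)) h * s" for s
    using linear_scale[OF has_derivative_linear[OF D]] by (simp add: mult.commute)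
  ultimately show ?thesis by (simp add: has_field_derivative_def)
qed

text \<open>Dominated convergence along sequences: the difference quotients are bounded by the
  maximum of the directional derivative and vanish outside one common ball, on which |u| is
  integrable.\<close>

lemma derivative_shifted_integral:
  fixes u \<phi> :: "'a::euclidean_space \<Rightarrow> real"
  assumes u: "L2 lborel u" and p: "test_fun \<phi>"
  shows "((\<lambda>t. LINT x|lborel. u x * \<phi> (x + t *\<^sub>R h)) has_real_derivative
     (LINT x|lborel. u x * frechet_derivative \<phi> (at (x + t *\<^sub>R h)) h)) (at t)"
  unfolding has_field_derivative_iff tendsto_at_iff_sequentially comp_def
proof (intro allI impI)
  fix s :: "nat \<Rightarrow> real" assume sn: "\<forall>i. s i \<in> UNIV - {t}" and st: "s \<longlonglongrightarrow> t"
  obtain r where r: "\<And>x. r < norm x \<Longrightarrow> \<phi> x = 0" using p by (auto simp: test_fun_def)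
  obtain K where K: "\<And>x. \<bar>frechet_derivative \<phi> (at x) h\<bar> \<le> K"
    using test_fun_bounded[OF test_fun_deriv[OF p]] by blast
  have K0: "0 \<le> K" using K[of 0] by linarith
  obtain b where b: "\<And>n. \<bar>s n\<bar> \<le> b" using convergent_imp_Bseq[OF convergentI[OF st]] by (auto simp: Bseq_def)
  \<comment> \<open>All shifts by \<tau> h with |\<tau>| \<le> b + |t| keep the support inside the
    ball of radius \<open>R\<close>; this covers every \<open>s n\<close> as well as
    \<open>t\<close>.\<close>
  define R where "R = \<bar>r\<bar> + (b + \<bar>t\<bar>) * norm h"
  define q where "q n x = (\<phi> (x + s n *\<^sub>R h) - \<phi> (x + t *\<^sub>R h)) / (s n - t)" for n x
  have lip: "\<bar>q n x\<bar> \<le> K" for n x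
  proof -
    have "norm (\<phi> (x + s n *\<^sub>R h) - \<phi> (x + t *\<^sub>R h)) \<le> K * norm (s n - t)"
      by (rule field_differentiable_bound[where S=UNIV and f'="\<lambda>s. frechet_derivative \<phi> (at (x + s *\<^sub>R h)) h"])
        (use test_fun_line_derivative[OF p] K in auto)
    then show ?thesis using sn by (simp add: q_def field_simps)
  qed
  have supp: "q n x = 0" if "R < norm x" for n x
  proof -
    have "\<phi> (x + \<tau> *\<^sub>R h) = 0" if "\<bar>\<tau>\<bar> \<le> b + \<bar>t\<bar>" for \<tau>
    proof (rule r)
      have "norm (\<tau> *\<^sub>R h) \<le> (b + \<bar>t\<bar>) * norm h" using that by (simp add: mult_right_mono)
      moreover have "norm x \<le> norm (x + \<tau> *\<^sub>R h) + norm (\<tau> *\<^sub>R h)" using norm_triangle_ineq4[of "x + \<tau> *\<^sub>R h" "\<tau> *\<^sub>R h"] by simp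
      ultimately show "r < norm (x + \<tau> *\<^sub>R h)" using \<open>R < norm x\<close> unfolding R_def by linarith
    qed
    from this[of "s n"] this[of t] show ?thesis using b[of n] by (simp add: q_def)
  qed
  have pm[measurable]: "\<phi> \<in> borel_measurable borel" using test_fun_measurable[OF p] by simp
  have um[measurable]: "u \<in> borel_measurable borel" using u by (simp add: L2_def)
  have Dm[measurable]: "(\<lambda>x. frechet_derivative \<phi> (at x) h) \<in> borel_measurable borel"
    using test_fun_measurable[OF test_fun_deriv[OF p]] by simp
  have Dm'[measurable]: "(\<lambda>x. frechet_derivative \<phi> (at (x + t *\<^sub>R h)) h) \<in> borel_measurable borel"
    using measurable_compose[OF _ Dm, of "\<lambda>x. x + t *\<^sub>R h" borel] by simp
  have "(\<lambda>n. LINT x|lborel. u x * q n x) \<longlonglongrightarrow> (LINT x|lborel. u x * frechet_derivative \<phi> (at (x + t *\<^sub>R h)) h)"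
  proof (rule integral_dominated_convergence[where w="\<lambda>x. K * \<bar>u x * indicator (cball 0 R) x\<bar>"])
    have "L2 lborel (indicator (cball 0 R) :: 'a \<Rightarrow> real)"
      using emeasure_bounded_finite[of "cball 0 R"] by (intro L2_indicator) auto
    then show "integrable lborel (\<lambda>x. K * \<bar>u x * indicator (cball 0 R) x\<bar>)"
      using L2_mult_integrable[OF u] by auto
    show "(\<lambda>x. u x * q n x) \<in> borel_measurable lborel" for n unfolding q_def by measurable
    show "AE x in lborel. (\<lambda>n. u x * q n x) \<longlonglongrightarrow> u x * frechet_derivative \<phi> (at (x + t *\<^sub>R h)) h"
    proof (intro AE_I2 tendsto_mult tendsto_const)
      fix x
      show "(\<lambda>n. q n x) \<longlonglongrightarrow> frechet_derivative \<phi> (at (x + t *\<^sub>R h)) h"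
        using test_fun_line_derivative[OF p, of x h t] sn st
        unfolding has_field_derivative_iff tendsto_at_iff_sequentially comp_def q_def by blast
    qed
    show "AE x in lborel. norm (u x * q n x) \<le> K * \<bar>u x * indicator (cball 0 R) x\<bar>" for n
    proof (rule AE_I2)
      fix x show "norm (u x * q n x) \<le> K * \<bar>u x * indicator (cball 0 R) x\<bar>"
        using supp[of x n] mult_left_mono[OF lip[of n x] abs_ge_zero[of "u x"]] K0
        by (cases "R < norm x") (auto simp: abs_mult mult.commute[of K])
    qed
  qed simp
  moreover have "(LINT x|lborel. u x * q n x) = ((LINT x|lborel. u x * \<phi> (x + s n *\<^sub>R h)) - (LINT x|lborel. u x * \<phi> (x + t *\<^sub>R h))) / (s n - t)" for n
  proof -
    have i: "integrable lborel (\<lambda>x. u x * \<phi> (x + c))" for c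
      using L2_mult_integrable[OF u test_fun_L2[OF test_fun_shift[OF p]]] .
    have "(LINT x|lborel. u x * q n x) = (LINT x|lborel. (u x * \<phi> (x + s n *\<^sub>R h) - u x * \<phi> (x + t *\<^sub>R h)) / (s n - t))"
      unfolding q_def by (simp add: algebra_simps)
    also have "\<dots> = (LINT x|lborel. u x * \<phi> (x + s n *\<^sub>R h) - u x * \<phi> (x + t *\<^sub>R h)) / (s n - t)"
      by (rule integral_divide_zero)
    finally show ?thesis by (simp add: Bochner_Integration.integral_diff[OF i i])
  qed
  ultimately show "(\<lambda>n. ((LINT x|lborel. u x * \<phi> (x + s n *\<^sub>R h)) - (LINT x|lborel. u x * \<phi> (x + t *\<^sub>R h))) / (s n - t))
      \<longlonglongrightarrow> (LINT x|lborel. u x * frechet_derivative \<phi> (at (x + t *\<^sub>R h)) h)" by simp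
qed

lemma integral_shift_test:
  fixes u \<phi> :: "'a::euclidean_space \<Rightarrow> real"
  assumes u: "L2 lborel u" and p: "test_fun \<phi>"
  shows "(LINT x|lborel. u x * \<phi> (x - h)) = (LINT x|lborel. u (x + h) * \<phi> x)"
proof -
  have "u \<in> borel_measurable borel" "\<phi> \<in> borel_measurable borel" using u test_fun_measurable[OF p] by (auto simp: L2_def)
  then show ?thesis using integral_shift[of "\<lambda>x. u x * \<phi> (x - h)" h] by simp
qed

lemma frechet_derivative_shift:
  assumes "test_fun \<phi>"
  shows "frechet_derivative (\<lambda>x. \<phi> (x + a)) (at x) v = frechet_derivative \<phi> (at (x + a)) v"
proof -
  have "((\<lambda>x. x + a) has_derivative (\<lambda>x. x)) (at x)" by (auto intro!: derivative_eq_intros)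
  from has_derivative_compose[OF this test_fun_has_derivative[OF assms]]
  show ?thesis using frechet_derivative_at by metis
qed

text \<open>Tested against \<phi>, the difference u(x + h) - u(x) becomes an increment of \<Theta>,
  a differentiable function of the shift of \<phi>. The mean value theorem, Cauchy-Schwarz and
  translation invariance bound it, and \<open>L2_duality\<close> returns to the L^2 norm.
  Differentiation falls on the test function throughout.\<close>

theorem translation_estimate:
  fixes u :: "'a::euclidean_space \<Rightarrow> real"
  assumes u: "L2 lborel u" and ug: "weak_grad u g" and g: "L2 lborel g"
  shows "(LINT x|lborel. (u (x + h) - u x)\<^sup>2) \<le> (LINT x|lborel. (g x \<bullet> h)\<^sup>2)"
proof (rule L2_duality[OF L2_diff[OF L2_shift[OF u] u]])
  fix \<phi> :: "'a \<Rightarrow> real" assume p: "test_fun \<phi>"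
  define \<Theta> where "\<Theta> t = (LINT x|lborel. u x * \<phi> (x + t *\<^sub>R (- h)))" for t
  have D: "(\<Theta> has_real_derivative (LINT x|lborel. (g x \<bullet> h) * \<phi> (x + t *\<^sub>R (- h)))) (at t)" for t
  proof -
    have "(LINT x|lborel. u x * frechet_derivative \<phi> (at (x + t *\<^sub>R (- h))) (- h)) = - (LINT x|lborel. (g x \<bullet> (- h)) * \<phi> (x + t *\<^sub>R (- h)))"
      using weak_gradD[OF ug test_fun_shift[OF p], of "t *\<^sub>R (- h)" "- h"] by (simp only: frechet_derivative_shift[OF p])
    also have "\<dots> = (LINT x|lborel. (g x \<bullet> h) * \<phi> (x + t *\<^sub>R (- h)))" by simp
    finally show ?thesis using derivative_shifted_integral[OF u p, of "- h" t] unfolding \<Theta>_def by simp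
  qed
  from MVT2[of 0 1 \<Theta> "\<lambda>t. LINT x|lborel. (g x \<bullet> h) * \<phi> (x + t *\<^sub>R (- h))"] D
  obtain z where z: "\<Theta> 1 - \<Theta> 0 = (LINT x|lborel. (g x \<bullet> h) * \<phi> (x + z *\<^sub>R (- h)))" by auto
  have "(LINT x|lborel. (u (x + h) - u x) * \<phi> x) = (LINT x|lborel. u (x + h) * \<phi> x) - (LINT x|lborel. u x * \<phi> x)"
    using pre_hilbert.B_diff_left[OF pre_hilbert_L2[of lborel], of "\<lambda>x. u (x + h)" u \<phi>] L2_shift[OF u] u test_fun_L2[OF p] by simp
  also have "\<dots> = \<Theta> 1 - \<Theta> 0" using integral_shift_test[OF u p, of h] by (simp add: \<Theta>_def)
  finally have "(LINT x|lborel. (u (x + h) - u x) * \<phi> x)\<^sup>2 = (LINT x|lborel. (g x \<bullet> h) * \<phi> (x + z *\<^sub>R (- h)))\<^sup>2"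
    using z by simp
  also have "\<dots> \<le> (LINT x|lborel. (g x \<bullet> h)\<^sup>2) * (LINT x|lborel. (\<phi> (x + z *\<^sub>R (- h)))\<^sup>2)"
    by (rule integral_Cauchy_Schwarz[OF L2_inner[OF g] test_fun_L2[OF test_fun_shift[OF p]]])
  also have "(LINT x|lborel. (\<phi> (x + z *\<^sub>R (- h)))\<^sup>2) = (LINT x|lborel. (\<phi> x)\<^sup>2)"
    using test_fun_measurable[OF p] by (intro integral_shift[of "\<lambda>x. (\<phi> x)\<^sup>2"]) auto
  finally show "(LINT x|lborel. (u (x + h) - u x) * \<phi> x)\<^sup>2 \<le> (LINT x|lborel. (g x \<bullet> h)\<^sup>2) * (LINT x|lborel. (\<phi> x)\<^sup>2)" .
qed simp

text \<open>The functional \<phi> \<mapsto> - \<integral> u D\<phi>(b) is a limit of pairings of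
  \<phi> with difference quotients of u, so the hypothesis bounds it and Riesz supplies the b-th
  component of the gradient. One constant per coordinate direction keeps the final bound free of
  losses, as \<open>H1_abs\<close> requires.\<close>

theorem weak_grad_from_differences:
  fixes u :: "'a::euclidean_space \<Rightarrow> real"
  assumes u: "L2 lborel u" and c: "\<And>b. b \<in> Basis \<Longrightarrow> 0 \<le> c b"
    and diff: "\<And>b t. b \<in> Basis \<Longrightarrow> (LINT x|lborel. (u (x + t *\<^sub>R b) - u x)\<^sup>2) \<le> c b * t\<^sup>2"
  obtains g where "weak_grad u g" "L2 lborel g" "(LINT x|lborel. (norm (g x))\<^sup>2) \<le> (\<Sum>b\<in>Basis. c b)"
proof -
  interpret L: pre_hilbert "{u::'a \<Rightarrow> real. L2 lborel u}" "\<lambda>u v. LINT x|lborel. u x * v x"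
    by (rule pre_hilbert_L2)
  have "\<exists>g. L2 lborel g \<and> (\<forall>\<phi>. test_fun \<phi> \<longrightarrow> (LINT x|lborel. g x * \<phi> x) = - (LINT x|lborel. u x * frechet_derivative \<phi> (at x) b))
     \<and> (LINT x|lborel. (g x)\<^sup>2) \<le> c b" if b: "b \<in> Basis" for b
  proof -
    define \<Lambda> where "\<Lambda> \<phi> = - (LINT x|lborel. u x * frechet_derivative \<phi> (at x) b)" for \<phi>
    have lin: "\<Lambda> (\<lambda>x. s * v x + t * w x) = s * \<Lambda> v + t * \<Lambda> w" if vw: "test_fun v" "test_fun w" for v w s t
    proof -
      have "frechet_derivative (\<lambda>x. s * v x + t * w x) (at x) b = s * frechet_derivative v (at x) b + t * frechet_derivative w (at x) b" for x
      proof -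
        have "((\<lambda>x. s * v x + t * w x) has_derivative (\<lambda>h. s * frechet_derivative v (at x) h + t * frechet_derivative w (at x) h)) (at x)"
          by (intro has_derivative_add has_derivative_mult_right test_fun_has_derivative vw)
        from frechet_derivative_at[OF this] show ?thesis by (simp add: fun_eq_iff)
      qed
      then show ?thesis
        using L.B_lin_right[of "\<lambda>x. frechet_derivative v (at x) b" "\<lambda>x. frechet_derivative w (at x) b" u s t]
          u test_fun_L2[OF test_fun_deriv[OF vw(1)]] test_fun_L2[OF test_fun_deriv[OF vw(2)]] by (simp add: \<Lambda>_def)
    qed
    have bdd: "(\<Lambda> \<phi>)\<^sup>2 \<le> c b * (LINT x|lborel. (\<phi> x)\<^sup>2)" if p: "test_fun \<phi>" for \<phi>
    proof -
      define \<Theta> where "\<Theta> t = (LINT x|lborel. u x * \<phi> (x + t *\<^sub>R (- b)))" for t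
      have "(LINT x|lborel. u x * frechet_derivative \<phi> (at x) (- b)) = \<Lambda> \<phi>"
        using linear_neg[OF has_derivative_linear[OF test_fun_has_derivative[OF p]]] by (simp add: \<Lambda>_def)
      then have "(\<Theta> has_real_derivative \<Lambda> \<phi>) (at 0)"
        using derivative_shifted_integral[OF u p, of "- b" 0] by (simp add: \<Theta>_def[abs_def])
      then have lim: "((\<lambda>t. ((\<Theta> t - \<Theta> 0) / (t - 0))\<^sup>2) \<longlongrightarrow> (\<Lambda> \<phi>)\<^sup>2) (at 0)"
        unfolding has_field_derivative_iff by (intro tendsto_intros)
      have "((\<Theta> t - \<Theta> 0) / (t - 0))\<^sup>2 \<le> c b * (LINT x|lborel. (\<phi> x)\<^sup>2)" if "t \<noteq> 0" for t
      proof -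
        have "\<Theta> t - \<Theta> 0 = (LINT x|lborel. u (x + t *\<^sub>R b) * \<phi> x) - (LINT x|lborel. u x * \<phi> x)"
          using integral_shift_test[OF u p, of "t *\<^sub>R b"] by (simp add: \<Theta>_def)
        also have "\<dots> = (LINT x|lborel. (u (x + t *\<^sub>R b) - u x) * \<phi> x)"
          using L.B_diff_left[of "\<lambda>x. u (x + t *\<^sub>R b)" u \<phi>] L2_shift[OF u] u test_fun_L2[OF p] by simp
        finally have "(\<Theta> t - \<Theta> 0)\<^sup>2 \<le> (LINT x|lborel. (u (x + t *\<^sub>R b) - u x)\<^sup>2) * (LINT x|lborel. (\<phi> x)\<^sup>2)"
          using integral_Cauchy_Schwarz[OF L2_diff[OF L2_shift[OF u] u] test_fun_L2[OF p]] by simp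
        also have "\<dots> \<le> (c b * t\<^sup>2) * (LINT x|lborel. (\<phi> x)\<^sup>2)"
          by (intro mult_right_mono diff b) simp
        finally show ?thesis using that by (simp add: power_divide field_simps)
      qed
      then have "\<forall>\<^sub>F t in at 0. ((\<Theta> t - \<Theta> 0) / (t - 0))\<^sup>2 \<le> c b * (LINT x|lborel. (\<phi> x)\<^sup>2)"
        by (auto simp: eventually_at_filter)
      from tendsto_upperbound[OF lim this] show ?thesis by simp
    qed
    obtain g where "L2 lborel g" "\<And>v. test_fun v \<Longrightarrow> (LINT x|lborel. g x * v x) = \<Lambda> v" "(LINT x|lborel. (g x)\<^sup>2) \<le> c b"
      by (rule Riesz_test_fun[where L=\<Lambda>, OF lin bdd c[OF b]]) (assumption | rule that)+
    then show ?thesis by (intro exI[of _ g]) (simp add: \<Lambda>_def)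
  qed
  then have "\<forall>b\<in>Basis. \<exists>g. L2 lborel g \<and> (\<forall>\<phi>. test_fun \<phi> \<longrightarrow> (LINT x|lborel. g x * \<phi> x) = - (LINT x|lborel. u x * frechet_derivative \<phi> (at x) b))
     \<and> (LINT x|lborel. (g x)\<^sup>2) \<le> c b" by blast
  from bchoice[OF this] obtain G where G: "\<And>b. b \<in> Basis \<Longrightarrow> L2 lborel (G b)"
    and GL: "\<And>b \<phi>. b \<in> Basis \<Longrightarrow> test_fun \<phi> \<Longrightarrow> (LINT x|lborel. G b x * \<phi> x) = - (LINT x|lborel. u x * frechet_derivative \<phi> (at x) b)"
    and Gc: "\<And>b. b \<in> Basis \<Longrightarrow> (LINT x|lborel. (G b x)\<^sup>2) \<le> c b" by blast
  define g where "g x = (\<Sum>b\<in>Basis. G b x *\<^sub>R b)" for x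
  have gb: "g x \<bullet> b = G b x" if "b \<in> Basis" for x b
    using that by (simp add: g_def inner_sum_left inner_Basis if_distrib cong: if_cong)
  have gm: "g \<in> borel_measurable lborel"
    unfolding g_def using G by (intro borel_measurable_sum borel_measurable_scaleR) (auto simp: L2_def)
  have n: "(norm (g x))\<^sup>2 = (\<Sum>b\<in>Basis. (G b x)\<^sup>2)" for x by (simp add: norm_square_Basis gb)
  have gL: "L2 lborel g" unfolding L2_def n using gm G by (auto simp: L2_def)
  show ?thesis
  proof (rule that[of g])
    show "(LINT x|lborel. (norm (g x))\<^sup>2) \<le> (\<Sum>b\<in>Basis. c b)"
      unfolding integral_norm_square_Basis[OF gL] by (intro sum_mono) (simp add: gb Gc)
    show "weak_grad u g"
      unfolding weak_grad_def
    proof (intro conjI allI impI)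
      fix \<phi> :: "'a \<Rightarrow> real" and v :: 'a assume p: "test_fun \<phi>"
      have v: "w \<bullet> v = (\<Sum>b\<in>Basis. (v \<bullet> b) * (w \<bullet> b))" for w by (subst euclidean_inner) (simp add: mult.commute)
      have D: "frechet_derivative \<phi> (at x) v = (\<Sum>b\<in>Basis. (v \<bullet> b) * frechet_derivative \<phi> (at x) b)" for x
      proof -
        have l: "linear (frechet_derivative \<phi> (at x))" by (rule has_derivative_linear[OF test_fun_has_derivative[OF p]])
        have "frechet_derivative \<phi> (at x) v = frechet_derivative \<phi> (at x) (\<Sum>b\<in>Basis. (v \<bullet> b) *\<^sub>R b)" by (simp add: euclidean_representation)
        then show ?thesis by (simp add: linear_sum[OF l] linear_scale[OF l])
      qed
      have "(LINT x|lborel. u x * frechet_derivative \<phi> (at x) v) = (LINT x|lborel. (\<Sum>b\<in>Basis. (v \<bullet> b) * (u x * frechet_derivative \<phi> (at x) b)))"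
        by (simp add: D sum_distrib_left mult.left_commute)
      also have "\<dots> = (\<Sum>b\<in>Basis. (v \<bullet> b) * (LINT x|lborel. u x * frechet_derivative \<phi> (at x) b))"
        using L2_mult_integrable[OF u test_fun_L2[OF test_fun_deriv[OF p]]] by (subst Bochner_Integration.integral_sum) auto
      also have "\<dots> = - (\<Sum>b\<in>Basis. (v \<bullet> b) * (LINT x|lborel. G b x * \<phi> x))"
        by (simp add: GL[OF _ p] sum_negf)
      also have "(\<Sum>b\<in>Basis. (v \<bullet> b) * (LINT x|lborel. G b x * \<phi> x)) = (LINT x|lborel. (\<Sum>b\<in>Basis. (v \<bullet> b) * (G b x * \<phi> x)))"
        using L2_mult_integrable[OF G test_fun_L2[OF p]] by (subst Bochner_Integration.integral_sum) auto
      also have "\<dots> = (LINT x|lborel. (g x \<bullet> v) * \<phi> x)"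
        by (simp add: v gb sum_distrib_right mult.assoc)
      finally show "(LINT x|lborel. u x * frechet_derivative \<phi> (at x) v) = - (LINT x|lborel. (g x \<bullet> v) * \<phi> x)" .
    qed (rule gm)
  qed (rule gL)
qed

text \<open>By the reverse triangle inequality |u| has no larger differences than u. Translation
  estimate and its converse then replace a chain rule; as the constants \<open>c b\<close> are the
  exact directional integrals, the Dirichlet integral does not grow.\<close>

lemma H1_abs:
  fixes u :: "'a::euclidean_space \<Rightarrow> real"
  assumes u: "H1 u"
  shows "H1 (\<lambda>x. \<bar>u x\<bar>)" "(LINT x|lborel. (norm (grad (\<lambda>x. \<bar>u x\<bar>) x))\<^sup>2) \<le> (LINT x|lborel. (norm (grad u x))\<^sup>2)"
proof -
  have uL: "L2 lborel u" and aL: "L2 lborel (\<lambda>x. \<bar>u x\<bar>)" using H1_L2[OF u] by (auto simp: L2_def)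
  have g: "L2 lborel (grad u)" and wg: "weak_grad u (grad u)" using grad_L2[OF u] grad_weak_grad[OF u] by auto
  define c where "c b = (LINT x|lborel. (grad u x \<bullet> b)\<^sup>2)" for b
  obtain h where h: "weak_grad (\<lambda>x. \<bar>u x\<bar>) h" "L2 lborel h" "(LINT x|lborel. (norm (h x))\<^sup>2) \<le> (\<Sum>b\<in>Basis. c b)"
  proof (rule weak_grad_from_differences[OF aL, where c=c])
    fix b :: 'a and t :: real assume b: "b \<in> Basis"
    show "0 \<le> c b" by (simp add: c_def)
    have "(LINT x|lborel. (\<bar>u (x + t *\<^sub>R b)\<bar> - \<bar>u x\<bar>)\<^sup>2) \<le> (LINT x|lborel. (u (x + t *\<^sub>R b) - u x)\<^sup>2)"
    proof (rule integral_mono)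
      show "integrable lborel (\<lambda>x. (\<bar>u (x + t *\<^sub>R b)\<bar> - \<bar>u x\<bar>)\<^sup>2)"
        using L2_square_integrable[OF L2_diff[OF L2_shift[OF aL] aL]] .
      show "integrable lborel (\<lambda>x. (u (x + t *\<^sub>R b) - u x)\<^sup>2)"
        using L2_square_integrable[OF L2_diff[OF L2_shift[OF uL] uL]] .
      show "(\<bar>u (x + t *\<^sub>R b)\<bar> - \<bar>u x\<bar>)\<^sup>2 \<le> (u (x + t *\<^sub>R b) - u x)\<^sup>2" for x
        using abs_triangle_ineq3[of "u (x + t *\<^sub>R b)" "u x"] by (simp add: abs_le_square_iff[symmetric])
    qed
    also have "\<dots> \<le> (LINT x|lborel. (grad u x \<bullet> (t *\<^sub>R b))\<^sup>2)" by (rule translation_estimate[OF uL wg g])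
    also have "\<dots> = c b * t\<^sup>2" by (simp add: c_def power_mult_distrib mult.commute)
    finally show "(LINT x|lborel. (\<bar>u (x + t *\<^sub>R b)\<bar> - \<bar>u x\<bar>)\<^sup>2) \<le> c b * t\<^sup>2" .
  qed (rule that)
  show "H1 (\<lambda>x. \<bar>u x\<bar>)" using H1_I[OF aL h(1,2)] .
  have "AE x in lborel. grad (\<lambda>x. \<bar>u x\<bar>) x = h x" by (rule grad_eqI[OF aL h(1,2)])
  moreover have "L2 lborel (grad (\<lambda>x. \<bar>u x\<bar>))" by (rule grad_L2[OF H1_I[OF aL h(1,2)]])
  ultimately have "(LINT x|lborel. (norm (grad (\<lambda>x. \<bar>u x\<bar>) x))\<^sup>2) = (LINT x|lborel. (norm (h x))\<^sup>2)"
    using h(2) by (intro integral_cong_AE) (auto simp: L2_def)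
  also have "\<dots> \<le> (LINT x|lborel. (norm (grad u x))\<^sup>2)"
    using h(3) unfolding integral_norm_square_Basis[OF g] c_def .
  finally show "(LINT x|lborel. (norm (grad (\<lambda>x. \<bar>u x\<bar>) x))\<^sup>2) \<le> (LINT x|lborel. (norm (grad u x))\<^sup>2)" .
qed

text \<open>Integration by parts comes from translation invariance: \<integral> \<phi>(x) \<psi>(x +
  t v) = \<integral> \<psi>(x) \<phi>(x - t v), differentiated at t = 0 on both sides.\<close>

lemma H1_test_fun:
  fixes \<phi> :: "'a::euclidean_space \<Rightarrow> real"
  assumes p: "test_fun \<phi>"
  shows "H1 \<phi>"
proof -
  define g where "g x = (\<Sum>b\<in>Basis. frechet_derivative \<phi> (at x) b *\<^sub>R b)" for x
  have gv: "g x \<bullet> v = frechet_derivative \<phi> (at x) v" for x v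
  proof -
    have l: "linear (frechet_derivative \<phi> (at x))" by (rule has_derivative_linear[OF test_fun_has_derivative[OF p]])
    have "frechet_derivative \<phi> (at x) v = frechet_derivative \<phi> (at x) (\<Sum>b\<in>Basis. (v \<bullet> b) *\<^sub>R b)" by (simp add: euclidean_representation)
    also have "\<dots> = (\<Sum>b\<in>Basis. (v \<bullet> b) * frechet_derivative \<phi> (at x) b)" by (simp add: linear_sum[OF l] linear_scale[OF l])
    also have "\<dots> = g x \<bullet> v" unfolding g_def inner_sum_left by (simp add: inner_commute[of v] mult.commute)
    finally show ?thesis by simp
  qed
  have D: "L2 lborel (\<lambda>x. frechet_derivative \<phi> (at x) v)" for v by (rule test_fun_L2[OF test_fun_deriv[OF p]])
  have gm: "g \<in> borel_measurable lborel"
    unfolding g_def using D by (intro borel_measurable_sum borel_measurable_scaleR) (auto simp: L2_def)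
  have gL: "L2 lborel g" unfolding L2_def norm_square_Basis gv using gm D by (auto simp: L2_def)
  have "weak_grad \<phi> g"
    unfolding weak_grad_def
  proof (intro conjI allI impI)
    fix \<psi> :: "'a \<Rightarrow> real" and v :: 'a assume q: "test_fun \<psi>"
    have 1: "((\<lambda>t. LINT x|lborel. \<phi> x * \<psi> (x + t *\<^sub>R v)) has_real_derivative (LINT x|lborel. \<phi> x * frechet_derivative \<psi> (at x) v)) (at 0)"
      using derivative_shifted_integral[OF test_fun_L2[OF p] q, of v 0] by simp
    have 2: "((\<lambda>t. LINT x|lborel. \<psi> x * \<phi> (x + t *\<^sub>R (- v))) has_real_derivative (LINT x|lborel. \<psi> x * frechet_derivative \<phi> (at x) (- v))) (at 0)"
      using derivative_shifted_integral[OF test_fun_L2[OF q] p, of "- v" 0] by simp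
    have "(LINT x|lborel. \<psi> x * \<phi> (x + t *\<^sub>R (- v))) = (LINT x|lborel. \<phi> x * \<psi> (x + t *\<^sub>R v))" for t
      using integral_shift_test[OF test_fun_L2[OF q] p, of "t *\<^sub>R v"] by (simp add: mult.commute)
    then have "(LINT x|lborel. \<phi> x * frechet_derivative \<psi> (at x) v) = (LINT x|lborel. \<psi> x * frechet_derivative \<phi> (at x) (- v))"
      using DERIV_unique[OF 1] 2 by simp
    also have "\<dots> = - (LINT x|lborel. (g x \<bullet> v) * \<psi> x)"
      using linear_neg[OF has_derivative_linear[OF test_fun_has_derivative[OF p]]] by (simp add: gv mult.commute)
    finally show "(LINT x|lborel. \<phi> x * frechet_derivative \<psi> (at x) v) = - (LINT x|lborel. (g x \<bullet> v) * \<psi> x)" .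
  qed (rule gm)
  then show ?thesis using H1_I[OF test_fun_L2[OF p] _ gL] by blast
qed

section \<open>Functions with bounded translation modulus\<close>

text \<open>\<open>D\<close> plays the role of a squared H^1 norm: one constant bounds both the mass
  and the translation modulus, and it scales quadratically.\<close>

definition tr_bound :: "('a::euclidean_space \<Rightarrow> real) \<Rightarrow> real \<Rightarrow> bool" where
  "tr_bound u D \<longleftrightarrow> L2 lborel u \<and> (LINT x|lborel. (u x)\<^sup>2) \<le> D \<and>
     (\<forall>h. (LINT x|lborel. (u (x + h) - u x)\<^sup>2) \<le> D * (norm h)\<^sup>2)"

lemma tr_bound_L2: "tr_bound u D \<Longrightarrow> L2 lborel u"
  by (simp add: tr_bound_def)

lemma tr_bound_nonneg: "tr_bound u D \<Longrightarrow> 0 \<le> D"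
proof -
  assume u: "tr_bound u D"
  have "0 \<le> (LINT x|lborel. (u x)\<^sup>2)" by simp
  also have "\<dots> \<le> D" using u by (simp add: tr_bound_def)
  finally show ?thesis .
qed

lemma tr_bound_mono: "tr_bound u D \<Longrightarrow> D \<le> D' \<Longrightarrow> tr_bound u D'"
  unfolding tr_bound_def by (meson mult_right_mono order_trans zero_le_power2)

lemma H1_tr_bound:
  assumes u: "H1 u" and "(LINT x|lborel. (u x)\<^sup>2) \<le> D" "(LINT x|lborel. (norm (grad u x))\<^sup>2) \<le> D"
  shows "tr_bound u D"
  unfolding tr_bound_def
proof (intro conjI allI)
  show "L2 lborel u" "(LINT x|lborel. (u x)\<^sup>2) \<le> D" using H1_L2[OF u] assms by auto
  fix h :: 'a
  have g: "L2 lborel (grad u)" by (rule grad_L2[OF u])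
  have "(LINT x|lborel. (u (x + h) - u x)\<^sup>2) \<le> (LINT x|lborel. (grad u x \<bullet> h)\<^sup>2)"
    by (rule translation_estimate[OF H1_L2[OF u] grad_weak_grad[OF u] g])
  also have "\<dots> \<le> (LINT x|lborel. (norm (grad u x))\<^sup>2 * (norm h)\<^sup>2)"
  proof (rule integral_mono)
    show "integrable lborel (\<lambda>x. (grad u x \<bullet> h)\<^sup>2)" by (rule L2_square_integrable[OF L2_inner[OF g]])
    show "integrable lborel (\<lambda>x. (norm (grad u x))\<^sup>2 * (norm h)\<^sup>2)" using g by (simp add: L2_def)
    show "(grad u x \<bullet> h)\<^sup>2 \<le> (norm (grad u x))\<^sup>2 * (norm h)\<^sup>2" for x
      using Cauchy_Schwarz_ineq[of "grad u x" h] by (simp add: power2_norm_eq_inner)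
  qed
  also have "\<dots> = (LINT x|lborel. (norm (grad u x))\<^sup>2) * (norm h)\<^sup>2" by simp
  also have "\<dots> \<le> D * (norm h)\<^sup>2" by (intro mult_right_mono assms) simp
  finally show "(LINT x|lborel. (u (x + h) - u x)\<^sup>2) \<le> D * (norm h)\<^sup>2" .
qed

lemma tr_bound_scale:
  assumes "tr_bound u D"
  shows "tr_bound (\<lambda>x. a * u x) (a\<^sup>2 * D)"
  unfolding tr_bound_def
proof (intro conjI allI)
  have u: "L2 lborel u" using assms by (rule tr_bound_L2)
  show "L2 lborel (\<lambda>x. a * u x)" using L2_lin_real[OF u u, of a 0] by simp
  show "(LINT x|lborel. (a * u x)\<^sup>2) \<le> a\<^sup>2 * D"
    using assms by (simp add: power_mult_distrib tr_bound_def mult_left_mono)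
  fix h
  have "(a * u (x + h) - a * u x)\<^sup>2 = a\<^sup>2 * (u (x + h) - u x)\<^sup>2" for x
    by (simp add: power_mult_distrib[symmetric] algebra_simps)
  then show "(LINT x|lborel. (a * u (x + h) - a * u x)\<^sup>2) \<le> a\<^sup>2 * D * (norm h)\<^sup>2"
    using assms by (simp add: tr_bound_def mult_left_mono mult.assoc)
qed

subsection \<open>Averages over balls\<close>

text \<open>Convolution with the normalized indicator of a ball, used as a mollifier at scale
  e.\<close>

definition bavg :: "real \<Rightarrow> ('a::euclidean_space \<Rightarrow> real) \<Rightarrow> 'a \<Rightarrow> real" where
  "bavg e u x = (LINT h|lborel. u (x + h) * indicator (ball 0 e) h) / measure lborel (ball (0::'a) e)"

lemma L2_indicator_ball: "L2 lborel (indicator (ball x e) :: 'a::euclidean_space \<Rightarrow> real)"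
  using emeasure_bounded_finite[OF bounded_ball[of x e]] by (intro L2_indicator) auto

lemma L2_shift': "L2 lborel u \<Longrightarrow> L2 lborel (\<lambda>h. u (x + h))" for u :: "'a::euclidean_space \<Rightarrow> real"
  using L2_shift[of u x] by (simp add: add.commute)

lemma integral_indicator_ball_square:
  "(LINT h|lborel. (indicator (ball x e) h :: real)\<^sup>2) = measure lborel (ball (x::'a::euclidean_space) e)"
proof -
  have "(indicator (ball x e) h :: real)\<^sup>2 = indicator (ball x e) h" for h by (simp add: indicator_def)
  then show ?thesis by simp
qed

lemma L2_times_indicator:
  fixes v :: "'a \<Rightarrow> real"
  assumes "L2 M v" "A \<in> sets M"
  shows "L2 M (\<lambda>x. v x * indicator A x)"
  using assms by (intro L2_bound[OF assms(1)]) (auto simp: L2_def indicator_def)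

lemma integrable_square_indicator:
  fixes v :: "'a \<Rightarrow> real"
  assumes "L2 M v" "A \<in> sets M"
  shows "integrable M (\<lambda>x. (v x)\<^sup>2 * indicator A x)"
proof -
  have "(v x * indicator A x)\<^sup>2 = (v x)\<^sup>2 * indicator A x" for x by (simp add: indicator_def)
  then show ?thesis using L2_square_integrable[OF L2_times_indicator[OF assms]] by simp
qed

lemma integral_ball_square_le:
  fixes v :: "'a::euclidean_space \<Rightarrow> real"
  assumes v: "L2 lborel v"
  shows "(LINT h|lborel. v h * indicator (ball x e) h)\<^sup>2 \<le>
    (LINT h|lborel. (v h)\<^sup>2 * indicator (ball x e) h) * measure lborel (ball x e)"
proof -
  have "(LINT h|lborel. (v h * indicator (ball x e) h) * indicator (ball x e) h)\<^sup>2 \<le>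
    (LINT h|lborel. (v h * indicator (ball x e) h)\<^sup>2) * (LINT h|lborel. (indicator (ball x e) h)\<^sup>2)"
    by (intro integral_Cauchy_Schwarz L2_times_indicator v L2_indicator_ball) auto
  moreover have "(v h * indicator (ball x e) h) * indicator (ball x e) h = v h * indicator (ball x e) h"
    "(v h * indicator (ball x e) h)\<^sup>2 = (v h)\<^sup>2 * indicator (ball x e) h" for h
    by (auto simp: indicator_def)
  ultimately show ?thesis by (simp add: integral_indicator_ball_square)
qed

lemma bavg_square_le:
  fixes u :: "'a::euclidean_space \<Rightarrow> real"
  assumes u: "L2 lborel u" and e: "0 < e"
  shows "(bavg e u x)\<^sup>2 * measure lborel (ball (0::'a) e) \<le> (LINT y|lborel. (u y)\<^sup>2 * indicator (ball x e) y)"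
proof -
  let ?V = "measure lborel (ball (0::'a) e)"
  have V: "?V > 0" using content_ball_pos[OF e, of 0] by simp
  have um: "u \<in> borel_measurable borel" using u by (simp add: L2_def)
  have "(bavg e u x)\<^sup>2 * ?V\<^sup>2 = (LINT h|lborel. u (x + h) * indicator (ball 0 e) h)\<^sup>2"
    using V by (simp add: bavg_def power_divide)
  also have "\<dots> \<le> (LINT h|lborel. (u (x + h))\<^sup>2 * indicator (ball 0 e) h) * ?V"
    by (rule integral_ball_square_le[OF L2_shift'[OF u]])
  also have "(LINT h|lborel. (u (x + h))\<^sup>2 * indicator (ball 0 e) h) = (LINT h|lborel. (u (h + x))\<^sup>2 * indicator (ball x e) (h + x))"
    by (intro Bochner_Integration.integral_cong) (auto simp: indicator_def dist_norm add.commute)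
  also have "\<dots> = (LINT y|lborel. (u y)\<^sup>2 * indicator (ball x e) y)"
    by (intro integral_shift borel_measurable_times borel_measurable_power borel_measurable_indicator um) auto
  finally show ?thesis using V by (simp add: power2_eq_square)
qed

lemma bavg_square_le_integral:
  fixes u :: "'a::euclidean_space \<Rightarrow> real"
  assumes u: "L2 lborel u" and e: "0 < e"
  shows "(bavg e u x)\<^sup>2 * measure lborel (ball (0::'a) e) \<le> (LINT y|lborel. (u y)\<^sup>2)"
proof -
  have "(LINT y|lborel. (u y)\<^sup>2 * indicator (ball x e) y) \<le> (LINT y|lborel. (u y)\<^sup>2)"
    by (intro integral_mono integrable_square_indicator[OF u] L2_square_integrable[OF u]) (auto simp: indicator_def)
  then show ?thesis using bavg_square_le[OF assms, of x] by linarith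
qed

text \<open>A Lipschitz estimate whose constant depends on \<open>D\<close> and e but not on u: the
  source of equicontinuity in the compactness proof.\<close>

lemma bavg_diff_le:
  fixes u :: "'a::euclidean_space \<Rightarrow> real"
  assumes u: "tr_bound u D" and e: "0 < e"
  shows "(bavg e u x - bavg e u y)\<^sup>2 * measure lborel (ball (0::'a) e) \<le> D * (norm (x - y))\<^sup>2"
proof -
  let ?V = "measure lborel (ball (0::'a) e)"
  have V: "?V > 0" using content_ball_pos[OF e, of 0] by simp
  have uL: "L2 lborel u" using u by (rule tr_bound_L2)
  have um: "u \<in> borel_measurable borel" using uL by (simp add: L2_def)
  have d: "L2 lborel (\<lambda>h. u (x + h) - u (y + h))" by (intro L2_diff L2_shift' uL)
  have i: "integrable lborel (\<lambda>h. u (x + h) * indicator (ball 0 e) h)" for x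
    by (intro L2_mult_integrable L2_shift' uL L2_indicator_ball)
  have "(bavg e u x - bavg e u y) * ?V = (LINT h|lborel. (u (x + h) - u (y + h)) * indicator (ball 0 e) h)"
  proof -
    have "bavg e u x * ?V = (LINT h|lborel. u (x + h) * indicator (ball 0 e) h)" for x using V by (simp add: bavg_def)
    then show ?thesis using i by (simp add: left_diff_distrib)
  qed
  then have "(bavg e u x - bavg e u y)\<^sup>2 * ?V\<^sup>2 = (LINT h|lborel. (u (x + h) - u (y + h)) * indicator (ball 0 e) h)\<^sup>2"
    by (simp add: power_mult_distrib[symmetric])
  also have "\<dots> \<le> (LINT h|lborel. (u (x + h) - u (y + h))\<^sup>2 * indicator (ball 0 e) h) * ?V"
    by (rule integral_ball_square_le[OF d])
  also have "(LINT h|lborel. (u (x + h) - u (y + h))\<^sup>2 * indicator (ball 0 e) h) \<le> (LINT h|lborel. (u (x + h) - u (y + h))\<^sup>2)"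
    by (intro integral_mono integrable_square_indicator[OF d] L2_square_integrable[OF d]) (auto simp: indicator_def)
  also have "(LINT h|lborel. (u (x + h) - u (y + h))\<^sup>2) = (LINT h|lborel. (u ((h + y) + (x - y)) - u (h + y))\<^sup>2)"
    by (simp add: algebra_simps)
  also have "\<dots> = (LINT z|lborel. (u (z + (x - y)) - u z)\<^sup>2)"
    using um by (intro integral_shift[of "\<lambda>z. (u (z + (x - y)) - u z)\<^sup>2"]) auto
  also have "\<dots> \<le> D * (norm (x - y))\<^sup>2" using u by (simp add: tr_bound_def)
  finally show ?thesis using V by (simp add: power2_eq_square mult.assoc[symmetric])
qed

text \<open>Local squared oscillation of u around x. The extended nonnegative values allow Tonelli's
  theorem to be applied directly.\<close>

definition dev :: "real \<Rightarrow> ('a::euclidean_space \<Rightarrow> real) \<Rightarrow> 'a \<Rightarrow> ennreal" where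
  "dev e u x = (\<integral>\<^sup>+h. ennreal ((u x - u (x + h))\<^sup>2) * indicator (ball 0 e) h \<partial>lborel)"

lemma bavg_dev:
  fixes u :: "'a::euclidean_space \<Rightarrow> real"
  assumes u: "L2 lborel u" and e: "0 < e"
  shows "ennreal (measure lborel (ball (0::'a) e) * (u x - bavg e u x)\<^sup>2) \<le> dev e u x"
proof -
  let ?V = "measure lborel (ball (0::'a) e)"
  have V: "?V > 0" using content_ball_pos[OF e, of 0] by simp
  have i1: "integrable lborel (\<lambda>h. u (x + h) * indicator (ball 0 e) h)"
    by (intro L2_mult_integrable L2_shift' u L2_indicator_ball)
  have i0: "integrable lborel (indicator (ball 0 e) :: 'a \<Rightarrow> real)"
    using L2_square_integrable[OF L2_indicator_ball[of 0 e]] by (simp add: power2_eq_square indicator_inter_arith[symmetric])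
  define v where "v h = (u x - u (x + h)) * indicator (ball 0 e) h" for h
  have vL: "L2 lborel v"
  proof -
    have "L2 lborel (\<lambda>h. u x * indicator (ball 0 e) h + (-1) * (u (x + h) * indicator (ball 0 e) h))"
      by (intro L2_lin_real L2_times_indicator L2_shift' u L2_indicator_ball) auto
    moreover have "v = (\<lambda>h. u x * indicator (ball 0 e) h + (-1) * (u (x + h) * indicator (ball 0 e) h))"
      by (simp add: v_def fun_eq_iff left_diff_distrib)
    ultimately show ?thesis by simp
  qed
  have "(u x - bavg e u x) * ?V = (LINT h|lborel. v h)"
    using V i0 i1 by (simp add: v_def left_diff_distrib bavg_def)
  moreover have "(LINT h|lborel. v h) = (LINT h|lborel. v h * indicator (ball 0 e) h)"
    by (intro Bochner_Integration.integral_cong) (auto simp: v_def indicator_def)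
  ultimately have "((u x - bavg e u x) * ?V)\<^sup>2 \<le> (LINT h|lborel. (v h)\<^sup>2 * indicator (ball 0 e) h) * ?V"
    using integral_ball_square_le[OF vL, of 0 e] by simp
  then have "?V * (u x - bavg e u x)\<^sup>2 \<le> (LINT h|lborel. (v h)\<^sup>2 * indicator (ball 0 e) h)"
    using V by (simp add: power2_eq_square mult_ac)
  also have "(LINT h|lborel. (v h)\<^sup>2 * indicator (ball 0 e) h) = (LINT h|lborel. (v h)\<^sup>2)"
    by (intro Bochner_Integration.integral_cong) (auto simp: v_def indicator_def)
  finally have "ennreal (?V * (u x - bavg e u x)\<^sup>2) \<le> ennreal (LINT h|lborel. (v h)\<^sup>2)" by (rule ennreal_leI)
  also have "\<dots> = (\<integral>\<^sup>+h. ennreal ((v h)\<^sup>2) \<partial>lborel)"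
    by (rule nn_integral_eq_integral[symmetric]) (use L2_square_integrable[OF vL] in auto)
  also have "\<dots> = dev e u x" unfolding dev_def by (intro nn_integral_cong) (auto simp: v_def indicator_def)
  finally show ?thesis .
qed

text \<open>Exchanging the integrals leaves, for each shift h with |h| < e, the translation modulus,
  which is at most D e^2; integrating over h gives the volume factor.\<close>

lemma dev_total:
  fixes u :: "'a::euclidean_space \<Rightarrow> real"
  assumes u: "tr_bound u D" and e: "0 < e"
  shows "(\<integral>\<^sup>+x. dev e u x \<partial>lborel) \<le> ennreal (measure lborel (ball (0::'a) e) * D * e\<^sup>2)"
proof -
  have uL: "L2 lborel u" using u by (rule tr_bound_L2)
  have um[measurable]: "u \<in> borel_measurable borel" using uL by (simp add: L2_def)
  have D0: "0 \<le> D" by (rule tr_bound_nonneg[OF u])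
  have [measurable]: "ball (0::'a) e \<in> sets borel" by simp
  have "(\<integral>\<^sup>+x. dev e u x \<partial>lborel) = (\<integral>\<^sup>+h. (\<integral>\<^sup>+x. ennreal ((u x - u (x + h))\<^sup>2) * indicator (ball 0 e) h \<partial>lborel) \<partial>lborel)"
    unfolding dev_def by (rule lborel_pair.Fubini'[symmetric]) measurable
  also have "\<dots> \<le> (\<integral>\<^sup>+h. ennreal (D * e\<^sup>2) * indicator (ball (0::'a) e) h \<partial>lborel)"
  proof (rule nn_integral_mono)
    fix h :: 'a
    show "(\<integral>\<^sup>+x. ennreal ((u x - u (x + h))\<^sup>2) * indicator (ball 0 e) h \<partial>lborel) \<le> ennreal (D * e\<^sup>2) * indicator (ball 0 e) h"
    proof (cases "h \<in> ball 0 e")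
      case True
      have "(\<integral>\<^sup>+x. ennreal ((u x - u (x + h))\<^sup>2) \<partial>lborel) = ennreal (LINT x|lborel. (u x - u (x + h))\<^sup>2)"
        by (rule nn_integral_eq_integral) (use L2_square_integrable[OF L2_diff[OF uL L2_shift[OF uL]]] in auto)
      also have "(LINT x|lborel. (u x - u (x + h))\<^sup>2) = (LINT x|lborel. (u (x + h) - u x)\<^sup>2)"
        by (simp add: power2_commute)
      also have "ennreal \<dots> \<le> ennreal (D * (norm h)\<^sup>2)" using u by (intro ennreal_leI) (simp add: tr_bound_def)
      also have "\<dots> \<le> ennreal (D * e\<^sup>2)"
        using True D0 by (intro ennreal_leI mult_left_mono power_mono) auto
      finally show ?thesis using True by simp
    qed simp
  qed
  also have "\<dots> = ennreal (D * e\<^sup>2) * emeasure lborel (ball (0::'a) e)"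
    by (rule nn_integral_cmult_indicator) simp
  also have "\<dots> = ennreal (D * e\<^sup>2) * ennreal (measure lborel (ball (0::'a) e))"
    using emeasure_bounded_finite[OF bounded_ball[of "0::'a" e]] by (subst emeasure_eq_ennreal_measure) auto
  also have "\<dots> = ennreal (measure lborel (ball (0::'a) e) * D * e\<^sup>2)"
    using D0 by (simp add: ennreal_mult[symmetric] mult_ac)
  finally show ?thesis .
qed

lemma bavg_continuous:
  fixes u :: "'a::euclidean_space \<Rightarrow> real"
  assumes u: "tr_bound u D" and e: "0 < e"
  shows "continuous_on UNIV (bavg e u)"
proof -
  let ?V = "measure lborel (ball (0::'a) e)"
  have V: "?V > 0" using content_ball_pos[OF e, of 0] by simp
  have "((bavg e u) \<longlongrightarrow> bavg e u x) (at x)" for x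
  proof -
    have l: "((\<lambda>y. D * (norm (y - x))\<^sup>2 / ?V) \<longlongrightarrow> D * (norm (x - x))\<^sup>2 / ?V) (at x)"
      using V by (intro tendsto_intros) auto
    have "((\<lambda>y. (bavg e u y - bavg e u x)\<^sup>2) \<longlongrightarrow> 0) (at x)"
    proof (rule tendsto_sandwich[OF _ _ tendsto_const])
      show "((\<lambda>y. D * (norm (y - x))\<^sup>2 / ?V) \<longlongrightarrow> 0) (at x)" using l by simp
      show "\<forall>\<^sub>F y in at x. (bavg e u y - bavg e u x)\<^sup>2 \<le> D * (norm (y - x))\<^sup>2 / ?V"
        using bavg_diff_le[OF u e] V by (simp add: field_simps)
    qed auto
    then have "((\<lambda>y. sqrt ((bavg e u y - bavg e u x)\<^sup>2)) \<longlongrightarrow> sqrt 0) (at x)" by (intro tendsto_intros)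
    then have "((\<lambda>y. bavg e u y - bavg e u x) \<longlongrightarrow> 0) (at x)" by (simp add: tendsto_rabs_zero_iff)
    then show ?thesis by (rule LIM_zero_cancel)
  qed
  then show ?thesis by (simp add: continuous_on_def)
qed

lemma bavg_measurable:
  "tr_bound u D \<Longrightarrow> 0 < e \<Longrightarrow> bavg e u \<in> borel_measurable borel"
  by (rule borel_measurable_continuous_onI[OF bavg_continuous])

lemma bavg_L2_error:
  fixes u :: "'a::euclidean_space \<Rightarrow> real"
  assumes u: "tr_bound u D" and e: "0 < e"
  shows "integrable lborel (\<lambda>x. (u x - bavg e u x)\<^sup>2)" "(LINT x|lborel. (u x - bavg e u x)\<^sup>2) \<le> D * e\<^sup>2"
proof -
  let ?V = "measure lborel (ball (0::'a) e)"
  have V: "?V > 0" using content_ball_pos[OF e, of 0] by simp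
  have uL: "L2 lborel u" using u by (rule tr_bound_L2)
  have [measurable]: "u \<in> borel_measurable borel" using uL by (simp add: L2_def)
  have [measurable]: "bavg e u \<in> borel_measurable borel" by (rule bavg_measurable[OF u e])
  have b: "(\<integral>\<^sup>+x. ennreal (?V * (u x - bavg e u x)\<^sup>2) \<partial>lborel) \<le> ennreal (?V * D * e\<^sup>2)"
    using order_trans[OF nn_integral_mono[OF bavg_dev[OF uL e]] dev_total[OF u e]] .
  have i: "integrable lborel (\<lambda>x. ?V * (u x - bavg e u x)\<^sup>2)"
  proof (rule integrableI_nonneg)
    show "(\<integral>\<^sup>+x. ennreal (?V * (u x - bavg e u x)\<^sup>2) \<partial>lborel) < \<infinity>"
      using b by (rule order_le_less_trans) simp
  qed auto
  then show 1: "integrable lborel (\<lambda>x. (u x - bavg e u x)\<^sup>2)" using V by simp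
  have "ennreal (LINT x|lborel. ?V * (u x - bavg e u x)\<^sup>2) \<le> ennreal (?V * D * e\<^sup>2)"
    using b nn_integral_eq_integral[OF i] by simp
  then have "(LINT x|lborel. ?V * (u x - bavg e u x)\<^sup>2) \<le> ?V * D * e\<^sup>2"
    using tr_bound_nonneg[OF u] V by (subst (asm) ennreal_le_iff) auto
  then have "?V * (LINT x|lborel. (u x - bavg e u x)\<^sup>2) \<le> ?V * (D * e\<^sup>2)" by simp
  then show "(LINT x|lborel. (u x - bavg e u x)\<^sup>2) \<le> D * e\<^sup>2" using V by simp
qed

text \<open>Where |u| exceeds 2l while the average stays below l, u differs from its average by at
  least l. Chebyshev's inequality with the L^2 error D e^2 does the rest.\<close>

lemma level_set_bound:
  fixes u :: "'a::euclidean_space \<Rightarrow> real"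
  assumes u: "tr_bound u D" and e: "0 < e" and l: "0 < l" and A: "\<And>x. \<bar>bavg e u x\<bar> \<le> l"
  shows "emeasure lborel {x. \<bar>u x\<bar> > 2 * l} \<le> ennreal (D * e\<^sup>2 / l\<^sup>2)"
proof -
  have uL: "L2 lborel u" using u by (rule tr_bound_L2)
  have [measurable]: "u \<in> borel_measurable borel" using uL by (simp add: L2_def)
  have [measurable]: "bavg e u \<in> borel_measurable borel" by (rule bavg_measurable[OF u e])
  note err = bavg_L2_error[OF u e]
  have "ennreal (l\<^sup>2) * emeasure lborel {x. \<bar>u x\<bar> > 2 * l} = (\<integral>\<^sup>+x. ennreal (l\<^sup>2) * indicator {x. \<bar>u x\<bar> > 2 * l} x \<partial>lborel)"
    by (rule nn_integral_cmult_indicator[symmetric]) simp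
  also have "\<dots> \<le> (\<integral>\<^sup>+x. ennreal ((u x - bavg e u x)\<^sup>2) \<partial>lborel)"
  proof (rule nn_integral_mono)
    fix x
    show "ennreal (l\<^sup>2) * indicator {x. \<bar>u x\<bar> > 2 * l} x \<le> ennreal ((u x - bavg e u x)\<^sup>2)"
    proof (cases "\<bar>u x\<bar> > 2 * l")
      case True
      then have "\<bar>l\<bar> \<le> \<bar>u x - bavg e u x\<bar>" using A[of x] l by linarith
      then show ?thesis using True by (simp add: abs_le_square_iff ennreal_leI)
    qed simp
  qed
  also have "\<dots> = ennreal (LINT x|lborel. (u x - bavg e u x)\<^sup>2)"
    by (rule nn_integral_eq_integral[OF err(1)]) simp
  also have "\<dots> \<le> ennreal (D * e\<^sup>2)" by (rule ennreal_leI[OF err(2)])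
  finally have le: "ennreal (l\<^sup>2) * emeasure lborel {x. \<bar>u x\<bar> > 2 * l} \<le> ennreal (D * e\<^sup>2)" .
  have "emeasure lborel {x. \<bar>u x\<bar> > 2 * l} = ennreal (1 / l\<^sup>2) * (ennreal (l\<^sup>2) * emeasure lborel {x. \<bar>u x\<bar> > 2 * l})"
    using l by (simp add: mult.assoc[symmetric] ennreal_mult[symmetric])
  also have "\<dots> \<le> ennreal (1 / l\<^sup>2) * ennreal (D * e\<^sup>2)" by (intro mult_left_mono le) simp
  also have "\<dots> = ennreal (D * e\<^sup>2 / l\<^sup>2)"
    using tr_bound_nonneg[OF u] by (simp add: ennreal_mult[symmetric])
  finally show ?thesis .
qed

subsection \<open>Subcritical Sobolev inequality\<close>

text \<open>The embedding at exponent q, normalized to \<open>tr_bound u 1\<close>; stated as a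
  property of q so that the admissible exponents can be enlarged step by step.\<close>

definition sobolev_exponent :: "'a::euclidean_space itself \<Rightarrow> real \<Rightarrow> bool" where
  "sobolev_exponent _ q \<longleftrightarrow> (\<exists>C\<ge>0. \<forall>u::'a \<Rightarrow> real. tr_bound u 1 \<longrightarrow>
     integrable lborel (\<lambda>x. \<bar>u x\<bar> powr q) \<and> (LINT x|lborel. \<bar>u x\<bar> powr q) \<le> C)"

lemma abs_powr_2: "\<bar>t\<bar> powr 2 = t\<^sup>2" for t :: real
  by (cases "t = 0") (simp_all add: powr_numeral)

lemma sobolev_exponent_2: "sobolev_exponent TYPE('a::euclidean_space) 2"
  unfolding sobolev_exponent_def abs_powr_2 tr_bound_def by (intro exI[of _ 1]) (auto intro: L2_square_integrable)

text \<open>Rests on the pointwise inequality |a| \<le> \<mu> + \<mu>^(1-q) |a|^q, obtained by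
  distinguishing values below and above the free level \<mu>.\<close>

lemma bavg_bound_from_Lq:
  fixes u :: "'a::euclidean_space \<Rightarrow> real"
  assumes u: "L2 lborel u" and e: "0 < e" and m: "0 < \<mu>" and q: "1 \<le> q"
    and i: "integrable lborel (\<lambda>x. \<bar>u x\<bar> powr q)" and C: "(LINT x|lborel. \<bar>u x\<bar> powr q) \<le> C"
  shows "\<bar>bavg e u x\<bar> \<le> \<mu> + \<mu> powr (1 - q) * C / measure lborel (ball (0::'a) e)"
proof -
  let ?V = "measure lborel (ball (0::'a) e)"
  have V: "?V > 0" using content_ball_pos[OF e, of 0] by simp
  have um[measurable]: "u \<in> borel_measurable borel" using u by (simp add: L2_def)
  have i0: "integrable lborel (indicator (ball 0 e) :: 'a \<Rightarrow> real)"
    using L2_square_integrable[OF L2_indicator_ball[of 0 e]] by (simp add: power2_eq_square indicator_inter_arith[symmetric])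
  have i1: "integrable lborel (\<lambda>h. u (x + h) * indicator (ball 0 e) h)"
    by (intro L2_mult_integrable L2_shift' u L2_indicator_ball)
  have iq: "integrable lborel (\<lambda>h. \<bar>u (h + x)\<bar> powr q)" "(LINT h|lborel. \<bar>u (h + x)\<bar> powr q) = (LINT x|lborel. \<bar>u x\<bar> powr q)"
    using integrable_shift[OF _ i, of x] integral_shift[of "\<lambda>x. \<bar>u x\<bar> powr q" x] by auto
  have pt: "\<bar>a\<bar> \<le> \<mu> + \<mu> powr (1 - q) * \<bar>a\<bar> powr q" for a :: real
  proof (cases "\<bar>a\<bar> \<le> \<mu>")
    case False
    then have a: "\<bar>a\<bar> > 0" "\<mu> \<le> \<bar>a\<bar>" using m by auto
    have "\<bar>a\<bar> = \<bar>a\<bar> powr (1 - q) * \<bar>a\<bar> powr q" using a by (simp add: powr_add[symmetric])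
    also have "\<dots> \<le> \<mu> powr (1 - q) * \<bar>a\<bar> powr q"
      using a m q by (intro mult_right_mono powr_mono2') auto
    finally show ?thesis using m by simp
  qed (use m in \<open>auto intro: add_increasing2\<close>)
  have "\<bar>bavg e u x\<bar> * ?V = \<bar>LINT h|lborel. u (x + h) * indicator (ball 0 e) h\<bar>"
    using V by (simp add: bavg_def abs_divide)
  also have "\<dots> \<le> (LINT h|lborel. \<bar>u (x + h) * indicator (ball 0 e) h\<bar>)" by (rule integral_abs_bound)
  also have "\<dots> \<le> (LINT h|lborel. \<mu> * indicator (ball 0 e) h + \<mu> powr (1 - q) * \<bar>u (h + x)\<bar> powr q)"
  proof (rule integral_mono)
    show "integrable lborel (\<lambda>h. \<bar>u (x + h) * indicator (ball 0 e) h\<bar>)" using i1 by simp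
    show "integrable lborel (\<lambda>h. \<mu> * indicator (ball 0 e) h + \<mu> powr (1 - q) * \<bar>u (h + x)\<bar> powr q)" using i0 iq by simp
    show "\<bar>u (x + h) * indicator (ball 0 e) h\<bar> \<le> \<mu> * indicator (ball 0 e) h + \<mu> powr (1 - q) * \<bar>u (h + x)\<bar> powr q" for h
      using pt[of "u (x + h)"] by (auto simp: indicator_def add.commute)
  qed
  also have "\<dots> = \<mu> * ?V + \<mu> powr (1 - q) * (LINT x|lborel. \<bar>u x\<bar> powr q)" using i0 iq by simp
  also have "\<dots> \<le> \<mu> * ?V + \<mu> powr (1 - q) * C" using C by (simp add: mult_left_mono)
  finally show ?thesis using V by (simp add: field_simps)
qed

text \<open>For each level l the averaging radius e is chosen with volume of order l^(-q); averages
  are then at most l/2, and \<open>level_set_bound\<close> gives e^2 / l^2, of order l^(-2-2q/N). An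
  L^q bound thus yields a weak-type bound at exponent 2 + 2q/N.\<close>

lemma weak_type_bound:
  assumes sq: "sobolev_exponent TYPE('a::euclidean_space) q" and q: "2 \<le> q"
  obtains c where "c \<ge> 0" "\<And>(u::'a \<Rightarrow> real) l. tr_bound u 1 \<Longrightarrow> l > 0 \<Longrightarrow>
     emeasure lborel {x. \<bar>u x\<bar> > l} \<le> ennreal (c * l powr - (2 + 2 * q / DIM('a)))"
proof -
  obtain C where C0: "C \<ge> 0" and C: "\<And>u::'a \<Rightarrow> real. tr_bound u 1 \<Longrightarrow>
     integrable lborel (\<lambda>x. \<bar>u x\<bar> powr q) \<and> (LINT x|lborel. \<bar>u x\<bar> powr q) \<le> C"
    using sq unfolding sobolev_exponent_def by blast
  define v1 where "v1 = measure lborel (ball (0::'a) 1)"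
  have v1: "v1 > 0" unfolding v1_def using content_ball_pos[of 1 "0::'a"] by simp
  define N where "N = real DIM('a)"
  have N: "N \<ge> 1" unfolding N_def using DIM_positive[where 'a='a] by linarith
  define c1 where "c1 = (C + 1) * 4 powr q / v1"
  have c1: "c1 > 0" using C0 v1 by (simp add: c1_def)
  \<comment> \<open>With this \<open>c1\<close> the ball of radius e has volume (C + 1) 4^q l^(-q).
    The second term of \<open>bavg_bound_from_Lq\<close> at \<mu> = l/4 then equals l/4 times C/(C +
    1).\<close>
  define r where "r = 2 + 2 * q / N"
  show ?thesis
  proof (rule that[of "4 * c1 powr (2 / N)"])
    show "0 \<le> 4 * c1 powr (2 / N)" by simp
    fix u :: "'a \<Rightarrow> real" and l :: real assume u: "tr_bound u 1" and l: "l > 0"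
    define e where "e = (c1 * l powr (- q)) powr (1 / N)"
    have e: "e > 0" using c1 l by (simp add: e_def)
    have eN: "e ^ DIM('a) = c1 * l powr (- q)"
    proof -
      have "e ^ DIM('a) = e powr N" using e by (simp add: N_def powr_realpow)
      also have "\<dots> = c1 * l powr (- q)" unfolding e_def using N c1 l by (simp add: powr_powr)
      finally show ?thesis .
    qed
    have V: "measure lborel (ball (0::'a) e) = (C + 1) * 4 powr q * l powr (- q)"
      using content_ball_conv_unit_ball[of e "0::'a"] e v1 eN unfolding v1_def[symmetric] by (simp add: c1_def)
    have "\<bar>bavg e u x\<bar> \<le> l / 2" for x
    proof -
      have "\<bar>bavg e u x\<bar> \<le> l / 4 + (l / 4) powr (1 - q) * C / measure lborel (ball (0::'a) e)"
        using C[OF u] q l by (intro bavg_bound_from_Lq tr_bound_L2[OF u] e) auto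
      also have "(l / 4) powr (1 - q) * C / measure lborel (ball (0::'a) e) = (l / 4) * (C / (C + 1))"
      proof -
        define P where "P = l powr (- q) * 4 powr q"
        have P: "P \<noteq> 0" using l by (simp add: P_def)
        have pe: "(l / 4) powr (1 - q) = l / 4 * P"
          using l by (simp add: P_def powr_diff powr_divide powr_minus field_simps)
        have Ve: "measure lborel (ball (0::'a) e) = (C + 1) * P" unfolding V P_def by (simp add: mult_ac)
        have "(l / 4 * P) * C / ((C + 1) * P) = (l / 4 * C) * P / ((C + 1) * P)" by (simp add: mult_ac)
        also have "\<dots> = l / 4 * C / (C + 1)" using P by (rule mult_divide_mult_cancel_right)
        finally show ?thesis unfolding Ve pe by simp
      qed
      also have "\<dots> \<le> l / 4" using l C0 by (intro mult_left_le) auto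
      finally show ?thesis by simp
    qed
    then have "emeasure lborel {x. \<bar>u x\<bar> > 2 * (l / 2)} \<le> ennreal (1 * e\<^sup>2 / (l / 2)\<^sup>2)"
      using l by (intro level_set_bound[OF u e]) auto
    also have "1 * e\<^sup>2 / (l / 2)\<^sup>2 = 4 * c1 powr (2 / N) * l powr - (2 + 2 * q / DIM('a))"
    proof -
      have "e\<^sup>2 = e powr 2" using e by (simp add: powr_numeral)
      also have "\<dots> = (c1 * l powr (- q)) powr (2 / N)" unfolding e_def by (simp add: powr_powr)
      also have "\<dots> = c1 powr (2 / N) * l powr (- (2 * q / N))" using c1 l by (simp add: powr_mult powr_powr mult.commute)
      finally have "e\<^sup>2 = c1 powr (2 / N) * l powr (- (2 * q / N))" .
      moreover have "l powr - (2 + 2 * q / N) = l powr (- (2 * q / N)) / l\<^sup>2"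
      proof -
        have "l powr - (2 + 2 * q / N) = l powr (- (2 * q / N) + (- 2))" by (simp add: algebra_simps)
        also have "\<dots> = l powr (- (2 * q / N)) * l powr (- 2)" by (rule powr_add)
        also have "l powr (- 2) = 1 / l powr 2" by (rule powr_minus_divide)
        also have "l powr 2 = l\<^sup>2" using l by simp
        finally show ?thesis by simp
      qed
      ultimately show ?thesis by (simp add: N_def power_divide)
    qed
    finally show "emeasure lborel {x. \<bar>u x\<bar> > l} \<le> ennreal (4 * c1 powr (2 / N) * l powr - (2 + 2 * q / DIM('a)))" by simp
  qed
qed

text \<open>Values up to 1 are covered by t^2 since q \<ge> 2; a larger value lies between 2^j and
  2^(j+1) for some j, and the j-th term of the series dominates it.\<close>

lemma dyadic_majorant:
  fixes t :: real
  assumes q: "2 \<le> q"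
  shows "ennreal (\<bar>t\<bar> powr q) \<le> ennreal (t\<^sup>2) + (\<Sum>j. ennreal ((2 ^ Suc j) powr q) * indicator {s. \<bar>s\<bar> > 2 ^ j} t)"
proof (cases "\<bar>t\<bar> \<le> 1")
  case True
  have "\<bar>t\<bar> powr q \<le> \<bar>t\<bar> powr 2" using True q by (intro powr_mono') auto
  then have "ennreal (\<bar>t\<bar> powr q) \<le> ennreal (t\<^sup>2)" by (intro ennreal_leI) (simp add: abs_powr_2)
  then show ?thesis by (rule order_trans) simp
next
  case False
  obtain n where "\<bar>t\<bar> < 2 ^ n" using real_arch_pow[of 2 "\<bar>t\<bar>"] by auto
  then have ex: "\<exists>n. \<bar>t\<bar> \<le> 2 ^ n" using less_imp_le by blast
  define m where "m = (LEAST n. \<bar>t\<bar> \<le> 2 ^ n)"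
  have m: "\<bar>t\<bar> \<le> 2 ^ m" unfolding m_def by (rule LeastI_ex[OF ex])
  have "m \<noteq> 0" using m False by (intro notI) simp
  then obtain j where j: "m = Suc j" by (cases m) auto
  have lt: "2 ^ j < \<bar>t\<bar>"
  proof (rule ccontr)
    assume "\<not> 2 ^ j < \<bar>t\<bar>"
    then have "m \<le> j" unfolding m_def by (intro Least_le) simp
    then show False using j by simp
  qed
  have "ennreal (\<bar>t\<bar> powr q) \<le> ennreal ((2 ^ Suc j) powr q)"
    using m q unfolding j by (intro ennreal_leI powr_mono2) auto
  also have "\<dots> = (\<Sum>i\<in>{j}. ennreal ((2 ^ Suc i) powr q) * indicator {s. \<bar>s\<bar> > 2 ^ i} t)" using lt by simp
  also have "\<dots> \<le> (\<Sum>i. ennreal ((2 ^ Suc i) powr q) * indicator {s. \<bar>s\<bar> > 2 ^ i} t)"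
    by (rule sum_le_suminf) auto
  finally show ?thesis by (rule order_trans) simp
qed

text \<open>Summing the dyadic layers against the weak-type bound at r = 2 + 2q/N gives a geometric
  series with ratio 2^(q' - r), convergent because q' is strictly below r.\<close>

lemma sobolev_step:
  assumes sq: "sobolev_exponent TYPE('a::euclidean_space) q" and q: "2 \<le> q"
    and q': "2 \<le> q'" "q' < 2 + 2 * q / DIM('a)"
  shows "sobolev_exponent TYPE('a) q'"
proof -
  define r where "r = 2 + 2 * q / DIM('a)"
  obtain c where c0: "c \<ge> 0" and c': "\<And>(u::'a \<Rightarrow> real) l. tr_bound u 1 \<Longrightarrow> l > 0 \<Longrightarrow>
     emeasure lborel {x. \<bar>u x\<bar> > l} \<le> ennreal (c * l powr - (2 + 2 * q / DIM('a)))"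
    by (rule weak_type_bound[OF sq q]) (assumption | rule that)+
  note c = c'[folded r_def]
  define a where "a j = (2 ^ Suc j) powr q' * (c * (2 ^ j) powr - r)" for j :: nat
  have a_eq: "a j = 2 powr q' * c * (2 powr (q' - r)) ^ j" for j
  proof -
    have p: "((2::real) ^ n) powr s = 2 powr (s * real n)" for n s
      by (simp add: powr_realpow[symmetric] powr_powr mult.commute)
    have "a j = c * (2 powr (q' * real (Suc j)) * 2 powr (- r * real j))" unfolding a_def p by simp
    also have "\<dots> = c * (2 powr q' * 2 powr ((q' - r) * real j))"
      by (simp add: powr_add[symmetric] algebra_simps)
    also have "2 powr ((q' - r) * real j) = (2 powr (q' - r)) ^ j"
      by (simp add: powr_powr[symmetric] powr_realpow)
    finally show ?thesis by (simp add: mult_ac)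
  qed
  have a0: "0 \<le> a j" for j using c0 by (simp add: a_def)
  have ratio: "norm ((2::real) powr (q' - r)) < 1"
    using q'(2) powr_less_mono[of "q' - r" 0 2] by (simp add: r_def)
  have sa: "summable a" unfolding a_eq[abs_def] by (intro summable_mult summable_geometric ratio)
  define C where "C = 1 + suminf a"
  show ?thesis unfolding sobolev_exponent_def
  proof (intro exI[of _ C] conjI allI impI)
    show "0 \<le> C" using suminf_nonneg[OF sa a0] by (simp add: C_def)
    fix u :: "'a \<Rightarrow> real" assume u: "tr_bound u 1"
    have uL: "L2 lborel u" using u by (rule tr_bound_L2)
    have um[measurable]: "u \<in> borel_measurable borel" using uL by (simp add: L2_def)
    have "(\<integral>\<^sup>+x. ennreal (\<bar>u x\<bar> powr q') \<partial>lborel) \<le>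
      (\<integral>\<^sup>+x. ennreal ((u x)\<^sup>2) + (\<Sum>j. ennreal ((2 ^ Suc j) powr q') * indicator {s. \<bar>s\<bar> > 2 ^ j} (u x)) \<partial>lborel)"
      by (intro nn_integral_mono dyadic_majorant q')
    also have "\<dots> = (\<integral>\<^sup>+x. ennreal ((u x)\<^sup>2) \<partial>lborel) + (\<integral>\<^sup>+x. (\<Sum>j. ennreal ((2 ^ Suc j) powr q') * indicator {s. \<bar>s\<bar> > 2 ^ j} (u x)) \<partial>lborel)"
      by (intro nn_integral_add) measurable
    also have "(\<integral>\<^sup>+x. (\<Sum>j. ennreal ((2 ^ Suc j) powr q') * indicator {s. \<bar>s\<bar> > 2 ^ j} (u x)) \<partial>lborel)
      = (\<Sum>j. \<integral>\<^sup>+x. ennreal ((2 ^ Suc j) powr q') * indicator {s. \<bar>s\<bar> > 2 ^ j} (u x) \<partial>lborel)"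
      by (intro nn_integral_suminf) measurable
    also have "\<dots> \<le> (\<Sum>j. ennreal (a j))"
    proof (intro suminf_le)
      fix j
      have "(\<integral>\<^sup>+x. ennreal ((2 ^ Suc j) powr q') * indicator {s. \<bar>s\<bar> > 2 ^ j} (u x) \<partial>lborel)
        = (\<integral>\<^sup>+x. ennreal ((2 ^ Suc j) powr q') * indicator {x. \<bar>u x\<bar> > 2 ^ j} x \<partial>lborel)"
        by (intro nn_integral_cong) (simp add: indicator_def)
      also have "\<dots> = ennreal ((2 ^ Suc j) powr q') * emeasure lborel {x. \<bar>u x\<bar> > 2 ^ j}"
        by (intro nn_integral_cmult_indicator) simp
      also have "\<dots> \<le> ennreal ((2 ^ Suc j) powr q') * ennreal (c * (2 ^ j) powr - r)"
        by (intro mult_left_mono c u) auto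
      also have "\<dots> = ennreal (a j)" using c0 by (simp add: a_def ennreal_mult[symmetric])
      finally show "(\<integral>\<^sup>+x. ennreal ((2 ^ Suc j) powr q') * indicator {s. \<bar>s\<bar> > 2 ^ j} (u x) \<partial>lborel) \<le> ennreal (a j)" .
    qed auto
    also have "(\<Sum>j. ennreal (a j)) = ennreal (suminf a)" by (intro suminf_ennreal2 a0 sa)
    also have "(\<integral>\<^sup>+x. ennreal ((u x)\<^sup>2) \<partial>lborel) = ennreal (LINT x|lborel. (u x)\<^sup>2)"
      by (intro nn_integral_eq_integral L2_square_integrable[OF uL]) auto
    also have "ennreal (LINT x|lborel. (u x)\<^sup>2) + ennreal (suminf a) \<le> ennreal C"
      using u suminf_nonneg[OF sa a0] by (subst ennreal_plus[symmetric]) (auto simp: C_def tr_bound_def intro!: ennreal_leI)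
    finally have b: "(\<integral>\<^sup>+x. ennreal (\<bar>u x\<bar> powr q') \<partial>lborel) \<le> ennreal C"
      by (simp add: add_right_mono)
    show i: "integrable lborel (\<lambda>x. \<bar>u x\<bar> powr q')"
      by (rule integrableI_nonneg) (use order_le_less_trans[OF b] in auto)
    have "ennreal (LINT x|lborel. \<bar>u x\<bar> powr q') \<le> ennreal C" using b nn_integral_eq_integral[OF i] by simp
    then show "(LINT x|lborel. \<bar>u x\<bar> powr q') \<le> C" using \<open>0 \<le> C\<close> by (simp add: ennreal_le_iff)
  qed
qed

text \<open>The map s \<mapsto> 2 + 2s/N has the critical exponent 2N/(N - 2) as fixed point and
  lies above the identity below it. Starting from 2, the supremum of the exponents reached must
  therefore be at least q; a supremum argument takes the place of counting iterations.\<close>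

theorem sobolev_subcritical:
  assumes N: "DIM('a::euclidean_space) \<ge> 3" and q: "2 \<le> q" "q < 2 * real DIM('a) / (real DIM('a) - 2)"
  shows "sobolev_exponent TYPE('a) q"
proof (rule ccontr)
  assume neg: "\<not> sobolev_exponent TYPE('a) q"
  define N where "N = real DIM('a)"
  have N3: "N \<ge> 3" using N by (simp add: N_def)
  define Q where "Q = {s. 2 \<le> s \<and> s \<le> q \<and> sobolev_exponent TYPE('a) s}"
  have Q2: "2 \<in> Q" using q sobolev_exponent_2[where 'a='a] by (simp add: Q_def)
  have bdd: "bdd_above Q" by (auto simp: Q_def intro!: bdd_aboveI[of _ q])
  define s where "s = Sup Q"
  have s: "2 \<le> s" "s \<le> q" unfolding s_def using Q2 bdd by (auto intro!: cSup_upper cSup_least simp: Q_def)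
  have "s * (N - 2) < 2 * N"
  proof -
    have "q * (N - 2) < 2 * N" using q N3 by (simp add: N_def[symmetric] field_simps)
    moreover have "s * (N - 2) \<le> q * (N - 2)" using s N3 by (intro mult_right_mono) auto
    ultimately show ?thesis by linarith
  qed
  \<comment> \<open>Equivalent to s < 2 + 2s/N; in this form it yields an exponent s' already
    reached whose improvement 2 + 2s'/N passes s.\<close>
  then have "(s - 2) * N / 2 < s" by (simp add: field_simps)
  then obtain s' where s': "s' \<in> Q" "(s - 2) * N / 2 < s'"
    using less_cSupD[of Q "(s - 2) * N / 2"] Q2 unfolding s_def by blast
  have gt: "s < 2 + 2 * s' / N" using s'(2) N3 by (simp add: field_simps)
  define t where "t = min q ((s + (2 + 2 * s' / N)) / 2)"
  have "t \<le> (s + (2 + 2 * s' / N)) / 2" unfolding t_def by (rule min.cobounded2)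
  then have t: "s \<le> t" "t < 2 + 2 * s' / N" using gt s by (auto simp: t_def)
  have st: "sobolev_exponent TYPE('a) t"
    by (rule sobolev_step[of s']) (use s' t s in \<open>auto simp: Q_def N_def\<close>)
  show False
  proof (cases "t = q")
    case True
    then show ?thesis using st neg by simp
  next
    case False
    moreover have "min q X = q \<or> min q X = X" for X :: real by (simp add: min_def)
    ultimately have "t = (s + (2 + 2 * s' / N)) / 2" unfolding t_def by blast
    then have "s < t" using gt by simp
    have "t \<le> q" unfolding t_def by (rule min.cobounded1)
    then have "t \<in> Q" using st t s by (simp add: Q_def)
    then have "t \<le> s" unfolding s_def by (rule cSup_upper[OF _ bdd])
    then show False using \<open>s < t\<close> by simp
  qed
qed

corollary sobolev_bound:
  assumes N: "DIM('a::euclidean_space) \<ge> 3" and q: "2 \<le> q" "q < 2 * real DIM('a) / (real DIM('a) - 2)"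
  obtains C where "C \<ge> 0" "\<And>u::'a \<Rightarrow> real. tr_bound u D \<Longrightarrow> integrable lborel (\<lambda>x. \<bar>u x\<bar> powr q) \<and> (LINT x|lborel. \<bar>u x\<bar> powr q) \<le> C"
proof -
  obtain C where C0: "C \<ge> 0" and C: "\<And>u::'a \<Rightarrow> real. tr_bound u 1 \<Longrightarrow>
     integrable lborel (\<lambda>x. \<bar>u x\<bar> powr q) \<and> (LINT x|lborel. \<bar>u x\<bar> powr q) \<le> C"
    using sobolev_subcritical[OF assms] unfolding sobolev_exponent_def by blast
  \<comment> \<open>The maximum keeps the scaling factor \<open>a\<close> meaningful for every real
    \<open>D\<close>.\<close>
  define D' where "D' = max D 1"
  define a where "a = 1 / sqrt D'"
  have D': "D' \<ge> 1" and a: "a > 0" "a\<^sup>2 * D' = 1" by (auto simp: D'_def a_def power_divide)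
  show ?thesis
  proof (rule that[of "C / a powr q"])
    show "0 \<le> C / a powr q" using C0 by simp
    fix u :: "'a \<Rightarrow> real" assume "tr_bound u D"
    then have "tr_bound u D'" by (rule tr_bound_mono) (simp add: D'_def)
    from tr_bound_scale[OF this, of a] have "tr_bound (\<lambda>x. a * u x) 1" by (simp add: a)
    from C[OF this] have c: "integrable lborel (\<lambda>x. \<bar>a * u x\<bar> powr q)" "(LINT x|lborel. \<bar>a * u x\<bar> powr q) \<le> C" by auto
    have e: "\<bar>a * u x\<bar> powr q = a powr q * \<bar>u x\<bar> powr q" for x using a by (simp add: abs_mult powr_mult)
    show "integrable lborel (\<lambda>x. \<bar>u x\<bar> powr q) \<and> (LINT x|lborel. \<bar>u x\<bar> powr q) \<le> C / a powr q"
      using c a unfolding e by (simp add: field_simps)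
  qed
qed

text \<open>Lions' lemma in quantitative form. Values below \<kappa> are paid for by the L^2 norm,
  values above \<open>K\<close> by a higher exponent q', and the values between lie in a level set
  whose measure is small once all local averages are small. Each of the three parts receives
  c/3.\<close>

theorem vanishing:
  assumes N: "DIM('a::euclidean_space) \<ge> 3" and q: "2 < q" "q < 2 * real DIM('a) / (real DIM('a) - 2)" and c: "0 < c"
  obtains \<delta> where "\<delta> > 0" "\<And>u::'a \<Rightarrow> real. tr_bound u D \<Longrightarrow>
    \<forall>x. (LINT y|lborel. (u y)\<^sup>2 * indicator (ball x 1) y) \<le> \<delta> \<Longrightarrow> (LINT x|lborel. \<bar>u x\<bar> powr q) \<le> c"
proof -
  define q' where "q' = (q + 2 * real DIM('a) / (real DIM('a) - 2)) / 2"
  have q': "q < q'" "q' < 2 * real DIM('a) / (real DIM('a) - 2)" using q by (auto simp: q'_def)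
  obtain C where C0: "C \<ge> 0" and C: "\<And>u::'a \<Rightarrow> real. tr_bound u D \<Longrightarrow>
      integrable lborel (\<lambda>x. \<bar>u x\<bar> powr q') \<and> (LINT x|lborel. \<bar>u x\<bar> powr q') \<le> C"
    by (rule sobolev_bound[OF N, of q' D]) (use q q' in \<open>(assumption | rule that | simp)+\<close>)
  have qi: "integrable lborel (\<lambda>x. \<bar>u x\<bar> powr q)" if "tr_bound u D" for u :: "'a \<Rightarrow> real"
    by (rule sobolev_bound[OF N, of q D]) (use q that in auto)
  define D' where "D' = max D 1"
  have D': "D' > 0" "D \<le> D'" by (auto simp: D'_def)
  \<comment> \<open>Solves \<kappa>^(q-2) D' = c/3; likewise K^(q-q') (C + 1) = c/3 and K^q m = c/3
    below.\<close>
  define \<kappa> where "\<kappa> = (c / (3 * D')) powr (1 / (q - 2))"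
  have k: "\<kappa> > 0" "\<kappa> powr (q - 2) = c / (3 * D')" using c D' q by (auto simp: \<kappa>_def powr_powr)
  define K where "K = (c / (3 * (C + 1))) powr (1 / (q - q'))"
  have K: "K > 0" "K powr (q - q') = c / (3 * (C + 1))" using c C0 q' by (auto simp: K_def powr_powr)
  define m where "m = c / (3 * K powr q)"
  have m: "m > 0" using c K by (simp add: m_def)
  \<comment> \<open>At most 1, so that balls of radius e lie in the unit balls whose mass is assumed
    small; the second entry makes the level set measure at most m.\<close>
  define e where "e = min 1 (sqrt (m * (\<kappa> / 2)\<^sup>2 / D'))"
  have e: "0 < e" "e \<le> 1" using m k D' by (auto simp: e_def)
  have e2: "D' * e\<^sup>2 / (\<kappa> / 2)\<^sup>2 \<le> m"
  proof -
    have "e\<^sup>2 \<le> (sqrt (m * (\<kappa> / 2)\<^sup>2 / D'))\<^sup>2" using e unfolding e_def by (intro power_mono) auto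
    also have "\<dots> = m * (\<kappa> / 2)\<^sup>2 / D'" using m D' by (intro real_sqrt_pow2) auto
    finally show ?thesis using D' k by (simp add: field_simps)
  qed
  let ?V = "measure lborel (ball (0::'a) e)"
  have V: "?V > 0" using content_ball_pos[OF e(1), of 0] by simp
  show ?thesis
  \<comment> \<open>By Jensen's inequality this mass bound is exactly what makes every average at
    scale e at most \<kappa>/2.\<close>
  proof (rule that[of "?V * (\<kappa> / 2)\<^sup>2"])
    show "0 < ?V * (\<kappa> / 2)\<^sup>2" using V k by (intro mult_pos_pos) auto
    fix u :: "'a \<Rightarrow> real" assume u: "tr_bound u D" and small: "\<forall>x. (LINT y|lborel. (u y)\<^sup>2 * indicator (ball x 1) y) \<le> ?V * (\<kappa> / 2)\<^sup>2"
    have uL: "L2 lborel u" using u by (rule tr_bound_L2)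
    have um[measurable]: "u \<in> borel_measurable borel" using uL by (simp add: L2_def)
    have A: "\<bar>bavg e u x\<bar> \<le> \<kappa> / 2" for x
    proof -
      have "(bavg e u x)\<^sup>2 * ?V \<le> (LINT y|lborel. (u y)\<^sup>2 * indicator (ball x e) y)" by (rule bavg_square_le[OF uL e(1)])
      also have "\<dots> \<le> (LINT y|lborel. (u y)\<^sup>2 * indicator (ball x 1) y)"
        by (intro integral_mono integrable_square_indicator uL) (use e in \<open>auto simp: indicator_def\<close>)
      also have "\<dots> \<le> ?V * (\<kappa> / 2)\<^sup>2" using small by blast
      finally have "(bavg e u x)\<^sup>2 \<le> (\<kappa> / 2)\<^sup>2" using V by (simp add: mult.commute[of _ ?V])
      then show ?thesis using k by (simp add: abs_le_square_iff[symmetric])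
    qed
    have "emeasure lborel {x. \<bar>u x\<bar> > 2 * (\<kappa> / 2)} \<le> ennreal (D' * e\<^sup>2 / (\<kappa> / 2)\<^sup>2)"
      using k A by (intro level_set_bound[OF tr_bound_mono[OF u D'(2)] e(1)]) auto
    also have "\<dots> \<le> ennreal m" by (rule ennreal_leI[OF e2])
    finally have em: "emeasure lborel {x. \<bar>u x\<bar> > \<kappa>} \<le> ennreal m" by simp
    then have fin: "emeasure lborel {x. \<bar>u x\<bar> > \<kappa>} < \<infinity>" by (rule order_le_less_trans) simp
    then have me: "measure lborel {x. \<bar>u x\<bar> > \<kappa>} \<le> m"
      using em m by (simp add: emeasure_eq_ennreal_measure)
    have pt: "t powr q \<le> \<kappa> powr (q - 2) * t\<^sup>2 + K powr (q - q') * t powr q' + K powr q * (if t > \<kappa> then 1 else 0)" if "t \<ge> 0" for t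
    proof -
      have nn: "0 \<le> \<kappa> powr (q - 2) * t\<^sup>2" "0 \<le> K powr (q - q') * t powr q'" "0 \<le> K powr q * (if t > \<kappa> then 1 else 0)" by auto
      consider "t = 0" | "t > 0" "t \<le> \<kappa>" | "t > 0" "t \<ge> K" | "t > \<kappa>" "t < K"
      proof -
        have "t = 0 \<or> t > 0" using \<open>t \<ge> 0\<close> by auto
        then show ?thesis using that by (cases "t \<le> \<kappa>"; cases "t \<ge> K") auto
      qed
      then show ?thesis
      proof cases
        case 2
        have "t powr q = t powr (q - 2) * t powr 2" by (simp add: powr_add[symmetric] del: powr_numeral)
        also have "\<dots> = t powr (q - 2) * t\<^sup>2" using 2 by simp
        also have "\<dots> \<le> \<kappa> powr (q - 2) * t\<^sup>2" using 2 q by (intro mult_right_mono powr_mono2) auto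
        finally show ?thesis using nn by linarith
      next
        case 3
        have "t powr q = t powr (q - q') * t powr q'" by (simp add: powr_add[symmetric])
        also have "\<dots> \<le> K powr (q - q') * t powr q'" using 3 K q' by (intro mult_right_mono powr_mono2') auto
        finally show ?thesis using nn by linarith
      next
        case 4
        have "t powr q \<le> K powr q" using 4 k q by (intro powr_mono2) auto
        then show ?thesis using nn(1,2) 4 by (simp add: add_increasing)
      qed (use nn in simp)
    qed
    have "(LINT x|lborel. \<bar>u x\<bar> powr q) \<le> (LINT x|lborel. \<kappa> powr (q - 2) * (u x)\<^sup>2 + K powr (q - q') * \<bar>u x\<bar> powr q' + K powr q * indicator {x. \<bar>u x\<bar> > \<kappa>} x)"
    proof (rule integral_mono[OF qi[OF u]])
      show "integrable lborel (\<lambda>x. \<kappa> powr (q - 2) * (u x)\<^sup>2 + K powr (q - q') * \<bar>u x\<bar> powr q' + K powr q * indicator {x. \<bar>u x\<bar> > \<kappa>} x)"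
        using L2_square_integrable[OF uL] C[OF u] fin by simp
      show "\<bar>u x\<bar> powr q \<le> \<kappa> powr (q - 2) * (u x)\<^sup>2 + K powr (q - q') * \<bar>u x\<bar> powr q' + K powr q * indicator {x. \<bar>u x\<bar> > \<kappa>} x" for x
        using pt[of "\<bar>u x\<bar>"] by (cases "\<bar>u x\<bar> > \<kappa>") auto
    qed
    also have "\<dots> = \<kappa> powr (q - 2) * (LINT x|lborel. (u x)\<^sup>2) + K powr (q - q') * (LINT x|lborel. \<bar>u x\<bar> powr q') + K powr q * measure lborel {x. \<bar>u x\<bar> > \<kappa>}"
      using L2_square_integrable[OF uL] C[OF u] fin by simp
    also have "\<dots> \<le> c / 3 + c / 3 + c / 3"
    proof (intro add_mono)
      have "(LINT x|lborel. (u x)\<^sup>2) \<le> D'" using u D' by (simp add: tr_bound_def)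
      then have "\<kappa> powr (q - 2) * (LINT x|lborel. (u x)\<^sup>2) \<le> c / (3 * D') * D'" unfolding k(2) using c D' by (intro mult_left_mono) auto
      then show "\<kappa> powr (q - 2) * (LINT x|lborel. (u x)\<^sup>2) \<le> c / 3" using D' by simp
      have "K powr (q - q') * (LINT x|lborel. \<bar>u x\<bar> powr q') \<le> c / (3 * (C + 1)) * (C + 1)"
        unfolding K(2) using c C0 C[OF u] by (intro mult_left_mono) auto
      also have "c / (3 * (C + 1)) * (C + 1) = c / 3" using C0 by (simp add: field_simps)
      finally show "K powr (q - q') * (LINT x|lborel. \<bar>u x\<bar> powr q') \<le> c / 3" .
      have "K powr q * measure lborel {x. \<bar>u x\<bar> > \<kappa>} \<le> K powr q * m" by (intro mult_left_mono me) simp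
      then show "K powr q * measure lborel {x. \<bar>u x\<bar> > \<kappa>} \<le> c / 3" using K by (simp add: m_def)
    qed
    finally show "(LINT x|lborel. \<bar>u x\<bar> powr q) \<le> c" by simp
  qed
qed

subsection \<open>Local compactness\<close>

text \<open>A finite measure with positive density, for which convergence in \<open>L\<^sup>2\<close> expresses \<open>L\<^sup>2\<^sub>l\<^sub>o\<^sub>c\<close> convergence.\<close>

definition wgt_term :: "nat \<Rightarrow> 'a::euclidean_space \<Rightarrow> real" where
  "wgt_term j x = (1/2) ^ j / (1 + measure lborel (ball (0::'a) (real j))) * indicator (ball 0 (real j)) x"

definition wgt :: "'a::euclidean_space \<Rightarrow> real" where
  "wgt x = (\<Sum>j. wgt_term j x)"

definition wmeas :: "'a::euclidean_space measure" where
  "wmeas = density lborel (\<lambda>x. ennreal (wgt x))"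

lemma wgt_term_bounds: "0 \<le> wgt_term j x" "wgt_term j x \<le> (1/2) ^ j"
proof -
  let ?V = "measure lborel (ball (0::'a) (real j))"
  have "(1/2) ^ j / (1 + ?V) \<le> (1/2) ^ j / 1" by (intro divide_left_mono) (auto simp: add_pos_nonneg)
  then show "0 \<le> wgt_term j x" "wgt_term j x \<le> (1/2) ^ j"
    by (auto simp: wgt_term_def indicator_def)
qed

lemma summable_wgt_term: "summable (\<lambda>j. wgt_term j x)"
proof (rule summable_comparison_test'[where N=0])
  show "summable (\<lambda>j. (1/2::real) ^ j)" by (intro summable_geometric) simp
  show "norm (wgt_term n x) \<le> (1/2) ^ n" for n using wgt_term_bounds[of n x] by simp
qed

lemma wgt_term_le_wgt: "wgt_term j x \<le> wgt x"
  unfolding wgt_def using sum_le_suminf[OF summable_wgt_term, of "{j}" x] by (simp add: wgt_term_bounds)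

lemma wgt_lower:
  obtains c where "c > 0" "\<And>x::'a::euclidean_space. x \<in> ball 0 R \<Longrightarrow> c \<le> wgt x"
proof -
  obtain j :: nat where j: "R < real j" using reals_Archimedean2 by blast
  show ?thesis
  proof (rule that[of "(1/2) ^ j / (1 + measure lborel (ball (0::'a) (real j)))"])
    show "0 < (1/2) ^ j / (1 + measure lborel (ball (0::'a) (real j)))" by (simp add: add_pos_nonneg)
    fix x :: 'a assume "x \<in> ball 0 R"
    then show "(1/2) ^ j / (1 + measure lborel (ball (0::'a) (real j))) \<le> wgt x"
      using wgt_term_le_wgt[of j x] j by (simp add: wgt_term_def)
  qed
qed

lemma wgt_pos: "0 < wgt (x::'a::euclidean_space)"
proof -
  obtain c where "c > 0" "\<And>y::'a. y \<in> ball 0 (norm x + 1) \<Longrightarrow> c \<le> wgt y" using wgt_lower[of "norm x + 1"] by blast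
  moreover have "x \<in> ball 0 (norm x + 1)" by simp
  ultimately show ?thesis by (meson less_le_trans)
qed

lemma wgt_le: "wgt x \<le> 2"
proof -
  have "wgt x \<le> (\<Sum>j. (1/2) ^ j)" unfolding wgt_def
    by (intro suminf_le summable_wgt_term wgt_term_bounds summable_geometric) simp
  then show ?thesis by (simp add: suminf_geometric)
qed

lemma wgt_measurable[measurable]: "(wgt :: 'a::euclidean_space \<Rightarrow> real) \<in> borel_measurable borel"
proof -
  have [measurable]: "ball (0::'a) e \<in> sets borel" for e by simp
  have "(\<lambda>x::'a. wgt_term j x) \<in> borel_measurable borel" for j unfolding wgt_term_def by measurable
  then show ?thesis unfolding wgt_def[abs_def] by (rule borel_measurable_suminf)
qed

lemma wgt_integrable: "integrable lborel (wgt :: 'a::euclidean_space \<Rightarrow> real)"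
  unfolding wgt_def[abs_def]
proof (rule integrable_suminf)
  have i0: "integrable lborel (indicator (ball (0::'a) e) :: 'a \<Rightarrow> real)" for e
    using L2_square_integrable[OF L2_indicator_ball[of 0 e]] by (simp add: power2_eq_square indicator_inter_arith[symmetric])
  show i: "integrable lborel (wgt_term j :: 'a \<Rightarrow> real)" for j
    unfolding wgt_term_def[abs_def] by (intro integrable_mult_right i0)
  show "AE x::'a in lborel. summable (\<lambda>j. norm (wgt_term j x))" 
    by (simp add: abs_of_nonneg[OF wgt_term_bounds(1)] summable_wgt_term)
  show "summable (\<lambda>j. LINT x::'a|lborel. norm (wgt_term j x))"
  proof (rule summable_comparison_test'[where N=0])
    show "summable (\<lambda>j. (1/2::real) ^ j)" by (intro summable_geometric) simp
    fix n
    let ?V = "measure lborel (ball (0::'a) (real n))"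
    have "(LINT x::'a|lborel. norm (wgt_term n x)) = (1/2) ^ n / (1 + ?V) * ?V"
      using wgt_term_bounds(1)[of n] i0[of "real n"] by (simp add: wgt_term_def)
    also have "\<dots> \<le> (1/2) ^ n"
      using divide_le_eq_1[of ?V "1 + ?V"] by (simp add: field_simps add_pos_nonneg)
    finally show "norm (LINT x::'a|lborel. norm (wgt_term n x)) \<le> (1/2) ^ n"
      by simp
  qed
qed

lemma space_wmeas[simp]: "space wmeas = UNIV" and sets_wmeas[simp, measurable_cong]: "sets wmeas = sets borel"
  by (simp_all add: wmeas_def)

lemma measurable_wmeas: "f \<in> borel_measurable wmeas \<longleftrightarrow> f \<in> borel_measurable borel"
  by (intro iffI; simp cong: measurable_cong_sets)

lemma AE_wmeas: "(AE x in wmeas. P x) \<longleftrightarrow> (AE x in lborel. P x)"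
  unfolding wmeas_def by (subst AE_density) (auto simp: wgt_pos)

lemma finite_wmeas: "finite_measure (wmeas :: 'a::euclidean_space measure)"
proof
  have "emeasure (wmeas :: 'a measure) (space wmeas) = (\<integral>\<^sup>+x. ennreal (wgt (x::'a)) \<partial>lborel)"
    unfolding wmeas_def by (simp add: emeasure_density)
  also have "\<dots> = ennreal (LINT x|lborel. wgt (x::'a))"
    by (rule nn_integral_eq_integral[OF wgt_integrable]) (simp add: wgt_pos less_imp_le)
  finally show "emeasure (wmeas :: 'a measure) (space wmeas) \<noteq> \<infinity>" by simp
qed

lemma integral_wmeas:
  fixes f :: "'a::euclidean_space \<Rightarrow> real"
  assumes "f \<in> borel_measurable borel"
  shows "(LINT x|wmeas. f x) = (LINT x|lborel. wgt x * f x)"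
    and "integrable wmeas f \<longleftrightarrow> integrable lborel (\<lambda>x. wgt x * f x)"
  using assms integral_density[of f lborel wgt] integrable_density[of f lborel wgt]
  by (auto simp: wmeas_def wgt_pos less_imp_le)

lemma wmeas_le:
  fixes f :: "'a::euclidean_space \<Rightarrow> real"
  assumes f: "integrable lborel f" and pos: "\<And>x. 0 \<le> f x"
  shows "integrable wmeas f" "(LINT x|wmeas. f x) \<le> 2 * (LINT x|lborel. f x)"
proof -
  have fm: "f \<in> borel_measurable borel" using f by simp
  have i: "integrable lborel (\<lambda>x. wgt x * f x)"
  proof (rule Bochner_Integration.integrable_bound[of _ "\<lambda>x. 2 * f x"])
    show "AE x in lborel. norm (wgt x * f x) \<le> norm (2 * f x)"
      using pos by (intro AE_I2) (simp add: abs_mult abs_of_pos[OF wgt_pos] mult_right_mono wgt_le)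
  qed (use f fm in auto)
  then show "integrable wmeas f" by (simp add: integral_wmeas[OF fm])
  have "(LINT x|lborel. wgt x * f x) \<le> (LINT x|lborel. 2 * f x)"
    using f i pos by (intro integral_mono) (auto simp: mult_right_mono wgt_le)
  then show "(LINT x|wmeas. f x) \<le> 2 * (LINT x|lborel. f x)" by (simp add: integral_wmeas[OF fm])
qed

lemma L2_wmeas: "L2 lborel u \<Longrightarrow> L2 wmeas u" for u :: "'a::euclidean_space \<Rightarrow> real"
  using wmeas_le(1)[of "\<lambda>x. (u x)\<^sup>2"] by (auto simp: L2_def measurable_wmeas)

text \<open>Returns from the weighted norm to mass on a fixed ball, with a constant uniform in u; it
  later prevents the local limit from being zero.\<close>

lemma wmeas_ball:
  obtains c where "c > 0" "\<And>u::'a::euclidean_space \<Rightarrow> real. L2 wmeas u \<Longrightarrow>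
     integrable lborel (\<lambda>x. (u x)\<^sup>2 * indicator (ball 0 R) x) \<and>
     c * (LINT x|lborel. (u x)\<^sup>2 * indicator (ball 0 R) x) \<le> (LINT x|wmeas. (u x)\<^sup>2)"
proof -
  obtain c where c: "c > 0" "\<And>x::'a. x \<in> ball 0 R \<Longrightarrow> c \<le> wgt x" using wgt_lower[of R] by blast
  show ?thesis
  proof (rule that[OF c(1)])
    fix u :: "'a \<Rightarrow> real" assume u: "L2 wmeas u"
    have um[measurable]: "u \<in> borel_measurable borel" using u by (simp add: L2_def measurable_wmeas)
    have i: "integrable lborel (\<lambda>x. wgt x * (u x)\<^sup>2)" using u by (simp add: L2_def integral_wmeas)
    have pt: "c * ((u x)\<^sup>2 * indicator (ball 0 R) x) \<le> wgt x * (u x)\<^sup>2" for x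
      using c(2)[of x] wgt_pos[of x] by (cases "x \<in> ball 0 R") (auto intro: mult_right_mono)
    have i': "integrable lborel (\<lambda>x. c * ((u x)\<^sup>2 * indicator (ball 0 R) x))"
    proof (rule Bochner_Integration.integrable_bound[OF i])
      show "AE x in lborel. norm (c * ((u x)\<^sup>2 * indicator (ball 0 R) x)) \<le> norm (wgt x * (u x)\<^sup>2)"
        using pt c by (intro AE_I2) (simp add: abs_mult abs_of_pos[OF wgt_pos])
      have [measurable]: "ball (0::'a) R \<in> sets borel" by simp
      show "(\<lambda>x. c * ((u x)\<^sup>2 * indicator (ball 0 R) x)) \<in> borel_measurable lborel" by measurable
    qed
    have "(LINT x|lborel. c * ((u x)\<^sup>2 * indicator (ball 0 R) x)) \<le> (LINT x|lborel. wgt x * (u x)\<^sup>2)"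
      by (rule integral_mono[OF i' i pt])
    then show "integrable lborel (\<lambda>x. (u x)\<^sup>2 * indicator (ball 0 R) x) \<and>
     c * (LINT x|lborel. (u x)\<^sup>2 * indicator (ball 0 R) x) \<le> (LINT x|wmeas. (u x)\<^sup>2)"
      using i' c by (simp add: integral_wmeas)
  qed
qed

text \<open>Arzela-Ascoli: convergence at countably many points for all scales at once, then
  extension to every point by the Lipschitz bound \<open>bavg_diff_le\<close>, which is uniform in n
  for each scale.\<close>

lemma bavg_convergent_subsequence:
  fixes un :: "nat \<Rightarrow> 'a::euclidean_space \<Rightarrow> real"
  assumes tb: "\<And>n. tr_bound (un n) D" and e: "\<And>j::nat. 0 < e j"
  obtains r where "strict_mono (r::nat \<Rightarrow> nat)" "\<And>j x. convergent (\<lambda>n. bavg (e j) (un (r n)) x)"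
proof -
  define V where "V j = measure lborel (ball (0::'a) (e j))" for j
  have V: "V j > 0" for j unfolding V_def using content_ball_pos[OF e[of j], of "0::'a"] by simp
  obtain S :: "'a set" where S: "countable S" "closure S = UNIV" using separable[of UNIV] by (metis closure_UNIV top.extremum_uniqueI)
  \<comment> \<open>The factor sqrt(V) makes one bound, sqrt(D), valid for all scales
    simultaneously, as the diagonal extraction requires.\<close>
  define f where "f n p = sqrt (V (fst p)) * bavg (e (fst p)) (un n) (snd p)" for n :: nat and p :: "nat \<times> 'a"
  have fb: "norm (f n p) \<le> sqrt D" for n p
  proof -
    have "(f n p)\<^sup>2 = (bavg (e (fst p)) (un n) (snd p))\<^sup>2 * V (fst p)"
      using V[of "fst p"] by (simp add: f_def power_mult_distrib)
    also have "\<dots> \<le> (LINT y|lborel. (un n y)\<^sup>2)"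
      unfolding V_def by (rule bavg_square_le_integral[OF tr_bound_L2[OF tb] e])
    also have "\<dots> \<le> D" using tb[of n] by (simp add: tr_bound_def)
    finally have "sqrt ((f n p)\<^sup>2) \<le> sqrt D" by (rule real_sqrt_le_mono)
    then show ?thesis by simp
  qed
  have "countable (UNIV \<times> S :: (nat \<times> 'a) set)" using S(1) by auto
  then obtain r where r: "strict_mono (r::nat \<Rightarrow> nat)" and rl: "\<And>p. p \<in> UNIV \<times> S \<Longrightarrow> \<exists>l. (\<lambda>n. f (r n) p) \<longlonglongrightarrow> l"
    by (rule function_convergent_subsequence[of _ f "sqrt D"]) (use fb that in auto)
  show ?thesis
  proof (rule that[OF r])
    fix j x
    have cS: "convergent (\<lambda>n. bavg (e j) (un (r n)) s)" if "s \<in> S" for s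
    proof -
      obtain l where "(\<lambda>n. f (r n) (j, s)) \<longlonglongrightarrow> l" using rl[of "(j, s)"] \<open>s \<in> S\<close> by auto
      then have "(\<lambda>n. f (r n) (j, s) / sqrt (V j)) \<longlonglongrightarrow> l / sqrt (V j)" using V[of j] by (intro tendsto_intros) auto
      then have "(\<lambda>n. bavg (e j) (un (r n)) s) \<longlonglongrightarrow> l / sqrt (V j)" using V[of j] by (simp add: f_def)
      then show ?thesis by (rule convergentI)
    qed
    have "Cauchy (\<lambda>n. bavg (e j) (un (r n)) x)"
    proof (rule CauchyI)
      fix \<epsilon> :: real assume eps: "\<epsilon> > 0"
      define L where "L = sqrt (D / V j) + 1"
      have L: "L > 0" using tr_bound_nonneg[OF tb[of 0]] V[of j] by (simp add: L_def add_nonneg_pos)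
      have "x \<in> closure S" using S(2) by simp
      moreover have "\<epsilon> / (3 * L) > 0" using eps L by simp
      ultimately obtain s where s: "s \<in> S" "dist s x < \<epsilon> / (3 * L)" unfolding closure_approachable by blast
      have lip: "\<bar>bavg (e j) (un n) x - bavg (e j) (un n) s\<bar> < \<epsilon> / 3" for n
      proof -
        have "(bavg (e j) (un n) x - bavg (e j) (un n) s)\<^sup>2 * V j \<le> D * (norm (x - s))\<^sup>2"
          unfolding V_def by (rule bavg_diff_le[OF tb e])
        then have "(bavg (e j) (un n) x - bavg (e j) (un n) s)\<^sup>2 \<le> D / V j * (norm (x - s))\<^sup>2"
          using V[of j] by (simp add: field_simps)
        then have "sqrt ((bavg (e j) (un n) x - bavg (e j) (un n) s)\<^sup>2) \<le> sqrt (D / V j * (norm (x - s))\<^sup>2)"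
          by (rule real_sqrt_le_mono)
        then have "\<bar>bavg (e j) (un n) x - bavg (e j) (un n) s\<bar> \<le> sqrt (D / V j) * norm (x - s)"
          by (simp add: real_sqrt_mult real_sqrt_divide)
        also have "\<dots> \<le> L * norm (x - s)" by (intro mult_right_mono) (auto simp: L_def)
        also have "\<dots> < L * (\<epsilon> / (3 * L))" using s(2) L by (intro mult_strict_left_mono) (auto simp: dist_norm norm_minus_commute)
        also have "\<dots> = \<epsilon> / 3" using L by simp
        finally show ?thesis .
      qed
      have "Cauchy (\<lambda>n. bavg (e j) (un (r n)) s)" using cS[OF s(1)] by (rule convergent_Cauchy)
      moreover have "\<epsilon> / 3 > 0" using eps by simp
      ultimately obtain M where M: "\<And>m n. m \<ge> M \<Longrightarrow> n \<ge> M \<Longrightarrow> norm (bavg (e j) (un (r m)) s - bavg (e j) (un (r n)) s) < \<epsilon> / 3"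
        unfolding Cauchy_iff by blast
      show "\<exists>M. \<forall>m\<ge>M. \<forall>n\<ge>M. norm (bavg (e j) (un (r m)) x - bavg (e j) (un (r n)) x) < \<epsilon>"
      proof (intro exI allI impI)
        fix m n assume "m \<ge> M" "n \<ge> M"
        from M[OF this] lip[of "r m"] lip[of "r n"]
        show "norm (bavg (e j) (un (r m)) x - bavg (e j) (un (r n)) x) < \<epsilon>"
          unfolding real_norm_def by linarith
      qed
    qed
    then show "convergent (\<lambda>n. bavg (e j) (un (r n)) x)" by (rule Cauchy_convergent)
  qed
qed

text \<open>A Rellich argument: at each scale the averages converge pointwise and boundedly, hence
  in L^2 of the finite measure \<open>wmeas\<close>, while the functions differ from their averages
  by at most D e^2 uniformly in n. Together this gives a Cauchy sequence.\<close>

theorem local_compactness: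
  fixes un :: "nat \<Rightarrow> 'a::euclidean_space \<Rightarrow> real"
  assumes tb: "\<And>n. tr_bound (un n) D"
  obtains r u where "strict_mono (r::nat \<Rightarrow> nat)" "L2 wmeas u" "(\<lambda>n. LINT x|wmeas. (un (r n) x - u x)\<^sup>2) \<longlonglongrightarrow> 0"
    "AE x in lborel. (\<lambda>n. un (r n) x) \<longlonglongrightarrow> u x"
proof -
  define e where "e j = 1 / real (Suc j)" for j
  have e: "0 < e j" for j by (simp add: e_def)
  obtain r where r: "strict_mono r" and rc: "\<And>j x. convergent (\<lambda>n. bavg (e j) (un (r n)) x)"
    by (rule bavg_convergent_subsequence[OF tb e]) (rule that)
  interpret W: finite_measure "wmeas :: 'a measure" by (rule finite_wmeas)
  have D0: "0 \<le> D" by (rule tr_bound_nonneg[OF tb[of 0]])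
  define A where "A j n = bavg (e j) (un (r n))" for j n
  define a where "a j x = lim (\<lambda>n. A j n x)" for j x
  have lim: "(\<lambda>n. A j n x) \<longlonglongrightarrow> a j x" for j x
    using rc[of j x] by (simp add: a_def A_def convergent_LIMSEQ_iff)
  have um[measurable]: "un n \<in> borel_measurable borel" for n using tr_bound_L2[OF tb[of n]] by (simp add: L2_def)
  have Am[measurable]: "A j n \<in> borel_measurable borel" for j n
    unfolding A_def by (rule bavg_measurable[OF tb e])
  have am[measurable]: "a j \<in> borel_measurable borel" for j unfolding a_def[abs_def] by measurable
  have Abound: "(A j n x)\<^sup>2 \<le> D / measure lborel (ball (0::'a) (e j))" for j n x
  proof -
    have V: "measure lborel (ball (0::'a) (e j)) > 0" using content_ball_pos[OF e[of j], of "0::'a"] by simp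
    have "(A j n x)\<^sup>2 * measure lborel (ball (0::'a) (e j)) \<le> D"
      using bavg_square_le_integral[OF tr_bound_L2[OF tb[of "r n"]] e[of j], of x] tb[of "r n"] unfolding A_def tr_bound_def by linarith
    then show ?thesis using V by (simp add: field_simps)
  qed
  have abound: "(a j x)\<^sup>2 \<le> D / measure lborel (ball (0::'a) (e j))" for j x
  proof (rule LIMSEQ_le_const2)
    show "(\<lambda>n. (A j n x)\<^sup>2) \<longlonglongrightarrow> (a j x)\<^sup>2" by (intro tendsto_intros lim)
  qed (use Abound in auto)
  have dbound: "(A j n x - a j x)\<^sup>2 \<le> 4 * (D / measure lborel (ball (0::'a) (e j)))" for j n x
  proof -
    have "(A j n x - a j x)\<^sup>2 \<le> 2 * (A j n x)\<^sup>2 + 2 * (a j x)\<^sup>2"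
      using zero_le_power2[of "A j n x + a j x"] by (simp add: power2_eq_square algebra_simps)
    then show ?thesis using Abound[of j n x] abound[of j x] by linarith
  qed
  have di: "integrable wmeas (\<lambda>x. (A j n x - a j x)\<^sup>2)" for j n
    by (rule W.integrable_const_bound[of _ "4 * (D / measure lborel (ball (0::'a) (e j)))"]) (use dbound in auto)
  have dlim: "(\<lambda>n. LINT x|wmeas. (A j n x - a j x)\<^sup>2) \<longlonglongrightarrow> 0" for j
  proof -
    have "(\<lambda>n. LINT x|wmeas. (A j n x - a j x)\<^sup>2) \<longlonglongrightarrow> (LINT x|(wmeas::'a measure). 0)"
    proof (rule integral_dominated_convergence[where w="\<lambda>x. 4 * (D / measure lborel (ball (0::'a) (e j)))"])
      show "AE x in wmeas. (\<lambda>n. (A j n x - a j x)\<^sup>2) \<longlonglongrightarrow> 0"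
      proof (rule AE_I2)
        fix x
        have "(\<lambda>n. (A j n x - a j x)\<^sup>2) \<longlonglongrightarrow> (a j x - a j x)\<^sup>2" by (intro tendsto_intros lim)
        then show "(\<lambda>n. (A j n x - a j x)\<^sup>2) \<longlonglongrightarrow> 0" by simp
      qed
    qed (use dbound in auto)
    then show ?thesis by simp
  qed
  have uA: "integrable wmeas (\<lambda>x. (un (r n) x - A j n x)\<^sup>2)" "(LINT x|wmeas. (un (r n) x - A j n x)\<^sup>2) \<le> 2 * (D * (e j)\<^sup>2)" for j n
  proof -
    note E = bavg_L2_error[OF tb e, of "r n" j]
    show "integrable wmeas (\<lambda>x. (un (r n) x - A j n x)\<^sup>2)" unfolding A_def by (rule wmeas_le[OF E(1)]) simp
    show "(LINT x|wmeas. (un (r n) x - A j n x)\<^sup>2) \<le> 2 * (D * (e j)\<^sup>2)"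
      using wmeas_le(2)[OF E(1)] E(2) unfolding A_def by simp
  qed
  have uL: "L2 wmeas (un (r n))" for n by (rule L2_wmeas[OF tr_bound_L2[OF tb]])
  have est: "(LINT x|wmeas. (un (r m) x - un (r n) x)\<^sup>2) \<le> 16 * D * (e j)\<^sup>2 + 4 * (LINT x|wmeas. (A j m x - a j x)\<^sup>2) + 4 * (LINT x|wmeas. (A j n x - a j x)\<^sup>2)" for j m n
  proof -
    have pt: "(p - q)\<^sup>2 \<le> 4 * (p - b)\<^sup>2 + 4 * (q - c)\<^sup>2 + 4 * (b - d)\<^sup>2 + 4 * (c - d)\<^sup>2" for p q b c d :: real
    proof -
      have "(w + x + y + z)\<^sup>2 \<le> 4 * w\<^sup>2 + 4 * x\<^sup>2 + 4 * y\<^sup>2 + 4 * z\<^sup>2" for w x y z :: real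
      proof -
        have "0 \<le> (w - x)\<^sup>2 + (w - y)\<^sup>2 + (w - z)\<^sup>2 + (x - y)\<^sup>2 + (x - z)\<^sup>2 + (y - z)\<^sup>2" by simp
        then show ?thesis by (simp add: power2_eq_square algebra_simps)
      qed
      from this[of "p - b" "c - q" "b - d" "d - c"] show ?thesis by (simp add: power2_commute)
    qed
    have "(LINT x|wmeas. (un (r m) x - un (r n) x)\<^sup>2) \<le> (LINT x|wmeas. 4 * (un (r m) x - A j m x)\<^sup>2 + 4 * (un (r n) x - A j n x)\<^sup>2 + 4 * (A j m x - a j x)\<^sup>2 + 4 * (A j n x - a j x)\<^sup>2)"
      using L2_square_integrable[OF L2_diff[OF uL uL]] uA di by (intro integral_mono pt) auto
    also have "\<dots> = 4 * (LINT x|wmeas. (un (r m) x - A j m x)\<^sup>2) + 4 * (LINT x|wmeas. (un (r n) x - A j n x)\<^sup>2) + 4 * (LINT x|wmeas. (A j m x - a j x)\<^sup>2) + 4 * (LINT x|wmeas. (A j n x - a j x)\<^sup>2)"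
      using uA di by simp
    finally show ?thesis using uA(2)[of m j] uA(2)[of n j] by simp
  qed
  obtain u s where u: "L2 wmeas u" and ul: "(\<lambda>n. LINT x|wmeas. (norm (un (r n) x - u x))\<^sup>2) \<longlonglongrightarrow> 0"
    and s: "strict_mono (s::nat\<Rightarrow>nat)" and sA: "AE x in wmeas. (\<lambda>k. un (r (s k)) x) \<longlonglongrightarrow> u x"
  proof (rule L2_complete[where f="\<lambda>n. un (r n)" and M=wmeas])
    fix \<epsilon> :: real assume eps: "\<epsilon> > 0"
    have "(\<lambda>j. 16 * D * (e j)\<^sup>2) \<longlonglongrightarrow> 0" unfolding e_def by real_asymp
    moreover have "\<epsilon> / 3 > 0" using eps by simp
    ultimately obtain j where j: "16 * D * (e j)\<^sup>2 < \<epsilon> / 3"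
      using order_tendstoD(2) eventually_sequentially by (metis (no_types, lifting) order_refl)
    have "\<epsilon> / 12 > 0" using eps by simp
    from order_tendstoD(2)[OF dlim[of j] this] obtain M where M: "\<And>n. n \<ge> M \<Longrightarrow> (LINT x|wmeas. (A j n x - a j x)\<^sup>2) < \<epsilon> / 12"
      unfolding eventually_sequentially by blast
    show "\<exists>M. \<forall>m\<ge>M. \<forall>n\<ge>M. (LINT x|wmeas. (norm (un (r m) x - un (r n) x))\<^sup>2) < \<epsilon>"
    proof (intro exI allI impI)
      fix m n assume "m \<ge> M" "n \<ge> M"
      then have "(LINT x|wmeas. (un (r m) x - un (r n) x)\<^sup>2) < \<epsilon>"
        using est[of m n j] j M[of m] M[of n] by linarith
      then show "(LINT x|wmeas. (norm (un (r m) x - un (r n) x))\<^sup>2) < \<epsilon>" by simp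
    qed
  qed (use uL that in blast)+
  show ?thesis
  proof (rule that[of "r \<circ> s" u])
    show "strict_mono (r \<circ> s)" by (rule strict_mono_o[OF r s])
    show "L2 wmeas u" by (rule u)
    show "(\<lambda>n. LINT x|wmeas. (un ((r \<circ> s) n) x - u x)\<^sup>2) \<longlonglongrightarrow> 0"
      using LIMSEQ_subseq_LIMSEQ[OF ul s] by (simp add: o_def)
    show "AE x in lborel. (\<lambda>n. un ((r \<circ> s) n) x) \<longlonglongrightarrow> u x" using sA by (simp add: AE_wmeas)
  qed
qed

section \<open>The Brezis-Lieb splitting\<close>

lemma powr_add_le:
  fixes a b :: real
  assumes "0 \<le> q"
  shows "\<bar>a + b\<bar> powr q \<le> 2 powr q * (\<bar>a\<bar> powr q + \<bar>b\<bar> powr q)"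
proof -
  define m where "m = max \<bar>a\<bar> \<bar>b\<bar>"
  have "\<bar>a + b\<bar> \<le> 2 * m" unfolding m_def by linarith
  then have "\<bar>a + b\<bar> powr q \<le> (2 * m) powr q" using assms by (intro powr_mono2) auto
  also have "\<dots> = 2 powr q * m powr q" by (simp add: powr_mult m_def)
  also have "m powr q \<le> \<bar>a\<bar> powr q + \<bar>b\<bar> powr q" by (auto simp: m_def max_def)
  finally show ?thesis by (simp add: mult_left_mono)
qed

lemma square_add_le: "(a + b)\<^sup>2 \<le> 2 * a\<^sup>2 + 2 * b\<^sup>2" for a b :: real
  using zero_le_power2[of "a - b"] by (simp add: power2_eq_square algebra_simps)

text \<open>As h is only continuous, smallness is extracted by cases. For b away from zero
  everything is absorbed into b^2; for small b either a and a + b both lie where |h| is dominated by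
  a small multiple of s^2 + |s|^q, or a lies in a compact set away from zero and uniform continuity
  applies.\<close>

lemma Brezis_Lieb_pointwise:
  fixes h :: "real \<Rightarrow> real"
  assumes hc: "continuous_on UNIV h" and pq: "2 < p" "p < q"
    and hb: "\<And>e. e > 0 \<Longrightarrow> \<exists>C\<ge>0. \<forall>s. \<bar>h s\<bar> \<le> e * s\<^sup>2 + C * \<bar>s\<bar> powr p"
    and e: "e > 0"
  obtains C where "C \<ge> 0" "\<And>a b. \<bar>h (a + b) - h a\<bar> \<le> e * (a\<^sup>2 + \<bar>a\<bar> powr q) + C * (b\<^sup>2 + \<bar>b\<bar> powr q)"
proof -
  \<comment> \<open>Covers the constants arising when the terms at a and at a + b are split: 1 + 2
    for the squares, 1 + 2^q for the powers.\<close>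
  define K where "K = 3 + 2 powr q"
  have K: "K \<ge> 3" by (simp add: K_def)
  define \<eta> where "\<eta> = e / K"
  have eta: "\<eta> > 0" using e K by (simp add: \<eta>_def)
  obtain C where C0: "C \<ge> 0" and C: "\<And>s. \<bar>h s\<bar> \<le> \<eta> / 2 * s\<^sup>2 + C * \<bar>s\<bar> powr p"
    using hb[of "\<eta> / 2"] eta by auto
  define t where "t = \<eta> / (2 * (C + 1))"
  have t: "t > 0" "C * t \<le> \<eta> / 2" using eta C0 by (auto simp: t_def field_simps)
  \<comment> \<open>Thresholds at which |s|^p is at most t s^2 (below \<delta>) and at most t |s|^q
    (above \<open>R\<close>).\<close>
  define \<delta> where "\<delta> = t powr (1 / (p - 2))"
  define R where "R = (1 / t) powr (1 / (q - p))"
  have d: "\<delta> > 0" "\<delta> powr (p - 2) = t" using t pq by (auto simp: \<delta>_def powr_powr)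
  have R: "R > 0" "R powr (q - p) = 1 / t" using t pq by (auto simp: R_def powr_powr)
  have good: "\<bar>h s\<bar> \<le> \<eta> * (s\<^sup>2 + \<bar>s\<bar> powr q)" if "\<bar>s\<bar> \<le> \<delta> \<or> \<bar>s\<bar> \<ge> R" for s
  proof -
    have "C * \<bar>s\<bar> powr p \<le> \<eta> / 2 * (s\<^sup>2 + \<bar>s\<bar> powr q)"
    proof (cases "s = 0")
      case False
      from that show ?thesis
      proof
        assume s: "\<bar>s\<bar> \<le> \<delta>"
        have "\<bar>s\<bar> powr p = \<bar>s\<bar> powr (p - 2) * \<bar>s\<bar> powr 2" by (simp add: powr_add[symmetric] del: powr_numeral)
        also have "\<dots> \<le> t * \<bar>s\<bar> powr 2" unfolding d(2)[symmetric] using s pq by (intro mult_right_mono powr_mono2) auto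
        also have "\<bar>s\<bar> powr 2 = s\<^sup>2" by (rule abs_powr_2)
        finally have "C * \<bar>s\<bar> powr p \<le> C * t * s\<^sup>2" using C0 by (simp add: mult_left_mono mult.assoc)
        also have "\<dots> \<le> \<eta> / 2 * s\<^sup>2" by (intro mult_right_mono t) simp
        also have "\<dots> \<le> \<eta> / 2 * (s\<^sup>2 + \<bar>s\<bar> powr q)" using eta by (intro mult_left_mono) auto
        finally show ?thesis .
      next
        assume s: "\<bar>s\<bar> \<ge> R"
        have "\<bar>s\<bar> powr p * (1 / t) \<le> \<bar>s\<bar> powr p * \<bar>s\<bar> powr (q - p)"
          unfolding R(2)[symmetric] using s pq R by (intro mult_left_mono powr_mono2) auto
        also have "\<dots> = \<bar>s\<bar> powr q" by (simp add: powr_add[symmetric])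
        finally have "\<bar>s\<bar> powr p \<le> t * \<bar>s\<bar> powr q" using t by (simp add: field_simps)
        then have "C * \<bar>s\<bar> powr p \<le> C * t * \<bar>s\<bar> powr q" using C0 by (simp add: mult_left_mono mult.assoc)
        also have "\<dots> \<le> \<eta> / 2 * \<bar>s\<bar> powr q" by (intro mult_right_mono t) simp
        also have "\<dots> \<le> \<eta> / 2 * (s\<^sup>2 + \<bar>s\<bar> powr q)" using eta by (intro mult_left_mono) auto
        finally show ?thesis .
      qed
    qed (use eta in simp)
    moreover have "\<eta> / 2 * s\<^sup>2 \<le> \<eta> / 2 * (s\<^sup>2 + \<bar>s\<bar> powr q)" using eta by (intro mult_left_mono) auto
    ultimately have "\<bar>h s\<bar> \<le> \<eta> / 2 * (s\<^sup>2 + \<bar>s\<bar> powr q) + \<eta> / 2 * (s\<^sup>2 + \<bar>s\<bar> powr q)" using C[of s] by linarith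
    then show ?thesis by (simp add: field_simps)
  qed
  have "compact (h ` {- R..R})" by (intro compact_continuous_image continuous_on_subset[OF hc]) auto
  then have "bounded (h ` {- R..R})" by (rule compact_imp_bounded)
  then obtain M where "\<forall>y\<in>h ` {- R..R}. norm y \<le> M" unfolding bounded_iff by blast
  then have M: "\<bar>h s\<bar> \<le> M" if "s \<in> {- R..R}" for s using that by auto
  have M0: "M \<ge> 0" using M[of 0] R by auto
  have all: "\<bar>h s\<bar> \<le> \<eta> * (s\<^sup>2 + \<bar>s\<bar> powr q) + M" for s
  proof (cases "\<bar>s\<bar> \<le> R")
    case True
    then have "\<bar>h s\<bar> \<le> M" by (intro M) auto
    moreover have "0 \<le> \<eta> * (s\<^sup>2 + \<bar>s\<bar> powr q)" using eta by simp
    ultimately show ?thesis by linarith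
  next
    case False
    then show ?thesis using good[of s] M0 by simp
  qed
  have sum: "\<eta> * (a\<^sup>2 + \<bar>a\<bar> powr q) + \<eta> * ((a + b)\<^sup>2 + \<bar>a + b\<bar> powr q) \<le> e * (a\<^sup>2 + \<bar>a\<bar> powr q) + e * (b\<^sup>2 + \<bar>b\<bar> powr q)" for a b
  proof -
    have "(a + b)\<^sup>2 + \<bar>a + b\<bar> powr q \<le> (2 * a\<^sup>2 + 2 * b\<^sup>2) + 2 powr q * (\<bar>a\<bar> powr q + \<bar>b\<bar> powr q)"
      using pq by (intro add_mono square_add_le powr_add_le) auto
    moreover have "2 powr q * a\<^sup>2 \<ge> 0" "2 powr q * b\<^sup>2 \<ge> 0" "\<bar>a\<bar> powr q \<ge> 0" "\<bar>b\<bar> powr q \<ge> 0" "a\<^sup>2 \<ge> 0" "b\<^sup>2 \<ge> 0" by auto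
    ultimately have "(a\<^sup>2 + \<bar>a\<bar> powr q) + ((a + b)\<^sup>2 + \<bar>a + b\<bar> powr q) \<le> K * (a\<^sup>2 + \<bar>a\<bar> powr q) + K * (b\<^sup>2 + \<bar>b\<bar> powr q)"
      unfolding K_def distrib_right distrib_left by linarith
    then have "\<eta> * ((a\<^sup>2 + \<bar>a\<bar> powr q) + ((a + b)\<^sup>2 + \<bar>a + b\<bar> powr q)) \<le> \<eta> * (K * (a\<^sup>2 + \<bar>a\<bar> powr q) + K * (b\<^sup>2 + \<bar>b\<bar> powr q))"
      using eta by (intro mult_left_mono) auto
    moreover have "\<eta> * K = e" using K by (simp add: \<eta>_def)
    ultimately show ?thesis by (simp add: distrib_left mult.assoc[symmetric])
  qed
  have "uniformly_continuous_on {- (R + 2)..R + 2} h"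
    by (intro compact_uniformly_continuous continuous_on_subset[OF hc]) auto
  moreover have "\<eta> * (\<delta> / 2)\<^sup>2 > 0" using eta d by simp
  ultimately obtain \<theta>' where th': "\<theta>' > 0" "\<And>x y. x \<in> {- (R + 2)..R + 2} \<Longrightarrow> y \<in> {- (R + 2)..R + 2} \<Longrightarrow> dist y x < \<theta>' \<Longrightarrow> dist (h y) (h x) < \<eta> * (\<delta> / 2)\<^sup>2"
    unfolding uniformly_continuous_on_def by meson
  define \<theta> where "\<theta> = min \<theta>' (min 1 (\<delta> / 2))"
  have th: "\<theta> > 0" "\<theta> \<le> \<theta>'" "\<theta> \<le> 1" "\<theta> \<le> \<delta> / 2" using th'(1) d by (auto simp: \<theta>_def)
  \<comment> \<open>For |b| \<ge> \<theta> the constant M, which occurs once for a and once for a +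
    b, is at most the corresponding multiple of b^2.\<close>
  define C1 where "C1 = e + 2 * M / \<theta>\<^sup>2"
  have C1: "C1 \<ge> e" using M0 by (simp add: C1_def)
  show ?thesis
  proof (rule that[of C1])
    show "C1 \<ge> 0" using C1 e by simp
    fix a b :: real
    have nn: "0 \<le> b\<^sup>2 + \<bar>b\<bar> powr q" "0 \<le> a\<^sup>2 + \<bar>a\<bar> powr q" by auto
    have Cb: "e * (b\<^sup>2 + \<bar>b\<bar> powr q) \<le> C1 * (b\<^sup>2 + \<bar>b\<bar> powr q)" by (rule mult_right_mono[OF C1 nn(1)])
    have tri: "\<bar>h (a + b) - h a\<bar> \<le> \<bar>h a\<bar> + \<bar>h (a + b)\<bar>" by linarith
    show "\<bar>h (a + b) - h a\<bar> \<le> e * (a\<^sup>2 + \<bar>a\<bar> powr q) + C1 * (b\<^sup>2 + \<bar>b\<bar> powr q)"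
    proof (cases "\<bar>b\<bar> \<ge> \<theta>")
      case True
      have "\<theta>\<^sup>2 \<le> b\<^sup>2" using True th(1) power_mono[of \<theta> "\<bar>b\<bar>" 2] by simp
      then have "2 * M \<le> 2 * M / \<theta>\<^sup>2 * b\<^sup>2" using M0 th(1) by (simp add: field_simps mult_left_mono)
      also have "\<dots> \<le> 2 * M / \<theta>\<^sup>2 * (b\<^sup>2 + \<bar>b\<bar> powr q)" using M0 by (intro mult_left_mono) auto
      finally have "2 * M + e * (b\<^sup>2 + \<bar>b\<bar> powr q) \<le> C1 * (b\<^sup>2 + \<bar>b\<bar> powr q)" by (simp add: C1_def distrib_right)
      then show ?thesis using all[of a] all[of "a + b"] sum[of a b] tri by linarith
    next
      case False
      consider "\<bar>a\<bar> < \<delta> / 2 \<or> \<bar>a\<bar> > R + 1" | "\<delta> / 2 \<le> \<bar>a\<bar>" "\<bar>a\<bar> \<le> R + 1" by linarith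
      then show ?thesis
      proof cases
        case 1
        then have "\<bar>a\<bar> \<le> \<delta> \<or> \<bar>a\<bar> \<ge> R" "\<bar>a + b\<bar> \<le> \<delta> \<or> \<bar>a + b\<bar> \<ge> R" using False th d by auto
        then show ?thesis using good[of a] good[of "a + b"] sum[of a b] tri Cb by linarith
      next
        case 2
        have "dist (h (a + b)) (h a) < \<eta> * (\<delta> / 2)\<^sup>2"
          using 2 False th by (intro th') (auto simp: dist_real_def)
        also have "\<eta> * (\<delta> / 2)\<^sup>2 \<le> \<eta> * a\<^sup>2" using 2(1) eta d power_mono[of "\<delta> / 2" "\<bar>a\<bar>" 2] by (intro mult_left_mono) auto
        also have "\<dots> \<le> e * (a\<^sup>2 + \<bar>a\<bar> powr q)"
        proof (intro mult_mono)
          show "\<eta> \<le> e" using K e by (simp add: \<eta>_def field_simps)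
        qed (use e in auto)
        finally have "\<bar>h (a + b) - h a\<bar> \<le> e * (a\<^sup>2 + \<bar>a\<bar> powr q)" by (simp add: dist_real_def)
        moreover have "0 \<le> C1 * (b\<^sup>2 + \<bar>b\<bar> powr q)" using C1 e by simp
        ultimately show ?thesis by linarith
      qed
    qed
  qed
qed

text \<open>The pointwise inequality is used with a = un - u, bounded in L^2 and L^q, and b = u, a
  fixed function. The error beyond a small multiple of the a-terms has an integrable majorant
  independent of n, so dominated convergence applies to that excess only.\<close>

theorem Brezis_Lieb:
  fixes h :: "real \<Rightarrow> real" and u :: "'a \<Rightarrow> real"
  assumes hc: "continuous_on UNIV h" and pq: "2 < p" "p < q"
    and hb: "\<And>e. e > 0 \<Longrightarrow> \<exists>C\<ge>0. \<forall>s. \<bar>h s\<bar> \<le> e * s\<^sup>2 + C * \<bar>s\<bar> powr p"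
    and um[measurable]: "u \<in> borel_measurable M" "\<And>n. un n \<in> borel_measurable M"
    and lim: "AE x in M. (\<lambda>n. un n x) \<longlonglongrightarrow> u x"
    and v2: "\<And>n. integrable M (\<lambda>x. (un n x - u x)\<^sup>2)" "\<And>n. (LINT x|M. (un n x - u x)\<^sup>2) \<le> K"
    and vq: "\<And>n. integrable M (\<lambda>x. \<bar>un n x - u x\<bar> powr q)" "\<And>n. (LINT x|M. \<bar>un n x - u x\<bar> powr q) \<le> K"
    and u2: "integrable M (\<lambda>x. (u x)\<^sup>2)" and uq: "integrable M (\<lambda>x. \<bar>u x\<bar> powr q)"
    and hi: "\<And>n. integrable M (\<lambda>x. h (un n x))" "\<And>n. integrable M (\<lambda>x. h (un n x - u x))" "integrable M (\<lambda>x. h (u x))"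
  shows "(\<lambda>n. (LINT x|M. h (un n x)) - (LINT x|M. h (un n x - u x))) \<longlonglongrightarrow> (LINT x|M. h (u x))"
proof -
  have hm[measurable]: "h \<in> borel_measurable borel" by (rule borel_measurable_continuous_onI[OF hc])
  have h0: "h 0 = 0"
  proof -
    obtain C where "\<forall>s. \<bar>h s\<bar> \<le> 1 * s\<^sup>2 + C * \<bar>s\<bar> powr p" using hb[of 1] by auto
    from this[rule_format, of 0] show ?thesis by simp
  qed
  define Rn where "Rn n x = \<bar>h (un n x) - h (un n x - u x) - h (u x)\<bar>" for n x
  have Rm[measurable]: "Rn n \<in> borel_measurable M" for n unfolding Rn_def[abs_def] by measurable
  have Ri: "integrable M (Rn n)" for n unfolding Rn_def[abs_def] using hi by auto
  have K0: "0 \<le> K"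
  proof -
    have "0 \<le> (LINT x|M. (un 0 x - u x)\<^sup>2)" by simp
    then show ?thesis using v2(2)[of 0] by linarith
  qed
  have "(\<lambda>n. LINT x|M. Rn n x) \<longlonglongrightarrow> 0"
  proof (rule LIMSEQ_I)
    fix r :: real assume r: "r > 0"
    define e where "e = r / (2 * (2 * K + 1))"
    have e: "e > 0" using r K0 by (simp add: e_def)
    have eK: "e * (2 * K) < r / 2"
    proof -
      have "e * (2 * K) < e * (2 * K + 1)" using e by simp
      also have "\<dots> = r / 2" using K0 by (simp add: e_def field_simps)
      finally show ?thesis .
    qed
    obtain C where C0: "C \<ge> 0" and C: "\<And>a b. \<bar>h (a + b) - h a\<bar> \<le> e * (a\<^sup>2 + \<bar>a\<bar> powr q) + C * (b\<^sup>2 + \<bar>b\<bar> powr q)"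
      by (rule Brezis_Lieb_pointwise[OF hc pq hb e]) (assumption | rule that)+
    define z where "z n x = e * ((un n x - u x)\<^sup>2 + \<bar>un n x - u x\<bar> powr q)" for n x
    have zi: "integrable M (z n)" for n unfolding z_def[abs_def] using v2 vq by auto
    \<comment> \<open>The part of the defect not covered by \<open>z n\<close>; the integral of
      \<open>z n\<close> is at most 2 e K, which the choice of e puts below r/2.\<close>
    define W where "W n x = max 0 (Rn n x - z n x)" for n x
    have Wi: "integrable M (W n)" for n unfolding W_def[abs_def] using Ri zi by auto
    have "(\<lambda>n. LINT x|M. W n x) \<longlonglongrightarrow> (LINT x|M. 0)"
    proof (rule integral_dominated_convergence[where w="\<lambda>x. C * ((u x)\<^sup>2 + \<bar>u x\<bar> powr q) + \<bar>h (u x)\<bar>"])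
      show "integrable M (\<lambda>x. C * ((u x)\<^sup>2 + \<bar>u x\<bar> powr q) + \<bar>h (u x)\<bar>)" using u2 uq hi by auto
      show "W n \<in> borel_measurable M" for n using Wi by auto
      show "AE x in M. (\<lambda>n. W n x) \<longlonglongrightarrow> 0"
        using lim
      proof eventually_elim
        case (elim x)
        have iso: "isCont h y" for y using hc by (simp add: continuous_on_eq_continuous_at)
        have v0: "(\<lambda>n. un n x - u x) \<longlonglongrightarrow> 0" using tendsto_diff[OF elim tendsto_const[of "u x"]] by simp
        have "(\<lambda>n. Rn n x) \<longlonglongrightarrow> \<bar>h (u x) - h 0 - h (u x)\<bar>"
          unfolding Rn_def by (intro tendsto_intros isCont_tendsto_compose[OF iso] elim v0)
        moreover have "(\<lambda>n. z n x) \<longlonglongrightarrow> e * (0\<^sup>2 + \<bar>0\<bar> powr q)"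
          unfolding z_def using pq by (intro tendsto_intros v0 tendsto_powr2) auto
        ultimately have "(\<lambda>n. W n x) \<longlonglongrightarrow> max 0 (\<bar>h (u x) - h 0 - h (u x)\<bar> - e * (0\<^sup>2 + \<bar>0\<bar> powr q))"
          unfolding W_def by (intro tendsto_intros)
        then show ?case by (simp add: h0)
      qed
      show "AE x in M. norm (W n x) \<le> C * ((u x)\<^sup>2 + \<bar>u x\<bar> powr q) + \<bar>h (u x)\<bar>" for n
      proof (rule AE_I2)
        fix x
        have "Rn n x \<le> \<bar>h ((un n x - u x) + u x) - h (un n x - u x)\<bar> + \<bar>h (u x)\<bar>" unfolding Rn_def by simp
        also have "\<dots> \<le> z n x + C * ((u x)\<^sup>2 + \<bar>u x\<bar> powr q) + \<bar>h (u x)\<bar>" unfolding z_def by (intro add_right_mono C)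
        finally have "Rn n x - z n x \<le> C * ((u x)\<^sup>2 + \<bar>u x\<bar> powr q) + \<bar>h (u x)\<bar>" by linarith
        moreover have "0 \<le> C * ((u x)\<^sup>2 + \<bar>u x\<bar> powr q) + \<bar>h (u x)\<bar>" using C0 by simp
        ultimately show "norm (W n x) \<le> C * ((u x)\<^sup>2 + \<bar>u x\<bar> powr q) + \<bar>h (u x)\<bar>" by (simp add: W_def)
      qed
    qed auto
    then have Wl: "(\<lambda>n. LINT x|M. W n x) \<longlonglongrightarrow> 0" by simp
    from order_tendstoD(2)[OF Wl half_gt_zero[OF r]] obtain N where N: "\<And>n. n \<ge> N \<Longrightarrow> (LINT x|M. W n x) < r / 2"
      unfolding eventually_sequentially by blast
    show "\<exists>no. \<forall>n\<ge>no. norm ((LINT x|M. Rn n x) - 0) < r"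
    proof (intro exI allI impI)
      fix n assume n: "n \<ge> N"
      have "(LINT x|M. Rn n x) \<le> (LINT x|M. W n x + z n x)"
        using Ri Wi zi by (intro integral_mono) (auto simp: W_def)
      also have "\<dots> = (LINT x|M. W n x) + e * ((LINT x|M. (un n x - u x)\<^sup>2) + (LINT x|M. \<bar>un n x - u x\<bar> powr q))"
        using Wi zi v2 vq by (simp add: z_def)
      also have "e * ((LINT x|M. (un n x - u x)\<^sup>2) + (LINT x|M. \<bar>un n x - u x\<bar> powr q)) \<le> e * (2 * K)"
        using v2(2)[of n] vq(2)[of n] e by (intro mult_left_mono) auto
      finally have "(LINT x|M. Rn n x) < r" using N[OF n] eK by linarith
      moreover have "0 \<le> (LINT x|M. Rn n x)" by (intro integral_nonneg_AE) (simp add: Rn_def)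
      ultimately show "norm ((LINT x|M. Rn n x) - 0) < r" by simp
    qed
  qed
  moreover have "\<bar>(LINT x|M. h (un n x)) - (LINT x|M. h (un n x - u x)) - (LINT x|M. h (u x))\<bar> \<le> (LINT x|M. Rn n x)" for n
  proof -
    have "(LINT x|M. h (un n x)) - (LINT x|M. h (un n x - u x)) - (LINT x|M. h (u x)) = (LINT x|M. h (un n x) - h (un n x - u x) - h (u x))"
      using hi by simp
    also have "\<bar>\<dots>\<bar> \<le> (LINT x|M. Rn n x)" unfolding Rn_def by (rule integral_abs_bound)
    finally show ?thesis .
  qed
  ultimately have "(\<lambda>n. (LINT x|M. h (un n x)) - (LINT x|M. h (un n x - u x)) - (LINT x|M. h (u x))) \<longlonglongrightarrow> 0"
    by (rule_tac Lim_null_comparison[of _ "\<lambda>n. LINT x|M. Rn n x"]) simp_all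
  then show ?thesis by (rule LIM_zero_cancel)
qed

subsection \<open>The nonlinearity\<close>

locale nonlinearity =
  fixes f :: "real \<Rightarrow> real" and C0 p :: real
  assumes f_cont: "continuous_on UNIV f"
    and p_gt: "2 < p"
    and f_growth: "\<And>s. \<bar>f s\<bar> \<le> C0 * (1 + \<bar>s\<bar> powr (p - 1))"
    and f_small: "((\<lambda>s. f s / s) \<longlongrightarrow> 0) (at 0)"
    and F_superquadratic: "filterlim (\<lambda>s. prim f s / s\<^sup>2) at_top at_infinity"
    and f_mono_pos: "strict_mono_on {0<..} (\<lambda>s. f s / \<bar>s\<bar>)"
    and f_mono_neg: "strict_mono_on {..<0} (\<lambda>s. f s / \<bar>s\<bar>)"
begin

text \<open>The energy density on the Nehari set, where half the quadratic form equals half the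
  integral of f(u) u.\<close>

definition H :: "real \<Rightarrow> real" where "H s = f s * s / 2 - prim f s"

lemma f_isCont: "isCont f s"
  using f_cont by (simp add: continuous_on_eq_continuous_at)

lemma f_0: "f 0 = 0"
proof -
  have "((\<lambda>s. f s / s * s) \<longlongrightarrow> 0 * 0) (at 0)" by (intro tendsto_intros f_small)
  moreover have "\<forall>\<^sub>F s in at 0. f s / s * s = f s" by (auto simp: eventually_at_filter)
  ultimately have "(f \<longlongrightarrow> 0) (at 0)" using tendsto_cong by fastforce
  moreover have "(f \<longlongrightarrow> f 0) (at 0)" using f_isCont[of 0] by (simp add: isCont_def)
  ultimately show ?thesis using tendsto_unique[OF trivial_limit_at] by blast
qed

lemma prim_0: "prim f 0 = 0"
  by (simp add: prim_def zero_ereal_def[symmetric])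

lemma prim_deriv: "(prim f has_real_derivative f s) (at s)"
proof -
  define a where "a = \<bar>s\<bar> + 1"
  have "((\<lambda>u. LBINT y=0..u. f y) has_vector_derivative f s) (at s within {-a..a})"
    by (rule interval_integral_FTC2[of "-a" 0 a f s, unfolded zero_ereal_def[symmetric]])
      (auto simp: a_def intro: continuous_on_subset[OF f_cont])
  then have "(prim f has_real_derivative f s) (at s within {-a..a})"
    by (simp add: has_real_derivative_iff_has_vector_derivative prim_def[abs_def])
  moreover have "at s within {-a..a} = at s"
    by (intro at_within_interior) (auto simp: a_def interior_atLeastAtMost_real)
  ultimately show ?thesis by simp
qed

lemma prim_cont: "continuous_on UNIV (prim f)"
  using prim_deriv by (meson DERIV_continuous_on has_field_derivative_at_within)

lemma H_cont: "continuous_on UNIV H"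
  unfolding H_def by (intro continuous_intros f_cont prim_cont) simp

text \<open>On the negative axis f(s)/|s| increases with s while |s| decreases; passing to f(s)/s
  reverses the sign, so on both half-lines the quotient increases with the distance from 0.\<close>

lemma quotient_mono:
  assumes "a \<noteq> 0" "0 < r" "r < s"
  shows "f (r * a) / (r * a) < f (s * a) / (s * a)"
proof (cases "a > 0")
  case True
  then have "f (r * a) / \<bar>r * a\<bar> < f (s * a) / \<bar>s * a\<bar>"
    using assms by (intro strict_mono_onD[OF f_mono_pos]) auto
  then show ?thesis using True assms by simp
next
  case False
  then have a: "a < 0" using assms by simp
  then have "f (s * a) / \<bar>s * a\<bar> < f (r * a) / \<bar>r * a\<bar>"
    using assms by (intro strict_mono_onD[OF f_mono_neg]) (auto simp: mult_pos_neg)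
  moreover have "\<bar>s * a\<bar> = - (s * a)" "\<bar>r * a\<bar> = - (r * a)" using a assms by (auto simp: abs_of_neg mult_pos_neg)
  ultimately show ?thesis by simp
qed

text \<open>By (F2) the quotient tends to 0 along the ray, so monotonicity makes it nonnegative at
  a/2 and strictness makes it positive at a.\<close>

lemma quotient_pos:
  assumes "a \<noteq> 0"
  shows "0 < f a / a"
proof -
  have "((\<lambda>r. f (r * a) / (r * a)) \<longlongrightarrow> 0) (at_right 0)"
  proof (rule filterlim_compose[OF f_small])
    show "filterlim (\<lambda>r. r * a) (at 0) (at_right 0)"
      unfolding filterlim_at
    proof
      show "\<forall>\<^sub>F r in at_right 0. r * a \<in> UNIV \<and> r * a \<noteq> 0"
        using eventually_at_right_less[of 0] by eventually_elim (use assms in auto)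
      have "((\<lambda>r. r * a) \<longlongrightarrow> 0 * a) (at_right 0)" by (intro tendsto_intros)
      then show "((\<lambda>r. r * a) \<longlongrightarrow> 0) (at_right 0)" by simp
    qed
  qed
  moreover have "\<forall>\<^sub>F r in at_right 0. f (r * a) / (r * a) \<le> f (1/2 * a) / (1/2 * a)"
  proof -
    have "\<forall>\<^sub>F r in at_right 0. r \<in> {0<..<1/2::real}" by (rule eventually_at_right_real) simp
    then show ?thesis by eventually_elim (rule less_imp_le[OF quotient_mono[OF assms]], auto)
  qed
  ultimately have "0 \<le> f (1/2 * a) / (1/2 * a)" by (intro tendsto_upperbound[of _ 0 "at_right 0"]) auto
  also have "\<dots> < f (1 * a) / (1 * a)" by (rule quotient_mono[OF assms]) auto
  finally show ?thesis by simp
qed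

lemma f_mult_pos: "a \<noteq> 0 \<Longrightarrow> 0 < f a * a"
  using quotient_pos[of a] by (simp add: zero_less_divide_iff zero_less_mult_iff)

lemma f_mult_nonneg: "0 \<le> f a * a"
  using f_mult_pos[of a] by (cases "a = 0") auto

lemma f_scaled_less:
  assumes "a \<noteq> 0" "0 < r" "r < s"
  shows "f (r * a) * a / r < f (s * a) * a / s"
proof -
  have eq: "f (t * a) * a / t = a\<^sup>2 * (f (t * a) / (t * a))" if "t > 0" for t
    using assms that by (simp add: power2_eq_square field_simps)
  have "a\<^sup>2 * (f (r * a) / (r * a)) < a\<^sup>2 * (f (s * a) / (s * a))"
    using assms by (intro mult_strict_left_mono quotient_mono) auto
  then show ?thesis using eq[of r] eq[of s] assms by linarith
qed

lemma f_scaled_le: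
  assumes "0 < r" "r \<le> s"
  shows "f (r * a) * a / r \<le> f (s * a) * a / s"
  using f_scaled_less[of a r s] assms by (cases "a = 0"; cases "r = s") auto

text \<open>The function k(t) = F(ta) - t^2/2 f(a) a has derivative t (f(ta) a/t - f(a) a), which by
  (F4) changes sign from minus to plus at t = 1; hence t = 1 is its minimum on t \<ge> 0. All ray
  comparisons come from this: \<open>prim_le\<close> at s = 0, the maximality of Nehari elements,
  and the monotonicity of \<open>H\<close>.\<close>

lemma prim_scaled_ge:
  assumes s: "0 \<le> s"
  shows "(s\<^sup>2 - 1) / 2 * (f a * a) \<le> prim f (s * a) - prim f a"
proof (cases "a = 0")
  case False
  define k where "k t = prim f (t * a) - t\<^sup>2 / 2 * (f a * a)" for t
  have kd: "(k has_real_derivative f (t * a) * a - t * (f a * a)) (at t)" for t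
    unfolding k_def by (auto intro!: derivative_eq_intros DERIV_chain2[OF prim_deriv])
  have kd_eq: "f (t * a) * a - t * (f a * a) = t * (f (t * a) * a / t - f (1 * a) * a / 1)" if "t > 0" for t
    using that by (simp add: field_simps)
  have "k 1 \<le> k s"
  proof (cases s "1::real" rule: linorder_cases)
    case less
    obtain z where z: "s < z" "z < 1" "k 1 - k s = (1 - s) * (f (z * a) * a - z * (f a * a))"
      using MVT2[OF less, of k "\<lambda>t. f (t * a) * a - t * (f a * a)"] kd by blast
    have "z > 0" using z s by simp
    have "f (z * a) * a - z * (f a * a) \<le> 0"
      unfolding kd_eq[OF \<open>z > 0\<close>] using f_scaled_le[of z 1 a] z \<open>z > 0\<close> by (intro mult_nonneg_nonpos) auto
    then show ?thesis using z(3) less by (smt (verit) mult_nonneg_nonpos)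
  next
    case greater
    obtain z where z: "1 < z" "z < s" "k s - k 1 = (s - 1) * (f (z * a) * a - z * (f a * a))"
      using MVT2[OF greater, of k "\<lambda>t. f (t * a) * a - t * (f a * a)"] kd by blast
    have "z > 0" using z by simp
    have "f (z * a) * a - z * (f a * a) \<ge> 0"
      unfolding kd_eq[OF \<open>z > 0\<close>] using f_scaled_le[of 1 z a] z by (intro mult_nonneg_nonneg) auto
    then show ?thesis using z(3) greater by (smt (verit) mult_nonneg_nonneg)
  qed simp
  then show ?thesis by (simp add: k_def field_simps)
qed (simp add: prim_0)

lemma prim_nonneg: "0 \<le> prim f a"
proof (cases a "0::real" rule: linorder_cases)
  case less
  obtain z where z: "a < z" "z < 0" "prim f 0 - prim f a = (0 - a) * f z" using MVT2[OF less] prim_deriv by blast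
  have "f z < 0" using f_mult_pos[of z] z by (simp add: zero_less_mult_iff)
  then have "(0 - a) * f z \<le> 0" using less by (intro mult_nonneg_nonpos) auto
  then show ?thesis using z prim_0 by simp
next
  case greater
  obtain z where z: "0 < z" "z < a" "prim f a - prim f 0 = (a - 0) * f z" using MVT2[OF greater] prim_deriv by blast
  have "f z > 0" using f_mult_pos[of z] z by (simp add: zero_less_mult_iff)
  then have "0 \<le> (a - 0) * f z" using greater by (intro mult_nonneg_nonneg) auto
  then show ?thesis using z prim_0 by simp
qed (simp add: prim_0)

lemma prim_le: "prim f a \<le> f a * a / 2"
  using prim_scaled_ge[of 0 a] prim_0 by simp

lemma H_nonneg: "0 \<le> H a"
  using prim_le[of a] by (simp add: H_def)

lemma H_le: "H a \<le> f a * a / 2"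
  using prim_nonneg[of a] by (simp add: H_def)

text \<open>\<open>prim_scaled_ge\<close> in terms of \<open>H\<close>. The extra summand is the
  gain along the ray: nonnegative for \<open>H_mono\<close>, and positive at s = 1/2 for
  \<open>H_pos\<close>.\<close>

lemma H_scaled:
  assumes "0 < s" "s \<le> 1"
  shows "H (s * a) + s\<^sup>2 / 2 * (f a * a - f (s * a) * a / s) \<le> H a"
proof -
  have "s\<^sup>2 / 2 * (f (s * a) * a / s) = f (s * a) * (s * a) / 2" using assms by (simp add: power2_eq_square)
  then show ?thesis using prim_scaled_ge[of s a] assms unfolding H_def by (simp add: algebra_simps diff_divide_distrib)
qed

lemma H_mono:
  assumes "0 < s" "s \<le> 1"
  shows "H (s * a) \<le> H a"
proof -
  have "0 \<le> s\<^sup>2 / 2 * (f a * a - f (s * a) * a / s)"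
    using f_scaled_le[of s 1 a] assms by (intro mult_nonneg_nonneg) auto
  then show ?thesis using H_scaled[OF assms, of a] by linarith
qed

lemma H_pos:
  assumes "a \<noteq> 0"
  shows "0 < H a"
proof -
  have "0 < (1/2)\<^sup>2 / 2 * (f a * a - f (1/2 * a) * a / (1/2))"
    using f_scaled_less[OF assms, of "1/2" 1] by (intro mult_pos_pos) auto
  then show ?thesis using H_scaled[of "1/2" a] H_nonneg[of "1/2 * a"] by linarith
qed

lemma f_bound:
  assumes e: "e > 0"
  obtains C where "C \<ge> 0" "\<And>s. \<bar>f s\<bar> \<le> e * \<bar>s\<bar> + C * \<bar>s\<bar> powr (p - 1)"
proof -
  have "\<forall>\<^sub>F s in at 0. \<bar>f s / s\<bar> < e"
    using order_tendstoD(2)[OF tendsto_rabs_zero[OF f_small] e] .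
  then obtain d where d: "d > 0" "\<And>s. s \<noteq> 0 \<Longrightarrow> \<bar>s\<bar> < d \<Longrightarrow> \<bar>f s / s\<bar> < e"
    by (auto simp: eventually_at dist_real_def)
  \<comment> \<open>For |s| \<ge> d the constant 1 in the growth condition is at most d^(1-p)
    |s|^(p-1).\<close>
  define C where "C = \<bar>C0\<bar> * (d powr (1 - p) + 1)"
  show ?thesis
  proof (rule that[of C])
    show "C \<ge> 0" by (simp add: C_def)
    fix s :: real
    show "\<bar>f s\<bar> \<le> e * \<bar>s\<bar> + C * \<bar>s\<bar> powr (p - 1)"
    proof (cases "\<bar>s\<bar> < d")
      case True
      have "\<bar>f s\<bar> \<le> e * \<bar>s\<bar>"
      proof (cases "s = 0")
        case False
        then show ?thesis using d(2)[of s] True by (simp add: abs_divide field_simps)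
      qed (simp add: f_0)
      moreover have "0 \<le> C * \<bar>s\<bar> powr (p - 1)" by (simp add: C_def)
      ultimately show ?thesis by linarith
    next
      case False
      have "d powr (p - 1) \<le> \<bar>s\<bar> powr (p - 1)" using False d p_gt by (intro powr_mono2) auto
      then have "1 \<le> d powr (1 - p) * \<bar>s\<bar> powr (p - 1)"
      proof -
        have "1 = d powr (1 - p) * d powr (p - 1)" using d by (simp add: powr_add[symmetric])
        also have "\<dots> \<le> d powr (1 - p) * \<bar>s\<bar> powr (p - 1)"
          using \<open>d powr (p - 1) \<le> \<bar>s\<bar> powr (p - 1)\<close> by (intro mult_left_mono) auto
        finally show ?thesis .
      qed
      then have "1 + \<bar>s\<bar> powr (p - 1) \<le> (d powr (1 - p) + 1) * \<bar>s\<bar> powr (p - 1)" by (simp add: distrib_right)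
      then have "\<bar>C0\<bar> * (1 + \<bar>s\<bar> powr (p - 1)) \<le> C * \<bar>s\<bar> powr (p - 1)"
        unfolding C_def mult.assoc by (intro mult_left_mono) auto
      moreover have "\<bar>f s\<bar> \<le> \<bar>C0\<bar> * (1 + \<bar>s\<bar> powr (p - 1))"
        using f_growth[of s] mult_right_mono[OF abs_ge_self[of C0], of "1 + \<bar>s\<bar> powr (p - 1)"] by (simp add: add_nonneg_nonneg)
      moreover have "0 \<le> e * \<bar>s\<bar>" using e by simp
      ultimately show ?thesis by linarith
    qed
  qed
qed

lemma f_mult_bound:
  assumes "e > 0"
  shows "\<exists>C\<ge>0. \<forall>s. f s * s \<le> e * s\<^sup>2 + C * \<bar>s\<bar> powr p"
proof -
  obtain C where C0: "C \<ge> 0" and C: "\<And>s. \<bar>f s\<bar> \<le> e * \<bar>s\<bar> + C * \<bar>s\<bar> powr (p - 1)"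
    by (rule f_bound[OF assms]) (assumption | rule that)+
  have "f s * s \<le> e * s\<^sup>2 + C * \<bar>s\<bar> powr p" for s
  proof -
    have "f s * s \<le> \<bar>f s\<bar> * \<bar>s\<bar>" by (simp add: abs_mult[symmetric])
    also have "\<dots> \<le> (e * \<bar>s\<bar> + C * \<bar>s\<bar> powr (p - 1)) * \<bar>s\<bar>" by (intro mult_right_mono C) simp
    also have "\<dots> = e * s\<^sup>2 + C * (\<bar>s\<bar> powr (p - 1) * \<bar>s\<bar>)" by (simp add: distrib_right mult.assoc power2_eq_square)
    also have "\<bar>s\<bar> powr (p - 1) * \<bar>s\<bar> = \<bar>s\<bar> powr p"
      by (cases "s = 0") (simp_all add: powr_diff)
    finally show ?thesis .
  qed
  then show ?thesis using C0 by blast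
qed

text \<open>(F3) in a form valid for all s: the failure near 0 is a constant, which can be
  integrated over any set of finite measure. The slope \<open>R\<close> is at the caller's
  disposal.\<close>

lemma prim_lower:
  assumes "R > 0"
  obtains s0 where "\<And>s. R * s\<^sup>2 - R * s0\<^sup>2 \<le> prim f s"
proof -
  have "\<forall>\<^sub>F s in at_infinity. R \<le> prim f s / s\<^sup>2"
    using F_superquadratic by (auto simp: filterlim_at_top)
  then obtain b where b: "\<And>s. norm s \<ge> b \<Longrightarrow> R \<le> prim f s / s\<^sup>2"
    by (auto simp: eventually_at_infinity)
  show ?thesis
  proof (rule that[of b])
    fix s
    show "R * s\<^sup>2 - R * b\<^sup>2 \<le> prim f s"
    proof (cases "\<bar>s\<bar> \<ge> b \<and> s \<noteq> 0")
      case True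
      then have "R * s\<^sup>2 \<le> prim f s" using b[of s] by (simp add: field_simps)
      moreover have "0 \<le> R * b\<^sup>2" using assms by simp
      ultimately show ?thesis by linarith
    next
      case False
      then have "s\<^sup>2 \<le> b\<^sup>2" by (cases "s = 0") (auto intro!: abs_le_square_iff[THEN iffD1])
      then have "R * s\<^sup>2 \<le> R * b\<^sup>2" using assms by (intro mult_left_mono) auto
      then show ?thesis using prim_nonneg[of s] by linarith
    qed
  qed
qed

end

subsection \<open>The space Y\<close>

text \<open>The map sending u to (grad u, u/|y|, sqrt(k) u). It is an isometry of Y into L^2, so
  Cauchy-Schwarz, linearity and completeness in Y reduce to vector-valued L^2.\<close>

definition Yvec :: "real \<Rightarrow> ((real^'k) \<times> (real^'m) \<Rightarrow> real) \<Rightarrow> (real^'k) \<times> (real^'m) \<Rightarrow> ((real^'k) \<times> (real^'m)) \<times> real \<times> real" where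
  "Yvec k u x = (grad u x, (u x / norm (fst x), sqrt k * u x))"

definition Yform :: "real \<Rightarrow> ((real^'k) \<times> (real^'m) \<Rightarrow> real) \<Rightarrow> ((real^'k) \<times> (real^'m) \<Rightarrow> real) \<Rightarrow> real" where
  "Yform k u v = (LINT x|lborel. Yvec k u x \<bullet> Yvec k v x)"

lemma T_inner:
  "0 \<le> k \<Longrightarrow> Yvec k u x \<bullet> Yvec k v x = grad u x \<bullet> grad v x + u x * v x / (norm (fst x))\<^sup>2 + k * u x * v x"
proof -
  assume k: "0 \<le> k"
  have "sqrt k * u x * (sqrt k * v x) = (sqrt k * sqrt k) * (u x * v x)" by (simp only: mult_ac)
  also have "sqrt k * sqrt k = k" using k by simp
  finally show ?thesis by (simp add: Yvec_def power2_eq_square mult.assoc)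
qed

lemma T_norm:
  "0 \<le> k \<Longrightarrow> (norm (Yvec k u x))\<^sup>2 = (norm (grad u x))\<^sup>2 + (u x)\<^sup>2 / (norm (fst x))\<^sup>2 + k * (u x)\<^sup>2"
  unfolding power2_norm_eq_inner[of "Yvec k u x"]
  by (simp add: T_inner power2_norm_eq_inner[of "grad u x"] power2_eq_square[of "u x"] mult.assoc)

lemma B_eq: "0 \<le> k \<Longrightarrow> Yform k u v = (LINT x|lborel. grad u x \<bullet> grad v x + u x * v x / (norm (fst x))\<^sup>2 + k * u x * v x)"
  by (simp add: Yform_def T_inner)

lemma quad_k_eq:
  assumes "0 \<le> k"
  shows "quad_k k u = Yform k u u"
proof -
  have "quad_k k u = (LINT x|lborel. (norm (Yvec k u x))\<^sup>2)" by (simp add: quad_k_def T_norm assms)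
  then show ?thesis unfolding Yform_def power2_norm_eq_inner .
qed

lemma Yspace_H1: "Yspace u \<Longrightarrow> H1 u"
  by (simp add: Yspace_def)

lemma Yspace_L2: "Yspace u \<Longrightarrow> L2 lborel u"
  by (simp add: Yspace_H1 H1_L2)

lemma Yspace_measurable: "Yspace u \<Longrightarrow> u \<in> borel_measurable borel"
  using Yspace_L2 by (auto simp: L2_def)

lemma norm_fst_measurable[measurable]:
  "(\<lambda>x::'a::euclidean_space \<times> 'b::euclidean_space. norm (fst x)) \<in> borel_measurable borel"
  by (intro borel_measurable_continuous_onI continuous_intros)

lemma T_measurable:
  assumes "H1 u"
  shows "Yvec k u \<in> borel_measurable lborel"
proof -
  have [measurable]: "u \<in> borel_measurable borel" "grad u \<in> borel_measurable borel"
    using H1_L2[OF assms] grad_L2[OF assms] by (auto simp: L2_def)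
  have [measurable]: "(\<lambda>x. u x / norm (fst x)) \<in> borel_measurable borel"
    by (rule borel_measurable_divide) measurable
  show ?thesis unfolding Yvec_def[abs_def] by (intro borel_measurable_Pair) (measurable; simp)+
qed

lemma Yspace_iff: "0 < k \<Longrightarrow> Yspace u \<longleftrightarrow> H1 u \<and> L2 lborel (Yvec k u)"
proof
  assume k: "0 < k" and u: "Yspace u"
  then have h: "H1 u" by (rule_tac Yspace_H1)
  have "integrable lborel (\<lambda>x. (norm (grad u x))\<^sup>2 + (u x)\<^sup>2 / (norm (fst x))\<^sup>2 + k * (u x)\<^sup>2)"
    using u h grad_L2[OF h] H1_L2[OF h] by (auto simp: Yspace_def L2_def)
  then show "H1 u \<and> L2 lborel (Yvec k u)" using h T_measurable[OF h] k by (simp add: L2_def T_norm)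
next
  assume k: "0 < k" and "H1 u \<and> L2 lborel (Yvec k u)"
  then have h: "H1 u" and t: "integrable lborel (\<lambda>x. (norm (grad u x))\<^sup>2 + (u x)\<^sup>2 / (norm (fst x))\<^sup>2 + k * (u x)\<^sup>2)"
    by (auto simp: L2_def T_norm)
  have [measurable]: "u \<in> borel_measurable borel" using H1_L2[OF h] by (auto simp: L2_def)
  have "integrable lborel (\<lambda>x. (u x)\<^sup>2 / (norm (fst x))\<^sup>2)"
  proof (rule Bochner_Integration.integrable_bound[OF t])
    show "AE x in lborel. norm ((u x)\<^sup>2 / (norm (fst x))\<^sup>2) \<le> norm ((norm (grad u x))\<^sup>2 + (u x)\<^sup>2 / (norm (fst x))\<^sup>2 + k * (u x)\<^sup>2)"
    proof (rule AE_I2)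
      fix x
      have "0 \<le> (norm (grad u x))\<^sup>2" "0 \<le> k * (u x)\<^sup>2" "0 \<le> (u x)\<^sup>2 / (norm (fst x))\<^sup>2" using k by auto
      then show "norm ((u x)\<^sup>2 / (norm (fst x))\<^sup>2) \<le> norm ((norm (grad u x))\<^sup>2 + (u x)\<^sup>2 / (norm (fst x))\<^sup>2 + k * (u x)\<^sup>2)"
        unfolding real_norm_def by linarith
    qed
    show "(\<lambda>x. (u x)\<^sup>2 / (norm (fst x))\<^sup>2) \<in> borel_measurable lborel"
      by (subst measurable_cong_sets[OF sets_lborel refl])
        (intro borel_measurable_divide borel_measurable_power norm_fst_measurable, simp)
  qed
  then show "Yspace u" using h by (simp add: Yspace_def)
qed

lemma T_lin:
  assumes "H1 u" "H1 v"
  shows "AE x in lborel. Yvec k (\<lambda>x. a * u x + b * v x) x = a *\<^sub>R Yvec k u x + b *\<^sub>R Yvec k v x"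
  using grad_lin[OF assms, of a b]
  by eventually_elim (simp add: Yvec_def algebra_simps add_divide_distrib)

lemma Yspace_lin:
  assumes u: "Yspace u" and v: "Yspace v"
  shows "Yspace (\<lambda>x. a * u x + b * v x)"
proof -
  have h: "H1 u" "H1 v" using u v by (auto intro: Yspace_H1)
  have t: "L2 lborel (Yvec 1 u)" "L2 lborel (Yvec 1 v)" using Yspace_iff[of 1] u v by auto
  have "L2 lborel (Yvec 1 (\<lambda>x. a * u x + b * v x))"
    by (rule L2_AE_cong[OF L2_lin[OF t, of a b] T_measurable[OF H1_lin[OF h]] T_lin[OF h]])
  then show ?thesis using Yspace_iff[of 1] H1_lin[OF h] by auto
qed

text \<open>The support stays away from y = 0 because 1/|y|^2 is not locally integrable when K =
  2.\<close>

lemma Yspace_test: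
  fixes \<phi> :: "(real^'k) \<times> (real^'m) \<Rightarrow> real"
  assumes p: "test_fun \<phi>" and z: "\<And>x. norm (fst x) < 1 \<Longrightarrow> \<phi> x = 0"
  shows "Yspace \<phi>"
  unfolding Yspace_def
proof
  show "H1 \<phi>" by (rule H1_test_fun[OF p])
  have [measurable]: "\<phi> \<in> borel_measurable borel" using test_fun_measurable[OF p] by simp
  show "integrable lborel (\<lambda>x. (\<phi> x)\<^sup>2 / (norm (fst x))\<^sup>2)"
  proof (rule Bochner_Integration.integrable_bound[OF L2_square_integrable[OF test_fun_L2[OF p]]])
    show "AE x in lborel. norm ((\<phi> x)\<^sup>2 / (norm (fst x))\<^sup>2) \<le> norm ((\<phi> x)\<^sup>2)"
    proof (rule AE_I2)
      fix x
      show "norm ((\<phi> x)\<^sup>2 / (norm (fst x))\<^sup>2) \<le> norm ((\<phi> x)\<^sup>2)"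
      proof (cases "norm (fst x) < 1")
        case False
        then have "1 \<le> (norm (fst x))\<^sup>2" by simp
        then have "(\<phi> x)\<^sup>2 / (norm (fst x))\<^sup>2 \<le> (\<phi> x)\<^sup>2 / 1" by (intro divide_left_mono) auto
        then show ?thesis by simp
      qed (simp add: z)
    qed
    show "(\<lambda>x. (\<phi> x)\<^sup>2 / (norm (fst x))\<^sup>2) \<in> borel_measurable lborel"
      by (subst measurable_cong_sets[OF sets_lborel refl])
        (intro borel_measurable_divide borel_measurable_power norm_fst_measurable, simp)
  qed
qed

lemma T_L2: "0 < k \<Longrightarrow> Yspace u \<Longrightarrow> L2 lborel (Yvec k u)"
  using Yspace_iff by blast

lemma pre_hilbert_Y:
  assumes k: "0 < k"
  shows "pre_hilbert {u::(real^'k) \<times> (real^'m) \<Rightarrow> real. Yspace u} (Yform k)"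
proof
  have "test_fun (\<lambda>x::(real^'k) \<times> (real^'m). 0)" by (rule test_fun_zero)
  then show "{u::(real^'k) \<times> (real^'m) \<Rightarrow> real. Yspace u} \<noteq> {}" using Yspace_test by blast
  fix u v w :: "(real^'k) \<times> (real^'m) \<Rightarrow> real" and a b :: real
  assume "u \<in> {u. Yspace u}" "v \<in> {u. Yspace u}"
  then have u: "Yspace u" and v: "Yspace v" by auto
  show "(\<lambda>x. a * u x + b * v x) \<in> {u. Yspace u}" using Yspace_lin[OF u v] by simp
  show "Yform k u v = Yform k v u" by (simp add: Yform_def inner_commute)
  assume "w \<in> {u. Yspace u}"
  then have w: "Yspace w" by simp
  note t = T_L2[OF k u] T_L2[OF k v] T_L2[OF k w]
  have "Yform k (\<lambda>x. a * u x + b * v x) w = (LINT x|lborel. a * (Yvec k u x \<bullet> Yvec k w x) + b * (Yvec k v x \<bullet> Yvec k w x))"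
    unfolding Yform_def
  proof (rule integral_cong_AE)
    show "AE x in lborel. Yvec k (\<lambda>x. a * u x + b * v x) x \<bullet> Yvec k w x = a * (Yvec k u x \<bullet> Yvec k w x) + b * (Yvec k v x \<bullet> Yvec k w x)"
      using T_lin[OF Yspace_H1[OF u] Yspace_H1[OF v], of k a b] by eventually_elim (simp add: inner_add_left)
  qed (use t L2_measurable[OF T_L2[OF k Yspace_lin[OF u v]]] in \<open>auto simp: L2_def\<close>)
  also have "\<dots> = a * Yform k u w + b * Yform k v w"
    using L2_inner_integrable[OF t(1,3)] L2_inner_integrable[OF t(2,3)] by (simp add: Yform_def)
  finally show "Yform k (\<lambda>x. a * u x + b * v x) w = a * Yform k u w + b * Yform k v w" .
next
  fix u :: "(real^'k) \<times> (real^'m) \<Rightarrow> real"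
  show "0 \<le> Yform k u u" unfolding Yform_def by (intro integral_nonneg_AE) simp
qed

lemma B_bounds:
  assumes k: "0 < k" and u: "Yspace u"
  shows "k * (LINT x|lborel. (u x)\<^sup>2) \<le> Yform k u u" "(LINT x|lborel. (norm (grad u x))\<^sup>2) \<le> Yform k u u"
proof -
  have Be: "Yform k u u = (LINT x|lborel. (norm (Yvec k u x))\<^sup>2)" by (simp add: Yform_def power2_norm_eq_inner)
  have i: "integrable lborel (\<lambda>x. (norm (Yvec k u x))\<^sup>2)" using T_L2[OF k u] by (simp add: L2_def)
  have pt: "0 \<le> (norm (grad u x))\<^sup>2" "0 \<le> k * (u x)\<^sup>2" "0 \<le> (u x)\<^sup>2 / (norm (fst x))\<^sup>2" for x using k by auto
  have "(LINT x|lborel. k * (u x)\<^sup>2) \<le> Yform k u u" unfolding Be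
  proof (rule integral_mono[OF _ i])
    show "integrable lborel (\<lambda>x. k * (u x)\<^sup>2)" using L2_square_integrable[OF Yspace_L2[OF u]] by simp
    show "k * (u x)\<^sup>2 \<le> (norm (Yvec k u x))\<^sup>2" for x using k T_norm[of k u x] pt[of x] by linarith
  qed
  then show "k * (LINT x|lborel. (u x)\<^sup>2) \<le> Yform k u u" by simp
  show "(LINT x|lborel. (norm (grad u x))\<^sup>2) \<le> Yform k u u" unfolding Be
  proof (rule integral_mono[OF _ i])
    show "integrable lborel (\<lambda>x. (norm (grad u x))\<^sup>2)" using grad_L2[OF Yspace_H1[OF u]] by (simp add: L2_def)
    show "(norm (grad u x))\<^sup>2 \<le> (norm (Yvec k u x))\<^sup>2" for x using k T_norm[of k u x] pt[of x] by linarith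
  qed
qed

lemma Yspace_tr_bound:
  assumes k: "0 < k" and u: "Yspace u" and D: "Yform k u u \<le> D"
  shows "tr_bound u (D * (1 + 1 / k))"
proof (rule H1_tr_bound[OF Yspace_H1[OF u]])
  have D0: "0 \<le> D"
  proof -
    have "0 \<le> (LINT x|lborel. (norm (grad u x))\<^sup>2)" by simp
    then show ?thesis using B_bounds(2)[OF k u] D by linarith
  qed
  have "(LINT x|lborel. (u x)\<^sup>2) \<le> D / k" using B_bounds(1)[OF k u] D k by (simp add: field_simps)
  also have "\<dots> \<le> D * (1 + 1 / k)" using D0 by (simp add: distrib_left)
  finally show "(LINT x|lborel. (u x)\<^sup>2) \<le> D * (1 + 1 / k)" .
  have "D \<le> D * (1 + 1 / k)" using D0 k by (simp add: distrib_left)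
  then show "(LINT x|lborel. (norm (grad u x))\<^sup>2) \<le> D * (1 + 1 / k)" using B_bounds(2)[OF k u] D by linarith
qed

lemma B_zero:
  assumes k: "0 < k" and u: "Yspace u" and "Yform k u u = 0"
  shows "AE x in lborel. u x = 0"
proof -
  have "k * (LINT x|lborel. (u x)\<^sup>2) \<le> 0" using B_bounds(1)[OF k u] assms(3) by simp
  then have "(LINT x|lborel. (u x)\<^sup>2) \<le> 0" using k by (simp add: mult_le_0_iff)
  moreover have "0 \<le> (LINT x|lborel. (u x)\<^sup>2)" by simp
  ultimately have "(LINT x|lborel. (u x)\<^sup>2) = 0" by linarith
  then have "AE x in lborel. (u x)\<^sup>2 = 0"
    using integral_nonneg_eq_0_iff_AE[OF L2_square_integrable[OF Yspace_L2[OF u]]] by simp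
  then show ?thesis by simp
qed

text \<open>The vectors \<open>Yvec k (w n)\<close> converge in L^2 to some \<open>G\<close>, which
  has to be recognized as \<open>Yvec k u\<close>. The last two components are matched through an
  a.e. convergent subsequence, the first through closedness of the weak gradient.\<close>

lemma Yspace_complete:
  fixes w :: "nat \<Rightarrow> (real^'k) \<times> (real^'m) \<Rightarrow> real"
  assumes k: "0 < k" and w: "\<And>n. Yspace (w n)"
    and C: "\<And>e. e > 0 \<Longrightarrow> \<exists>M. \<forall>m\<ge>M. \<forall>n\<ge>M. Yform k (\<lambda>x. w n x - w m x) (\<lambda>x. w n x - w m x) < e"
  obtains u where "Yspace u" "(\<lambda>n. Yform k (\<lambda>x. w n x - u x) (\<lambda>x. w n x - u x)) \<longlonglongrightarrow> 0"
proof -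
  have h: "H1 (w n)" for n using w by (rule Yspace_H1)
  have t: "L2 lborel (Yvec k (w n))" for n by (rule T_L2[OF k w])
  have diff: "Yform k (\<lambda>x. u x - v x) (\<lambda>x. u x - v x) = (LINT x|lborel. (norm (Yvec k u x - Yvec k v x))\<^sup>2)" if u: "Yspace u" and v: "Yspace v" for u v :: "(real^'k) \<times> (real^'m) \<Rightarrow> real"
  proof -
    have d: "Yspace (\<lambda>x. u x - v x)" using Yspace_lin[OF u v, of 1 "-1"] by simp
    have "AE x in lborel. Yvec k (\<lambda>x. u x - v x) x = Yvec k u x - Yvec k v x"
      using T_lin[OF Yspace_H1[OF u] Yspace_H1[OF v], of k 1 "-1"] by simp
    then show ?thesis unfolding Yform_def power2_norm_eq_inner
      using L2_measurable[OF T_L2[OF k d]] L2_measurable[OF T_L2[OF k u]] L2_measurable[OF T_L2[OF k v]]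
      by (intro integral_cong_AE) auto
  qed
  obtain G r where G: "L2 lborel G" and Gl: "(\<lambda>n. LINT x|lborel. (norm (Yvec k (w n) x - G x))\<^sup>2) \<longlonglongrightarrow> 0"
    and r: "strict_mono (r::nat\<Rightarrow>nat)" and rA: "AE x in lborel. (\<lambda>j. Yvec k (w (r j)) x) \<longlonglongrightarrow> G x"
  proof (rule L2_complete[where f="\<lambda>n. Yvec k (w n)" and M=lborel])
    fix e :: real assume "e > 0"
    then show "\<exists>N. \<forall>m\<ge>N. \<forall>n\<ge>N. (LINT x|lborel. (norm (Yvec k (w m) x - Yvec k (w n) x))\<^sup>2) < e"
      using C[of e] by (simp add: diff[OF w w] norm_minus_commute)
  qed (use t that in blast)+
  have Gm[measurable]: "G \<in> borel_measurable borel" using G by (simp add: L2_def)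
  define g where "g x = fst (G x)" for x
  \<comment> \<open>The third component determines u since k > 0; the second is then forced to be
    u/|y|.\<close>
  define u where "u x = snd (snd (G x)) / sqrt k" for x
  have gm: "g \<in> borel_measurable borel" and um: "u \<in> borel_measurable borel"
  proof -
    have "continuous_on UNIV (\<lambda>q::((real^'k) \<times> (real^'m)) \<times> real \<times> real. fst q)"
      "continuous_on UNIV (\<lambda>q::((real^'k) \<times> (real^'m)) \<times> real \<times> real. snd (snd q) / sqrt k)"
      using k by (auto intro!: continuous_intros)
    then show "g \<in> borel_measurable borel" "u \<in> borel_measurable borel"
      unfolding g_def[abs_def] u_def[abs_def] using Gm by (auto intro: borel_measurable_continuous_on)
  qed
  have nG: "norm (g x) \<le> norm (G x)" "norm (snd (snd (G x))) \<le> norm (G x)" for x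
    unfolding g_def using norm_fst_le[of "fst (G x)" "snd (G x)"] norm_snd_le[of "snd (G x)" "fst (G x)"] norm_snd_le[of "snd (snd (G x))" "fst (snd (G x))"] by auto
  have gL: "L2 lborel g" using G gm nG by (intro L2_bound[OF G]) auto
  have "continuous_on UNIV (\<lambda>q::((real^'k) \<times> (real^'m)) \<times> real \<times> real. snd (snd q))" by (intro continuous_intros)
  then have "(\<lambda>x. snd (snd (G x))) \<in> borel_measurable lborel" using Gm by (auto intro: borel_measurable_continuous_on)
  then have "L2 lborel (\<lambda>x. snd (snd (G x)))" using nG by (intro L2_bound[OF G]) auto
  from L2_lin_real[OF this this, of "1 / sqrt k" 0] have uL: "L2 lborel u" by (simp add: u_def[abs_def])
  have sk: "sqrt k > 0" using k by simp
  have G_eq: "AE x in lborel. G x = (g x, (u x / norm (fst x), sqrt k * u x))"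
    using rA
  proof eventually_elim
    case (elim x)
    have 2: "(\<lambda>j. fst (snd (Yvec k (w (r j)) x))) \<longlonglongrightarrow> fst (snd (G x))" "(\<lambda>j. snd (snd (Yvec k (w (r j)) x))) \<longlonglongrightarrow> snd (snd (G x))"
      by (intro tendsto_fst tendsto_snd elim)+
    have "(\<lambda>j. snd (snd (Yvec k (w (r j)) x)) / sqrt k) \<longlonglongrightarrow> u x" unfolding u_def using sk by (intro tendsto_divide 2 tendsto_const) auto
    then have "(\<lambda>j. w (r j) x) \<longlonglongrightarrow> u x" using sk by (simp add: Yvec_def)
    from tendsto_mult[OF this tendsto_const[of "1 / norm (fst x)"]]
    have "(\<lambda>j. w (r j) x / norm (fst x)) \<longlonglongrightarrow> u x / norm (fst x)" by simp
    moreover have "(\<lambda>j. w (r j) x / norm (fst x)) \<longlonglongrightarrow> fst (snd (G x))" using 2(1) by (simp add: Yvec_def)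
    ultimately have "fst (snd (G x)) = u x / norm (fst x)" using LIMSEQ_unique by blast
    moreover have "snd (snd (G x)) = sqrt k * u x" using sk by (simp add: u_def)
    ultimately show ?case unfolding g_def by (metis prod.collapse)
  qed
  have ineq: "(norm (grad (w n) x - g x))\<^sup>2 \<le> (norm (Yvec k (w n) x - G x))\<^sup>2" "k * (w n x - u x)\<^sup>2 \<le> (norm (Yvec k (w n) x - G x))\<^sup>2" for n x
  proof -
    let ?d = "Yvec k (w n) x - G x"
    have "norm (fst ?d) \<le> norm ?d" by (rule norm_fst_le[of "fst ?d" "snd ?d", unfolded prod.collapse])
    then show "(norm (grad (w n) x - g x))\<^sup>2 \<le> (norm ?d)\<^sup>2" by (intro power_mono) (auto simp: Yvec_def g_def)
    have "norm (snd (snd ?d)) \<le> norm ?d"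
      by (rule order_trans[OF norm_snd_le[of "snd (snd ?d)" "fst (snd ?d)", unfolded prod.collapse]
          norm_snd_le[of "snd ?d" "fst ?d", unfolded prod.collapse]])
    then have "(norm (snd (snd ?d)))\<^sup>2 \<le> (norm ?d)\<^sup>2" by (intro power_mono) auto
    moreover have "snd (snd ?d) = sqrt k * (w n x - u x)" using sk by (simp add: Yvec_def u_def algebra_simps)
    ultimately show "k * (w n x - u x)\<^sup>2 \<le> (norm ?d)\<^sup>2" using k by (simp add: power_mult_distrib)
  qed
  have iG: "integrable lborel (\<lambda>x. (norm (Yvec k (w n) x - G x))\<^sup>2)" for n using L2_diff[OF t G, of n] by (simp add: L2_def)
  have wg: "weak_grad u g"
  proof (rule weak_grad_closed[where un=w and gn="\<lambda>n. grad (w n)"])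
    show "(\<lambda>n. LINT x|lborel. (norm (grad (w n) x - g x))\<^sup>2) \<longlonglongrightarrow> 0"
    proof (rule tendsto_sandwich[OF _ _ tendsto_const Gl])
      show "\<forall>\<^sub>F n in sequentially. (LINT x|lborel. (norm (grad (w n) x - g x))\<^sup>2) \<le> (LINT x|lborel. (norm (Yvec k (w n) x - G x))\<^sup>2)"
        using L2_diff[OF grad_L2[OF h] gL] iG ineq by (intro always_eventually allI integral_mono) (auto simp: L2_def)
    qed auto
    have l: "(\<lambda>n. (LINT x|lborel. (norm (Yvec k (w n) x - G x))\<^sup>2) / k) \<longlonglongrightarrow> 0"
      using tendsto_divide[OF Gl tendsto_const[of k]] k by simp
    show "(\<lambda>n. LINT x|lborel. (w n x - u x)\<^sup>2) \<longlonglongrightarrow> 0"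
    proof (rule tendsto_sandwich[OF _ _ tendsto_const l])
      have "k * (LINT x|lborel. (w n x - u x)\<^sup>2) \<le> (LINT x|lborel. (norm (Yvec k (w n) x - G x))\<^sup>2)" for n
      proof -
        have "(LINT x|lborel. k * (w n x - u x)\<^sup>2) \<le> (LINT x|lborel. (norm (Yvec k (w n) x - G x))\<^sup>2)"
          using L2_square_integrable[OF L2_diff[OF H1_L2[OF h] uL]] iG ineq by (intro integral_mono) auto
        then show ?thesis by simp
      qed
      then show "\<forall>\<^sub>F n in sequentially. (LINT x|lborel. (w n x - u x)\<^sup>2) \<le> (LINT x|lborel. (norm (Yvec k (w n) x - G x))\<^sup>2) / k"
        using k by (intro always_eventually allI) (simp add: field_simps)
    qed auto
  qed (use h gL uL in \<open>auto intro: H1_L2 grad_L2 grad_weak_grad\<close>)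
  have hu: "H1 u" by (rule H1_I[OF uL wg gL])
  have TG: "AE x in lborel. Yvec k u x = G x"
    using G_eq grad_eqI[OF uL wg gL] by eventually_elim (simp add: Yvec_def)
  have "L2 lborel (Yvec k u)" by (rule L2_AE_cong[OF G T_measurable[OF hu] TG])
  then have Yu: "Yspace u" using Yspace_iff[OF k] hu by blast
  have "Yform k (\<lambda>x. w n x - u x) (\<lambda>x. w n x - u x) = (LINT x|lborel. (norm (Yvec k (w n) x - G x))\<^sup>2)" for n
    unfolding diff[OF w Yu]
  proof (rule integral_cong_AE)
    show "AE x in lborel. (norm (Yvec k (w n) x - Yvec k u x))\<^sup>2 = (norm (Yvec k (w n) x - G x))\<^sup>2"
      using TG by eventually_elim simp
  qed (use L2_measurable[OF T_L2[OF k Yu]] L2_measurable[OF t[of n]] in auto)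
  then have "(\<lambda>n. Yform k (\<lambda>x. w n x - u x) (\<lambda>x. w n x - u x)) \<longlonglongrightarrow> 0" using Gl by simp
  then show ?thesis using that Yu by blast
qed

subsection \<open>Symmetries\<close>

text \<open>One map for both symmetries of the problem: \<open>z = 0\<close> is the action of O(K),
  \<open>A = mat 1\<close> is translation in the second variable.\<close>

definition symm :: "real^'k^'k \<Rightarrow> real^'m \<Rightarrow> (real^'k) \<times> (real^'m) \<Rightarrow> (real^'k) \<times> (real^'m)" where
  "symm A z x = (A *v fst x, snd x + z)"

lemma orthogonal_matrix_vector:
  fixes A :: "real^'k^'k"
  assumes "orthogonal_matrix A"
  shows "orthogonal_transformation ((*v) A)"
  using assms by (simp add: orthogonal_transformation_matrix matrix_vector_mul_linear matrix_of_matrix_vector_mul)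

lemma symm_orthogonal:
  fixes A :: "real^'k^'k"
  assumes "orthogonal_matrix A"
  shows "orthogonal_transformation (symm A (0::real^'m))"
  unfolding orthogonal_transformation_def
proof
  have o: "orthogonal_transformation ((*v) A)" by (rule orthogonal_matrix_vector[OF assms])
  show "linear (symm A (0::real^'m))"
    by (rule linearI) (auto simp: symm_def matrix_vector_right_distrib matrix_vector_mult_scaleR)
  show "\<forall>v w. symm A (0::real^'m) v \<bullet> symm A 0 w = v \<bullet> w"
    using o by (auto simp: symm_def inner_prod_def orthogonal_transformation_def)
qed

lemma symm_eq: "symm A z x = symm A 0 x + (0, z)"
  by (simp add: symm_def)

lemma symm_inverse:
  assumes "orthogonal_matrix A"
  shows "symm A 0 (symm (transpose A) 0 x) = x" "symm (transpose A) 0 (symm A 0 x) = x"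
proof -
  have "A *v (transpose A *v y) = y" "transpose A *v (A *v y) = y" for y
    using assms unfolding matrix_vector_mul_assoc orthogonal_matrix_def by (simp_all only: matrix_vector_mul_lid)
  then show "symm A 0 (symm (transpose A) 0 x) = x" "symm (transpose A) 0 (symm A 0 x) = x"
    unfolding symm_def by (simp_all only: fst_conv snd_conv add_0_right prod.collapse)
qed

lemma symm_measurable[measurable]: "symm A z \<in> borel_measurable borel"
proof -
  have "continuous_on UNIV (symm A z)" unfolding symm_def
    by (intro continuous_intros linear_continuous_on_compose[OF _ matrix_vector_mul_linear])
  then show ?thesis by (rule borel_measurable_continuous_onI)
qed

lemma nn_integral_shift:
  fixes F :: "'a::euclidean_space \<Rightarrow> ennreal"
  assumes "F \<in> borel_measurable borel"
  shows "(\<integral>\<^sup>+x. F (x + a) \<partial>lborel) = (\<integral>\<^sup>+x. F x \<partial>lborel)"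
  using nn_integral_distr[of "\<lambda>x. x + a" lborel borel F] assms by (simp add: lborel_shift_distr)

text \<open>Invariance of Lebesgue measure, by the usual Fubini argument for uniqueness of translation invariant
  measures: the unit ball \<open>U\<close> fixes the constant.\<close>

lemma orthogonal_distr:
  fixes g :: "'a::euclidean_space \<Rightarrow> 'a"
  assumes g: "orthogonal_transformation g"
  shows "distr lborel borel g = lborel"
proof (rule measure_eqI)
  have gl: "linear g" by (rule orthogonal_transformation_linear[OF g])
  have gm[measurable]: "g \<in> borel_measurable borel"
    using gl by (intro borel_measurable_continuous_onI linear_continuous_on) (simp add: linear_conv_bounded_linear[symmetric])
  have gs: "g (inv g y) = y" for y using orthogonal_transformation_surj[OF g] by (rule surj_f_inv_f)
  define U where "U = ball (0::'a) 1"
  have Um[measurable]: "U \<in> sets borel" by (simp add: U_def)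
  have Um': "(\<lambda>x. indicator U x :: ennreal) \<in> borel_measurable borel" by simp
  fix E assume "E \<in> sets (distr lborel borel g)"
  then have Em[measurable]: "E \<in> sets borel" by simp
  have "emeasure (distr lborel borel g) E * emeasure lborel U = (\<integral>\<^sup>+x. indicator E (g x) * emeasure lborel U \<partial>lborel)"
  proof -
    have "emeasure (distr lborel borel g) E = (\<integral>\<^sup>+x. indicator E x \<partial>distr lborel borel g)" by simp
    also have "\<dots> = (\<integral>\<^sup>+x. indicator E (g x) \<partial>lborel)" by (rule nn_integral_distr) auto
    finally show ?thesis by (simp add: nn_integral_multc)
  qed
  also have "\<dots> = (\<integral>\<^sup>+x. (\<integral>\<^sup>+y. indicator E (g x) * indicator U (y - g x) \<partial>lborel) \<partial>lborel)"
  proof (rule nn_integral_cong)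
    fix x
    have "(\<integral>\<^sup>+y. indicator E (g x) * indicator U (y - g x) \<partial>lborel) = indicator E (g x) * (\<integral>\<^sup>+y. indicator U (y + (- g x)) \<partial>lborel)"
      by (subst nn_integral_cmult[symmetric]) auto
    also have "(\<integral>\<^sup>+y. indicator U (y + (- g x)) \<partial>lborel) = (\<integral>\<^sup>+y. indicator U y \<partial>lborel)"
      by (rule nn_integral_shift[OF Um'])
    finally show "indicator E (g x) * emeasure lborel U = (\<integral>\<^sup>+y. indicator E (g x) * indicator U (y - g x) \<partial>lborel)" by simp
  qed
  also have "\<dots> = (\<integral>\<^sup>+y. (\<integral>\<^sup>+x. indicator E (g x) * indicator U (y - g x) \<partial>lborel) \<partial>lborel)"
    by (rule lborel_pair.Fubini'[symmetric]) measurable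
  \<comment> \<open>Substitution of x + g^(-1) y for x: then y - g x becomes - g x, which lies in
    \<open>U\<close> exactly when x does, because g preserves norms and \<open>U\<close> is a
    centred ball.\<close>
  also have "\<dots> = (\<integral>\<^sup>+y. (\<integral>\<^sup>+x. indicator E (g x + y) * indicator U x \<partial>lborel) \<partial>lborel)"
  proof (rule nn_integral_cong)
    fix y
    have "(\<integral>\<^sup>+x. indicator E (g x) * indicator U (y - g x) \<partial>lborel) = (\<integral>\<^sup>+x. indicator E (g (x + inv g y)) * indicator U (y - g (x + inv g y)) \<partial>lborel)"
      by (rule nn_integral_shift[symmetric, of "\<lambda>x. indicator E (g x) * indicator U (y - g x)"]) measurable
    also have "\<dots> = (\<integral>\<^sup>+x. indicator E (g x + y) * indicator U x \<partial>lborel)"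
    proof (rule nn_integral_cong)
      fix x
      have "g (x + inv g y) = g x + y" by (simp add: linear_add[OF gl] gs)
      moreover have "indicator U (- g x) = (indicator U x :: ennreal)"
        by (simp add: U_def indicator_def orthogonal_transformation_norm[OF g])
      ultimately show "indicator E (g (x + inv g y)) * indicator U (y - g (x + inv g y)) = (indicator E (g x + y) * indicator U x :: ennreal)"
        by simp
    qed
    finally show "(\<integral>\<^sup>+x. indicator E (g x) * indicator U (y - g x) \<partial>lborel) = (\<integral>\<^sup>+x. indicator E (g x + y) * indicator U x \<partial>lborel)" .
  qed
  also have "\<dots> = (\<integral>\<^sup>+x. (\<integral>\<^sup>+y. indicator E (g x + y) * indicator U x \<partial>lborel) \<partial>lborel)"
    by (rule lborel_pair.Fubini') measurable
  also have "\<dots> = (\<integral>\<^sup>+x. emeasure lborel E * indicator U x \<partial>lborel)"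
  proof (rule nn_integral_cong)
    fix x
    have "(\<integral>\<^sup>+y. indicator E (g x + y) * indicator U x \<partial>lborel) = (\<integral>\<^sup>+y. indicator E (y + g x) \<partial>lborel) * indicator U x"
      by (subst nn_integral_multc[symmetric]) (auto simp: add.commute)
    also have "(\<integral>\<^sup>+y. indicator E (y + g x) \<partial>lborel) = (\<integral>\<^sup>+y. indicator E y \<partial>lborel)"
      by (rule nn_integral_shift) simp
    finally show "(\<integral>\<^sup>+y. indicator E (g x + y) * indicator U x \<partial>lborel) = emeasure lborel E * indicator U x" by simp
  qed
  also have "\<dots> = emeasure lborel E * emeasure lborel U" by (simp add: nn_integral_cmult)
  finally have eq: "emeasure (distr lborel borel g) E * emeasure lborel U = emeasure lborel E * emeasure lborel U" .
  have "emeasure lborel U = ennreal (measure lborel U)"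
    using emeasure_bounded_finite[OF bounded_ball[of "0::'a" 1]] by (simp add: U_def emeasure_eq_ennreal_measure)
  moreover have "measure lborel U > 0" unfolding U_def using content_ball_pos[of 1 "0::'a"] by simp
  ultimately have U0: "emeasure lborel U \<noteq> 0" "emeasure lborel U \<noteq> top" by auto
  show "emeasure (distr lborel borel g) E = emeasure lborel E"
    using eq U0 by (simp add: mult.commute[of _ "emeasure lborel U"] ennreal_mult_cancel_left)
qed simp

lemma symm_distr:
  fixes A :: "real^'k^'k" and z :: "real^'m"
  assumes "orthogonal_matrix A"
  shows "distr lborel borel (symm A z) = lborel"
proof -
  have o: "orthogonal_transformation (symm A (0::real^'m))" by (rule symm_orthogonal[OF assms])
  have "symm A z = (\<lambda>x. symm A 0 x + (0, z))" by (rule ext, rule symm_eq)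
  then have "distr lborel borel (symm A z) = distr (distr lborel borel (symm A 0)) borel (\<lambda>x. x + (0, z))"
    by (subst distr_distr) (auto simp: comp_def)
  also have "\<dots> = lborel" unfolding orthogonal_distr[OF o] by (rule lborel_shift_distr)
  finally show ?thesis .
qed

lemma integral_symm:
  fixes F :: "(real^'k) \<times> (real^'m) \<Rightarrow> real"
  assumes "orthogonal_matrix A" "F \<in> borel_measurable borel"
  shows "(LINT x|lborel. F (symm A z x)) = (LINT x|lborel. F x)"
  using integral_distr[of "symm A z" lborel borel F] assms by (simp add: symm_distr)

lemma integrable_symm:
  fixes F :: "(real^'k) \<times> (real^'m) \<Rightarrow> 'e::euclidean_space"
  assumes "orthogonal_matrix A" "F \<in> borel_measurable borel" "integrable lborel F"
  shows "integrable lborel (\<lambda>x. F (symm A z x))"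
  using integrable_distr_eq[of "symm A z" lborel borel F] assms by (simp add: symm_distr)

lemma AE_symm:
  fixes P :: "(real^'k) \<times> (real^'m) \<Rightarrow> bool"
  assumes "orthogonal_matrix A" "AE x in lborel. P x"
  shows "AE x in lborel. P (symm A z x)"
  using AE_distrD[of "symm A z" lborel borel P] assms unfolding symm_distr[OF assms(1)] by simp

lemma norm_fst_symm: "orthogonal_matrix A \<Longrightarrow> norm (fst (symm A z x)) = norm (fst x)"
  using orthogonal_transformation_norm[OF orthogonal_matrix_vector] by (simp add: symm_def)

lemma L2_symm:
  fixes F :: "(real^'k) \<times> (real^'m) \<Rightarrow> 'e::euclidean_space"
  assumes A: "orthogonal_matrix A" and F: "L2 lborel F"
  shows "L2 lborel (\<lambda>x. F (symm A z x))"
proof -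
  have [measurable]: "F \<in> borel_measurable borel" using F by (simp add: L2_def)
  show ?thesis using integrable_symm[OF A, of "\<lambda>x. (norm (F x))\<^sup>2" z] F by (simp add: L2_def)
qed

lemma Yspace_symm:
  fixes u :: "(real^'k) \<times> (real^'m) \<Rightarrow> real"
  assumes A: "orthogonal_matrix A" and u: "Yspace u"
  shows "Yspace (\<lambda>x. u (symm A z x))"
    and grad_symm: "AE x in lborel. grad (\<lambda>x. u (symm A z x)) x = symm (transpose A) 0 (grad u (symm A z x))"
proof -
  have um: "u \<in> borel_measurable borel" by (rule Yspace_measurable[OF u])
  have h: "H1 u" by (rule Yspace_H1[OF u])
  let ?T = "symm (transpose A) (0::real^'m)"
  have At: "orthogonal_matrix (transpose A)" using A by simp
  have oT: "orthogonal_transformation ?T" by (rule symm_orthogonal[OF At])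
  have "weak_grad (\<lambda>x. u (symm A 0 x + (0, z))) (\<lambda>x. ?T (grad u (symm A 0 x + (0, z))))"
  proof (rule weak_grad_isometry[OF symm_orthogonal[OF A] oT])
    show "distr lborel borel (\<lambda>x. symm A 0 x + (0, z)) = lborel"
      unfolding symm_eq[symmetric] by (rule symm_distr[OF A])
    show "weak_grad u (grad u)" by (rule grad_weak_grad[OF h])
  qed (use um symm_inverse[OF A] in auto)
  then have wg: "weak_grad (\<lambda>x. u (symm A z x)) (\<lambda>x. ?T (grad u (symm A z x)))" unfolding symm_eq[symmetric] .
  have uL: "L2 lborel (\<lambda>x. u (symm A z x))" by (rule L2_symm[OF A H1_L2[OF h]])
  have gL: "L2 lborel (\<lambda>x. ?T (grad u (symm A z x)))"
  proof (rule L2_bound[OF L2_symm[OF A grad_L2[OF h]]])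
    show "(\<lambda>x. ?T (grad u (symm A z x))) \<in> borel_measurable lborel" using wg by (simp add: weak_grad_def)
    show "AE x in lborel. norm (?T (grad u (symm A z x))) \<le> norm (grad u (symm A z x))"
      by (simp add: orthogonal_transformation_norm[OF oT])
  qed
  show "AE x in lborel. grad (\<lambda>x. u (symm A z x)) x = ?T (grad u (symm A z x))"
    by (rule grad_eqI[OF uL wg gL])
  have "integrable lborel (\<lambda>x. (u (symm A z x))\<^sup>2 / (norm (fst (symm A z x)))\<^sup>2)"
  proof (rule integrable_symm[OF A])
    show "(\<lambda>x. (u x)\<^sup>2 / (norm (fst x))\<^sup>2) \<in> borel_measurable borel"
      by (intro borel_measurable_divide borel_measurable_power um norm_fst_measurable)
    show "integrable lborel (\<lambda>x. (u x)\<^sup>2 / (norm (fst x))\<^sup>2)" using u by (simp add: Yspace_def)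
  qed
  then show "Yspace (\<lambda>x. u (symm A z x))"
    unfolding Yspace_def using H1_I[OF uL wg gL] by (simp add: norm_fst_symm[OF A])
qed

lemma B_symm:
  fixes u v :: "(real^'k) \<times> (real^'m) \<Rightarrow> real"
  assumes k: "0 < k" and A: "orthogonal_matrix A" and u: "Yspace u" and v: "Yspace v"
  shows "Yform k (\<lambda>x. u (symm A z x)) (\<lambda>x. v (symm A z x)) = Yform k u v"
proof -
  have At: "orthogonal_matrix (transpose A)" using A by simp
  have oT: "orthogonal_transformation (symm (transpose A) (0::real^'m))" by (rule symm_orthogonal[OF At])
  have m: "Yvec k u \<in> borel_measurable borel" "Yvec k v \<in> borel_measurable borel"
    using L2_measurable[OF T_L2[OF k u]] L2_measurable[OF T_L2[OF k v]] by auto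
  have m': "(\<lambda>x. Yvec k u (symm A z x) \<bullet> Yvec k v (symm A z x)) \<in> borel_measurable borel"
    using measurable_compose[OF symm_measurable[of A z] m(1)] measurable_compose[OF symm_measurable[of A z] m(2)] by simp
  have "Yform k (\<lambda>x. u (symm A z x)) (\<lambda>x. v (symm A z x)) = (LINT x|lborel. Yvec k u (symm A z x) \<bullet> Yvec k v (symm A z x))"
    unfolding Yform_def
  proof (rule integral_cong_AE)
    show "AE x in lborel. Yvec k (\<lambda>x. u (symm A z x)) x \<bullet> Yvec k (\<lambda>x. v (symm A z x)) x = Yvec k u (symm A z x) \<bullet> Yvec k v (symm A z x)"
      using grad_symm[OF A u, of z] grad_symm[OF A v, of z]
    proof eventually_elim
      case (elim x)
      moreover have "symm (transpose A) (0::real^'m) a \<bullet> symm (transpose A) 0 b = a \<bullet> b" for a b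
        using oT unfolding orthogonal_transformation_def by blast
      ultimately show ?case using k by (simp add: T_inner norm_fst_symm[OF A])
    qed
  qed (use m' L2_measurable[OF T_L2[OF k Yspace_symm(1)[OF A u, of z]]] L2_measurable[OF T_L2[OF k Yspace_symm(1)[OF A v, of z]]] in auto)
  also have "\<dots> = Yform k u v" unfolding Yform_def using m by (intro integral_symm[OF A, of "\<lambda>x. Yvec k u x \<bullet> Yvec k v x"]) auto
  finally show ?thesis .
qed

lemma G_inv_iff: "G_inv u \<longleftrightarrow> (\<forall>A. orthogonal_matrix A \<longrightarrow> (AE x in lborel. u (symm A 0 x) = u x))"
  by (simp add: G_inv_def symm_def)

lemma G_inv_lin:
  assumes "G_inv u" "G_inv v"
  shows "G_inv (\<lambda>x. a * u x + b * v x)"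
  unfolding G_inv_iff
proof (intro allI impI)
  fix A :: "real^'a^'a" assume "orthogonal_matrix A"
  then have "AE x in lborel. u (symm A 0 x) = u x" "AE x in lborel. v (symm A 0 x) = v x"
    using assms by (auto simp: G_inv_iff)
  then show "AE x in lborel. a * u (symm A 0 x) + b * v (symm A 0 x) = a * u x + b * v x"
    by eventually_elim simp
qed

lemma G_inv_shift:
  assumes "G_inv u"
  shows "G_inv (\<lambda>x. u (symm (mat 1) z x))"
  unfolding G_inv_iff
proof (intro allI impI)
  fix A :: "real^'a^'a" assume A: "orthogonal_matrix A"
  have i: "orthogonal_matrix (mat 1 :: real^'a^'a)" by (simp add: orthogonal_matrix_id)
  have "AE x in lborel. u (symm A 0 (symm (mat 1) z x)) = u (symm (mat 1) z x)"
    using assms A by (intro AE_symm[OF i]) (auto simp: G_inv_iff)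
  then show "AE x in lborel. u (symm (mat 1) z (symm A 0 x)) = u (symm (mat 1) z x)"
    by (simp add: symm_def)
qed

lemma G_inv_limit:
  assumes un: "\<And>n. G_inv (un n)" and lim: "AE x in lborel. (\<lambda>n. un n x) \<longlonglongrightarrow> u x"
  shows "G_inv u"
  unfolding G_inv_iff
proof (intro allI impI)
  fix A :: "real^'a^'a" assume A: "orthogonal_matrix A"
  have "AE x in lborel. \<forall>n. un n (symm A 0 x) = un n x"
    using un A by (auto simp: AE_all_countable G_inv_iff)
  moreover have "AE x in lborel. (\<lambda>n. un n (symm A 0 x)) \<longlonglongrightarrow> u (symm A 0 x)" by (rule AE_symm[OF A lim])
  ultimately show "AE x in lborel. u (symm A 0 x) = u x"
    using lim
  proof eventually_elim
    case (elim x)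
    then have "(\<lambda>n. un n x) \<longlonglongrightarrow> u (symm A 0 x)" by simp
    then show ?case using elim(3) LIMSEQ_unique by blast
  qed
qed

text \<open>Rotating a ball far from \<open>y = 0\<close> produces many disjoint balls carrying the same mass.\<close>

lemma G_inv_ball_location:
  assumes K2: "CARD('k::finite) \<ge> 2" and d: "0 < \<delta>"
  obtains R where "\<And>(u::(real^'k) \<times> (real^'m) \<Rightarrow> real) x. L2 lborel u \<Longrightarrow> G_inv u \<Longrightarrow> (LINT x|lborel. (u x)\<^sup>2) \<le> D \<Longrightarrow>
     \<delta> \<le> (LINT y|lborel. (u y)\<^sup>2 * indicator (ball x 1) y) \<Longrightarrow> norm (fst x) \<le> R"
proof -
  obtain n :: nat where n: "D < real n * \<delta>" using d reals_Archimedean3[OF d] by blast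
  \<comment> \<open>Here K \<ge> 2 enters: the sphere is connected and contains two points e and -e,
    so it cannot be finite.\<close>
  have "infinite (sphere (0::real^'k) 1)"
  proof
    assume f: "finite (sphere (0::real^'k) 1)"
    have "connected (sphere (0::real^'k) 1)" using K2 by (intro connected_sphere) simp
    obtain e :: "real^'k" where "norm e = 1" using vector_choose_size[of 1] by auto
    then have "e \<in> sphere 0 1" "- e \<in> sphere 0 1" "e \<noteq> - e"
    proof -
      show "e \<noteq> - e"
      proof
        assume "e = - e"
        then have "2 *\<^sub>R e = 0" unfolding scaleR_2 by (metis add.right_inverse)
        then show False using \<open>norm e = 1\<close> by simp
      qed
    qed auto
    obtain a where "sphere (0::real^'k) 1 = {a}"
      using f connected_finite_iff_sing[OF \<open>connected (sphere (0::real^'k) 1)\<close>] \<open>e \<in> sphere 0 1\<close> by blast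
    then have "e = a" "- e = a" using \<open>e \<in> sphere 0 1\<close> \<open>- e \<in> sphere 0 1\<close> by blast+
    then show False using \<open>e \<noteq> - e\<close> by simp
  qed
  then obtain E where E: "finite E" "card E = n" "E \<subseteq> sphere (0::real^'k) 1" using infinite_arbitrarily_large by blast
  \<comment> \<open>The pairwise distances of the chosen directions; the inserted 1 keeps the set
    nonempty when there are fewer than two directions.\<close>
  define S where "S = insert 1 ((\<lambda>p. dist (fst p) (snd p)) ` {p \<in> E \<times> E. fst p \<noteq> snd p})"
  have S: "finite S" "S \<noteq> {}" using E by (auto simp: S_def)
  have sp: "Min S > 0" using S by (auto simp: S_def)
  have dE: "Min S \<le> dist a b" if "a \<in> E" "b \<in> E" "a \<noteq> b" for a b
  proof (rule Min_le[OF S(1)])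
    show "dist a b \<in> S" unfolding S_def using that by (force intro!: image_eqI[of _ _ "(a, b)"])
  qed
  show ?thesis
  \<comment> \<open>Beyond this radius the rotated centres are more than 2 apart, so their unit
    balls are disjoint and n of them would carry mass n \<delta> > D.\<close>
  proof (rule that[of "2 / Min S"])
    fix u :: "(real^'k) \<times> (real^'m) \<Rightarrow> real" and x :: "(real^'k) \<times> (real^'m)"
    assume uL: "L2 lborel u" and ug: "G_inv u" and uD: "(LINT x|lborel. (u x)\<^sup>2) \<le> D"
      and mass: "\<delta> \<le> (LINT y|lborel. (u y)\<^sup>2 * indicator (ball x 1) y)"
    show "norm (fst x) \<le> 2 / Min S"
    proof (rule ccontr)
      assume "\<not> norm (fst x) \<le> 2 / Min S"
      then have far: "2 < norm (fst x) * Min S" using sp by (simp add: field_simps)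
      define c where "c e = (norm (fst x) *\<^sub>R e, snd x)" for e :: "real^'k"
      have disj: "ball (c a) 1 \<inter> ball (c b) 1 = {}" if "a \<in> E" "b \<in> E" "a \<noteq> b" for a b
      proof -
        have "dist (c a) (c b) = norm (fst x) * dist a b"
          by (simp add: c_def dist_Pair_Pair dist_norm scaleR_diff_right[symmetric])
        also have "\<dots> \<ge> norm (fst x) * Min S" by (intro mult_left_mono dE that) simp
        finally have "2 < dist (c a) (c b)" using far by linarith
        then show ?thesis by (intro disjoint_ballI) simp
      qed
      have um: "u \<in> borel_measurable borel" using uL by (simp add: L2_def)
      have same: "(LINT y|lborel. (u y)\<^sup>2 * indicator (ball (c e) 1) y) = (LINT y|lborel. (u y)\<^sup>2 * indicator (ball x 1) y)" if "e \<in> E" for e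
      proof -
        have "norm (fst x) = norm (norm (fst x) *\<^sub>R e)" using E(3) that by auto
        then obtain g where g: "orthogonal_transformation g" "g (fst x) = norm (fst x) *\<^sub>R e"
          using orthogonal_transformation_exists by blast
        define A where "A = matrix g"
        have A: "orthogonal_matrix A" using g(1) by (simp add: A_def orthogonal_transformation_matrix)
        have Ag: "A *v y = g y" for y unfolding A_def using g(1) by (simp add: matrix_works orthogonal_transformation_linear)
        have cx: "symm A 0 x = c e" by (simp add: symm_def Ag g c_def)
        have o: "orthogonal_transformation (symm A (0::real^'m))" by (rule symm_orthogonal[OF A])
        have "dist (symm A 0 x) (symm A 0 y) = dist x y" for y
          using o by (simp add: dist_norm linear_diff[OF orthogonal_transformation_linear[OF o], symmetric] orthogonal_transformation_norm[OF o])
        then have ind: "indicator (ball (c e) 1) (symm A 0 y) = (indicator (ball x 1) y :: real)" for y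
          unfolding cx[symmetric] by (simp add: indicator_def)
        have "(LINT y|lborel. (u y)\<^sup>2 * indicator (ball (c e) 1) y) = (LINT y|lborel. (u (symm A 0 y))\<^sup>2 * indicator (ball (c e) 1) (symm A 0 y))"
          by (rule integral_symm[OF A, symmetric, of "\<lambda>y. (u y)\<^sup>2 * indicator (ball (c e) 1) y"])
            (intro borel_measurable_times borel_measurable_power um borel_measurable_indicator, simp)
        also have "\<dots> = (LINT y|lborel. (u y)\<^sup>2 * indicator (ball x 1) y)"
          unfolding ind
        proof (rule integral_cong_AE)
          show "AE y in lborel. (u (symm A 0 y))\<^sup>2 * indicator (ball x 1) y = (u y)\<^sup>2 * indicator (ball x 1) y"
            using ug A unfolding G_inv_iff by auto
          show "(\<lambda>y. (u y)\<^sup>2 * indicator (ball x 1) y) \<in> borel_measurable lborel"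
            using um by (simp, intro borel_measurable_times borel_measurable_power borel_measurable_indicator) auto
          show "(\<lambda>y. (u (symm A 0 y))\<^sup>2 * indicator (ball x 1) y) \<in> borel_measurable lborel"
            using measurable_compose[OF symm_measurable um] by (simp, intro borel_measurable_times borel_measurable_power borel_measurable_indicator) auto
        qed
        finally show ?thesis .
      qed
      have i: "integrable lborel (\<lambda>y. (u y)\<^sup>2 * indicator (ball (c e) 1) y)" for e
        by (intro integrable_square_indicator uL) simp
      have "real n * \<delta> \<le> (\<Sum>e\<in>E. LINT y|lborel. (u y)\<^sup>2 * indicator (ball (c e) 1) y)"
        using sum_mono[of E "\<lambda>_. \<delta>" "\<lambda>e. LINT y|lborel. (u y)\<^sup>2 * indicator (ball (c e) 1) y"] same mass E(2) by simp
      also have "\<dots> = (LINT y|lborel. (\<Sum>e\<in>E. (u y)\<^sup>2 * indicator (ball (c e) 1) y))"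
        using i by (intro Bochner_Integration.integral_sum[symmetric]) auto
      also have "\<dots> \<le> (LINT y|lborel. (u y)\<^sup>2)"
      proof (rule integral_mono)
        show "integrable lborel (\<lambda>y. \<Sum>e\<in>E. (u y)\<^sup>2 * indicator (ball (c e) 1) y)" using i by (intro Bochner_Integration.integrable_sum) auto
        show "integrable lborel (\<lambda>y. (u y)\<^sup>2)" by (rule L2_square_integrable[OF uL])
        fix y
        have "(\<Sum>e\<in>E. indicator (ball (c e) 1) y) \<le> (1::real)"
        proof (cases "\<exists>e\<in>E. y \<in> ball (c e) 1")
          case True
          then obtain e where e: "e \<in> E" "y \<in> ball (c e) 1" by blast
          have "(\<Sum>a\<in>E. indicator (ball (c a) 1) y) = (\<Sum>a\<in>E. if a = e then 1 else (0::real))"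
          proof (rule sum.cong[OF refl])
            fix a assume a: "a \<in> E"
            show "indicator (ball (c a) 1) y = (if a = e then 1 else (0::real))"
              using disj[OF a e(1)] e(2) by (auto simp: indicator_def simp del: mem_ball)
          qed
          then show ?thesis using E(1) by simp
        next
          case False
          then have "(\<Sum>a\<in>E. indicator (ball (c a) 1) y) = (0::real)" by (intro sum.neutral) (auto simp: indicator_def)
          then show ?thesis by simp
        qed
        then have "(u y)\<^sup>2 * (\<Sum>e\<in>E. indicator (ball (c e) 1) y) \<le> (u y)\<^sup>2 * 1" by (intro mult_left_mono) auto
        then show "(\<Sum>e\<in>E. (u y)\<^sup>2 * indicator (ball (c e) 1) y) \<le> (u y)\<^sup>2" by (simp add: sum_distrib_left)
      qed
      finally show False using uD n by linarith
    qed
  qed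
qed

subsection \<open>The functional\<close>

text \<open>The two \<open>itself\<close> parameters fix the types, and thereby the dimensions, to
  which all statements of the locale refer.\<close>

locale problem = nonlinearity f C0 p for f C0 p +
  fixes k :: real and tk :: "'k::finite itself" and tm :: "'m::finite itself"
  assumes K2: "CARD('k) \<ge> 2" and kpos: "0 < k"
    and p_less: "p < 2 * real (CARD('k) + CARD('m)) / (real (CARD('k) + CARD('m)) - 2)"
begin

lemma dim_eq: "DIM((real^'k) \<times> (real^'m)) = CARD('k) + CARD('m)"
  by simp

lemma dim_ge: "DIM((real^'k) \<times> (real^'m)) \<ge> 3"
proof -
  have "CARD('m) > 0" by simp
  then have "CARD('k) + CARD('m) \<ge> 3" using K2 by linarith
  then show ?thesis by (simp only: dim_eq)
qed

lemma Yspace_powr_bound: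
  assumes q: "2 \<le> q" "q < 2 * real (CARD('k) + CARD('m)) / (real (CARD('k) + CARD('m)) - 2)"
  obtains C where "C \<ge> 0" "\<And>u::(real^'k) \<times> (real^'m) \<Rightarrow> real. Yspace u \<Longrightarrow> Yform k u u \<le> D \<Longrightarrow>
    integrable lborel (\<lambda>x. \<bar>u x\<bar> powr q) \<and> (LINT x|lborel. \<bar>u x\<bar> powr q) \<le> C"
proof -
  obtain C where C: "C \<ge> 0" "\<And>u::(real^'k) \<times> (real^'m) \<Rightarrow> real. tr_bound u (D * (1 + 1 / k)) \<Longrightarrow>
    integrable lborel (\<lambda>x. \<bar>u x\<bar> powr q) \<and> (LINT x|lborel. \<bar>u x\<bar> powr q) \<le> C"
  proof (rule sobolev_bound[OF dim_ge q(1), of "D * (1 + 1 / k)"])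
    show "q < 2 * real DIM((real^'k) \<times> (real^'m)) / (real DIM((real^'k) \<times> (real^'m)) - 2)" unfolding dim_eq by (rule q)
  qed (rule that)
  show ?thesis by (rule that[of C]) (use C Yspace_tr_bound[OF kpos] in auto)
qed

lemma Yspace_powr_integrable:
  fixes u :: "(real^'k) \<times> (real^'m) \<Rightarrow> real"
  assumes q: "2 \<le> q" "q < 2 * real (CARD('k) + CARD('m)) / (real (CARD('k) + CARD('m)) - 2)" and u: "Yspace u"
  shows "integrable lborel (\<lambda>x. \<bar>u x\<bar> powr q)"
  by (rule Yspace_powr_bound[OF q, of "Yform k u u"]) (use u in auto)

section \<open>Integrals of the nonlinear terms\<close>

text \<open>L^2 together with L^p: the class in which the growth conditions control all integrals of
  f, F and \<open>H\<close>.\<close>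

definition adm :: "((real^'k) \<times> (real^'m) \<Rightarrow> real) \<Rightarrow> bool" where
  "adm u \<longleftrightarrow> u \<in> borel_measurable borel \<and> integrable lborel (\<lambda>x. (u x)\<^sup>2) \<and> integrable lborel (\<lambda>x. \<bar>u x\<bar> powr p)"

lemma Yspace_adm: "Yspace u \<Longrightarrow> adm u"
  unfolding adm_def using Yspace_measurable L2_square_integrable[OF Yspace_L2] Yspace_powr_integrable[OF _ p_less] p_gt by auto

lemma f_measurable[measurable]: "f \<in> borel_measurable borel"
  by (rule borel_measurable_continuous_onI[OF f_cont])

lemma prim_measurable[measurable]: "prim f \<in> borel_measurable borel"
  by (rule borel_measurable_continuous_onI[OF prim_cont])

lemma H_measurable[measurable]: "H \<in> borel_measurable borel"
  by (rule borel_measurable_continuous_onI[OF H_cont])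

text \<open>A single majorant for all dominated convergence arguments. The point r may be any value
  of size at most c(|s| + |t|), so that linear combinations and intermediate points of the mean
  value theorem are both covered.\<close>

lemma f_dominated:
  assumes c: "0 \<le> c"
  obtains K where "K \<ge> 0" "\<And>r s t. \<bar>r\<bar> \<le> c * (\<bar>s\<bar> + \<bar>t\<bar>) \<Longrightarrow>
     \<bar>f r\<bar> * (\<bar>s\<bar> + \<bar>t\<bar>) \<le> K * (s\<^sup>2 + t\<^sup>2 + \<bar>s\<bar> powr p + \<bar>t\<bar> powr p)"
proof -
  obtain C where C0: "C \<ge> 0" and C: "\<And>s. \<bar>f s\<bar> \<le> 1 * \<bar>s\<bar> + C * \<bar>s\<bar> powr (p - 1)"
    by (rule f_bound[OF zero_less_one]) (assumption | rule that)+
  define K where "K = 2 * c + C * c powr (p - 1) * 2 powr p"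
  show ?thesis
  proof (rule that[of K])
    show "K \<ge> 0" using c C0 by (simp add: K_def)
    fix r s t :: real assume r: "\<bar>r\<bar> \<le> c * (\<bar>s\<bar> + \<bar>t\<bar>)"
    define z where "z = \<bar>s\<bar> + \<bar>t\<bar>"
    have z: "z \<ge> 0" by (simp add: z_def)
    have "\<bar>f r\<bar> * z \<le> (c * z + C * (c * z) powr (p - 1)) * z"
    proof (rule mult_right_mono[OF order_trans[OF C] z], intro add_mono)
      show "1 * \<bar>r\<bar> \<le> c * z" using r by (simp add: z_def)
      show "C * \<bar>r\<bar> powr (p - 1) \<le> C * (c * z) powr (p - 1)"
        using r p_gt C0 by (intro mult_left_mono powr_mono2) (auto simp: z_def)
    qed
    also have "\<dots> = c * z\<^sup>2 + C * c powr (p - 1) * (z powr (p - 1) * z)"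
      using c z by (simp add: distrib_right power2_eq_square powr_mult mult.assoc)
    also have "z powr (p - 1) * z = z powr p" using z by (cases "z = 0") (simp_all add: powr_diff)
    also have "c * z\<^sup>2 + C * c powr (p - 1) * z powr p \<le> c * (2 * s\<^sup>2 + 2 * t\<^sup>2) + C * c powr (p - 1) * (2 powr p * (\<bar>s\<bar> powr p + \<bar>t\<bar> powr p))"
    proof (intro add_mono mult_left_mono)
      show "z\<^sup>2 \<le> 2 * s\<^sup>2 + 2 * t\<^sup>2" using square_add_le[of "\<bar>s\<bar>" "\<bar>t\<bar>"] by (simp add: z_def)
      show "z powr p \<le> 2 powr p * (\<bar>s\<bar> powr p + \<bar>t\<bar> powr p)" using powr_add_le[of p "\<bar>s\<bar>" "\<bar>t\<bar>"] p_gt by (simp add: z_def)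
    qed (use c C0 in auto)
    also have "\<dots> = (2 * c) * (s\<^sup>2 + t\<^sup>2) + (C * c powr (p - 1) * 2 powr p) * (\<bar>s\<bar> powr p + \<bar>t\<bar> powr p)"
      by (simp add: algebra_simps)
    also have "\<dots> \<le> K * (s\<^sup>2 + t\<^sup>2) + K * (\<bar>s\<bar> powr p + \<bar>t\<bar> powr p)"
      using c C0 by (intro add_mono mult_right_mono) (auto simp: K_def)
    finally show "\<bar>f r\<bar> * (\<bar>s\<bar> + \<bar>t\<bar>) \<le> K * (s\<^sup>2 + t\<^sup>2 + \<bar>s\<bar> powr p + \<bar>t\<bar> powr p)"
      by (simp add: z_def algebra_simps)
  qed
qed

lemma adm_dominant:
  "adm u \<Longrightarrow> adm v \<Longrightarrow> integrable lborel (\<lambda>x. K * ((u x)\<^sup>2 + (v x)\<^sup>2 + \<bar>u x\<bar> powr p + \<bar>v x\<bar> powr p))"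
  by (auto simp: adm_def)

lemma integrable_f_mult:
  assumes u: "adm u" and v: "adm v"
  shows "integrable lborel (\<lambda>x. f (u x) * v x)"
proof -
  obtain K where K: "\<And>r s t. \<bar>r\<bar> \<le> 1 * (\<bar>s\<bar> + \<bar>t\<bar>) \<Longrightarrow>
     \<bar>f r\<bar> * (\<bar>s\<bar> + \<bar>t\<bar>) \<le> K * (s\<^sup>2 + t\<^sup>2 + \<bar>s\<bar> powr p + \<bar>t\<bar> powr p)"
    by (rule f_dominated[OF zero_le_one]) (assumption | rule that)+
  have [measurable]: "u \<in> borel_measurable borel" "v \<in> borel_measurable borel" using u v by (auto simp: adm_def)
  show ?thesis
  proof (rule Bochner_Integration.integrable_bound[OF adm_dominant[OF u v, of K]])
    show "AE x in lborel. norm (f (u x) * v x) \<le> norm (K * ((u x)\<^sup>2 + (v x)\<^sup>2 + \<bar>u x\<bar> powr p + \<bar>v x\<bar> powr p))"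
    proof (rule AE_I2)
      fix x
      have "norm (f (u x) * v x) \<le> \<bar>f (u x)\<bar> * (\<bar>u x\<bar> + \<bar>v x\<bar>)" unfolding real_norm_def abs_mult by (intro mult_left_mono) auto
      also have "\<dots> \<le> K * ((u x)\<^sup>2 + (v x)\<^sup>2 + \<bar>u x\<bar> powr p + \<bar>v x\<bar> powr p)" by (rule K) simp
      finally show "norm (f (u x) * v x) \<le> norm (K * ((u x)\<^sup>2 + (v x)\<^sup>2 + \<bar>u x\<bar> powr p + \<bar>v x\<bar> powr p))" by simp
    qed
  qed measurable
qed

lemma integrable_prim:
  assumes u: "adm u"
  shows "integrable lborel (\<lambda>x. prim f (u x))"
proof -
  have [measurable]: "u \<in> borel_measurable borel" using u by (auto simp: adm_def)
  show ?thesis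
  proof (rule Bochner_Integration.integrable_bound[OF integrable_f_mult[OF u u]])
    show "AE x in lborel. norm (prim f (u x)) \<le> norm (f (u x) * u x)"
    proof (rule AE_I2)
      fix x
      show "norm (prim f (u x)) \<le> norm (f (u x) * u x)"
        using prim_nonneg[of "u x"] prim_le[of "u x"] f_mult_nonneg[of "u x"] unfolding real_norm_def by linarith
    qed
  qed measurable
qed

lemma integrable_H: "adm u \<Longrightarrow> integrable lborel (\<lambda>x. H (u x))"
  unfolding H_def using integrable_prim integrable_f_mult[of u u] by auto

text \<open>Gives continuity of the Nehari constraint jointly in the ray factor and in the size of
  the perturbation, as the intermediate value arguments require.\<close>

lemma tendsto_f_integral:
  assumes u: "adm u" and v: "adm v" and a: "a \<longlonglongrightarrow> a'" and b: "b \<longlonglongrightarrow> b'"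
  shows "(\<lambda>n. LINT x|lborel. f (a n * u x + b n * v x) * (a n * u x + b n * v x))
    \<longlonglongrightarrow> (LINT x|lborel. f (a' * u x + b' * v x) * (a' * u x + b' * v x))"
proof -
  obtain c1 where c1: "\<And>n. \<bar>a n\<bar> \<le> c1" using convergent_imp_Bseq[OF convergentI[OF a]] by (auto simp: Bseq_def)
  obtain c2 where c2: "\<And>n. \<bar>b n\<bar> \<le> c2" using convergent_imp_Bseq[OF convergentI[OF b]] by (auto simp: Bseq_def)
  define c where "c = max c1 c2"
  have c0: "0 \<le> c" using c1[of 0] by (simp add: c_def)
  have lin: "\<bar>a n * s + b n * t\<bar> \<le> c * (\<bar>s\<bar> + \<bar>t\<bar>)" for n s t
  proof -
    have "\<bar>a n * s + b n * t\<bar> \<le> \<bar>a n\<bar> * \<bar>s\<bar> + \<bar>b n\<bar> * \<bar>t\<bar>" by (metis abs_mult abs_triangle_ineq)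
    also have "\<dots> \<le> c * \<bar>s\<bar> + c * \<bar>t\<bar>"
      using order_trans[OF c1[of n] max.cobounded1[of c1 c2]] order_trans[OF c2[of n] max.cobounded2[of c2 c1]]
      by (intro add_mono mult_right_mono) (auto simp: c_def)
    finally show ?thesis by (simp add: distrib_left)
  qed
  obtain K where K: "\<And>r s t. \<bar>r\<bar> \<le> c * (\<bar>s\<bar> + \<bar>t\<bar>) \<Longrightarrow>
     \<bar>f r\<bar> * (\<bar>s\<bar> + \<bar>t\<bar>) \<le> K * (s\<^sup>2 + t\<^sup>2 + \<bar>s\<bar> powr p + \<bar>t\<bar> powr p)"
    by (rule f_dominated[OF c0]) (assumption | rule that)+
  have [measurable]: "u \<in> borel_measurable borel" "v \<in> borel_measurable borel" using u v by (auto simp: adm_def)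
  show ?thesis
  proof (rule integral_dominated_convergence[OF _ _ adm_dominant[OF u v, of "c * K"]])
    show "AE x in lborel. (\<lambda>n. f (a n * u x + b n * v x) * (a n * u x + b n * v x)) \<longlonglongrightarrow> f (a' * u x + b' * v x) * (a' * u x + b' * v x)"
      by (intro AE_I2 tendsto_mult isCont_tendsto_compose[OF f_isCont] tendsto_add a b tendsto_const)
    show "AE x in lborel. norm (f (a n * u x + b n * v x) * (a n * u x + b n * v x)) \<le> c * K * ((u x)\<^sup>2 + (v x)\<^sup>2 + \<bar>u x\<bar> powr p + \<bar>v x\<bar> powr p)" for n
    proof (rule AE_I2)
      fix x
      have "norm (f (a n * u x + b n * v x) * (a n * u x + b n * v x)) \<le> \<bar>f (a n * u x + b n * v x)\<bar> * (c * (\<bar>u x\<bar> + \<bar>v x\<bar>))"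
        unfolding real_norm_def abs_mult by (intro mult_left_mono lin) simp
      also have "\<dots> = c * (\<bar>f (a n * u x + b n * v x)\<bar> * (\<bar>u x\<bar> + \<bar>v x\<bar>))" by (simp only: mult_ac)
      also have "\<dots> \<le> c * (K * ((u x)\<^sup>2 + (v x)\<^sup>2 + \<bar>u x\<bar> powr p + \<bar>v x\<bar> powr p))" by (intro mult_left_mono K lin c0)
      finally show "norm (f (a n * u x + b n * v x) * (a n * u x + b n * v x)) \<le> c * K * ((u x)\<^sup>2 + (v x)\<^sup>2 + \<bar>u x\<bar> powr p + \<bar>v x\<bar> powr p)" by (simp add: mult.assoc)
    qed
  qed measurable
qed

lemma prim_mean_value: "\<exists>\<xi>. \<bar>\<xi> - a\<bar> \<le> \<bar>b\<bar> \<and> prim f (a + b) - prim f a = b * f \<xi>"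
proof (cases b "0::real" rule: linorder_cases)
  case less
  then have "a + b < a" by simp
  then obtain z where "a + b < z" "z < a" "prim f a - prim f (a + b) = (a - (a + b)) * f z"
    using MVT2[of "a + b" a "prim f" f] prim_deriv by blast
  then show ?thesis by (intro exI[of _ z]) auto
next
  case greater
  then have "a < a + b" by simp
  then obtain z where "a < z" "z < a + b" "prim f (a + b) - prim f a = (a + b - a) * f z"
    using MVT2[of a "a + b" "prim f" f] prim_deriv by blast
  then show ?thesis by (intro exI[of _ z]) auto
qed auto

text \<open>A directional derivative with moving base point \<open>a n * u\<close>: in the
  criticality proof the ray factor tends to 1 simultaneously with the perturbation tending to
  0.\<close>

lemma tendsto_prim_quotient:
  assumes u: "adm u" and v: "adm v" and a: "a \<longlonglongrightarrow> 1" and b: "b \<longlonglongrightarrow> 0" and b0: "\<And>n. b n \<noteq> 0"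
  shows "(\<lambda>n. LINT x|lborel. (prim f (a n * u x + b n * v x) - prim f (a n * u x)) / b n) \<longlonglongrightarrow> (LINT x|lborel. f (u x) * v x)"
proof -
  obtain c1 where c1: "\<And>n. \<bar>a n\<bar> \<le> c1" using convergent_imp_Bseq[OF convergentI[OF a]] by (auto simp: Bseq_def)
  obtain c2 where c2: "\<And>n. \<bar>b n\<bar> \<le> c2" using convergent_imp_Bseq[OF convergentI[OF b]] by (auto simp: Bseq_def)
  define c where "c = max c1 c2"
  have c0: "0 \<le> c" using c1[of 0] by (simp add: c_def)
  obtain K where K: "\<And>r s t. \<bar>r\<bar> \<le> c * (\<bar>s\<bar> + \<bar>t\<bar>) \<Longrightarrow>
     \<bar>f r\<bar> * (\<bar>s\<bar> + \<bar>t\<bar>) \<le> K * (s\<^sup>2 + t\<^sup>2 + \<bar>s\<bar> powr p + \<bar>t\<bar> powr p)"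
    by (rule f_dominated[OF c0]) (assumption | rule that)+
  have [measurable]: "u \<in> borel_measurable borel" "v \<in> borel_measurable borel" using u v by (auto simp: adm_def)
  obtain \<xi> where xi1: "\<And>n x. \<bar>\<xi> n x - a n * u x\<bar> \<le> \<bar>b n * v x\<bar>"
    and xi2: "\<And>n x. prim f (a n * u x + b n * v x) - prim f (a n * u x) = b n * v x * f (\<xi> n x)"
  proof -
    have "\<forall>n x. \<exists>\<xi>. \<bar>\<xi> - a n * u x\<bar> \<le> \<bar>b n * v x\<bar> \<and> prim f (a n * u x + b n * v x) - prim f (a n * u x) = b n * v x * f \<xi>"
      using prim_mean_value by blast
    then obtain \<xi> where "\<forall>n x. \<bar>\<xi> n x - a n * u x\<bar> \<le> \<bar>b n * v x\<bar> \<and> prim f (a n * u x + b n * v x) - prim f (a n * u x) = b n * v x * f (\<xi> n x)"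
      unfolding choice_iff by blast
    then show thesis using that by blast
  qed
  have q: "(prim f (a n * u x + b n * v x) - prim f (a n * u x)) / b n = f (\<xi> n x) * v x" for n x
    using b0[of n] by (simp add: xi2)
  have xib: "\<bar>\<xi> n x\<bar> \<le> c * (\<bar>u x\<bar> + \<bar>v x\<bar>)" for n x
  proof -
    have "\<bar>\<xi> n x\<bar> \<le> \<bar>a n\<bar> * \<bar>u x\<bar> + \<bar>b n\<bar> * \<bar>v x\<bar>" using xi1[of n x] unfolding abs_mult[symmetric] by linarith
    also have "\<dots> \<le> c * \<bar>u x\<bar> + c * \<bar>v x\<bar>"
      using order_trans[OF c1[of n] max.cobounded1[of c1 c2]] order_trans[OF c2[of n] max.cobounded2[of c2 c1]]
      by (intro add_mono mult_right_mono) (auto simp: c_def)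
    finally show ?thesis by (simp add: distrib_left)
  qed
  show ?thesis
  proof (rule integral_dominated_convergence[OF _ _ adm_dominant[OF u v, of K]])
    show "AE x in lborel. (\<lambda>n. (prim f (a n * u x + b n * v x) - prim f (a n * u x)) / b n) \<longlonglongrightarrow> f (u x) * v x"
    proof (rule AE_I2)
      fix x
      have "(\<lambda>n. \<bar>b n * v x\<bar>) \<longlonglongrightarrow> \<bar>0 * v x\<bar>" by (intro tendsto_intros b)
      then have "(\<lambda>n. \<bar>b n * v x\<bar>) \<longlonglongrightarrow> 0" by simp
      then have "(\<lambda>n. \<xi> n x - a n * u x) \<longlonglongrightarrow> 0" by (rule Lim_null_comparison[rotated]) (simp add: xi1)
      from tendsto_add[OF this tendsto_mult[OF a tendsto_const[of "u x"]]] have "(\<lambda>n. \<xi> n x) \<longlonglongrightarrow> u x" by simp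
      then have "(\<lambda>n. f (\<xi> n x) * v x) \<longlonglongrightarrow> f (u x) * v x" by (intro tendsto_mult tendsto_const isCont_tendsto_compose[OF f_isCont])
      then show "(\<lambda>n. (prim f (a n * u x + b n * v x) - prim f (a n * u x)) / b n) \<longlonglongrightarrow> f (u x) * v x" by (simp only: q)
    qed
    show "AE x in lborel. norm ((prim f (a n * u x + b n * v x) - prim f (a n * u x)) / b n) \<le> K * ((u x)\<^sup>2 + (v x)\<^sup>2 + \<bar>u x\<bar> powr p + \<bar>v x\<bar> powr p)" for n
    proof (rule AE_I2)
      fix x
      have "norm (f (\<xi> n x) * v x) \<le> \<bar>f (\<xi> n x)\<bar> * (\<bar>u x\<bar> + \<bar>v x\<bar>)" unfolding real_norm_def abs_mult by (intro mult_left_mono) auto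
      also have "\<dots> \<le> K * ((u x)\<^sup>2 + (v x)\<^sup>2 + \<bar>u x\<bar> powr p + \<bar>v x\<bar> powr p)" by (rule K[OF xib])
      finally show "norm ((prim f (a n * u x + b n * v x) - prim f (a n * u x)) / b n) \<le> K * ((u x)\<^sup>2 + (v x)\<^sup>2 + \<bar>u x\<bar> powr p + \<bar>v x\<bar> powr p)" by (simp only: q)
    qed
  qed measurable
qed

section \<open>The Nehari set: rays, projection and energy levels\<close>

sublocale Y: pre_hilbert "{u::(real^'k) \<times> (real^'m) \<Rightarrow> real. Yspace u}" "Yform k"
  by (rule pre_hilbert_Y[OF kpos])

lemma Phi_eq: "Phi k f u = Yform k u u / 2 - (LINT x|lborel. prim f (u x))"
  using kpos by (simp add: Phi_def quad_k_eq)

lemma Nehari_iff: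
  "u \<in> Nehari k f \<longleftrightarrow> Yspace u \<and> G_inv u \<and> \<not> (AE x in lborel. u x = 0) \<and> Yform k u u = (LINT x|lborel. f (u x) * u x)"
  using kpos by (simp add: Nehari_def quad_k_eq)

lemma Yspace_scale: "Yspace u \<Longrightarrow> Yspace (\<lambda>x. a * u x)"
  using Yspace_lin[of u u a 0] by simp

lemma G_inv_scale: "G_inv u \<Longrightarrow> G_inv (\<lambda>x. a * u x)"
  using G_inv_lin[of u u a 0] by simp

lemma Yspace_diff: "Yspace u \<Longrightarrow> Yspace v \<Longrightarrow> Yspace (\<lambda>x. u x - v x)"
  using Yspace_lin[of u v 1 "-1"] by simp

lemma B_scale: "Yspace u \<Longrightarrow> Yform k (\<lambda>x. a * u x) (\<lambda>x. a * u x) = a\<^sup>2 * Yform k u u"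
  for u :: "(real^'k) \<times> (real^'m) \<Rightarrow> real"
  using Y.B_scale[of u a] by simp

lemma B_pos: "Yspace u \<Longrightarrow> \<not> (AE x in lborel. u x = 0) \<Longrightarrow> 0 < Yform k u u"
  for u :: "(real^'k) \<times> (real^'m) \<Rightarrow> real"
  using B_zero[OF kpos, of u] Y.B_pos[of u] by (auto simp: less_le)

text \<open>Integrate \<open>prim_scaled_ge\<close>; the Nehari identity turns its left side into
  the change of the quadratic part.\<close>

lemma Phi_scale_le:
  fixes u :: "(real^'k) \<times> (real^'m) \<Rightarrow> real"
  assumes u: "u \<in> Nehari k f" and s: "0 \<le> s"
  shows "Phi k f (\<lambda>x. s * u x) \<le> Phi k f u"
proof -
  have Yu: "Yspace u" and e: "Yform k u u = (LINT x|lborel. f (u x) * u x)" using u by (auto simp: Nehari_iff)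
  note a = Yspace_adm[OF Yu] and as = Yspace_adm[OF Yspace_scale[OF Yu, of s]]
  have "(s\<^sup>2 - 1) / 2 * Yform k u u = (LINT x|lborel. (s\<^sup>2 - 1) / 2 * (f (u x) * u x))" by (simp add: e)
  also have "\<dots> \<le> (LINT x|lborel. prim f (s * u x) - prim f (u x))"
    using integrable_f_mult[OF a a] integrable_prim[OF a] integrable_prim[OF as]
    by (intro integral_mono prim_scaled_ge s) auto
  also have "\<dots> = (LINT x|lborel. prim f (s * u x)) - (LINT x|lborel. prim f (u x))"
    using integrable_prim[OF a] integrable_prim[OF as] by simp
  finally show ?thesis unfolding Phi_eq B_scale[OF Yu] by (simp add: field_simps)
qed

lemma Nehari_Phi:
  fixes u :: "(real^'k) \<times> (real^'m) \<Rightarrow> real"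
  assumes u: "u \<in> Nehari k f"
  shows "Phi k f u = (LINT x|lborel. H (u x))"
proof -
  have Yu: "Yspace u" and e: "Yform k u u = (LINT x|lborel. f (u x) * u x)" using u by (auto simp: Nehari_iff)
  note a = Yspace_adm[OF Yu]
  show ?thesis unfolding Phi_eq e H_def using integrable_f_mult[OF a a] integrable_prim[OF a] by simp
qed

lemma H_integral_nonneg: "0 \<le> (LINT x|lborel. H (u x))"
  by (intro integral_nonneg_AE AE_I2 H_nonneg)

text \<open>The defect \<psi> is at most 0 at t = 1 by hypothesis and nonnegative at some small t,
  since f is superlinear at 0; a zero lies between. Because t \<le> 1, monotonicity of
  \<open>H\<close> along rays compares the energy of the projection with the integral of
  \<open>H\<close> at w itself.\<close>

lemma Nehari_projection:
  fixes w :: "(real^'k) \<times> (real^'m) \<Rightarrow> real"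
  assumes Yw: "Yspace w" and Gw: "G_inv w" and w0: "\<not> (AE x in lborel. w x = 0)"
    and le: "Yform k w w \<le> (LINT x|lborel. f (w x) * w x)"
  obtains t where "0 < t" "t \<le> 1" "(\<lambda>x. t * w x) \<in> Nehari k f" "Phi k f (\<lambda>x. t * w x) \<le> (LINT x|lborel. H (w x))"
proof -
  note a = Yspace_adm[OF Yw]
  have Q: "Yform k w w > 0" by (rule B_pos[OF Yw w0])
  define \<psi> where "\<psi> t = t\<^sup>2 * Yform k w w - (LINT x|lborel. f (t * w x) * (t * w x))" for t
  have cont: "continuous_on UNIV \<psi>"
  proof (rule continuous_on_sequentiallyI)
    fix s :: "nat \<Rightarrow> real" and s' assume "s \<longlonglongrightarrow> s'"
    then show "(\<lambda>n. \<psi> (s n)) \<longlonglongrightarrow> \<psi> s'"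
      using tendsto_f_integral[OF a a, of s s' "\<lambda>_. 0" 0] unfolding \<psi>_def by (intro tendsto_intros) auto
  qed
  have "\<psi> 1 \<le> 0" using le by (simp add: \<psi>_def)
  \<comment> \<open>With the factor k/2 the quadratic part of f costs at most half of the form,
    since k times the L^2 norm square is bounded by it.\<close>
  obtain C where C: "C \<ge> 0" "\<And>s. f s * s \<le> k / 2 * s\<^sup>2 + C * \<bar>s\<bar> powr p" using f_mult_bound[of "k / 2"] kpos by auto
  define P where "P = (LINT x|lborel. \<bar>w x\<bar> powr p)"
  have P: "P \<ge> 0" by (simp add: P_def)
  have est: "\<psi> t \<ge> t\<^sup>2 * (Yform k w w / 2 - C * P * t powr (p - 2))" if t: "0 < t" for t
  proof -
    have "(LINT x|lborel. f (t * w x) * (t * w x)) \<le> (LINT x|lborel. k / 2 * t\<^sup>2 * (w x)\<^sup>2 + C * t powr p * \<bar>w x\<bar> powr p)"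
    proof (rule integral_mono)
      show "integrable lborel (\<lambda>x. f (t * w x) * (t * w x))" using integrable_f_mult[OF Yspace_adm[OF Yspace_scale[OF Yw]] Yspace_adm[OF Yspace_scale[OF Yw]]] .
      show "integrable lborel (\<lambda>x. k / 2 * t\<^sup>2 * (w x)\<^sup>2 + C * t powr p * \<bar>w x\<bar> powr p)" using a by (simp add: adm_def)
      show "f (t * w x) * (t * w x) \<le> k / 2 * t\<^sup>2 * (w x)\<^sup>2 + C * t powr p * \<bar>w x\<bar> powr p" for x
        using C(2)[of "t * w x"] t by (simp add: power_mult_distrib abs_mult powr_mult mult.assoc)
    qed
    also have "\<dots> = t\<^sup>2 / 2 * (k * (LINT x|lborel. (w x)\<^sup>2)) + C * t powr p * P" using a by (simp add: adm_def P_def)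
    also have "\<dots> \<le> t\<^sup>2 / 2 * Yform k w w + C * t powr p * P"
      using B_bounds(1)[OF kpos Yw] by (intro add_right_mono mult_left_mono) auto
    also have "t powr p = t\<^sup>2 * t powr (p - 2)"
    proof -
      have "t powr p = t powr (2 + (p - 2))" by simp
      also have "\<dots> = t powr 2 * t powr (p - 2)" by (rule powr_add)
      finally show ?thesis using t by simp
    qed
    finally show ?thesis unfolding \<psi>_def by (simp add: algebra_simps)
  qed
  have "((\<lambda>t. C * P * t powr (p - 2)) \<longlongrightarrow> C * P * 0 powr (p - 2)) (at_right 0)"
    using p_gt eventually_at_right_less[of 0] by (intro tendsto_mult tendsto_const tendsto_powr2) (auto elim: eventually_mono)
  then have "((\<lambda>t. C * P * t powr (p - 2)) \<longlongrightarrow> 0) (at_right 0)" by simp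
  moreover have "Yform k w w / 2 > 0" using Q by simp
  ultimately have "\<forall>\<^sub>F t in at_right 0. C * P * t powr (p - 2) < Yform k w w / 2" by (rule order_tendstoD)
  moreover have "\<forall>\<^sub>F t in at_right 0. t \<in> {0<..<1::real}" by (rule eventually_at_right_real) simp
  ultimately have "\<forall>\<^sub>F t in at_right (0::real). t \<in> {0<..<1} \<and> C * P * t powr (p - 2) < Yform k w w / 2" by (rule eventually_elim2) blast
  then obtain t0 where t0: "0 < t0" "t0 < 1" "C * P * t0 powr (p - 2) < Yform k w w / 2"
    using eventually_happens[of _ "at_right (0::real)"] by (auto simp: trivial_limit_at_right_real)
  have "0 \<le> t0\<^sup>2 * (Yform k w w / 2 - C * P * t0 powr (p - 2))" using t0 by (intro mult_nonneg_nonneg) auto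
  then have "\<psi> t0 \<ge> 0" using est[OF t0(1)] by linarith
  obtain t where t: "t0 \<le> t" "t \<le> 1" "\<psi> t = 0"
    using IVT2'[of \<psi> 1 0 t0] \<open>\<psi> 1 \<le> 0\<close> \<open>\<psi> t0 \<ge> 0\<close> t0 continuous_on_subset[OF cont] by auto
  have tpos: "t > 0" using t t0 by simp
  have N: "(\<lambda>x. t * w x) \<in> Nehari k f"
    unfolding Nehari_iff
  proof (intro conjI)
    show "Yspace (\<lambda>x. t * w x)" "G_inv (\<lambda>x. t * w x)" by (rule Yspace_scale[OF Yw], rule G_inv_scale[OF Gw])
    show "\<not> (AE x in lborel. t * w x = 0)" using w0 tpos by simp
    show "Yform k (\<lambda>x. t * w x) (\<lambda>x. t * w x) = (LINT x|lborel. f (t * w x) * (t * w x))"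
      using t(3) by (simp add: B_scale[OF Yw] \<psi>_def)
  qed
  have "Phi k f (\<lambda>x. t * w x) = (LINT x|lborel. H (t * w x))" by (rule Nehari_Phi[OF N])
  also have "\<dots> \<le> (LINT x|lborel. H (w x))"
    using integrable_H[OF a] integrable_H[OF Yspace_adm[OF Yspace_scale[OF Yw]]] t tpos by (intro integral_mono H_mono) auto
  finally show ?thesis using that tpos t N by blast
qed

text \<open>The energy of u dominates the energy at distance s on its ray, for every s. Lower bounds
  for unit vectors thereby become bounds for u that do not involve its norm.\<close>

lemma Nehari_normalized:
  fixes u :: "(real^'k) \<times> (real^'m) \<Rightarrow> real"
  assumes u: "u \<in> Nehari k f"
  obtains q where "q > 0" "q\<^sup>2 = Yform k u u" "Yspace (\<lambda>x. 1 / q * u x)" "Yform k (\<lambda>x. 1 / q * u x) (\<lambda>x. 1 / q * u x) = 1"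
    "\<And>s. 0 \<le> s \<Longrightarrow> s\<^sup>2 / 2 - (LINT x|lborel. prim f (s * (1 / q * u x))) \<le> Phi k f u"
proof -
  have Yu: "Yspace u" and e: "Yform k u u = (LINT x|lborel. f (u x) * u x)" and Q: "Yform k u u > 0"
    using u B_pos[of u] by (auto simp: Nehari_iff)
  define q where "q = sqrt (Yform k u u)"
  have q: "q > 0" "q\<^sup>2 = Yform k u u" using Q by (auto simp: q_def)
  have B1: "Yform k (\<lambda>x. 1 / q * u x) (\<lambda>x. 1 / q * u x) = 1"
    unfolding B_scale[OF Yu] q(2)[symmetric] using q(1) by (simp add: power_divide)
  show ?thesis
  proof (rule that[OF q Yspace_scale[OF Yu] B1])
    fix s :: real assume s: "0 \<le> s"
    have "Phi k f (\<lambda>x. s * (1 / q * u x)) \<le> Phi k f u"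
      using Phi_scale_le[OF u, of "s / q"] s q by (simp add: mult.assoc[symmetric])
    then show "s\<^sup>2 / 2 - (LINT x|lborel. prim f (s * (1 / q * u x))) \<le> Phi k f u"
      unfolding Phi_eq B_scale[OF Yspace_scale[OF Yu]] B1 by simp
  qed
qed

lemma prim_integral_bound:
  fixes w :: "(real^'k) \<times> (real^'m) \<Rightarrow> real"
  assumes Yw: "Yspace w" and B1: "Yform k w w = 1" and e: "e > 0" and s: "0 \<le> s"
    and C: "C \<ge> 0" "\<And>s. f s * s \<le> e * s\<^sup>2 + C * \<bar>s\<bar> powr p"
  shows "(LINT x|lborel. prim f (s * w x)) \<le> e * s\<^sup>2 / k + C * s powr p * (LINT x|lborel. \<bar>w x\<bar> powr p)"
proof -
  note a = Yspace_adm[OF Yw]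
  have "(LINT x|lborel. prim f (s * w x)) \<le> (LINT x|lborel. e * s\<^sup>2 * (w x)\<^sup>2 + C * s powr p * \<bar>w x\<bar> powr p)"
  proof (rule integral_mono)
    show "integrable lborel (\<lambda>x. prim f (s * w x))" by (rule integrable_prim[OF Yspace_adm[OF Yspace_scale[OF Yw]]])
    show "integrable lborel (\<lambda>x. e * s\<^sup>2 * (w x)\<^sup>2 + C * s powr p * \<bar>w x\<bar> powr p)" using a by (simp add: adm_def)
    fix x
    have "prim f (s * w x) \<le> f (s * w x) * (s * w x)" using prim_le[of "s * w x"] f_mult_nonneg[of "s * w x"] by linarith
    also have "\<dots> \<le> e * (s * w x)\<^sup>2 + C * \<bar>s * w x\<bar> powr p" by (rule C)
    finally show "prim f (s * w x) \<le> e * s\<^sup>2 * (w x)\<^sup>2 + C * s powr p * \<bar>w x\<bar> powr p"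
      using s by (simp add: power_mult_distrib abs_mult powr_mult mult.assoc)
  qed
  also have "\<dots> = e * s\<^sup>2 * (LINT x|lborel. (w x)\<^sup>2) + C * s powr p * (LINT x|lborel. \<bar>w x\<bar> powr p)" using a by (simp add: adm_def)
  also have "\<dots> \<le> e * s\<^sup>2 * (1 / k) + C * s powr p * (LINT x|lborel. \<bar>w x\<bar> powr p)"
    using B_bounds(1)[OF kpos Yw] kpos e B1 by (intro add_right_mono mult_left_mono) (auto simp: field_simps)
  finally show ?thesis by simp
qed

lemma Nehari_lower_bound:
  obtains c where "c > 0" "\<And>u::(real^'k) \<times> (real^'m) \<Rightarrow> real. u \<in> Nehari k f \<Longrightarrow> c \<le> Phi k f u"
proof -
  obtain P where P: "P \<ge> 0" "\<And>u::(real^'k) \<times> (real^'m) \<Rightarrow> real. Yspace u \<Longrightarrow> Yform k u u \<le> 1 \<Longrightarrow>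
    integrable lborel (\<lambda>x. \<bar>u x\<bar> powr p) \<and> (LINT x|lborel. \<bar>u x\<bar> powr p) \<le> P"
  proof (rule Yspace_powr_bound[OF _ p_less, of 1])
    show "2 \<le> p" using p_gt by simp
  qed (rule that)
  obtain C where C: "C \<ge> 0" "\<And>s. f s * s \<le> k / 4 * s\<^sup>2 + C * \<bar>s\<bar> powr p" using f_mult_bound[of "k / 4"] kpos by auto
  \<comment> \<open>Makes C P s^p at most s^2/8; together with s^2/4 from the quadratic part, s^2/2
    - s^2/4 - s^2/8 = s^2/8 remains.\<close>
  define s where "s = (1 / (8 * (C * P + 1))) powr (1 / (p - 2))"
  have CP: "C * P \<ge> 0" using C P by simp
  have s: "s > 0" "s powr (p - 2) = 1 / (8 * (C * P + 1))" using CP p_gt by (auto simp: s_def powr_powr)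
  have sp: "C * P * s powr p \<le> s\<^sup>2 / 8"
  proof -
    have "s powr p = s powr (2 + (p - 2))" by simp
    also have "\<dots> = s powr 2 * s powr (p - 2)" by (rule powr_add)
    also have "\<dots> = s\<^sup>2 * (1 / (8 * (C * P + 1)))" using s by simp
    finally have "C * P * s powr p = s\<^sup>2 / 8 * (C * P / (C * P + 1))" by simp
    also have "\<dots> \<le> s\<^sup>2 / 8" using CP by (intro mult_left_le) auto
    finally show ?thesis .
  qed
  show ?thesis
  proof (rule that[of "s\<^sup>2 / 8"])
    show "s\<^sup>2 / 8 > 0" using s by simp
    fix u :: "(real^'k) \<times> (real^'m) \<Rightarrow> real" assume u: "u \<in> Nehari k f"
    obtain q where Yw: "Yspace (\<lambda>x. 1 / q * u x)" and B1: "Yform k (\<lambda>x. 1 / q * u x) (\<lambda>x. 1 / q * u x) = 1"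
      and ph: "\<And>s. 0 \<le> s \<Longrightarrow> s\<^sup>2 / 2 - (LINT x|lborel. prim f (s * (1 / q * u x))) \<le> Phi k f u"
      by (rule Nehari_normalized[OF u]) (assumption | rule that)+
    have "(LINT x|lborel. prim f (s * (1 / q * u x))) \<le> k / 4 * s\<^sup>2 / k + C * s powr p * (LINT x|lborel. \<bar>1 / q * u x\<bar> powr p)"
      using s kpos by (intro prim_integral_bound[OF Yw B1 _ _ C]) auto
    also have "\<dots> \<le> s\<^sup>2 / 4 + C * s powr p * P"
      using P(2)[OF Yw] B1 C(1) kpos by (intro add_mono mult_left_mono) auto
    also have "\<dots> \<le> s\<^sup>2 / 4 + s\<^sup>2 / 8" using sp by (simp add: mult_ac)
    finally show "s\<^sup>2 / 8 \<le> Phi k f u" using ph[of s] s by simp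
  qed
qed

text \<open>If the normalized function had small mass in every unit ball, \<open>vanishing\<close>
  would make F negligible at a fixed large distance on its ray, where the energy would then exceed
  b. So some unit ball carries a fixed fraction of the form of u; on it (F3) gives \<integral> F(u)
  \<ge> Q(u) - const. Nonnegativity of the energy gives \<integral> F(u) \<le> Q(u)/2, and Q(u) is
  bounded.\<close>

lemma Nehari_level_bounds:
  assumes b: "0 \<le> b"
  obtains K \<delta> where "\<delta> > 0" "\<And>u::(real^'k) \<times> (real^'m) \<Rightarrow> real. u \<in> Nehari k f \<Longrightarrow> Phi k f u \<le> b \<Longrightarrow>
    Yform k u u \<le> K \<and> (\<exists>x. \<delta> * Yform k u u \<le> (LINT y|lborel. (u y)\<^sup>2 * indicator (ball x 1) y))"
proof -
  \<comment> \<open>The quadratic energy at distance s is b + 2. The constants e and c below limit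
    the integral of F there to 1/2 + 1/2, which would leave energy b + 1.\<close>
  define s where "s = sqrt (2 * (b + 2))"
  have s: "s > 0" "s\<^sup>2 = 2 * (b + 2)" using b by (auto simp: s_def)
  define e where "e = k / (2 * s\<^sup>2)"
  have e: "e > 0" "e * s\<^sup>2 / k = 1 / 2" using kpos s(1) by (auto simp: e_def)
  obtain C where C: "C \<ge> 0" "\<And>s. f s * s \<le> e * s\<^sup>2 + C * \<bar>s\<bar> powr p" using f_mult_bound[OF e(1)] by auto
  define c where "c = 1 / (2 * (C * s powr p + 1))"
  have Cs: "0 \<le> C * s powr p" using C by simp
  have c: "c > 0" using Cs by (simp add: c_def)
  have cC: "C * s powr p * c \<le> 1 / 2"
  proof -
    have "C * s powr p * c = 1 / 2 * (C * s powr p / (C * s powr p + 1))" by (simp add: c_def)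
    also have "\<dots> \<le> 1 / 2" using Cs by (intro mult_left_le) auto
    finally show ?thesis .
  qed
  obtain \<delta> where d: "\<delta> > 0" "\<And>u::(real^'k) \<times> (real^'m) \<Rightarrow> real. tr_bound u (1 * (1 + 1 / k)) \<Longrightarrow>
    \<forall>x. (LINT y|lborel. (u y)\<^sup>2 * indicator (ball x 1) y) \<le> \<delta> \<Longrightarrow> (LINT x|lborel. \<bar>u x\<bar> powr p) \<le> c"
  proof (rule vanishing[OF dim_ge p_gt _ c, of "1 * (1 + 1 / k)"])
    show "p < 2 * real DIM((real^'k) \<times> (real^'m)) / (real DIM((real^'k) \<times> (real^'m)) - 2)" unfolding dim_eq by (rule p_less)
  qed (rule that)
  \<comment> \<open>The slope 1/\<delta> cancels the fraction \<delta> of the form carried by the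
    ball, so that the whole form reappears in the lower bound.\<close>
  obtain s0 where s0: "\<And>s. 1 / \<delta> * s\<^sup>2 - 1 / \<delta> * s0\<^sup>2 \<le> prim f s"
  proof (rule prim_lower[of "1 / \<delta>"])
    show "0 < 1 / \<delta>" using d(1) by simp
  qed (rule that)
  define V where "V = measure lborel (ball (0::(real^'k) \<times> (real^'m)) 1)"
  show ?thesis
  proof (rule that[of \<delta> "2 * (1 / \<delta> * s0\<^sup>2 * V)"])
    show "\<delta> > 0" by (rule d)
    fix u :: "(real^'k) \<times> (real^'m) \<Rightarrow> real" assume u: "u \<in> Nehari k f" and ub: "Phi k f u \<le> b"
    have Yu: "Yspace u" using u by (simp add: Nehari_iff)
    note uL = Yspace_L2[OF Yu]
    obtain q where q: "q > 0" "q\<^sup>2 = Yform k u u" and Yw: "Yspace (\<lambda>x. 1 / q * u x)" and B1: "Yform k (\<lambda>x. 1 / q * u x) (\<lambda>x. 1 / q * u x) = 1"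
      and ph: "\<And>s. 0 \<le> s \<Longrightarrow> s\<^sup>2 / 2 - (LINT x|lborel. prim f (s * (1 / q * u x))) \<le> Phi k f u"
      by (rule Nehari_normalized[OF u]) (assumption | rule that)+
    have sc: "(LINT y|lborel. (1 / q * u y)\<^sup>2 * indicator (ball x 1) y) = (LINT y|lborel. (u y)\<^sup>2 * indicator (ball x 1) y) / Yform k u u" for x
      unfolding q(2)[symmetric] by (simp add: power_mult_distrib power_divide)
    have Q: "Yform k u u > 0" unfolding q(2)[symmetric] using q(1) by simp
    have "\<exists>x. \<delta> < (LINT y|lborel. (1 / q * u y)\<^sup>2 * indicator (ball x 1) y)"
    proof (rule ccontr)
      assume "\<nexists>x. \<delta> < (LINT y|lborel. (1 / q * u y)\<^sup>2 * indicator (ball x 1) y)"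
      then have small: "(LINT y|lborel. (1 / q * u y)\<^sup>2 * indicator (ball x 1) y) \<le> \<delta>" for x using not_le by blast
      have pc: "(LINT x|lborel. \<bar>1 / q * u x\<bar> powr p) \<le> c"
        by (rule d(2)[OF Yspace_tr_bound[OF kpos Yw eq_refl[OF B1]]]) (use small in blast)
      have "(LINT x|lborel. prim f (s * (1 / q * u x))) \<le> e * s\<^sup>2 / k + C * s powr p * (LINT x|lborel. \<bar>1 / q * u x\<bar> powr p)"
        using s by (intro prim_integral_bound[OF Yw B1 e(1) _ C]) auto
      also have "\<dots> \<le> 1 / 2 + C * s powr p * c" unfolding e(2) by (intro add_left_mono mult_left_mono pc Cs)
      finally have "(LINT x|lborel. prim f (s * (1 / q * u x))) \<le> 1" using cC by linarith
      then have "b + 2 - 1 \<le> s\<^sup>2 / 2 - (LINT x|lborel. prim f (s * (1 / q * u x)))" 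
        unfolding s(2) nonzero_mult_div_cancel_left[OF zero_neq_numeral[symmetric]] by (rule diff_left_mono)
      also have "\<dots> \<le> b" using ph[OF less_imp_le[OF s(1)]] ub by (rule order_trans)
      finally show False by simp
    qed
    then obtain x where x: "\<delta> < (LINT y|lborel. (u y)\<^sup>2 * indicator (ball x 1) y) / Yform k u u" unfolding sc by blast
    then have mass: "\<delta> * Yform k u u \<le> (LINT y|lborel. (u y)\<^sup>2 * indicator (ball x 1) y)" using Q by (simp add: field_simps)
    have Vx: "measure lborel (ball x 1) = V" using content_ball_conv_unit_ball[of 1 x] by (simp add: V_def)
    have fin: "emeasure lborel (ball x 1) < \<infinity>" by (rule emeasure_bounded_finite[OF bounded_ball])
    have "(LINT y|lborel. 1 / \<delta> * ((u y)\<^sup>2 * indicator (ball x 1) y) - 1 / \<delta> * s0\<^sup>2 * indicator (ball x 1) y) \<le> (LINT y|lborel. prim f (u y))"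
    proof (rule integral_mono)
      show "integrable lborel (\<lambda>y. 1 / \<delta> * ((u y)\<^sup>2 * indicator (ball x 1) y) - 1 / \<delta> * s0\<^sup>2 * indicator (ball x 1) y)"
        using integrable_square_indicator[OF uL, of "ball x 1"] fin by (intro Bochner_Integration.integrable_diff integrable_mult_right) auto
      show "integrable lborel (\<lambda>y. prim f (u y))" by (rule integrable_prim[OF Yspace_adm[OF Yu]])
      show "1 / \<delta> * ((u y)\<^sup>2 * indicator (ball x 1) y) - 1 / \<delta> * s0\<^sup>2 * indicator (ball x 1) y \<le> prim f (u y)" for y
        using s0[of "u y"] prim_nonneg[of "u y"] by (cases "y \<in> ball x 1") auto
    qed
    also have "(LINT y|lborel. 1 / \<delta> * ((u y)\<^sup>2 * indicator (ball x 1) y) - 1 / \<delta> * s0\<^sup>2 * indicator (ball x 1) y)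
      = 1 / \<delta> * (LINT y|lborel. (u y)\<^sup>2 * indicator (ball x 1) y) - 1 / \<delta> * s0\<^sup>2 * V"
    proof -
      have i1: "integrable lborel (\<lambda>y. 1 / \<delta> * ((u y)\<^sup>2 * indicator (ball x 1) y))"
        by (intro integrable_mult_right integrable_square_indicator[OF uL]) simp
      have i2: "integrable lborel (\<lambda>y. 1 / \<delta> * s0\<^sup>2 * indicator (ball x 1) y)" using fin by (intro integrable_mult_right) simp
      show ?thesis unfolding Bochner_Integration.integral_diff[OF i1 i2] integral_mult_right_zero using fin by (simp add: Vx)
    qed
    finally have "1 / \<delta> * (LINT y|lborel. (u y)\<^sup>2 * indicator (ball x 1) y) - 1 / \<delta> * s0\<^sup>2 * V \<le> (LINT y|lborel. prim f (u y))" .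
    moreover have "Yform k u u \<le> 1 / \<delta> * (LINT y|lborel. (u y)\<^sup>2 * indicator (ball x 1) y)" using mass d(1) by (simp add: field_simps)
    moreover have "(LINT y|lborel. prim f (u y)) \<le> Yform k u u / 2"
      using H_integral_nonneg[of u] Nehari_Phi[OF u] unfolding Phi_eq by linarith
    ultimately have "Yform k u u \<le> 2 * (1 / \<delta> * s0\<^sup>2 * V)" by linarith
    then show "Yform k u u \<le> 2 * (1 / \<delta> * s0\<^sup>2 * V) \<and> (\<exists>x. \<delta> * Yform k u u \<le> (LINT y|lborel. (u y)\<^sup>2 * indicator (ball x 1) y))"
      using mass by blast
  qed
qed

end

section \<open>Minimizers on the Nehari set are critical points\<close>

context problem
begin

lemma f_scaled_integral_less:
  fixes u :: "(real^'k) \<times> (real^'m) \<Rightarrow> real"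
  assumes Yu: "Yspace u" and u0: "\<not> (AE x in lborel. u x = 0)" and rs: "0 < r" "r < s"
  shows "(LINT x|lborel. f (r * u x) * u x / r) < (LINT x|lborel. f (s * u x) * u x / s)"
proof -
  have i: "integrable lborel (\<lambda>x. f (t * u x) * u x / t)" for t
    using integrable_f_mult[OF Yspace_adm[OF Yspace_scale[OF Yu, of t]] Yspace_adm[OF Yu]] by simp
  have nn: "0 \<le> f (s * u x) * u x / s - f (r * u x) * u x / r" for x
    using f_scaled_le[of r s "u x"] rs by simp
  have "0 \<le> (LINT x|lborel. f (s * u x) * u x / s - f (r * u x) * u x / r)" by (intro integral_nonneg_AE AE_I2 nn)
  moreover have "(LINT x|lborel. f (s * u x) * u x / s - f (r * u x) * u x / r) \<noteq> 0"
  proof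
    assume "(LINT x|lborel. f (s * u x) * u x / s - f (r * u x) * u x / r) = 0"
    then have "AE x in lborel. f (s * u x) * u x / s - f (r * u x) * u x / r = 0"
      using integral_nonneg_eq_0_iff_AE[OF Bochner_Integration.integrable_diff[OF i[of s] i[of r]] AE_I2[OF nn]] by simp
    then have "AE x in lborel. u x = 0"
    proof eventually_elim
      case (elim x)
      then show ?case using f_scaled_less[of "u x" r s] rs by (cases "u x = 0") auto
    qed
    then show False using u0 by simp
  qed
  ultimately have "0 < (LINT x|lborel. f (s * u x) * u x / s - f (r * u x) * u x / r)" by linarith
  then show ?thesis by (simp only: Bochner_Integration.integral_diff[OF i i])
qed

lemma B_combination:
  fixes u v :: "(real^'k) \<times> (real^'m) \<Rightarrow> real"
  assumes "Yspace u" "Yspace v"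
  shows "Yform k (\<lambda>x. t * u x + e * v x) (\<lambda>x. t * u x + e * v x) = t\<^sup>2 * Yform k u u + 2 * t * e * Yform k u v + e\<^sup>2 * Yform k v v"
  using Y.B_expand[of u v t e] assms by simp

text \<open>In place of an implicit function theorem: on the ray of u the constraint defect is
  positive at 1 - d and negative at 1 + d by strictness in (F4). These signs survive a small
  multiple of v, and the intermediate value theorem yields a suitable t.\<close>

lemma Nehari_perturbation:
  fixes u v :: "(real^'k) \<times> (real^'m) \<Rightarrow> real"
  assumes u: "u \<in> Nehari k f" and Yv: "Yspace v" and Gv: "G_inv v"
    and ne: "Yform k u v \<noteq> (LINT x|lborel. f (u x) * v x)" and d: "0 < d" "d < 1"
  obtains e t where "0 < e" "e < d" "\<bar>t - 1\<bar> \<le> d" "(\<lambda>x. t * u x + e * v x) \<in> Nehari k f"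
proof -
  have Yu: "Yspace u" and Gu: "G_inv u" and u0: "\<not> (AE x in lborel. u x = 0)" and Bu: "Yform k u u = (LINT x|lborel. f (u x) * u x)"
    using u by (auto simp: Nehari_iff)
  note au = Yspace_adm[OF Yu] and av = Yspace_adm[OF Yv]
  define \<psi> where "\<psi> t e = (t\<^sup>2 * Yform k u u + 2 * t * e * Yform k u v + e\<^sup>2 * Yform k v v) - (LINT x|lborel. f (t * u x + e * v x) * (t * u x + e * v x))" for t e
  have tl: "(\<lambda>n. \<psi> (a n) (b n)) \<longlonglongrightarrow> \<psi> a' b'" if "a \<longlonglongrightarrow> a'" "b \<longlonglongrightarrow> b'" for a b a' b'
    unfolding \<psi>_def by (intro tendsto_diff tendsto_f_integral[OF au av that] tendsto_intros that)
  have psi0: "\<psi> t 0 = t\<^sup>2 * ((LINT x|lborel. f (1 * u x) * u x / 1) - (LINT x|lborel. f (t * u x) * u x / t))" if "t > 0" for t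
  proof -
    have "(LINT x|lborel. f (t * u x) * (t * u x)) = (LINT x|lborel. t\<^sup>2 * (f (t * u x) * u x / t))"
      using that by (intro Bochner_Integration.integral_cong) (auto simp: power2_eq_square)
    then show ?thesis unfolding \<psi>_def Bu by (simp add: right_diff_distrib)
  qed
  have pos: "\<psi> (1 - d) 0 > 0"
    unfolding psi0[of "1 - d", simplified, OF d(2)] using f_scaled_integral_less[OF Yu u0, of "1 - d" 1] d by (intro mult_pos_pos) auto
  have neg: "\<psi> (1 + d) 0 < 0"
  proof -
    have "1 + d > 0" using d by simp
    show ?thesis unfolding psi0[OF \<open>1 + d > 0\<close>] using f_scaled_integral_less[OF Yu u0, of 1 "1 + d"] d by (intro mult_pos_neg) auto
  qed
  \<comment> \<open>The shift by 2 keeps every member strictly below d.\<close>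
  define b where "b n = d / real (n + 2)" for n
  have b: "b \<longlonglongrightarrow> 0" unfolding b_def by real_asymp
  have ev1: "\<forall>\<^sub>F n in sequentially. \<psi> (1 - d) (b n) > 0" by (rule order_tendstoD(1)[OF tl[OF tendsto_const b] pos])
  have ev2: "\<forall>\<^sub>F n in sequentially. \<psi> (1 + d) (b n) < 0" by (rule order_tendstoD(2)[OF tl[OF tendsto_const b] neg])
  obtain n where n: "\<psi> (1 - d) (b n) > 0" "\<psi> (1 + d) (b n) < 0"
    using eventually_happens[OF eventually_conj[OF ev1 ev2]] by auto
  define e where "e = b n"
  have e: "0 < e" "e < d" using d by (auto simp: e_def b_def field_simps intro: add_pos_nonneg)
  have cont: "continuous_on UNIV (\<lambda>t. \<psi> t e)"
    by (rule continuous_on_sequentiallyI) (intro tl tendsto_const)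
  have "1 - d \<le> 1 + d" using d by simp
  then obtain t where t: "1 - d \<le> t" "t \<le> 1 + d" "\<psi> t e = 0"
    using IVT2'[of "\<lambda>t. \<psi> t e" "1 + d" 0 "1 - d"] n continuous_on_subset[OF cont] unfolding e_def[symmetric] by fastforce
  \<comment> \<open>This uses the hypothesis \<open>ne\<close>: if the combination vanished, pairing
    it with u in the form and with f(u) would give 0 in both cases. The u-terms agree by the Nehari
    identity, which would force equality for v.\<close>
  have "\<not> (AE x in lborel. t * u x + e * v x = 0)"
  proof
    assume z: "AE x in lborel. t * u x + e * v x = 0"
    let ?w = "\<lambda>x. t * u x + e * v x"
    have Yw: "Yspace ?w" by (rule Yspace_lin[OF Yu Yv])
    have "(LINT x|lborel. f (u x) * ?w x) = 0"
      by (rule integral_eq_zero_AE) (use z in \<open>eventually_elim, simp\<close>)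
    moreover have "(LINT x|lborel. f (u x) * ?w x) = t * (LINT x|lborel. f (u x) * u x) + e * (LINT x|lborel. f (u x) * v x)"
    proof -
      have "(LINT x|lborel. f (u x) * ?w x) = (LINT x|lborel. t * (f (u x) * u x) + e * (f (u x) * v x))" by (simp add: algebra_simps)
      then show ?thesis using integrable_f_mult[OF au au] integrable_f_mult[OF au av] by simp
    qed
    moreover have "Yform k u ?w = t * (LINT x|lborel. f (u x) * u x) + e * Yform k u v"
      using Y.B_lin_right[of u v u t e] Yu Yv by (simp add: Bu)
    moreover have "Yform k u ?w = 0"
    proof -
      have "Yform k ?w ?w = 0"
      proof -
        have "(LINT x|lborel. f (?w x) * ?w x) = 0"
          by (rule integral_eq_zero_AE) (use z in \<open>eventually_elim, simp\<close>)
        then show ?thesis using t(3) unfolding \<psi>_def B_combination[OF Yu Yv, symmetric] by simp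
      qed
      then have "(Yform k u ?w)\<^sup>2 \<le> 0" using Y.Cauchy_Schwarz[of u ?w] Yu Yw by simp
      then show ?thesis by simp
    qed
    ultimately have "e * Yform k u v = e * (LINT x|lborel. f (u x) * v x)" by linarith
    then show False using e ne by simp
  qed
  moreover have "Yform k (\<lambda>x. t * u x + e * v x) (\<lambda>x. t * u x + e * v x) = (LINT x|lborel. f (t * u x + e * v x) * (t * u x + e * v x))"
    using t(3) unfolding \<psi>_def B_combination[OF Yu Yv] by simp
  ultimately have "(\<lambda>x. t * u x + e * v x) \<in> Nehari k f"
    unfolding Nehari_iff using Yspace_lin[OF Yu Yv] G_inv_lin[OF Gu Gv] by blast
  moreover have "\<bar>t - 1\<bar> \<le> d" using t by auto
  ultimately show ?thesis using that e by blast
qed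

text \<open>Minimality gives Phi(u) \<le> Phi(t u + e v), and maximality on the ray gives Phi(t u)
  \<le> Phi(u). The increment from t u to t u + e v is therefore nonnegative; divided by e, it tends
  to the derivative in direction v, whatever the rate at which t tends to 1.\<close>

lemma minimizer_critical_sign:
  fixes u v :: "(real^'k) \<times> (real^'m) \<Rightarrow> real"
  assumes u: "u \<in> Nehari k f" and min: "\<And>v::(real^'k) \<times> (real^'m) \<Rightarrow> real. v \<in> Nehari k f \<Longrightarrow> Phi k f u \<le> Phi k f v"
    and Yv: "Yspace v" and Gv: "G_inv v"
  shows "(LINT x|lborel. f (u x) * v x) \<le> Yform k u v"
proof (rule ccontr)
  assume lt: "\<not> (LINT x|lborel. f (u x) * v x) \<le> Yform k u v"
  then have ne: "Yform k u v \<noteq> (LINT x|lborel. f (u x) * v x)" by auto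
  have Yu: "Yspace u" using u by (auto simp: Nehari_iff)
  note au = Yspace_adm[OF Yu] and av = Yspace_adm[OF Yv]
  define d where "d n = 1 / real (n + 2)" for n
  have d: "0 < d n" "d n < 1" for n by (auto simp: d_def)
  have dl: "d \<longlonglongrightarrow> 0" unfolding d_def by real_asymp
  have "\<forall>n. \<exists>q. 0 < fst q \<and> fst q < d n \<and> \<bar>snd q - 1\<bar> \<le> d n \<and> (\<lambda>x. snd q * u x + fst q * v x) \<in> Nehari k f"
  proof
    fix n
    obtain e t where "0 < e" "e < d n" "\<bar>t - 1\<bar> \<le> d n" "(\<lambda>x. t * u x + e * v x) \<in> Nehari k f"
      by (rule Nehari_perturbation[OF u Yv Gv ne d])
    then show "\<exists>q. 0 < fst q \<and> fst q < d n \<and> \<bar>snd q - 1\<bar> \<le> d n \<and> (\<lambda>x. snd q * u x + fst q * v x) \<in> Nehari k f"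
      by (intro exI[of _ "(e, t)"]) simp
  qed
  from choice[OF this] obtain q where q: "\<forall>n. 0 < fst (q n) \<and> fst (q n) < d n \<and> \<bar>snd (q n) - 1\<bar> \<le> d n \<and>
    (\<lambda>x. snd (q n) * u x + fst (q n) * v x) \<in> Nehari k f" ..
  define e where "e n = fst (q n)" for n
  define t where "t n = snd (q n)" for n
  have et: "\<And>n. 0 < e n" "\<And>n. e n < d n" "\<And>n. \<bar>t n - 1\<bar> \<le> d n" "\<And>n. (\<lambda>x. t n * u x + e n * v x) \<in> Nehari k f"
    using q by (simp_all add: e_def t_def)
  have el: "e \<longlonglongrightarrow> 0"
    by (rule tendsto_sandwich[OF _ _ tendsto_const dl]) (simp_all add: less_imp_le[OF et(1)] less_imp_le[OF et(2)])
  have "(\<lambda>n. t n - 1) \<longlonglongrightarrow> 0" by (rule Lim_null_comparison[OF _ dl]) (use et in auto)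
  then have tl: "t \<longlonglongrightarrow> 1" by (rule LIM_zero_cancel)
  define Qn where "Qn n = (LINT x|lborel. (prim f (t n * u x + e n * v x) - prim f (t n * u x)) / e n)" for n
  have Ql: "Qn \<longlonglongrightarrow> (LINT x|lborel. f (u x) * v x)"
    unfolding Qn_def by (rule tendsto_prim_quotient[OF au av tl el]) (use et(1) in \<open>simp add: less_imp_neq[THEN not_sym]\<close>)
  have main: "0 \<le> t n * Yform k u v + e n / 2 * Yform k v v - Qn n" for n
  proof -
    note ac = Yspace_adm[OF Yspace_lin[OF Yu Yv, of "t n" "e n"]] and as = Yspace_adm[OF Yspace_scale[OF Yu, of "t n"]]
    have tpos: "0 \<le> t n" using et(3)[of n] d(2)[of n] by linarith
    have "Phi k f u \<le> Phi k f (\<lambda>x. t n * u x + e n * v x)" by (rule min[OF et(4)])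
    also have "\<dots> = Phi k f (\<lambda>x. t n * u x) + e n * (t n * Yform k u v + e n / 2 * Yform k v v - Qn n)"
    proof -
      have "e n * Qn n = (LINT x|lborel. prim f (t n * u x + e n * v x)) - (LINT x|lborel. prim f (t n * u x))"
        unfolding Qn_def integral_divide_zero using et(1)[of n] integrable_prim[OF ac] integrable_prim[OF as] by simp
      then show ?thesis unfolding Phi_eq B_combination[OF Yu Yv] B_scale[OF Yu]
        by (simp add: algebra_simps power2_eq_square)
    qed
    also have "Phi k f (\<lambda>x. t n * u x) \<le> Phi k f u" by (rule Phi_scale_le[OF u tpos])
    finally have "0 \<le> e n * (t n * Yform k u v + e n / 2 * Yform k v v - Qn n)" by simp
    then show ?thesis using et(1)[of n] by (simp add: zero_le_mult_iff)
  qed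
  have "(\<lambda>n. t n * Yform k u v + e n / 2 * Yform k v v - Qn n) \<longlonglongrightarrow> 1 * Yform k u v + 0 / 2 * Yform k v v - (LINT x|lborel. f (u x) * v x)"
    by (intro tendsto_intros tl el Ql) auto
  then have "0 \<le> 1 * Yform k u v + 0 / 2 * Yform k v v - (LINT x|lborel. f (u x) * v x)"
    by (rule LIMSEQ_le_const) (use main in auto)
  then show False using lt by simp
qed

lemma minimizer_critical_invariant:
  fixes u v :: "(real^'k) \<times> (real^'m) \<Rightarrow> real"
  assumes u: "u \<in> Nehari k f" and min: "\<And>v::(real^'k) \<times> (real^'m) \<Rightarrow> real. v \<in> Nehari k f \<Longrightarrow> Phi k f u \<le> Phi k f v"
    and Yv: "Yspace v" and Gv: "G_inv v"
  shows "Yform k u v = (LINT x|lborel. f (u x) * v x)"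
proof -
  have Yu: "Yspace u" using u by (auto simp: Nehari_iff)
  have "(LINT x|lborel. f (u x) * ((- 1) * v x)) \<le> Yform k u (\<lambda>x. (- 1) * v x)"
    by (rule minimizer_critical_sign[OF u min Yspace_scale[OF Yv] G_inv_scale[OF Gv]])
  moreover have "Yform k u (\<lambda>x. (- 1) * v x) = - Yform k u v" using Y.B_lin_right[of v v u "-1" 0] Yu Yv by simp
  ultimately have "Yform k u v \<le> (LINT x|lborel. f (u x) * v x)" by simp
  then show ?thesis using minimizer_critical_sign[OF u min Yv Gv] by linarith
qed

text \<open>The growth bound on f is not homogeneous in v, so the estimate is made for form at most
  1 and extended by scaling. Where the form of v is 0, v vanishes almost everywhere.\<close>

lemma f_functional_bounded:
  fixes u :: "(real^'k) \<times> (real^'m) \<Rightarrow> real"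
  assumes Yu: "Yspace u"
  obtains K where "\<And>v. Yspace v \<Longrightarrow> (LINT x|lborel. f (u x) * v x)\<^sup>2 \<le> K * Yform k v v"
proof -
  note au = Yspace_adm[OF Yu]
  obtain P where P: "P \<ge> 0" "\<And>u::(real^'k) \<times> (real^'m) \<Rightarrow> real. Yspace u \<Longrightarrow> Yform k u u \<le> 1 \<Longrightarrow>
    integrable lborel (\<lambda>x. \<bar>u x\<bar> powr p) \<and> (LINT x|lborel. \<bar>u x\<bar> powr p) \<le> P"
  proof (rule Yspace_powr_bound[OF _ p_less, of 1])
    show "2 \<le> p" using p_gt by simp
  qed (rule that)
  obtain C where C0: "C \<ge> 0" and C: "\<And>r s t. \<bar>r\<bar> \<le> 1 * (\<bar>s\<bar> + \<bar>t\<bar>) \<Longrightarrow>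
     \<bar>f r\<bar> * (\<bar>s\<bar> + \<bar>t\<bar>) \<le> C * (s\<^sup>2 + t\<^sup>2 + \<bar>s\<bar> powr p + \<bar>t\<bar> powr p)"
    by (rule f_dominated[OF zero_le_one]) (assumption | rule that)+
  define M where "M = C * ((LINT x|lborel. (u x)\<^sup>2) + 1 / k + (LINT x|lborel. \<bar>u x\<bar> powr p) + P)"
  have unit: "\<bar>LINT x|lborel. f (u x) * v x\<bar> \<le> M" if Yv: "Yspace v" and B1: "Yform k v v \<le> 1" for v
  proof -
    note av = Yspace_adm[OF Yv]
    have "\<bar>LINT x|lborel. f (u x) * v x\<bar> \<le> (LINT x|lborel. \<bar>f (u x) * v x\<bar>)" by (rule integral_abs_bound)
    also have "\<dots> \<le> (LINT x|lborel. C * ((u x)\<^sup>2 + (v x)\<^sup>2 + \<bar>u x\<bar> powr p + \<bar>v x\<bar> powr p))"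
    proof (rule integral_mono)
      show "integrable lborel (\<lambda>x. \<bar>f (u x) * v x\<bar>)" using integrable_f_mult[OF au av] by simp
      show "integrable lborel (\<lambda>x. C * ((u x)\<^sup>2 + (v x)\<^sup>2 + \<bar>u x\<bar> powr p + \<bar>v x\<bar> powr p))" by (rule adm_dominant[OF au av])
      fix x
      have "\<bar>f (u x) * v x\<bar> \<le> \<bar>f (u x)\<bar> * (\<bar>u x\<bar> + \<bar>v x\<bar>)" unfolding abs_mult by (intro mult_left_mono) auto
      also have "\<dots> \<le> C * ((u x)\<^sup>2 + (v x)\<^sup>2 + \<bar>u x\<bar> powr p + \<bar>v x\<bar> powr p)" by (rule C) simp
      finally show "\<bar>f (u x) * v x\<bar> \<le> C * ((u x)\<^sup>2 + (v x)\<^sup>2 + \<bar>u x\<bar> powr p + \<bar>v x\<bar> powr p)" .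
    qed
    also have "\<dots> = C * ((LINT x|lborel. (u x)\<^sup>2) + (LINT x|lborel. (v x)\<^sup>2) + (LINT x|lborel. \<bar>u x\<bar> powr p) + (LINT x|lborel. \<bar>v x\<bar> powr p))"
      using au av by (simp add: adm_def)
    also have "\<dots> \<le> M" unfolding M_def
    proof (intro mult_left_mono add_mono order_refl C0)
      show "(LINT x|lborel. (v x)\<^sup>2) \<le> 1 / k" using B_bounds(1)[OF kpos Yv] B1 kpos by (simp add: field_simps)
      show "(LINT x|lborel. \<bar>v x\<bar> powr p) \<le> P" using P(2)[OF Yv B1] by simp
    qed
    finally show ?thesis .
  qed
  show ?thesis
  proof (rule that[of "M\<^sup>2"])
    fix v :: "(real^'k) \<times> (real^'m) \<Rightarrow> real" assume Yv: "Yspace v"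
    show "(LINT x|lborel. f (u x) * v x)\<^sup>2 \<le> M\<^sup>2 * Yform k v v"
    proof (cases "Yform k v v = 0")
      case True
      then have z: "AE x in lborel. v x = 0" by (rule B_zero[OF kpos Yv])
      have "(LINT x|lborel. f (u x) * v x) = 0"
        by (rule integral_eq_zero_AE) (use z in \<open>eventually_elim, simp\<close>)
      then show ?thesis using True by simp
    next
      case False
      define b where "b = sqrt (Yform k v v)"
      have "Yform k v v > 0" using False Y.B_pos[of v] Yv by simp
      then have b: "b > 0" "b\<^sup>2 = Yform k v v" by (auto simp: b_def)
      have "Yform k (\<lambda>x. 1 / b * v x) (\<lambda>x. 1 / b * v x) = 1" unfolding B_scale[OF Yv] b(2)[symmetric] using b(1) by (simp add: power_divide)
      then have "\<bar>LINT x|lborel. f (u x) * (1 / b * v x)\<bar> \<le> M" by (intro unit Yspace_scale[OF Yv]) simp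
      then have "\<bar>LINT x|lborel. f (u x) * v x\<bar> \<le> M * b" using b(1) by (simp add: field_simps)
      then have "\<bar>LINT x|lborel. f (u x) * v x\<bar>\<^sup>2 \<le> (M * b)\<^sup>2" by (intro power_mono) auto
      then show ?thesis unfolding b(2)[symmetric] by (simp add: power_mult_distrib)
    qed
  qed
qed

text \<open>Symmetric criticality: the Riesz representative of the invariant functional \<open>v \<mapsto> \<integral> f(u) v\<close> is unique,
  hence itself invariant, hence equal to \<open>u\<close>.\<close>

lemma symmetric_criticality:
  fixes u v :: "(real^'k) \<times> (real^'m) \<Rightarrow> real"
  assumes Yu: "Yspace u" and Gu: "G_inv u" and Yv: "Yspace v"
    and crit: "\<And>v. Yspace v \<Longrightarrow> G_inv v \<Longrightarrow> Yform k u v = (LINT x|lborel. f (u x) * v x)"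
  shows "Yform k u v = (LINT x|lborel. f (u x) * v x)"
proof -
  note au = Yspace_adm[OF Yu]
  define \<Lambda> where "\<Lambda> v = (LINT x|lborel. f (u x) * v x)" for v
  obtain K where K': "\<And>v. Yspace v \<Longrightarrow> (LINT x|lborel. f (u x) * v x)\<^sup>2 \<le> K * Yform k v v"
    by (rule f_functional_bounded[OF Yu]) (assumption | rule that)+
  note K = K'[folded \<Lambda>_def]
  have lin: "\<Lambda> (\<lambda>x. a * w x + b * z x) = a * \<Lambda> w + b * \<Lambda> z" if "Yspace w" "Yspace z" for a b w z
  proof -
    have "\<Lambda> (\<lambda>x. a * w x + b * z x) = (LINT x|lborel. a * (f (u x) * w x) + b * (f (u x) * z x))"
      unfolding \<Lambda>_def by (simp add: algebra_simps)
    then show ?thesis using integrable_f_mult[OF au Yspace_adm[OF that(1)]] integrable_f_mult[OF au Yspace_adm[OF that(2)]]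
      by (simp add: \<Lambda>_def)
  qed
  obtain wn where wn: "\<And>n. Yspace (wn n)"
    and wC: "\<And>n m. Yform k (\<lambda>x. wn n x - wn m x) (\<lambda>x. wn n x - wn m x) \<le> 2 / real (Suc n) + 2 / real (Suc m)"
    and wL: "\<And>v. Yspace v \<Longrightarrow> (\<lambda>n. Yform k (wn n) v) \<longlonglongrightarrow> \<Lambda> v"
  proof (rule Y.Riesz_sequence[of \<Lambda> K])
    fix wn :: "nat \<Rightarrow> (real^'k) \<times> (real^'m) \<Rightarrow> real"
    assume "\<And>n. wn n \<in> {u. Yspace u}" "\<And>n m. Yform k (\<lambda>x. wn n x - wn m x) (\<lambda>x. wn n x - wn m x) \<le> 2 / real (Suc n) + 2 / real (Suc m)"
      "\<And>v. v \<in> {u. Yspace u} \<Longrightarrow> (\<lambda>n. Yform k (wn n) v) \<longlonglongrightarrow> \<Lambda> v"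
    then show thesis using that[of wn] by simp
  qed (use lin K in auto)
  obtain w where Yw: "Yspace w" and wl: "(\<lambda>n. Yform k (\<lambda>x. wn n x - w x) (\<lambda>x. wn n x - w x)) \<longlonglongrightarrow> 0"
  proof (rule Yspace_complete[OF kpos wn])
    fix e :: real assume "e > 0"
    have "(\<lambda>n. 2 / real (Suc n)) \<longlonglongrightarrow> 0" by real_asymp
    from order_tendstoD(2)[OF this half_gt_zero[OF \<open>e > 0\<close>]] obtain N where N: "\<And>n. n \<ge> N \<Longrightarrow> 2 / real (Suc n) < e / 2"
      unfolding eventually_sequentially by blast
    show "\<exists>M. \<forall>m\<ge>M. \<forall>n\<ge>M. Yform k (\<lambda>x. wn n x - wn m x) (\<lambda>x. wn n x - wn m x) < e"
    proof (intro exI[of _ N] allI impI)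
      fix m n assume mn: "m \<ge> N" "n \<ge> N"
      have "c < e" if "c \<le> a + b" "a < e / 2" "b < e / 2" for a b c :: real using that by linarith
      from this[OF wC[of n m] N[OF mn(2)] N[OF mn(1)]]
      show "Yform k (\<lambda>x. wn n x - wn m x) (\<lambda>x. wn n x - wn m x) < e" .
    qed
  qed (rule that)
  have Bw: "Yform k w v = \<Lambda> v" if "Yspace v" for v
    using Y.tendsto_B[of wn w v, OF _ _ _ wl] wn Yw that wL[OF that] LIMSEQ_unique by blast
  have Gw: "G_inv w"
    unfolding G_inv_iff
  proof (intro allI impI)
    fix A :: "real^'k^'k" assume A: "orthogonal_matrix A"
    have At: "orthogonal_matrix (transpose A)" using A by simp
    define wA where "wA x = w (symm A 0 x)" for x
    have YwA: "Yspace wA" unfolding wA_def by (rule Yspace_symm(1)[OF A Yw])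
    \<comment> \<open>The rotated representative represents the same functional, by rotating the
      test function back and using the invariance of u; testing the difference with itself then
      shows \<open>wA\<close> and \<open>w\<close> agree.\<close>
    have BwA: "Yform k wA v = \<Lambda> v" if v: "Yspace v" for v
    proof -
      define v' where "v' x = v (symm (transpose A) 0 x)" for x
      have Yv': "Yspace v'" unfolding v'_def by (rule Yspace_symm(1)[OF At v])
      have vv: "v = (\<lambda>x. v' (symm A 0 x))" unfolding v'_def by (simp add: symm_inverse(2)[OF A])
      have "Yform k wA v = Yform k w v'" unfolding wA_def vv by (rule B_symm[OF kpos A Yw Yv'])
      also have "\<dots> = \<Lambda> v'" by (rule Bw[OF Yv'])
      also have "\<dots> = (LINT x|lborel. f (u (symm A 0 x)) * v' (symm A 0 x))"
        unfolding \<Lambda>_def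
        using integral_symm[OF A, of "\<lambda>x. f (u x) * v' x" 0] integrable_f_mult[OF au Yspace_adm[OF Yv']] by simp
      also have "\<dots> = (LINT x|lborel. f (u x) * v x)"
      proof (rule integral_cong_AE)
        show "(\<lambda>x. f (u (symm A 0 x)) * v' (symm A 0 x)) \<in> borel_measurable lborel"
          using integrable_f_mult[OF Yspace_adm[OF Yspace_symm(1)[OF A Yu]] Yspace_adm[OF Yspace_symm(1)[OF A Yv']]] by simp
        show "(\<lambda>x. f (u x) * v x) \<in> borel_measurable lborel" using integrable_f_mult[OF au Yspace_adm[OF v]] by simp
        have "AE x in lborel. u (symm A 0 x) = u x" using Gu A by (simp add: G_inv_iff)
        then show "AE x in lborel. f (u (symm A 0 x)) * v' (symm A 0 x) = f (u x) * v x"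
          by eventually_elim (simp add: vv)
      qed
      finally show ?thesis by (simp add: \<Lambda>_def)
    qed
    have Yd: "Yspace (\<lambda>x. wA x - w x)" by (rule Yspace_diff[OF YwA Yw])
    have "Yform k (\<lambda>x. wA x - w x) (\<lambda>x. wA x - w x) = 0"
      using Y.B_diff_left[of wA w "\<lambda>x. wA x - w x"] YwA Yw Yd by (simp add: BwA Bw)
    then have "AE x in lborel. wA x - w x = 0" by (rule B_zero[OF kpos Yd])
    then show "AE x in lborel. w (symm A 0 x) = w x" by (simp add: wA_def)
  qed
  have Yd: "Yspace (\<lambda>x. u x - w x)" by (rule Yspace_diff[OF Yu Yw])
  have "G_inv (\<lambda>x. 1 * u x + (- 1) * w x)" by (rule G_inv_lin[OF Gu Gw])
  then have Gd: "G_inv (\<lambda>x. u x - w x)" by simp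
  \<comment> \<open>Both u and w represent the functional on invariant functions, and their
    difference is itself an admissible test function. Cauchy-Schwarz then extends the equality to
    all of Y.\<close>
  have "Yform k (\<lambda>x. u x - w x) (\<lambda>x. u x - w x) = 0"
    using Y.B_diff_left[of u w "\<lambda>x. u x - w x"] Yu Yw Yd crit[OF Yd Gd] Bw[OF Yd] by (simp add: \<Lambda>_def)
  then have "(Yform k (\<lambda>x. u x - w x) v)\<^sup>2 \<le> 0" using Y.Cauchy_Schwarz[of "\<lambda>x. u x - w x" v] Yd Yv by simp
  then have "Yform k u v = Yform k w v" using Y.B_diff_left[of u w v] Yu Yw Yv by simp
  then show ?thesis by (simp add: Bw[OF Yv] \<Lambda>_def)
qed

lemma Phi_derivative:
  fixes u v :: "(real^'k) \<times> (real^'m) \<Rightarrow> real"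
  assumes Yu: "Yspace u" and Yv: "Yspace v"
  shows "((\<lambda>t. Phi k f (\<lambda>x. u x + t * v x)) has_real_derivative Yform k u v - (LINT x|lborel. f (u x) * v x)) (at 0)"
  unfolding has_field_derivative_iff tendsto_at_iff_sequentially comp_def
proof (intro allI impI)
  fix s :: "nat \<Rightarrow> real" assume sn: "\<forall>i. s i \<in> UNIV - {0}" and s: "s \<longlonglongrightarrow> 0"
  have s0: "s n \<noteq> 0" for n using sn by auto
  note au = Yspace_adm[OF Yu] and av = Yspace_adm[OF Yv]
  have "(\<lambda>n. Yform k u v + s n / 2 * Yform k v v - (LINT x|lborel. (prim f (1 * u x + s n * v x) - prim f (1 * u x)) / s n))
    \<longlonglongrightarrow> Yform k u v + 0 / 2 * Yform k v v - (LINT x|lborel. f (u x) * v x)"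
    by (intro tendsto_intros s tendsto_prim_quotient[OF au av tendsto_const s s0]) simp
  moreover have "Yform k u v + s n / 2 * Yform k v v - (LINT x|lborel. (prim f (1 * u x + s n * v x) - prim f (1 * u x)) / s n)
     = (Phi k f (\<lambda>x. u x + s n * v x) - Phi k f (\<lambda>x. u x + 0 * v x)) / (s n - 0)" for n
  proof -
    have ac: "adm (\<lambda>x. u x + s n * v x)" using Yspace_adm[OF Yspace_lin[OF Yu Yv, of 1 "s n"]] by simp
    have "(LINT x|lborel. (prim f (1 * u x + s n * v x) - prim f (1 * u x)) / s n)
      = ((LINT x|lborel. prim f (u x + s n * v x)) - (LINT x|lborel. prim f (u x))) / s n"
      unfolding integral_divide_zero using integrable_prim[OF ac] integrable_prim[OF au] by simp
    moreover have "Yform k (\<lambda>x. u x + s n * v x) (\<lambda>x. u x + s n * v x) = Yform k u u + 2 * s n * Yform k u v + (s n)\<^sup>2 * Yform k v v"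
      using Y.B_add_expand[of u v "s n"] Yu Yv by simp
    moreover have "b + t / 2 * c - (F1 - F0) / t = ((a + 2 * t * b + t\<^sup>2 * c) / 2 - F1 - (a / 2 - F0)) / t" if "t \<noteq> 0" for a b c t F0 F1 :: real
      using that by (simp add: field_simps power2_eq_square)
    from this[OF s0] have "Yform k u v + s n / 2 * Yform k v v - ((LINT x|lborel. prim f (u x + s n * v x)) - (LINT x|lborel. prim f (u x))) / s n
      = ((Yform k u u + 2 * s n * Yform k u v + (s n)\<^sup>2 * Yform k v v) / 2 - (LINT x|lborel. prim f (u x + s n * v x)) - (Yform k u u / 2 - (LINT x|lborel. prim f (u x)))) / s n" .
    ultimately show ?thesis unfolding Phi_eq by (simp only: mult_zero_left add_0_right diff_zero)
  qed
  ultimately show "(\<lambda>n. (Phi k f (\<lambda>x. u x + s n * v x) - Phi k f (\<lambda>x. u x + 0 * v x)) / (s n - 0))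
    \<longlonglongrightarrow> Yform k u v - (LINT x|lborel. f (u x) * v x)" by simp
qed

text \<open>Without this the infimum would carry no information. The witness is a bump depending
  only on |y| and |z|, hence invariant, supported in 1 \<le> |y| \<le> 2 and therefore in Y.
  Multiplied by a large t it satisfies Q \<le> 2 \<integral> F \<le> \<integral> f(u) u by (F3), and
  is then projected.\<close>

lemma Nehari_nonempty: "Nehari k f \<noteq> ({} :: ((real^'k) \<times> (real^'m) \<Rightarrow> real) set)"
proof -
  define \<phi> where "\<phi> x = flat 1 (fst x \<bullet> fst x - 1) * flat 1 (4 - fst x \<bullet> fst x) * flat 1 (1 - snd x \<bullet> snd x)" for x :: "(real^'k) \<times> (real^'m)"
  have sm1: "C_k n (\<lambda>x::(real^'k) \<times> (real^'m). fst x \<bullet> fst x)" for n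
  proof (cases n)
    case (Suc j)
    show ?thesis unfolding Suc
    proof (rule C_k_SucI)
      show "((\<lambda>x::(real^'k) \<times> (real^'m). fst x \<bullet> fst x) has_derivative (\<lambda>v. 2 * (fst x \<bullet> fst v))) (at x)" for x
        by (auto intro!: derivative_eq_intros simp: inner_commute)
      show "C_k j (\<lambda>x::(real^'k) \<times> (real^'m). 2 * (fst x \<bullet> fst v))" for v :: "(real^'k) \<times> (real^'m)"
        by (intro C_k_linear) (auto intro!: linearI simp: linear_conv_bounded_linear[symmetric] algebra_simps)
    qed
  qed (auto intro!: continuous_intros)
  have sm2: "C_k n (\<lambda>x::(real^'k) \<times> (real^'m). snd x \<bullet> snd x)" for n
  proof (cases n)
    case (Suc j)
    show ?thesis unfolding Suc
    proof (rule C_k_SucI)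
      show "((\<lambda>x::(real^'k) \<times> (real^'m). snd x \<bullet> snd x) has_derivative (\<lambda>v. 2 * (snd x \<bullet> snd v))) (at x)" for x
        by (auto intro!: derivative_eq_intros simp: inner_commute)
      show "C_k j (\<lambda>x::(real^'k) \<times> (real^'m). 2 * (snd x \<bullet> snd v))" for v :: "(real^'k) \<times> (real^'m)"
        by (intro C_k_linear) (auto intro!: linearI simp: linear_conv_bounded_linear[symmetric] algebra_simps)
    qed
  qed (auto intro!: continuous_intros)
  have lin: "C_k n (\<lambda>x. c * g x + d)" if "\<And>n. C_k n g" for n c d and g :: "(real^'k) \<times> (real^'m) \<Rightarrow> real"
    by (intro C_k_add C_k_mult C_k_const that)
  have smooth: "C_k n \<phi>" for n
  proof -
    have "C_k n (\<lambda>x::(real^'k) \<times> (real^'m). flat 1 (1 * (fst x \<bullet> fst x) + (- 1)) * flat 1 ((- 1) * (fst x \<bullet> fst x) + 4) * flat 1 ((- 1) * (snd x \<bullet> snd x) + 1))"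
      by (intro C_k_mult C_k_flat lin sm1 sm2)
    then show ?thesis unfolding \<phi>_def by simp
  qed
  have supp: "\<phi> x = 0" if "norm (fst x) \<ge> 2 \<or> norm (snd x) \<ge> 1 \<or> norm (fst x) < 1" for x
  proof -
    have "fst x \<bullet> fst x \<ge> 4 \<or> snd x \<bullet> snd x \<ge> 1 \<or> fst x \<bullet> fst x \<le> 1"
      using that power_mono[of 2 "norm (fst x)" 2] power_mono[of 1 "norm (snd x)" 2] power_mono[of "norm (fst x)" 1 2]
      by (auto simp: power2_norm_eq_inner)
    then show ?thesis by (auto simp: \<phi>_def flat_def)
  qed
  have out: "\<phi> x = 0" if "3 < norm x" for x
  proof (rule supp)
    have "norm x \<le> norm (fst x) + norm (snd x)" using norm_Pair_le[of "fst x" "snd x"] by simp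
    then show "norm (fst x) \<ge> 2 \<or> norm (snd x) \<ge> 1 \<or> norm (fst x) < 1" using that by linarith
  qed
  have tf: "test_fun \<phi>" unfolding test_fun_def using smooth out by blast
  have Yp: "Yspace \<phi>" by (rule Yspace_test[OF tf]) (simp add: supp)
  have Gp: "G_inv \<phi>" unfolding G_inv_iff
  proof (intro allI impI)
    fix A :: "real^'k^'k" assume A: "orthogonal_matrix A"
    have "(A *v y) \<bullet> (A *v y) = y \<bullet> y" for y
      using orthogonal_matrix_vector[OF A] unfolding orthogonal_transformation_def by blast
    then show "AE x in lborel. \<phi> (symm A 0 x) = \<phi> x" by (simp add: \<phi>_def symm_def)
  qed
  have nz: "\<not> (AE x in lborel. \<phi> x = 0)"
  proof
    assume z: "AE x in lborel. \<phi> x = 0"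
    define O' where "O' = {x. 0 < \<phi> x}"
    have "open O'" unfolding O'_def by (intro open_Collect_less continuous_on_const test_fun_continuous[OF tf])
    \<comment> \<open>At (y0, 0) the three cutoffs have the positive arguments 1, 2 and 1.\<close>
    obtain y0 :: "real^'k" where y0: "norm y0 = sqrt 2" using vector_choose_size[of "sqrt 2"] by auto
    have "y0 \<bullet> y0 = 2" using y0 by (simp add: power2_norm_eq_inner[symmetric])
    then have "(y0, 0) \<in> O'" by (simp add: O'_def \<phi>_def flat_def)
    then obtain r where r: "r > 0" "ball (y0, 0) r \<subseteq> O'" using \<open>open O'\<close> open_contains_ball by blast
    have "O' \<in> null_sets lborel"
      using z \<open>open O'\<close> by (subst AE_iff_null_sets) (auto simp: O'_def elim: eventually_mono)
    then have "ball (y0, 0::real^'m) r \<in> null_sets lborel" by (rule null_sets_subset[OF _ _ r(2)]) simp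
    then have "emeasure lborel (ball (y0, 0::real^'m) r) = 0" by (rule null_setsD1)
    then have "measure lborel (ball (y0, 0::real^'m) r) = 0" by (simp add: measure_def)
    then show False using content_ball_pos[OF r(1), of "(y0, 0::real^'m)"] by simp
  qed
  define I where "I = (LINT x|lborel. (\<phi> x)\<^sup>2)"
  have pL: "L2 lborel \<phi>" by (rule Yspace_L2[OF Yp])
  have I: "I > 0"
  proof -
    have "I \<noteq> 0" unfolding I_def using integral_nonneg_eq_0_iff_AE[OF L2_square_integrable[OF pL]] nz by auto
    moreover have "I \<ge> 0" by (simp add: I_def)
    ultimately show ?thesis by simp
  qed
  have Q: "Yform k \<phi> \<phi> > 0" by (rule B_pos[OF Yp nz])
  \<comment> \<open>With this slope R times the L^2 norm square of t \<phi> equals its form. The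
    factor 2 in 2 \<integral> F then provides the form twice, one copy of which absorbs the constant
    term.\<close>
  define R where "R = Yform k \<phi> \<phi> / I"
  have R: "R > 0" "R * I = Yform k \<phi> \<phi>" using Q I by (auto simp: R_def)
  obtain s0 where s0: "\<And>s. R * s\<^sup>2 - R * s0\<^sup>2 \<le> prim f s" by (rule prim_lower[OF R(1)]) (assumption | rule that)+
  \<comment> \<open>A set of finite measure outside which \<phi> vanishes; the constant term of
    \<open>prim_lower\<close> is integrated over it only.\<close>
  define U where "U = ball (0::(real^'k) \<times> (real^'m)) 4"
  define V where "V = measure lborel U"
  have fin: "emeasure lborel U < \<infinity>" unfolding U_def by (rule emeasure_bounded_finite[OF bounded_ball])
  have Um: "U \<in> sets lborel" by (simp add: U_def)
  \<comment> \<open>Large enough for t^2 Q to dominate twice the constant term; the added 1 makes t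
    positive.\<close>
  define t where "t = sqrt (2 * R * s0\<^sup>2 * V / Yform k \<phi> \<phi>) + 1"
  have t: "t > 0" unfolding t_def using R(1) Q by (intro add_nonneg_pos) (auto simp: V_def)
  have t2: "2 * R * s0\<^sup>2 * V \<le> t\<^sup>2 * Yform k \<phi> \<phi>"
  proof -
    have nn: "0 \<le> 2 * R * s0\<^sup>2 * V / Yform k \<phi> \<phi>" using R Q by (simp add: V_def)
    have "2 * R * s0\<^sup>2 * V / Yform k \<phi> \<phi> = (sqrt (2 * R * s0\<^sup>2 * V / Yform k \<phi> \<phi>))\<^sup>2" using nn by simp
    also have "\<dots> \<le> t\<^sup>2" unfolding t_def using nn by (intro power_mono) auto
    finally show ?thesis using Q by (simp add: field_simps)
  qed
  note Yt = Yspace_scale[OF Yp, of t] and at = Yspace_adm[OF Yspace_scale[OF Yp, of t]]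
  have "Yform k (\<lambda>x. t * \<phi> x) (\<lambda>x. t * \<phi> x) = t\<^sup>2 * Yform k \<phi> \<phi>" by (rule B_scale[OF Yp])
  also have "\<dots> \<le> 2 * (R * t\<^sup>2 * I - R * s0\<^sup>2 * V)" 
  proof -
    have e: "R * t\<^sup>2 * I = t\<^sup>2 * Yform k \<phi> \<phi>" unfolding R(2)[symmetric] by (simp only: mult_ac)
    show ?thesis unfolding e using t2 by (simp add: right_diff_distrib mult.assoc mult.commute[of "Yform k \<phi> \<phi>"])
  qed
  also have "R * t\<^sup>2 * I - R * s0\<^sup>2 * V = (LINT x|lborel. R * t\<^sup>2 * (\<phi> x)\<^sup>2 - R * s0\<^sup>2 * indicator U x)"
    using L2_square_integrable[OF pL] fin Um by (simp add: I_def V_def)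
  also have "\<dots> \<le> (LINT x|lborel. prim f (t * \<phi> x))"
  proof (rule integral_mono)
    show "integrable lborel (\<lambda>x. R * t\<^sup>2 * (\<phi> x)\<^sup>2 - R * s0\<^sup>2 * indicator U x)" using L2_square_integrable[OF pL] fin Um by simp
    show "integrable lborel (\<lambda>x. prim f (t * \<phi> x))" by (rule integrable_prim[OF at])
    show "R * t\<^sup>2 * (\<phi> x)\<^sup>2 - R * s0\<^sup>2 * indicator U x \<le> prim f (t * \<phi> x)" for x
    proof (cases "x \<in> U")
      case True
      then show ?thesis using s0[of "t * \<phi> x"] by (simp add: power_mult_distrib mult.assoc)
    next
      case False
      then have "\<phi> x = 0" by (intro out) (simp add: U_def)
      then show ?thesis using False by (simp add: prim_0)
    qed
  qed
  finally have "Yform k (\<lambda>x. t * \<phi> x) (\<lambda>x. t * \<phi> x) \<le> 2 * (LINT x|lborel. prim f (t * \<phi> x))" by simp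
  also have "\<dots> = (LINT x|lborel. 2 * prim f (t * \<phi> x))" by simp
  also have "\<dots> \<le> (LINT x|lborel. f (t * \<phi> x) * (t * \<phi> x))"
  proof (rule integral_mono)
    show "2 * prim f (t * \<phi> x) \<le> f (t * \<phi> x) * (t * \<phi> x)" for x using prim_le[of "t * \<phi> x"] by linarith
  qed (use integrable_prim[OF at] integrable_f_mult[OF at at] in auto)
  finally have le: "Yform k (\<lambda>x. t * \<phi> x) (\<lambda>x. t * \<phi> x) \<le> (LINT x|lborel. f (t * \<phi> x) * (t * \<phi> x))" .
  have nzt: "\<not> (AE x in lborel. t * \<phi> x = 0)" using nz t by simp
  show ?thesis by (rule Nehari_projection[OF Yt G_inv_scale[OF Gp] nzt le]) auto
qed

end

section \<open>Minimizing sequences and their limits\<close>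

context problem
begin

lemma Nehari_shift:
  fixes u :: "(real^'k) \<times> (real^'m) \<Rightarrow> real"
  assumes u: "u \<in> Nehari k f"
  shows "(\<lambda>x. u (symm (mat 1) z x)) \<in> Nehari k f"
    and "Yform k (\<lambda>x. u (symm (mat 1) z x)) (\<lambda>x. u (symm (mat 1) z x)) = Yform k u u"
    and "Phi k f (\<lambda>x. u (symm (mat 1) z x)) = Phi k f u"
proof -
  let ?v = "\<lambda>x. u (symm (mat 1) z x)"
  have i: "orthogonal_matrix (mat 1 :: real^'k^'k)" by (simp add: orthogonal_matrix_id)
  have Yu: "Yspace u" and Gu: "G_inv u" and u0: "\<not> (AE x in lborel. u x = 0)" and Bu: "Yform k u u = (LINT x|lborel. f (u x) * u x)"
    using u by (auto simp: Nehari_iff)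
  have um[measurable]: "u \<in> borel_measurable borel" by (rule Yspace_measurable[OF Yu])
  have Bv: "Yform k ?v ?v = Yform k u u" by (rule B_symm[OF kpos i Yu Yu])
  have fv: "(LINT x|lborel. f (?v x) * ?v x) = (LINT x|lborel. f (u x) * u x)"
    by (rule integral_symm[OF i, of "\<lambda>x. f (u x) * u x"]) measurable
  have pv: "(LINT x|lborel. prim f (?v x)) = (LINT x|lborel. prim f (u x))"
    by (rule integral_symm[OF i, of "\<lambda>x. prim f (u x)"]) measurable
  have "\<not> (AE x in lborel. ?v x = 0)"
  proof
    assume "AE x in lborel. ?v x = 0"
    then have "AE x in lborel. f (?v x) * ?v x = 0" by eventually_elim simp
    then have "(LINT x|lborel. f (?v x) * ?v x) = 0" by (rule integral_eq_zero_AE)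
    then show False using B_pos[OF Yu u0] Bu fv by simp
  qed
  then show "?v \<in> Nehari k f" unfolding Nehari_iff
    using Yspace_symm(1)[OF i Yu] G_inv_shift[OF Gu] Bv fv Bu by simp
  show "Yform k ?v ?v = Yform k u u" by (rule Bv)
  show "Phi k f ?v = Phi k f u" unfolding Phi_eq Bv pv ..
qed

text \<open>Translation in z moves the centre to (fst x, 0), whose distance from the origin is at
  most \<open>R\<close>; the mass then sits in one ball independent of the function.\<close>

lemma shift_mass:
  fixes u :: "(real^'k) \<times> (real^'m) \<Rightarrow> real"
  assumes u: "L2 lborel u" and R: "norm (fst x) \<le> R"
  shows "(LINT y|lborel. (u y)\<^sup>2 * indicator (ball x 1) y) \<le> (LINT y|lborel. (u (symm (mat 1) (snd x) y))\<^sup>2 * indicator (ball 0 (R + 2)) y)"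
proof -
  let ?v = "\<lambda>y. u (symm (mat 1) (snd x) y)"
  have i: "orthogonal_matrix (mat 1 :: real^'k^'k)" by (simp add: orthogonal_matrix_id)
  have um: "u \<in> borel_measurable borel" using u by (simp add: L2_def)
  have vL: "L2 lborel ?v" by (rule L2_symm[OF i u])
  have ind: "indicator (ball x 1) (symm (mat 1) (snd x) y) = (indicator (ball (fst x, 0) 1) y :: real)" for y
  proof -
    have "x - symm (mat 1) (snd x) y = (fst x, 0) - y" by (cases x, cases y) (simp add: symm_def)
    then have "dist x (symm (mat 1) (snd x) y) = dist (fst x, 0) y" by (simp only: dist_norm)
    then show ?thesis by (simp add: indicator_def)
  qed
  have "(LINT y|lborel. (u y)\<^sup>2 * indicator (ball x 1) y) = (LINT y|lborel. (?v y)\<^sup>2 * indicator (ball x 1) (symm (mat 1) (snd x) y))"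
    by (rule integral_symm[OF i, symmetric, of "\<lambda>y. (u y)\<^sup>2 * indicator (ball x 1) y"])
      (intro borel_measurable_times borel_measurable_power um borel_measurable_indicator, simp)
  also have "\<dots> = (LINT y|lborel. (?v y)\<^sup>2 * indicator (ball (fst x, 0) 1) y)" unfolding ind ..
  also have "\<dots> \<le> (LINT y|lborel. (?v y)\<^sup>2 * indicator (ball 0 (R + 2)) y)"
  proof (intro integral_mono integrable_square_indicator vL)
    fix y :: "(real^'k) \<times> (real^'m)"
    have "y \<in> ball 0 (R + 2)" if "y \<in> ball (fst x, 0) 1"
    proof -
      have "norm y \<le> norm (fst x, 0::real^'m) + norm (y - (fst x, 0))" using norm_triangle_ineq[of "(fst x, 0)" "y - (fst x, 0)"] by simp
      moreover have "norm (fst x, 0::real^'m) = norm (fst x)" by (simp add: norm_Pair)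
      moreover have "norm (y - (fst x, 0)) < 1" using that by (simp only: mem_ball dist_norm norm_minus_commute)
      ultimately show ?thesis using R by simp
    qed
    then show "(?v y)\<^sup>2 * indicator (ball (fst x, 0) 1) y \<le> (?v y)\<^sup>2 * indicator (ball 0 (R + 2)) y"
      by (cases "y \<in> ball (fst x, 0) 1") (auto simp del: mem_ball)
  qed auto
  finally show ?thesis .
qed

lemma square_convex: "((1 - s) * a + s * b)\<^sup>2 \<le> (1 - s) * a\<^sup>2 + s * b\<^sup>2" if "0 \<le> s" "s \<le> 1" for a b s :: real
proof -
  have "(1 - s) * a\<^sup>2 + s * b\<^sup>2 - ((1 - s) * a + s * b)\<^sup>2 = s * (1 - s) * (a - b)\<^sup>2" by (simp add: power2_eq_square algebra_simps)
  moreover have "0 \<le> s * (1 - s) * (a - b)\<^sup>2" using that by simp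
  ultimately show ?thesis by linarith
qed

text \<open>The substitute for a weak limit: the last property yields
  \<open>limsup Q(w m - z) \<le> lim Q(w m) - Q(z)\<close> for \<open>Q(u) = Yform k u u\<close>.\<close>

lemma weak_limit:
  fixes w :: "nat \<Rightarrow> (real^'k) \<times> (real^'m) \<Rightarrow> real"
  assumes Yw: "\<And>n. Yspace (w n)" and K: "\<And>n. Yform k (w n) (w n) \<le> K"
    and u: "L2 wmeas u" and wu: "\<And>n. (LINT x|wmeas. (w n x - u x)\<^sup>2) \<le> 1 / real (Suc n)"
  obtains z where "Yspace z" "AE x in lborel. z x = u x"
    "\<And>e. e > 0 \<Longrightarrow> \<forall>\<^sub>F n in sequentially. Yform k z z - e \<le> Yform k (w n) z"
proof -
  \<comment> \<open>Convex, decreasing sets around the local limit: each contains all later members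
    of the sequence, and a limit of elements taken from ever smaller sets must equal u almost
    everywhere.\<close>
  define C where "C n = {v. Yspace v \<and> (LINT x|wmeas. (v x - u x)\<^sup>2) \<le> 1 / real (Suc n)}" for n
  have L: "L2 wmeas (\<lambda>x. v x - u x)" if "Yspace v" for v by (rule L2_diff[OF L2_wmeas[OF Yspace_L2[OF that]] u])
  obtain zn where zC: "\<And>n. zn n \<in> C n"
    and zCau: "\<And>e. e > 0 \<Longrightarrow> \<exists>M. \<forall>m\<ge>M. \<forall>n\<ge>M. Yform k (\<lambda>x. zn n x - zn m x) (\<lambda>x. zn n x - zn m x) < e"
    and zlow: "\<And>e. e > 0 \<Longrightarrow> \<exists>M. \<forall>n\<ge>M. \<forall>m\<ge>n. Yform k (zn n) (w m) \<ge> Yform k (zn n) (zn n) - e"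
  proof (rule Y.convex_sequence[of C w K])
    show "C n \<subseteq> {u. Yspace u}" for n by (auto simp: C_def)
    show "C n \<subseteq> C m" if "m \<le> n" for m n
    proof -
      have "1 / real (Suc n) \<le> 1 / real (Suc m)" using that by (simp add: frac_le)
      then show ?thesis by (auto simp: C_def)
    qed
    show "w n \<in> C n" for n using Yw wu by (simp add: C_def)
    show "Yform k (w n) (w n) \<le> K" for n by (rule K)
    fix n a b and s :: real assume a: "a \<in> C n" and b: "b \<in> C n" and s: "0 \<le> s" "s \<le> 1"
    have Ya: "Yspace a" and Yb: "Yspace b" using a b by (auto simp: C_def)
    have Yc: "Yspace (\<lambda>x. (1 - s) * a x + s * b x)" by (rule Yspace_lin[OF Ya Yb])
    have "(LINT x|wmeas. ((1 - s) * a x + s * b x - u x)\<^sup>2) \<le> (LINT x|wmeas. (1 - s) * (a x - u x)\<^sup>2 + s * (b x - u x)\<^sup>2)"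
    proof (rule integral_mono)
      show "integrable wmeas (\<lambda>x. ((1 - s) * a x + s * b x - u x)\<^sup>2)" by (rule L2_square_integrable[OF L[OF Yc]])
      show "integrable wmeas (\<lambda>x. (1 - s) * (a x - u x)\<^sup>2 + s * (b x - u x)\<^sup>2)"
        using L2_square_integrable[OF L[OF Ya]] L2_square_integrable[OF L[OF Yb]] by simp
      show "((1 - s) * a x + s * b x - u x)\<^sup>2 \<le> (1 - s) * (a x - u x)\<^sup>2 + s * (b x - u x)\<^sup>2" for x
      proof -
        have "(1 - s) * a x + s * b x - u x = (1 - s) * (a x - u x) + s * (b x - u x)" by (simp add: algebra_simps)
        then show ?thesis using square_convex[OF s, of "a x - u x" "b x - u x"] by simp
      qed
    qed
    also have "\<dots> = (1 - s) * (LINT x|wmeas. (a x - u x)\<^sup>2) + s * (LINT x|wmeas. (b x - u x)\<^sup>2)"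
      using L2_square_integrable[OF L[OF Ya]] L2_square_integrable[OF L[OF Yb]] by simp
    also have "\<dots> \<le> (1 - s) * (1 / real (Suc n)) + s * (1 / real (Suc n))"
      using a b s by (intro add_mono mult_left_mono) (auto simp: C_def)
    also have "\<dots> = 1 / real (Suc n)" unfolding distrib_right[symmetric] by simp
    finally show "(\<lambda>x. (1 - s) * a x + s * b x) \<in> C n" using Yc by (simp add: C_def)
  qed (rule that)
  have Yzn: "Yspace (zn n)" for n using zC[of n] by (simp add: C_def)
  obtain z where Yz: "Yspace z" and zl: "(\<lambda>n. Yform k (\<lambda>x. zn n x - z x) (\<lambda>x. zn n x - z x)) \<longlonglongrightarrow> 0"
    by (rule Yspace_complete[OF kpos Yzn zCau]) (assumption | rule that)+
  have "(LINT x|wmeas. (z x - u x)\<^sup>2) = 0"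
  proof -
    have "(LINT x|wmeas. (z x - u x)\<^sup>2) \<le> 2 * (1 / real (Suc n)) + 4 / k * Yform k (\<lambda>x. zn n x - z x) (\<lambda>x. zn n x - z x)" for n
    proof -
      have Yd: "Yspace (\<lambda>x. zn n x - z x)" by (rule Yspace_diff[OF Yzn Yz])
      have dL: "L2 lborel (\<lambda>x. zn n x - z x)" by (rule Yspace_L2[OF Yd])
      have dW: "L2 wmeas (\<lambda>x. zn n x - z x)" by (rule L2_wmeas[OF dL])
      have "(LINT x|wmeas. (z x - u x)\<^sup>2) \<le> (LINT x|wmeas. 2 * (zn n x - u x)\<^sup>2 + 2 * (zn n x - z x)\<^sup>2)"
      proof (rule integral_mono)
        show "integrable wmeas (\<lambda>x. (z x - u x)\<^sup>2)" by (rule L2_square_integrable[OF L[OF Yz]])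
        show "integrable wmeas (\<lambda>x. 2 * (zn n x - u x)\<^sup>2 + 2 * (zn n x - z x)\<^sup>2)"
          using L2_square_integrable[OF L[OF Yzn[of n]]] L2_square_integrable[OF dW] by simp
        show "(z x - u x)\<^sup>2 \<le> 2 * (zn n x - u x)\<^sup>2 + 2 * (zn n x - z x)\<^sup>2" for x
          using square_add_le[of "zn n x - u x" "z x - zn n x"] by (simp add: power2_commute[of "z x" "zn n x"])
      qed
      also have "\<dots> = 2 * (LINT x|wmeas. (zn n x - u x)\<^sup>2) + 2 * (LINT x|wmeas. (zn n x - z x)\<^sup>2)"
        using L2_square_integrable[OF L[OF Yzn[of n]]] L2_square_integrable[OF dW] by simp
      also have "\<dots> \<le> 2 * (1 / real (Suc n)) + 2 * (2 / k * Yform k (\<lambda>x. zn n x - z x) (\<lambda>x. zn n x - z x))"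
      proof (intro add_mono mult_left_mono)
        show "(LINT x|wmeas. (zn n x - u x)\<^sup>2) \<le> 1 / real (Suc n)" using zC[of n] by (simp add: C_def)
        have "(LINT x|wmeas. (zn n x - z x)\<^sup>2) \<le> 2 * (LINT x|lborel. (zn n x - z x)\<^sup>2)" by (rule wmeas_le(2)[OF L2_square_integrable[OF dL]]) simp
        also have "\<dots> \<le> 2 / k * Yform k (\<lambda>x. zn n x - z x) (\<lambda>x. zn n x - z x)" using B_bounds(1)[OF kpos Yd] kpos by (simp add: field_simps)
        finally show "(LINT x|wmeas. (zn n x - z x)\<^sup>2) \<le> 2 / k * Yform k (\<lambda>x. zn n x - z x) (\<lambda>x. zn n x - z x)" .
      qed auto
      finally show ?thesis by simp
    qed
    moreover have "(\<lambda>n. 2 * (1 / real (Suc n)) + 4 / k * Yform k (\<lambda>x. zn n x - z x) (\<lambda>x. zn n x - z x)) \<longlonglongrightarrow> 2 * 0 + 4 / k * 0"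
    proof (intro tendsto_add tendsto_mult tendsto_const zl)
      show "(\<lambda>n. 1 / real (Suc n)) \<longlonglongrightarrow> 0" by real_asymp
    qed
    ultimately have "(LINT x|wmeas. (z x - u x)\<^sup>2) \<le> 2 * 0 + 4 / k * 0" by (meson LIMSEQ_le_const)
    moreover have "0 \<le> (LINT x|wmeas. (z x - u x)\<^sup>2)" by simp
    ultimately show ?thesis by simp
  qed
  then have "AE x in wmeas. (z x - u x)\<^sup>2 = 0"
    using integral_nonneg_eq_0_iff_AE[OF L2_square_integrable[OF L[OF Yz]]] by simp
  then have zu: "AE x in lborel. z x = u x" by (simp add: AE_wmeas)
  show ?thesis
  proof (rule that[OF Yz zu])
    fix e :: real assume e: "e > 0"
    have e3: "e / 3 > 0" using e by simp
    obtain M1 where M1: "\<And>n m. n \<ge> M1 \<Longrightarrow> m \<ge> n \<Longrightarrow> Yform k (zn n) (w m) \<ge> Yform k (zn n) (zn n) - e / 3" using zlow[OF e3] by blast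
    have "(\<lambda>n. Yform k (zn n) (zn n)) \<longlonglongrightarrow> Yform k z z" using Y.tendsto_B_self[of zn z, OF _ _ zl] Yzn Yz by simp
    then have ev1: "\<forall>\<^sub>F n in sequentially. Yform k z z - e / 3 < Yform k (zn n) (zn n)" by (rule order_tendstoD(1)) (use e in simp)
    have K0: "0 \<le> K" using K[of 0] Y.B_pos[of "w 0"] Yw by (meson mem_Collect_eq order_trans)
    \<comment> \<open>By Cauchy-Schwarz this closeness of \<open>zn n\<close> to z changes the
      pairing with any \<open>w m\<close> by at most e/3, uniformly in m.\<close>
    have pos: "0 < (e / 3)\<^sup>2 / (K + 1)" using e K0 by simp
    have ev2: "\<forall>\<^sub>F n in sequentially. Yform k (\<lambda>x. zn n x - z x) (\<lambda>x. zn n x - z x) < (e / 3)\<^sup>2 / (K + 1)"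
      by (rule order_tendstoD(2)[OF zl pos])
    obtain n where n: "n \<ge> M1" "Yform k z z - e / 3 < Yform k (zn n) (zn n)" "Yform k (\<lambda>x. zn n x - z x) (\<lambda>x. zn n x - z x) < (e / 3)\<^sup>2 / (K + 1)"
      using eventually_happens[OF eventually_conj[OF eventually_ge_at_top[of M1] eventually_conj[OF ev1 ev2]]] by auto
    have "Yform k z z - e \<le> Yform k (w m) z" if "m \<ge> n" for m
    proof -
      have Yd: "Yspace (\<lambda>x. zn n x - z x)" by (rule Yspace_diff[OF Yzn Yz])
      have "(Yform k (\<lambda>x. zn n x - z x) (w m))\<^sup>2 \<le> Yform k (\<lambda>x. zn n x - z x) (\<lambda>x. zn n x - z x) * Yform k (w m) (w m)"
        using Y.Cauchy_Schwarz[of "\<lambda>x. zn n x - z x" "w m"] Yd Yw by simp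
      also have "\<dots> \<le> (e / 3)\<^sup>2 / (K + 1) * (K + 1)"
        using n(3) K[of m] Y.B_pos[of "w m"] Yw pos by (intro mult_mono) auto
      also have "\<dots> = (e / 3)\<^sup>2" using K0 by simp
      finally have "\<bar>Yform k (\<lambda>x. zn n x - z x) (w m)\<bar> \<le> \<bar>e / 3\<bar>" by (simp only: abs_le_square_iff)
      then have "Yform k (\<lambda>x. zn n x - z x) (w m) \<le> e / 3" using e by simp
      then have "Yform k (zn n) (w m) - Yform k z (w m) \<le> e / 3" using Y.B_diff_left[of "zn n" z "w m"] Yzn Yz Yw by simp
      moreover have "Yform k z (w m) = Yform k (w m) z" using Y.B_sym[of z "w m"] Yz Yw by simp
      moreover have "Yform k (zn n) (w m) \<ge> Yform k (zn n) (zn n) - e / 3" by (rule M1[OF n(1) that])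
      moreover have "E - e \<le> x" if "y - x \<le> e / 3" "q - e / 3 \<le> y" "E - e / 3 < q" for E x y q :: real using that by linarith
      ultimately show ?thesis using n(2) by metis
    qed
    then show "\<forall>\<^sub>F n in sequentially. Yform k z z - e \<le> Yform k (w n) z" unfolding eventually_sequentially by blast
  qed
qed

text \<open>The pairing estimate is stated with the limit itself and only from below; this is the
  part of weak convergence that the later splitting of the form consumes.\<close>

lemma minimizing_sequence:
  obtains w :: "nat \<Rightarrow> (real^'k) \<times> (real^'m) \<Rightarrow> real" and z K where
    "\<And>n. w n \<in> Nehari k f" "(\<lambda>n. Phi k f (w n)) \<longlonglongrightarrow> Inf (Phi k f ` (Nehari k f :: ((real^'k) \<times> (real^'m) \<Rightarrow> real) set))"
    "\<And>n. Yform k (w n) (w n) \<le> K" "Yspace z" "G_inv z" "\<not> (AE x in lborel. z x = 0)"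
    "AE x in lborel. (\<lambda>n. w n x) \<longlonglongrightarrow> z x"
    "\<And>e. e > 0 \<Longrightarrow> \<forall>\<^sub>F n in sequentially. Yform k z z - e \<le> Yform k (w n) z"
proof -
  define NN where "NN = (Nehari k f :: ((real^'k) \<times> (real^'m) \<Rightarrow> real) set)"
  define m where "m = Inf (Phi k f ` NN)"
  have NN0: "NN \<noteq> {}" unfolding NN_def by (rule Nehari_nonempty)
  have low: "0 \<le> Phi k f u" if "u \<in> NN" for u using Nehari_Phi[of u] that H_integral_nonneg[of u] by (simp add: NN_def)
  have bdd: "bdd_below (Phi k f ` NN)" using low by (auto intro!: bdd_belowI[of _ 0])
  have mle: "m \<le> Phi k f u" if "u \<in> NN" for u unfolding m_def using that bdd by (intro cInf_lower) auto
  have m0: "0 \<le> m" unfolding m_def using NN0 low by (intro cInf_greatest) auto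
  obtain c where c: "c > 0" "\<And>u::(real^'k) \<times> (real^'m) \<Rightarrow> real. u \<in> Nehari k f \<Longrightarrow> c \<le> Phi k f u"
    by (rule Nehari_lower_bound) (assumption | rule that)+
  have "\<forall>n. \<exists>u. u \<in> NN \<and> Phi k f u < m + 1 / real (Suc n)"
  proof
    fix n
    have "Inf (Phi k f ` NN) < m + 1 / real (Suc n)" by (simp add: m_def)
    then show "\<exists>u. u \<in> NN \<and> Phi k f u < m + 1 / real (Suc n)" using cInf_lessD[of "Phi k f ` NN"] NN0 by blast
  qed
  from choice[OF this] obtain un where un: "\<forall>n. un n \<in> NN \<and> Phi k f (un n) < m + 1 / real (Suc n)" ..
  have unN: "un n \<in> Nehari k f" and unP: "Phi k f (un n) < m + 1 / real (Suc n)" for n using un by (auto simp: NN_def)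
  have Yun: "Yspace (un n)" and Gun: "G_inv (un n)" for n using unN[of n] by (auto simp: Nehari_iff)
  have unP1: "Phi k f (un n) \<le> m + 1" for n
  proof -
    have "1 / real (Suc n) \<le> 1" by simp
    then show ?thesis using unP[of n] by linarith
  qed
  have m1: "0 \<le> m + 1" using m0 by simp
  obtain K \<delta> where d: "\<delta> > 0" and KB: "\<And>u::(real^'k) \<times> (real^'m) \<Rightarrow> real. u \<in> Nehari k f \<Longrightarrow> Phi k f u \<le> m + 1 \<Longrightarrow>
    Yform k u u \<le> K \<and> (\<exists>x. \<delta> * Yform k u u \<le> (LINT y|lborel. (u y)\<^sup>2 * indicator (ball x 1) y))"
    by (rule Nehari_level_bounds[OF m1]) (assumption | rule that)+
  have unK: "Yform k (un n) (un n) \<le> K" for n using KB[OF unN unP1] by blast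
  \<comment> \<open>A mass bound independent of n: F \<ge> 0 gives Q(u) \<ge> 2 Phi(u) \<ge> 2c on
    the Nehari set.\<close>
  define d0 where "d0 = \<delta> * (2 * c)"
  have d0: "d0 > 0" using d c by (simp add: d0_def)
  have "\<forall>n. \<exists>x. d0 \<le> (LINT y|lborel. (un n y)\<^sup>2 * indicator (ball x 1) y)"
  proof
    fix n
    obtain x where x: "\<delta> * Yform k (un n) (un n) \<le> (LINT y|lborel. (un n y)\<^sup>2 * indicator (ball x 1) y)" using KB[OF unN unP1] by blast
    have "0 \<le> (LINT x|lborel. prim f (un n x))" by (intro integral_nonneg_AE AE_I2 prim_nonneg)
    then have "2 * c \<le> Yform k (un n) (un n)" using c(2)[OF unN, of n] unfolding Phi_eq by simp
    then have "d0 \<le> \<delta> * Yform k (un n) (un n)" unfolding d0_def using d by (intro mult_left_mono) auto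
    then show "\<exists>x. d0 \<le> (LINT y|lborel. (un n y)\<^sup>2 * indicator (ball x 1) y)" using x order_trans by blast
  qed
  from choice[OF this] obtain xn where xn: "\<forall>n. d0 \<le> (LINT y|lborel. (un n y)\<^sup>2 * indicator (ball (xn n) 1) y)" ..
  obtain R where R: "\<And>(u::(real^'k) \<times> (real^'m) \<Rightarrow> real) x. L2 lborel u \<Longrightarrow> G_inv u \<Longrightarrow> (LINT x|lborel. (u x)\<^sup>2) \<le> K / k \<Longrightarrow>
     d0 \<le> (LINT y|lborel. (u y)\<^sup>2 * indicator (ball x 1) y) \<Longrightarrow> norm (fst x) \<le> R"
    by (rule G_inv_ball_location[OF K2 d0, of "K / k"]) (assumption | rule that)+
  have unL: "(LINT x|lborel. (un n x)\<^sup>2) \<le> K / k" for n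
    using B_bounds(1)[OF kpos Yun[of n]] unK[of n] kpos by (simp add: field_simps)
  have xR: "norm (fst (xn n)) \<le> R" for n using xn by (intro R[OF Yspace_L2[OF Yun] Gun unL]) blast
  define vn where "vn n x = un n (symm (mat 1) (snd (xn n)) x)" for n x
  have vN: "vn n \<in> Nehari k f" and vB: "Yform k (vn n) (vn n) = Yform k (un n) (un n)" and vP: "Phi k f (vn n) = Phi k f (un n)" for n
    unfolding vn_def using Nehari_shift[OF unN[of n], of "snd (xn n)"] by auto
  have Yvn: "Yspace (vn n)" and Gvn: "G_inv (vn n)" for n using vN[of n] by (auto simp: Nehari_iff)
  have vK: "Yform k (vn n) (vn n) \<le> K" for n using vB unK by simp
  have mass: "d0 \<le> (LINT y|lborel. (vn n y)\<^sup>2 * indicator (ball 0 (R + 2)) y)" for n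
    unfolding vn_def using order_trans[OF xn[rule_format, of n] shift_mass[OF Yspace_L2[OF Yun] xR]] .
  obtain r0 u where r0: "strict_mono (r0::nat \<Rightarrow> nat)" and uW: "L2 wmeas u"
    and ul: "(\<lambda>n. LINT x|wmeas. (vn (r0 n) x - u x)\<^sup>2) \<longlonglongrightarrow> 0" and uA: "AE x in lborel. (\<lambda>n. vn (r0 n) x) \<longlonglongrightarrow> u x"
    by (rule local_compactness[OF Yspace_tr_bound[OF kpos Yvn vK]]) (assumption | rule that)+
  \<comment> \<open>A second extraction produces the rate 1/(n+1) on which the shrinking convex sets
    of \<open>weak_limit\<close> are built.\<close>
  have "\<forall>j. \<exists>N. \<forall>n\<ge>N. (LINT x|wmeas. (vn (r0 n) x - u x)\<^sup>2) < 1 / real (Suc j)"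
  proof
    fix j
    have "0 < 1 / real (Suc j)" by simp
    from order_tendstoD(2)[OF ul this] show "\<exists>N. \<forall>n\<ge>N. (LINT x|wmeas. (vn (r0 n) x - u x)\<^sup>2) < 1 / real (Suc j)"
      unfolding eventually_sequentially .
  qed
  from choice[OF this] obtain Nj where Nj: "\<forall>j. \<forall>n\<ge>Nj j. (LINT x|wmeas. (vn (r0 n) x - u x)\<^sup>2) < 1 / real (Suc j)" ..
  obtain r1 where r1: "strict_mono (r1::nat\<Rightarrow>nat)" and r1N: "\<And>j. Nj j \<le> r1 j" using strict_mono_above by blast
  define w where "w n = vn (r0 (r1 n))" for n
  have wu: "(LINT x|wmeas. (w n x - u x)\<^sup>2) \<le> 1 / real (Suc n)" for n
    unfolding w_def using Nj r1N[of n] by (auto intro: less_imp_le)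
  have Yw: "Yspace (w n)" and wK: "Yform k (w n) (w n) \<le> K" for n using Yvn vK by (auto simp: w_def)
  obtain z where Yz: "Yspace z" and zu: "AE x in lborel. z x = u x"
    and zlow: "\<And>e. e > 0 \<Longrightarrow> \<forall>\<^sub>F n in sequentially. Yform k z z - e \<le> Yform k (w n) z"
    by (rule weak_limit[OF Yw wK uW wu]) (assumption | rule that)+
  have wz: "AE x in lborel. (\<lambda>n. w n x) \<longlonglongrightarrow> z x"
    using uA zu
  proof eventually_elim
    case (elim x)
    from LIMSEQ_subseq_LIMSEQ[OF elim(1) r1] show ?case unfolding w_def using elim(2) by (simp add: o_def)
  qed
  show ?thesis
  proof (rule that[of w K z])
    show "w n \<in> Nehari k f" for n unfolding w_def by (rule vN)
    show "(\<lambda>n. Phi k f (w n)) \<longlonglongrightarrow> Inf (Phi k f ` (Nehari k f :: ((real^'k) \<times> (real^'m) \<Rightarrow> real) set))"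
      unfolding NN_def[symmetric] m_def[symmetric]
    proof -
      have l: "(\<lambda>n. m + 1 / real (Suc n)) \<longlonglongrightarrow> m" by real_asymp
      have "(\<lambda>n. Phi k f (un n)) \<longlonglongrightarrow> m"
        by (rule tendsto_sandwich[OF _ _ tendsto_const l]) (use mle un unP in \<open>auto intro: less_imp_le simp: eventually_sequentially\<close>)
      from LIMSEQ_subseq_LIMSEQ[OF this strict_mono_o[OF r0 r1]]
      show "(\<lambda>n. Phi k f (w n)) \<longlonglongrightarrow> m" by (simp add: o_def w_def vP)
    qed
    show "Yform k (w n) (w n) \<le> K" for n by (rule wK)
    show "Yspace z" by (rule Yz)
    show "G_inv z"
      by (rule G_inv_limit[OF _ wz]) (simp add: w_def Gvn)
    show "AE x in lborel. (\<lambda>n. w n x) \<longlonglongrightarrow> z x" by (rule wz)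
    show "\<forall>\<^sub>F n in sequentially. Yform k z z - e \<le> Yform k (w n) z" if "e > 0" for e by (rule zlow[OF that])
    show "\<not> (AE x in lborel. z x = 0)"
    proof
      assume "AE x in lborel. z x = 0"
      then have u0: "AE x in wmeas. u x = 0" unfolding AE_wmeas using zu by eventually_elim simp
      obtain a where a: "a > 0" "\<And>u::(real^'k) \<times> (real^'m) \<Rightarrow> real. L2 wmeas u \<Longrightarrow>
         integrable lborel (\<lambda>x. (u x)\<^sup>2 * indicator (ball 0 (R + 2)) x) \<and>
         a * (LINT x|lborel. (u x)\<^sup>2 * indicator (ball 0 (R + 2)) x) \<le> (LINT x|wmeas. (u x)\<^sup>2)"
        by (rule wmeas_ball) (assumption | rule that)+
      \<comment> \<open>If u vanished, the mass retained in the fixed ball would keep the weighted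
        distance to u bounded away from 0, against convergence.\<close>
      have "a * d0 \<le> (LINT x|wmeas. (vn (r0 n) x - u x)\<^sup>2)" for n
      proof -
        have vW: "L2 wmeas (vn (r0 n))" by (rule L2_wmeas[OF Yspace_L2[OF Yvn]])
        have "a * d0 \<le> a * (LINT y|lborel. (vn (r0 n) y)\<^sup>2 * indicator (ball 0 (R + 2)) y)" using a(1) by (intro mult_left_mono mass) auto
        also have "\<dots> \<le> (LINT x|wmeas. (vn (r0 n) x)\<^sup>2)" using a(2)[OF vW] by blast
        also have "\<dots> = (LINT x|wmeas. (vn (r0 n) x - u x)\<^sup>2)"
        proof (rule integral_cong_AE)
          show "AE x in wmeas. (vn (r0 n) x)\<^sup>2 = (vn (r0 n) x - u x)\<^sup>2" using u0 by eventually_elim simp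
        qed (use L2_measurable[OF vW] L2_measurable[OF uW] in auto)
        finally show ?thesis .
      qed
      then have "a * d0 \<le> 0" using LIMSEQ_le_const[OF ul] by blast
      then show False using a(1) d0 by (simp add: mult_le_0_iff)
    qed
  qed
qed

section \<open>Existence of a minimizer\<close>

lemma f_mult_abs_bound: "e > 0 \<Longrightarrow> \<exists>C\<ge>0. \<forall>s. \<bar>f s * s\<bar> \<le> e * s\<^sup>2 + C * \<bar>s\<bar> powr p"
  using f_mult_bound[of e] f_mult_nonneg by simp

lemma H_abs_bound:
  assumes "e > 0"
  shows "\<exists>C\<ge>0. \<forall>s. \<bar>H s\<bar> \<le> e * s\<^sup>2 + C * \<bar>s\<bar> powr p"
proof -
  obtain C where C: "C \<ge> 0" "\<And>s. f s * s \<le> e * s\<^sup>2 + C * \<bar>s\<bar> powr p" using f_mult_bound[OF assms] by blast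
  have "\<bar>H s\<bar> \<le> e * s\<^sup>2 + C * \<bar>s\<bar> powr p" for s
    using C(2)[of s] H_le[of s] H_nonneg[of s] f_mult_nonneg[of s] by linarith
  then show ?thesis using C(1) by blast
qed

theorem minimizer_exists:
  obtains u :: "(real^'k) \<times> (real^'m) \<Rightarrow> real" where "u \<in> Nehari k f"
    "\<And>v::(real^'k) \<times> (real^'m) \<Rightarrow> real. v \<in> Nehari k f \<Longrightarrow> Phi k f u \<le> Phi k f v"
proof -
  define m where "m = Inf (Phi k f ` (Nehari k f :: ((real^'k) \<times> (real^'m) \<Rightarrow> real) set))"
  have low: "0 \<le> Phi k f u" if "u \<in> Nehari k f" for u :: "(real^'k) \<times> (real^'m) \<Rightarrow> real"
    using Nehari_Phi[OF that] H_integral_nonneg[of u] by simp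
  have bdd: "bdd_below (Phi k f ` (Nehari k f :: ((real^'k) \<times> (real^'m) \<Rightarrow> real) set))" using low by (auto intro!: bdd_belowI[of _ 0])
  have mle: "m \<le> Phi k f u" if "u \<in> Nehari k f" for u :: "(real^'k) \<times> (real^'m) \<Rightarrow> real"
    unfolding m_def using that bdd by (intro cInf_lower) auto
  obtain w :: "nat \<Rightarrow> (real^'k) \<times> (real^'m) \<Rightarrow> real" and z K where wN: "\<And>n. w n \<in> Nehari k f" and wP: "(\<lambda>n. Phi k f (w n)) \<longlonglongrightarrow> m"
    and wK: "\<And>n. Yform k (w n) (w n) \<le> K" and Yz: "Yspace z" and Gz: "G_inv z" and z0: "\<not> (AE x in lborel. z x = 0)"
    and wz: "AE x in lborel. (\<lambda>n. w n x) \<longlonglongrightarrow> z x"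
    and zlow: "\<And>e. e > 0 \<Longrightarrow> \<forall>\<^sub>F n in sequentially. Yform k z z - e \<le> Yform k (w n) z"
    unfolding m_def by (rule minimizing_sequence) blast
  have Yw: "Yspace (w n)" and Gw: "G_inv (w n)" and wB: "Yform k (w n) (w n) = (LINT x|lborel. f (w n x) * w n x)" for n
    using wN[of n] by (auto simp: Nehari_iff)
  have wH: "(\<lambda>n. LINT x|lborel. H (w n x)) \<longlonglongrightarrow> m" using wP by (simp add: Nehari_Phi[OF wN])
  note aw = Yspace_adm[OF Yw] and az = Yspace_adm[OF Yz]
  define vn where "vn n x = w n x - z x" for n x
  have Yv: "Yspace (vn n)" for n unfolding vn_def by (rule Yspace_diff[OF Yw Yz])
  note avn = Yspace_adm[OF Yv]
  define K' where "K' = 2 * K + 2 * Yform k z z"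
  have vK: "Yform k (vn n) (vn n) \<le> K'" for n
    using Y.B_diff_le[of "w n" z] Yw Yz wK[of n] by (simp add: vn_def[abs_def] K'_def)
  \<comment> \<open>Midpoint between p and the critical exponent: the Brezis-Lieb theorem asks for
    boundedness at an exponent strictly above p.\<close>
  define q where "q = (p + 2 * real (CARD('k) + CARD('m)) / (real (CARD('k) + CARD('m)) - 2)) / 2"
  have q: "p < q" "q < 2 * real (CARD('k) + CARD('m)) / (real (CARD('k) + CARD('m)) - 2)" "2 \<le> q"
  proof -
    have "a < (a + b) / 2" "(a + b) / 2 < b" if "a < b" for a b :: real using that by auto
    from this[OF p_less] show "p < q" "q < 2 * real (CARD('k) + CARD('m)) / (real (CARD('k) + CARD('m)) - 2)" unfolding q_def by blast+
    then show "2 \<le> q" using p_gt by linarith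
  qed
  obtain D where D: "\<And>u::(real^'k) \<times> (real^'m) \<Rightarrow> real. Yspace u \<Longrightarrow> Yform k u u \<le> K' \<Longrightarrow>
    integrable lborel (\<lambda>x. \<bar>u x\<bar> powr q) \<and> (LINT x|lborel. \<bar>u x\<bar> powr q) \<le> D"
    by (rule Yspace_powr_bound[OF q(3) q(2), of K']) (assumption | rule that)+
  define D' where "D' = max D (K' / k)"
  have BL: "(\<lambda>n. (LINT x|lborel. h (w n x)) - (LINT x|lborel. h (vn n x))) \<longlonglongrightarrow> (LINT x|lborel. h (z x))"
    if hc: "continuous_on UNIV h" and hb: "\<And>e. e > 0 \<Longrightarrow> \<exists>C\<ge>0. \<forall>s. \<bar>h s\<bar> \<le> e * s\<^sup>2 + C * \<bar>s\<bar> powr p"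
      and hi: "\<And>u. adm u \<Longrightarrow> integrable lborel (\<lambda>x. h (u x))" for h
    unfolding vn_def
  proof (rule Brezis_Lieb[OF hc p_gt q(1) hb, where K=D'])
    show "z \<in> borel_measurable lborel" using Yspace_measurable[OF Yz] by simp
    show "w n \<in> borel_measurable lborel" for n using Yspace_measurable[OF Yw] by simp
    show "AE x in lborel. (\<lambda>n. w n x) \<longlonglongrightarrow> z x" by (rule wz)
    show "integrable lborel (\<lambda>x. (w n x - z x)\<^sup>2)" for n using L2_square_integrable[OF Yspace_L2[OF Yv[of n]]] by (simp add: vn_def)
    show "(LINT x|lborel. (w n x - z x)\<^sup>2) \<le> D'" for n
    proof -
      have "(LINT x|lborel. (vn n x)\<^sup>2) \<le> K' / k" using B_bounds(1)[OF kpos Yv[of n]] vK[of n] kpos by (simp add: field_simps)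
      then show ?thesis by (simp add: vn_def D'_def)
    qed
    show "integrable lborel (\<lambda>x. \<bar>w n x - z x\<bar> powr q)" "(LINT x|lborel. \<bar>w n x - z x\<bar> powr q) \<le> D'" for n
      using D[OF Yv vK, of n] by (auto simp: vn_def D'_def)
    show "integrable lborel (\<lambda>x. (z x)\<^sup>2)" by (rule L2_square_integrable[OF Yspace_L2[OF Yz]])
    show "integrable lborel (\<lambda>x. \<bar>z x\<bar> powr q)" by (rule Yspace_powr_integrable[OF q(3,2) Yz])
    show "integrable lborel (\<lambda>x. h (w n x))" for n by (rule hi[OF aw])
    show "integrable lborel (\<lambda>x. h (w n x - z x))" for n using hi[OF avn[of n]] by (simp add: vn_def)
    show "integrable lborel (\<lambda>x. h (z x))" by (rule hi[OF az])
  qed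
  have BLf: "(\<lambda>n. (LINT x|lborel. f (w n x) * w n x) - (LINT x|lborel. f (vn n x) * vn n x)) \<longlonglongrightarrow> (LINT x|lborel. f (z x) * z x)"
    using BL[of "\<lambda>s. f s * s"] f_mult_abs_bound integrable_f_mult by (simp add: continuous_on_mult f_cont)
  have BLH: "(\<lambda>n. (LINT x|lborel. H (w n x)) - (LINT x|lborel. H (vn n x))) \<longlonglongrightarrow> (LINT x|lborel. H (z x))"
    using BL[OF H_cont H_abs_bound integrable_H] .
  have Hz: "0 < (LINT x|lborel. H (z x))"
  proof -
    have "(LINT x|lborel. H (z x)) \<noteq> 0"
    proof
      assume "(LINT x|lborel. H (z x)) = 0"
      then have "AE x in lborel. H (z x) = 0"
        using integral_nonneg_eq_0_iff_AE[OF integrable_H[OF az] AE_I2[OF H_nonneg]] by simp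
      then have "AE x in lborel. z x = 0" by eventually_elim (use H_pos in force)
      then show False using z0 by simp
    qed
    then show ?thesis using H_integral_nonneg[of z] by simp
  qed
  have le: "Yform k z z \<le> (LINT x|lborel. f (z x) * z x)"
  proof (rule ccontr)
    assume "\<not> Yform k z z \<le> (LINT x|lborel. f (z x) * z x)"
    then have gap: "0 < Yform k z z - (LINT x|lborel. f (z x) * z x)" by simp
    \<comment> \<open>A quarter of the gap suffices: expanding the form of \<open>vn n\<close> loses
      2e through the pairing with z, the splitting of \<integral> f(u) u loses e, and 3e is less
      than the gap.\<close>
    define e where "e = (Yform k z z - (LINT x|lborel. f (z x) * z x)) / 4"
    have e: "e > 0" "Yform k z z - (LINT x|lborel. f (z x) * z x) = 4 * e" using gap by (auto simp: e_def)
    have ev1: "\<forall>\<^sub>F n in sequentially. Yform k z z - e \<le> Yform k (w n) z" by (rule zlow[OF e(1)])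
    have ev2: "\<forall>\<^sub>F n in sequentially. (LINT x|lborel. f (w n x) * w n x) - (LINT x|lborel. f (vn n x) * vn n x) < (LINT x|lborel. f (z x) * z x) + e"
      by (rule order_tendstoD(2)[OF BLf]) (use e in simp)
    have "\<forall>\<^sub>F n in sequentially. m \<le> (LINT x|lborel. H (vn n x))"
      using ev1 ev2
    proof eventually_elim
      case (elim n)
      have "Yform k (vn n) (vn n) = Yform k (w n) (w n) - 2 * Yform k (w n) z + Yform k z z"
        using Y.B_diff_expand[of "w n" z] Yw Yz by (simp add: vn_def[abs_def])
      then have lt: "Yform k (vn n) (vn n) < (LINT x|lborel. f (vn n x) * vn n x)"
        using elim e wB[of n] by linarith
      have v0: "\<not> (AE x in lborel. vn n x = 0)"
      proof
        assume "AE x in lborel. vn n x = 0"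
        then have "AE x in lborel. f (vn n x) * vn n x = 0" by eventually_elim simp
        then have "(LINT x|lborel. f (vn n x) * vn n x) = 0" by (rule integral_eq_zero_AE)
        then show False using lt Y.B_pos[of "vn n"] Yv by (simp add: not_less[symmetric])
      qed
      have "G_inv (\<lambda>x. 1 * w n x + (- 1) * z x)" by (rule G_inv_lin[OF Gw Gz])
      then have Gv: "G_inv (vn n)" by (simp add: vn_def[abs_def])
      obtain t where "(\<lambda>x. t * vn n x) \<in> Nehari k f" "Phi k f (\<lambda>x. t * vn n x) \<le> (LINT x|lborel. H (vn n x))"
        by (rule Nehari_projection[OF Yv Gv v0 less_imp_le[OF lt]]) (assumption | rule that)+
      then show ?case using mle order_trans by blast
    qed
    moreover have "(\<lambda>n. (LINT x|lborel. H (w n x)) - ((LINT x|lborel. H (w n x)) - (LINT x|lborel. H (vn n x)))) \<longlonglongrightarrow> m - (LINT x|lborel. H (z x))"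
      by (intro tendsto_diff wH BLH)
    then have "(\<lambda>n. LINT x|lborel. H (vn n x)) \<longlonglongrightarrow> m - (LINT x|lborel. H (z x))" by simp
    ultimately have "m \<le> m - (LINT x|lborel. H (z x))" by (intro tendsto_lowerbound[of _ _ sequentially m]) auto
    then show False using Hz by simp
  qed
  have Hm: "(LINT x|lborel. H (z x)) \<le> m"
  proof (rule field_le_epsilon)
    fix e :: real assume e: "e > 0"
    have "integrable lborel (\<lambda>x. H (z x)) \<and> (LINT x|lborel. H (z x)) \<le> m + e"
    proof (rule Fatou_bounded[where F="\<lambda>n x. H (w n x)"])
      show "integrable lborel (\<lambda>x. H (w n x))" for n by (rule integrable_H[OF aw])
      show "AE x in lborel. (\<lambda>n. H (w n x)) \<longlonglongrightarrow> H (z x)"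
        using wz
      proof eventually_elim
        case (elim x)
        have "isCont H (z x)" using H_cont by (simp add: continuous_on_eq_continuous_at)
        then show ?case by (rule isCont_tendsto_compose[OF _ elim])
      qed
      show "(\<lambda>x. H (z x)) \<in> borel_measurable lborel" using integrable_H[OF az] by simp
      have "\<forall>\<^sub>F n in sequentially. (LINT x|lborel. H (w n x)) < m + e" by (rule order_tendstoD(2)[OF wH]) (use e in simp)
      then show "\<forall>\<^sub>F n in sequentially. (LINT x|lborel. H (w n x)) \<le> m + e" by eventually_elim simp
    qed (rule H_nonneg)
    then show "(LINT x|lborel. H (z x)) \<le> m + e" by blast
  qed
  obtain t where tN: "(\<lambda>x. t * z x) \<in> Nehari k f" and tP: "Phi k f (\<lambda>x. t * z x) \<le> (LINT x|lborel. H (z x))"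
    by (rule Nehari_projection[OF Yz Gz z0 le]) (assumption | rule that)+
  show ?thesis
  proof (rule that[OF tN])
    fix v :: "(real^'k) \<times> (real^'m) \<Rightarrow> real" assume "v \<in> Nehari k f"
    then show "Phi k f (\<lambda>x. t * z x) \<le> Phi k f v" using tP Hm mle[of v] by linarith
  qed
qed

section \<open>From minimizers to solutions, and nonnegative minimizers for odd f\<close>

lemma minimizer_is_solution:
  fixes u :: "(real^'k) \<times> (real^'m) \<Rightarrow> real"
  assumes u: "u \<in> Nehari k f" and min: "\<And>v::(real^'k) \<times> (real^'m) \<Rightarrow> real. v \<in> Nehari k f \<Longrightarrow> Phi k f u \<le> Phi k f v"
  shows "Phi k f u = m_k k f TYPE('k) TYPE('m)" "critical k f u" "weak_solution k f u"
proof -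
  have Yu: "Yspace u" and Gu: "G_inv u" using u by (auto simp: Nehari_iff)
  have eq: "Yform k u v = (LINT x|lborel. f (u x) * v x)" if v: "Yspace v" for v
    by (rule symmetric_criticality[OF Yu Gu v minimizer_critical_invariant[OF u min]])
  show "Phi k f u = m_k k f TYPE('k) TYPE('m)"
    unfolding m_k_def by (rule cInf_eq_minimum[symmetric]) (use u min in auto)
  show "critical k f u"
    unfolding critical_def using Phi_derivative[OF Yu] eq by fastforce
  show "weak_solution k f u"
    unfolding weak_solution_def using eq kpos by (simp add: B_eq)
qed

lemma odd_prim:
  assumes odd: "\<And>s. f (- s) = - f s"
  shows "prim f (- s) = prim f s"
proof -
  have "((\<lambda>s. prim f (- s) - prim f s) has_real_derivative 0) (at x)" for x
    by (auto intro!: derivative_eq_intros DERIV_chain2[OF prim_deriv] prim_deriv simp: odd)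
  then have "prim f (- s) - prim f s = prim f (- 0) - prim f 0" using DERIV_isconst_all[of "\<lambda>s. prim f (- s) - prim f s"] by blast
  then show ?thesis by simp
qed

text \<open>For odd f the integrals of f(u) u and of \<open>H\<close> are unchanged under u
  \<mapsto> |u|, while the form does not grow. So |u| meets the criterion for projection, and the
  factor t brings it back to the Nehari set at no cost in energy.\<close>

lemma minimizer_abs:
  fixes u :: "(real^'k) \<times> (real^'m) \<Rightarrow> real"
  assumes u: "u \<in> Nehari k f" and odd: "\<And>s. f (- s) = - f s"
  obtains t where "0 < t" "(\<lambda>x. t * \<bar>u x\<bar>) \<in> Nehari k f" "Phi k f (\<lambda>x. t * \<bar>u x\<bar>) \<le> Phi k f u"
proof -
  have Yu: "Yspace u" and Gu: "G_inv u" and u0: "\<not> (AE x in lborel. u x = 0)" and Bu: "Yform k u u = (LINT x|lborel. f (u x) * u x)"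
    using u by (auto simp: Nehari_iff)
  have h: "H1 u" by (rule Yspace_H1[OF Yu])
  have Ya: "Yspace (\<lambda>x. \<bar>u x\<bar>)" using H1_abs(1)[OF h] Yu by (simp add: Yspace_def)
  have Ga: "G_inv (\<lambda>x. \<bar>u x\<bar>)"
    unfolding G_inv_iff
  proof (intro allI impI)
    fix A :: "real^'k^'k" assume "orthogonal_matrix A"
    then have "AE x in lborel. u (symm A 0 x) = u x" using Gu by (simp add: G_inv_iff)
    then show "AE x in lborel. \<bar>u (symm A 0 x)\<bar> = \<bar>u x\<bar>" by eventually_elim simp
  qed
  have a0: "\<not> (AE x in lborel. \<bar>u x\<bar> = 0)" using u0 by simp
  have split: "Yform k v v = (LINT x|lborel. (norm (grad v x))\<^sup>2) + (LINT x|lborel. (v x)\<^sup>2 / (norm (fst x))\<^sup>2) + k * (LINT x|lborel. (v x)\<^sup>2)"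
    if v: "Yspace v" for v :: "(real^'k) \<times> (real^'m) \<Rightarrow> real"
  proof -
    have "Yform k v v = (LINT x|lborel. (norm (grad v x))\<^sup>2 + (v x)\<^sup>2 / (norm (fst x))\<^sup>2 + k * (v x)\<^sup>2)"
      using quad_k_eq[of k v] kpos by (simp add: quad_k_def)
    moreover have "integrable lborel (\<lambda>x. (norm (grad v x))\<^sup>2)" using grad_L2[OF Yspace_H1[OF v]] by (simp add: L2_def)
    moreover have "integrable lborel (\<lambda>x. (v x)\<^sup>2 / (norm (fst x))\<^sup>2)" using v by (simp add: Yspace_def)
    moreover have "integrable lborel (\<lambda>x. (v x)\<^sup>2)" by (rule L2_square_integrable[OF Yspace_L2[OF v]])
    ultimately show ?thesis by simp
  qed
  have fa: "f \<bar>s\<bar> * \<bar>s\<bar> = f s * s" for s using odd[of s] by (cases "s \<ge> 0") auto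
  have Ha: "H \<bar>s\<bar> = H s" for s
    unfolding H_def fa using odd_prim[OF odd, of s] by (cases "s \<ge> 0") auto
  have "Yform k (\<lambda>x. \<bar>u x\<bar>) (\<lambda>x. \<bar>u x\<bar>) \<le> Yform k u u" unfolding split[OF Yu] split[OF Ya] using H1_abs(2)[OF h] by simp
  then have le: "Yform k (\<lambda>x. \<bar>u x\<bar>) (\<lambda>x. \<bar>u x\<bar>) \<le> (LINT x|lborel. f \<bar>u x\<bar> * \<bar>u x\<bar>)" by (simp add: fa Bu)
  obtain t where "0 < t" "(\<lambda>x. t * \<bar>u x\<bar>) \<in> Nehari k f" "Phi k f (\<lambda>x. t * \<bar>u x\<bar>) \<le> (LINT x|lborel. H \<bar>u x\<bar>)"
    by (rule Nehari_projection[OF Ya Ga a0 le]) (assumption | rule that)+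
  then show ?thesis using that[of t] by (simp add: Ha Nehari_Phi[OF u])
qed

end

theorem theorem4p1:
  fixes f :: "real \<Rightarrow> real" and k :: real
  assumes K2: "CARD('k) \<ge> 2"
    and kpos: "k > 0"
    and F1_cont: "continuous_on UNIV f"
    and F1_growth: "\<exists>C p. 2 < p \<and>
         p < 2 * real (CARD('k) + CARD('m)) / (real (CARD('k) + CARD('m)) - 2) \<and>
         (\<forall>s. \<bar>f s\<bar> \<le> C * (1 + \<bar>s\<bar> powr (p - 1)))"
    and F2: "((\<lambda>s. f s / s) \<longlongrightarrow> 0) (at 0)"
    and F3: "filterlim (\<lambda>s. prim f s / s\<^sup>2) at_top at_infinity"
    and F4: "strict_mono_on {0<..} (\<lambda>s. f s / \<bar>s\<bar>)"
            "strict_mono_on {..<0} (\<lambda>s. f s / \<bar>s\<bar>)"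
  shows "(\<exists>u::(real^'k) \<times> (real^'m) \<Rightarrow> real.
            u \<in> Nehari k f \<and> Phi k f u = m_k k f TYPE('k) TYPE('m) \<and>
            (\<forall>v\<in>(Nehari k f :: ((real^'k) \<times> (real^'m) \<Rightarrow> real) set). Phi k f u \<le> Phi k f v) \<and>
            critical k f u \<and> weak_solution k f u)
       \<and> ((\<forall>s. f (- s) = - f s) \<longrightarrow>
          (\<exists>u::(real^'k) \<times> (real^'m) \<Rightarrow> real.
            u \<in> Nehari k f \<and> Phi k f u = m_k k f TYPE('k) TYPE('m) \<and>
            (\<forall>v\<in>(Nehari k f :: ((real^'k) \<times> (real^'m) \<Rightarrow> real) set). Phi k f u \<le> Phi k f v) \<and>
            critical k f u \<and> weak_solution k f u \<and>
            (AE x in lborel. 0 \<le> u x)))"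
proof -
  obtain C p where "2 < p" "p < 2 * real (CARD('k) + CARD('m)) / (real (CARD('k) + CARD('m)) - 2)"
    "\<And>s. \<bar>f s\<bar> \<le> C * (1 + \<bar>s\<bar> powr (p - 1))" using F1_growth by blast
  then interpret problem f C p k "TYPE('k)" "TYPE('m)"
    using K2 kpos F1_cont F2 F3 F4 by unfold_locales auto
  obtain u :: "(real^'k) \<times> (real^'m) \<Rightarrow> real" where u: "u \<in> Nehari k f"
    and min: "\<And>v::(real^'k) \<times> (real^'m) \<Rightarrow> real. v \<in> Nehari k f \<Longrightarrow> Phi k f u \<le> Phi k f v"
    by (rule minimizer_exists) (assumption | rule that)+
  show ?thesis
  proof (intro conjI impI)
    show "\<exists>u::(real^'k) \<times> (real^'m) \<Rightarrow> real.
            u \<in> Nehari k f \<and> Phi k f u = m_k k f TYPE('k) TYPE('m) \<and>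
            (\<forall>v\<in>(Nehari k f :: ((real^'k) \<times> (real^'m) \<Rightarrow> real) set). Phi k f u \<le> Phi k f v) \<and>
            critical k f u \<and> weak_solution k f u"
      using u min minimizer_is_solution[OF u min] by blast
    assume "\<forall>s. f (- s) = - f s"
    then have odd: "f (- s) = - f s" for s by blast
    obtain t where t: "0 < t" and w: "(\<lambda>x. t * \<bar>u x\<bar>) \<in> Nehari k f" and le: "Phi k f (\<lambda>x. t * \<bar>u x\<bar>) \<le> Phi k f u"
      by (rule minimizer_abs[OF u odd])
    have min': "Phi k f (\<lambda>x. t * \<bar>u x\<bar>) \<le> Phi k f v" if "v \<in> Nehari k f" for v :: "(real^'k) \<times> (real^'m) \<Rightarrow> real"
      using le min[OF that] by linarith
    have nn: "AE x in lborel. 0 \<le> t * \<bar>u x\<bar>" using t by simp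
    show "\<exists>u::(real^'k) \<times> (real^'m) \<Rightarrow> real.
            u \<in> Nehari k f \<and> Phi k f u = m_k k f TYPE('k) TYPE('m) \<and>
            (\<forall>v\<in>(Nehari k f :: ((real^'k) \<times> (real^'m) \<Rightarrow> real) set). Phi k f u \<le> Phi k f v) \<and>
            critical k f u \<and> weak_solution k f u \<and> (AE x in lborel. 0 \<le> u x)"
      by (intro exI[of _ "\<lambda>x. t * \<bar>u x\<bar>"] conjI ballI w min' nn minimizer_is_solution[OF w min'])
  qed
qed

end
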